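(* Let $R$ be a one-dimensional commutative Noetherian local ring. Let $M$ be a finitely generated, generically free, two-periodic $R$-module and let $N$ be a finitely generated torsionless $R$-module that has rank. Then $M\otimes_R N$ is torsion-free if and only if $M$ and $N$ are Tor-independent, that is, $\operatorname{Tor}_i^R(M,N)=0$ for all $i\ge 1$.
   Context: For a finitely generated module $M$ over a local ring, $\Omega^i_R M$ denotes the $i$-th syzygy of $M$ in its minimal free resolution. $M$ is two-periodic if $M\cong\Omega^2_R M$. $M$ is generically free if $M_{\mathfrak p}$ is a free $R_{\mathfrak p}$-module for every $\mathfrak p\in\operatorname{Ass}(R)$. $N$ is torsionless if the canonical map $N\to N^{**}$ is injective, where $(-)^*=\operatorname{Hom}_R(-,R)$. $N$ has rank if there is an integer $r\ge 0$ with $N\otimes_R Q\cong Q^r$, where $Q$ is the total ring of fractions of $R$. The torsion submodule of a module consists of the elements annihilated by some non-zero-divisor of $R$; a module is torsion-free if its torsion submodule is zero. *)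

theory Defs
  imports "HOL-Algebra.Algebra" "HOL-Library.Extended_Nat"
begin

text \<open>
  Modules are the records of \<^theory>\<open>HOL-Algebra.Module\<close>. That record type extends the ring
  record, but the locale \<^locale>\<open>module\<close> does not constrain the fields \<open>mult\<close> and \<open>one\<close>; they are
  left \<open>undefined\<close> below whenever there is no natural multiplication.
\<close>

section \<open>Rings\<close>

definition local_ring :: "('a, 'r) ring_scheme \<Rightarrow> bool" where
  "local_ring R \<longleftrightarrow> cring R \<and> (\<exists>!I. maximalideal I R)"

definition max_ideal :: "('a, 'r) ring_scheme \<Rightarrow> 'a set" where
  "max_ideal R = (THE I. maximalideal I R)"

definition krull_dim :: "('a, 'r) ring_scheme \<Rightarrow> enat" where
  "krull_dim R = Sup {enat n | n. \<exists>P :: nat \<Rightarrow> 'a set.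
     (\<forall>i\<le>n. primeideal (P i) R) \<and> (\<forall>i<n. P i \<subset> P (Suc i))}"

definition nonzerodivisors :: "('a, 'r) ring_scheme \<Rightarrow> 'a set" where
  "nonzerodivisors R =
     {a \<in> carrier R. \<forall>b\<in>carrier R. a \<otimes>\<^bsub>R\<^esub> b = \<zero>\<^bsub>R\<^esub> \<longrightarrow> b = \<zero>\<^bsub>R\<^esub>}"

definition ring_Ass :: "('a, 'r) ring_scheme \<Rightarrow> 'a set set" where
  "ring_Ass R =
     {P. primeideal P R \<and> (\<exists>x\<in>carrier R. P = {a \<in> carrier R. a \<otimes>\<^bsub>R\<^esub> x = \<zero>\<^bsub>R\<^esub>})}"

section \<open>Modules\<close>

definition mod_hom ::
  "('a, 'r) ring_scheme \<Rightarrow> ('a, 'b, 'm) module_scheme \<Rightarrow> ('a, 'c, 'n) module_scheme \<Rightarrow> ('b \<Rightarrow> 'c) set"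
  where
  "mod_hom R M N = {f \<in> carrier M \<rightarrow> carrier N.
     (\<forall>x\<in>carrier M. \<forall>y\<in>carrier M. f (x \<oplus>\<^bsub>M\<^esub> y) = f x \<oplus>\<^bsub>N\<^esub> f y) \<and>
     (\<forall>a\<in>carrier R. \<forall>x\<in>carrier M. f (a \<odot>\<^bsub>M\<^esub> x) = a \<odot>\<^bsub>N\<^esub> f x)}"

definition mod_isomorphic ::
  "('a, 'r) ring_scheme \<Rightarrow> ('a, 'b, 'm) module_scheme \<Rightarrow> ('a, 'c, 'n) module_scheme \<Rightarrow> bool"
  where
  "mod_isomorphic R M N \<longleftrightarrow> (\<exists>f\<in>mod_hom R M N. bij_betw f (carrier M) (carrier N))"

definition mod_span ::
  "('a, 'r) ring_scheme \<Rightarrow> ('a, 'b, 'm) module_scheme \<Rightarrow> 'b set \<Rightarrow> 'b set" where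
  "mod_span R M A = \<Inter>{H. submodule H R M \<and> A \<subseteq> H}"

definition finitely_generated ::
  "('a, 'r) ring_scheme \<Rightarrow> ('a, 'b, 'm) module_scheme \<Rightarrow> bool" where
  "finitely_generated R M \<longleftrightarrow>
     (\<exists>A. finite A \<and> A \<subseteq> carrier M \<and> mod_span R M A = carrier M)"

definition lin_indep ::
  "('a, 'r) ring_scheme \<Rightarrow> ('a, 'b, 'm) module_scheme \<Rightarrow> 'b set \<Rightarrow> bool" where
  "lin_indep R M B \<longleftrightarrow> (\<forall>A c. finite A \<longrightarrow> A \<subseteq> B \<longrightarrow> c \<in> A \<rightarrow> carrier R \<longrightarrow>
     (\<Oplus>\<^bsub>M\<^esub>b\<in>A. c b \<odot>\<^bsub>M\<^esub> b) = \<zero>\<^bsub>M\<^esub> \<longrightarrow> (\<forall>b\<in>A. c b = \<zero>\<^bsub>R\<^esub>))"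

definition free_module :: "('a, 'r) ring_scheme \<Rightarrow> ('a, 'b, 'm) module_scheme \<Rightarrow> bool" where
  "free_module R M \<longleftrightarrow>
     (\<exists>B. B \<subseteq> carrier M \<and> mod_span R M B = carrier M \<and> lin_indep R M B)"

definition self_module :: "('a, 'r) ring_scheme \<Rightarrow> ('a, 'a) module" where
  "self_module R = \<lparr>carrier = carrier R, monoid.mult = monoid.mult R, monoid.one = monoid.one R,
     ring.zero = ring.zero R, ring.add = ring.add R, module.smult = monoid.mult R\<rparr>"

text \<open>The free module \<open>R\<^sup>n\<close>.\<close>

definition free_mod :: "('a, 'r) ring_scheme \<Rightarrow> nat \<Rightarrow> ('a, nat \<Rightarrow> 'a) module" where
  "free_mod R n = \<lparr>carrier = {..<n} \<rightarrow>\<^sub>E carrier R, monoid.mult = undefined, monoid.one = undefined,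
     ring.zero = (\<lambda>i\<in>{..<n}. \<zero>\<^bsub>R\<^esub>),
     ring.add = (\<lambda>x y. \<lambda>i\<in>{..<n}. x i \<oplus>\<^bsub>R\<^esub> y i),
     module.smult = (\<lambda>a x. \<lambda>i\<in>{..<n}. a \<otimes>\<^bsub>R\<^esub> x i)\<rparr>"

text \<open>The quotient of \<open>M\<close> by a submodule \<open>H\<close>.\<close>

definition quot_module :: "('a, 'b, 'm) module_scheme \<Rightarrow> 'b set \<Rightarrow> ('a, 'b set) module" where
  "quot_module M H = \<lparr>carrier = a_rcosets\<^bsub>M\<^esub> H, monoid.mult = undefined, monoid.one = undefined,
     ring.zero = H, ring.add = set_add M, module.smult = (\<lambda>a U. \<Union>x\<in>U. H +>\<^bsub>M\<^esub> (a \<odot>\<^bsub>M\<^esub> x))\<rparr>"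

definition torsion :: "('a, 'r) ring_scheme \<Rightarrow> ('a, 'b, 'm) module_scheme \<Rightarrow> 'b set" where
  "torsion R M = {x \<in> carrier M. \<exists>a\<in>nonzerodivisors R. a \<odot>\<^bsub>M\<^esub> x = \<zero>\<^bsub>M\<^esub>}"

definition torsion_free :: "('a, 'r) ring_scheme \<Rightarrow> ('a, 'b, 'm) module_scheme \<Rightarrow> bool" where
  "torsion_free R M \<longleftrightarrow> torsion R M = {\<zero>\<^bsub>M\<^esub>}"

text \<open>Homomorphisms are taken extensional, so that equality in the dual is equality on \<open>M\<close>.\<close>

definition dual_module ::
  "('a, 'r) ring_scheme \<Rightarrow> ('a, 'b, 'm) module_scheme \<Rightarrow> ('a, 'b \<Rightarrow> 'a) module" where
  "dual_module R M = \<lparr>carrier = mod_hom R M (self_module R) \<inter> extensional (carrier M),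
     monoid.mult = undefined, monoid.one = undefined,
     ring.zero = (\<lambda>x\<in>carrier M. \<zero>\<^bsub>R\<^esub>),
     ring.add = (\<lambda>f g. \<lambda>x\<in>carrier M. f x \<oplus>\<^bsub>R\<^esub> g x),
     module.smult = (\<lambda>a f. \<lambda>x\<in>carrier M. a \<otimes>\<^bsub>R\<^esub> f x)\<rparr>"

definition bidual_map ::
  "('a, 'r) ring_scheme \<Rightarrow> ('a, 'b, 'm) module_scheme \<Rightarrow> 'b \<Rightarrow> ('b \<Rightarrow> 'a) \<Rightarrow> 'a" where
  "bidual_map R M x = (\<lambda>f\<in>carrier (dual_module R M). f x)"

definition torsionless :: "('a, 'r) ring_scheme \<Rightarrow> ('a, 'b, 'm) module_scheme \<Rightarrow> bool" where
  "torsionless R M \<longleftrightarrow> inj_on (bidual_map R M) (carrier M)"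

section \<open>Localization\<close>

text \<open>
  For a multiplicative subset \<open>S\<close> of \<open>R\<close>, the fraction \<open>m/s\<close> is the set of all pairs \<open>(n, t)\<close>
  with \<open>u t m = u s n\<close> for some \<open>u \<in> S\<close>. In the operations on fractions, all members of
  each union are equal, so a union expresses independence of representatives.
\<close>

definition mod_frac :: "'a set \<Rightarrow> ('a, 'b, 'm) module_scheme \<Rightarrow> 'b \<Rightarrow> 'a \<Rightarrow> ('b \<times> 'a) set" where
  "mod_frac S M m s = {(n, t). n \<in> carrier M \<and> t \<in> S \<and>
     (\<exists>u\<in>S. u \<odot>\<^bsub>M\<^esub> (t \<odot>\<^bsub>M\<^esub> m) = u \<odot>\<^bsub>M\<^esub> (s \<odot>\<^bsub>M\<^esub> n))}"

definition loc_module ::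
  "('a, 'r) ring_scheme \<Rightarrow> 'a set \<Rightarrow> ('a, 'b, 'm) module_scheme
     \<Rightarrow> (('a \<times> 'a) set, ('b \<times> 'a) set) module" where
  "loc_module R S M = \<lparr>carrier = {mod_frac S M m s | m s. m \<in> carrier M \<and> s \<in> S},
     monoid.mult = undefined, monoid.one = undefined,
     ring.zero = mod_frac S M \<zero>\<^bsub>M\<^esub> \<one>\<^bsub>R\<^esub>,
     ring.add = (\<lambda>U V. \<Union>(m, s)\<in>U. \<Union>(n, t)\<in>V.
       mod_frac S M ((t \<odot>\<^bsub>M\<^esub> m) \<oplus>\<^bsub>M\<^esub> (s \<odot>\<^bsub>M\<^esub> n)) (s \<otimes>\<^bsub>R\<^esub> t)),
     module.smult = (\<lambda>A U. \<Union>(a, s)\<in>A. \<Union>(m, t)\<in>U. mod_frac S M (a \<odot>\<^bsub>M\<^esub> m) (s \<otimes>\<^bsub>R\<^esub> t))\<rparr>"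

definition loc_ring :: "('a, 'r) ring_scheme \<Rightarrow> 'a set \<Rightarrow> ('a \<times> 'a) set ring" where
  "loc_ring R S = \<lparr>carrier = carrier (loc_module R S (self_module R)),
     monoid.mult = module.smult (loc_module R S (self_module R)),
     monoid.one = mod_frac S (self_module R) \<one>\<^bsub>R\<^esub> \<one>\<^bsub>R\<^esub>,
     ring.zero = ring.zero (loc_module R S (self_module R)),
     ring.add = ring.add (loc_module R S (self_module R))\<rparr>"

definition generically_free ::
  "('a, 'r) ring_scheme \<Rightarrow> ('a, 'b, 'm) module_scheme \<Rightarrow> bool" where
  "generically_free R M \<longleftrightarrow> (\<forall>P\<in>ring_Ass R.
     free_module (loc_ring R (carrier R - P)) (loc_module R (carrier R - P) M))"

definition total_fractions :: "('a, 'r) ring_scheme \<Rightarrow> ('a \<times> 'a) set ring" where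
  "total_fractions R = loc_ring R (nonzerodivisors R)"

definition to_total_fractions :: "('a, 'r) ring_scheme \<Rightarrow> 'a \<Rightarrow> ('a \<times> 'a) set" where
  "to_total_fractions R a = mod_frac (nonzerodivisors R) (self_module R) a \<one>\<^bsub>R\<^esub>"

section \<open>Tensor products\<close>

text \<open>
  \<open>M \<otimes>\<^sub>R N\<close> is the free abelian group on \<open>carrier M \<times> carrier N\<close> modulo the subgroup generated
  by the bilinearity and balancing relations. Module structures are added afterwards.
\<close>

definition tensor_relations ::
  "('a, 'r) ring_scheme \<Rightarrow> ('a, 'b, 'm) module_scheme \<Rightarrow> ('a, 'c, 'n) module_scheme
     \<Rightarrow> ('b \<times> 'c \<Rightarrow>\<^sub>0 int) set" where
  "tensor_relations R M N = generate (free_Abelian_group (carrier M \<times> carrier N))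
     ({frag_of (x \<oplus>\<^bsub>M\<^esub> x', y) - frag_of (x, y) - frag_of (x', y) | x x' y.
          x \<in> carrier M \<and> x' \<in> carrier M \<and> y \<in> carrier N} \<union>
      {frag_of (x, y \<oplus>\<^bsub>N\<^esub> y') - frag_of (x, y) - frag_of (x, y') | x y y'.
          x \<in> carrier M \<and> y \<in> carrier N \<and> y' \<in> carrier N} \<union>
      {frag_of (a \<odot>\<^bsub>M\<^esub> x, y) - frag_of (x, a \<odot>\<^bsub>N\<^esub> y) | a x y.
          a \<in> carrier R \<and> x \<in> carrier M \<and> y \<in> carrier N})"

definition tensor_group ::
  "('a, 'r) ring_scheme \<Rightarrow> ('a, 'b, 'm) module_scheme \<Rightarrow> ('a, 'c, 'n) module_scheme
     \<Rightarrow> ('b \<times> 'c \<Rightarrow>\<^sub>0 int) set monoid" where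
  "tensor_group R M N =
     free_Abelian_group (carrier M \<times> carrier N) Mod tensor_relations R M N"

text \<open>
  \<open>tensor_push R M N h\<close> is the additive map into \<open>M \<otimes>\<^sub>R N\<close> which sends a pure tensor \<open>x \<otimes> y\<close> to
  \<open>x' \<otimes> y'\<close>, where \<open>(x', y') = h (x, y)\<close>. It is used only for \<open>h\<close> that respect the relations.
\<close>

definition tensor_push ::
  "('a, 'r) ring_scheme \<Rightarrow> ('a, 'b, 'm) module_scheme \<Rightarrow> ('a, 'c, 'n) module_scheme
     \<Rightarrow> ('d \<times> 'e \<Rightarrow> 'b \<times> 'c) \<Rightarrow> ('d \<times> 'e \<Rightarrow>\<^sub>0 int) set \<Rightarrow> ('b \<times> 'c \<Rightarrow>\<^sub>0 int) set" where
  "tensor_push R M N h U =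
     (\<Union>c\<in>U. tensor_relations R M N
        #>\<^bsub>free_Abelian_group (carrier M \<times> carrier N)\<^esub> frag_extend (frag_of \<circ> h) c)"

definition tensor ::
  "('a, 'r) ring_scheme \<Rightarrow> ('a, 'b, 'm) module_scheme \<Rightarrow> ('a, 'c, 'n) module_scheme
     \<Rightarrow> ('a, ('b \<times> 'c \<Rightarrow>\<^sub>0 int) set) module" where
  "tensor R M N = \<lparr>carrier = carrier (tensor_group R M N), monoid.mult = undefined, monoid.one = undefined,
     ring.zero = monoid.one (tensor_group R M N), ring.add = monoid.mult (tensor_group R M N),
     module.smult = (\<lambda>a. tensor_push R M N (\<lambda>(x, y). (a \<odot>\<^bsub>M\<^esub> x, y)))\<rparr>"

text \<open>For a ring homomorphism \<open>\<phi>\<close> from \<open>R\<close> to \<open>S\<close>: the ring \<open>S\<close> as an \<open>R\<close>-module, and the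
  \<open>S\<close>-module \<open>M \<otimes>\<^sub>R S\<close>.\<close>

definition restrict_scalars :: "('a \<Rightarrow> 's) \<Rightarrow> ('s, 't) ring_scheme \<Rightarrow> ('a, 's) module" where
  "restrict_scalars \<phi> S = \<lparr>carrier = carrier S, monoid.mult = monoid.mult S, monoid.one = monoid.one S,
     ring.zero = ring.zero S, ring.add = ring.add S, module.smult = (\<lambda>a x. \<phi> a \<otimes>\<^bsub>S\<^esub> x)\<rparr>"

definition base_change ::
  "('a, 'r) ring_scheme \<Rightarrow> ('a \<Rightarrow> 's) \<Rightarrow> ('s, 't) ring_scheme \<Rightarrow> ('a, 'b, 'm) module_scheme
     \<Rightarrow> ('s, ('b \<times> 's \<Rightarrow>\<^sub>0 int) set) module" where
  "base_change R \<phi> S M = \<lparr>carrier = carrier (tensor_group R M (restrict_scalars \<phi> S)),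
     monoid.mult = undefined, monoid.one = undefined,
     ring.zero = monoid.one (tensor_group R M (restrict_scalars \<phi> S)),
     ring.add = monoid.mult (tensor_group R M (restrict_scalars \<phi> S)),
     module.smult = (\<lambda>s. tensor_push R M (restrict_scalars \<phi> S) (\<lambda>(x, t). (x, s \<otimes>\<^bsub>S\<^esub> t)))\<rparr>"

definition has_rank :: "('a, 'r) ring_scheme \<Rightarrow> ('a, 'b, 'm) module_scheme \<Rightarrow> bool" where
  "has_rank R M \<longleftrightarrow> (\<exists>r. mod_isomorphic (total_fractions R)
     (base_change R (to_total_fractions R) (total_fractions R) M)
     (free_mod (total_fractions R) r))"

section \<open>Free resolutions, syzygies and Tor\<close>

text \<open>
  A free resolution by finitely generated free modules consists of the ranks \<open>n i\<close>, the
  differentials \<open>d i\<close> from \<open>R\<^bsup>n (i+1)\<^esup>\<close> to \<open>R\<^bsup>n i\<^esup>\<close>, and the augmentation \<open>\<epsilon>\<close> from \<open>R\<^bsup>n 0\<^esup>\<close> to \<open>M\<close>.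
\<close>

definition free_resolution ::
  "('a, 'r) ring_scheme \<Rightarrow> ('a, 'b, 'm) module_scheme \<Rightarrow> (nat \<Rightarrow> nat)
     \<Rightarrow> (nat \<Rightarrow> (nat \<Rightarrow> 'a) \<Rightarrow> (nat \<Rightarrow> 'a)) \<Rightarrow> ((nat \<Rightarrow> 'a) \<Rightarrow> 'b) \<Rightarrow> bool" where
  "free_resolution R M n d \<epsilon> \<longleftrightarrow>
     \<epsilon> \<in> mod_hom R (free_mod R (n 0)) M \<and>
     (\<forall>i. d i \<in> mod_hom R (free_mod R (n (Suc i))) (free_mod R (n i))) \<and>
     \<epsilon> ` carrier (free_mod R (n 0)) = carrier M \<and>
     d 0 ` carrier (free_mod R (n 1)) = a_kernel (free_mod R (n 0)) M \<epsilon> \<and>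
     (\<forall>i. d (Suc i) ` carrier (free_mod R (n (Suc (Suc i)))) =
            a_kernel (free_mod R (n (Suc i))) (free_mod R (n i)) (d i))"

definition minimal_free_resolution ::
  "('a, 'r) ring_scheme \<Rightarrow> ('a, 'b, 'm) module_scheme \<Rightarrow> (nat \<Rightarrow> nat)
     \<Rightarrow> (nat \<Rightarrow> (nat \<Rightarrow> 'a) \<Rightarrow> (nat \<Rightarrow> 'a)) \<Rightarrow> ((nat \<Rightarrow> 'a) \<Rightarrow> 'b) \<Rightarrow> bool" where
  "minimal_free_resolution R M n d \<epsilon> \<longleftrightarrow> free_resolution R M n d \<epsilon> \<and>
     (\<forall>i. d i ` carrier (free_mod R (n (Suc i))) \<subseteq>
        mod_span R (free_mod R (n i))
          {a \<odot>\<^bsub>free_mod R (n i)\<^esub> x | a x. a \<in> max_ideal R \<and> x \<in> carrier (free_mod R (n i))})"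

text \<open>The syzygy with index \<open>i + 1\<close> of a resolution is the image of \<open>d i\<close>, a submodule of \<open>R\<^bsup>n i\<^esup>\<close>
  (the syzygy with index 0 is the resolved module itself).\<close>

definition Suc_syzygy ::
  "('a, 'r) ring_scheme \<Rightarrow> (nat \<Rightarrow> nat) \<Rightarrow> (nat \<Rightarrow> (nat \<Rightarrow> 'a) \<Rightarrow> (nat \<Rightarrow> 'a)) \<Rightarrow> nat
     \<Rightarrow> ('a, nat \<Rightarrow> 'a) module" where
  "Suc_syzygy R n d i =
     (free_mod R (n i))\<lparr>carrier := d i ` carrier (free_mod R (n (Suc i)))\<rparr>"

text \<open>Minimal free resolutions of a finitely generated module over a Noetherian local ring exist
  and are unique up to isomorphism, so any one of them may be used.\<close>

definition two_periodic :: "('a, 'r) ring_scheme \<Rightarrow> ('a, 'b, 'm) module_scheme \<Rightarrow> bool" where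
  "two_periodic R M \<longleftrightarrow> (\<exists>n d \<epsilon>. minimal_free_resolution R M n d \<epsilon> \<and>
     mod_isomorphic R M (Suc_syzygy R n d 1))"

text \<open>Homology of a chain complex concentrated in nonnegative degrees, with \<open>\<delta> i\<close> mapping
  \<open>C (i+1)\<close> to \<open>C i\<close>.\<close>

definition homology ::
  "(nat \<Rightarrow> ('a, 'b) module) \<Rightarrow> (nat \<Rightarrow> 'b \<Rightarrow> 'b) \<Rightarrow> nat \<Rightarrow> ('a, 'b set) module" where
  "homology C \<delta> i = quot_module
     ((C i)\<lparr>carrier := (case i of 0 \<Rightarrow> carrier (C 0) | Suc j \<Rightarrow> a_kernel (C i) (C j) (\<delta> j))\<rparr>)
     (\<delta> i ` carrier (C (Suc i)))"

text \<open>
  \<open>Tor\<close> is computed from a chosen resolution of \<open>M\<close> by finitely generated free modules; it is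
  meaningful whenever one exists, in particular for finitely generated \<open>M\<close> and Noetherian \<open>R\<close>.
\<close>

definition Tor ::
  "('a, 'r) ring_scheme \<Rightarrow> nat \<Rightarrow> ('a, 'b, 'm) module_scheme \<Rightarrow> ('a, 'c, 'n) module_scheme
     \<Rightarrow> ('a, ((nat \<Rightarrow> 'a) \<times> 'c \<Rightarrow>\<^sub>0 int) set set) module" where
  "Tor R i M N = (let (n, d, \<epsilon>) = (SOME (n, d, \<epsilon>). free_resolution R M n d \<epsilon>) in
     homology (\<lambda>k. tensor R (free_mod R (n k)) N)
       (\<lambda>k. tensor_push R (free_mod R (n k)) N (\<lambda>(x, y). (d k x, y))) i)"

definition Tor_independent ::
  "('a, 'r) ring_scheme \<Rightarrow> ('a, 'b, 'm) module_scheme \<Rightarrow> ('a, 'c, 'n) module_scheme \<Rightarrow> bool" where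
  "Tor_independent R M N \<longleftrightarrow> (\<forall>i\<ge>1. carrier (Tor R i M N) = {\<zero>\<^bsub>Tor R i M N\<^esub>})"

end

theory Submission
  imports Defs
begin

text \<open>
  Let \<open>R\<^bsup>n\<^sub>1\<^esup> \<rightarrow> R\<^bsup>n\<^sub>0\<^esup> \<rightarrow> M \<rightarrow> 0\<close> be a minimal presentation with first map \<open>A\<close>. An isomorphism of \<open>M\<close> with
  its second syzygy, the kernel of \<open>A\<close>, yields \<open>B : R\<^bsup>n\<^sub>0\<^esup> \<rightarrow> R\<^bsup>n\<^sub>1\<^esup>\<close> with \<open>ker A = im B\<close> and \<open>ker B = im A\<close>, so
  that \<open>A, B, A, B, \<dots>\<close> is a free resolution of \<open>M\<close>. Write \<open>A\<^sub>N : N\<^bsup>n\<^sub>1\<^esup> \<rightarrow> N\<^bsup>n\<^sub>0\<^esup>\<close> and \<open>B\<^sub>N\<close> for the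
  maps obtained by tensoring with \<open>N\<close>. Then \<open>M \<otimes> N\<close> is the cokernel of \<open>A\<^sub>N\<close>, and \<open>M\<close> and \<open>N\<close> are
  Tor-independent if and only if \<open>ker B\<^sub>N = im A\<^sub>N\<close> and \<open>ker A\<^sub>N = im B\<^sub>N\<close>.

  Since \<open>N\<close> is torsionless and has rank, it is isomorphic to a submodule of some \<open>R\<^sup>r\<close> that contains
  \<open>d R\<^sup>r\<close> for a non-zero-divisor \<open>d\<close>. If \<open>ker B\<^sub>N = im A\<^sub>N\<close>, then \<open>B\<^sub>N\<close> embeds the cokernel of \<open>A\<^sub>N\<close> into
  a power of the torsion-free module \<open>N\<close>. Conversely, generic freeness of \<open>M\<close> provides a
  non-zero-divisor \<open>a\<close> and linear maps \<open>U, W\<close> with \<open>a = A U + W B\<close>, hence \<open>a\<close> annihilates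
  \<open>ker B\<^sub>N / im A\<^sub>N\<close>, which vanishes if the cokernel of \<open>A\<^sub>N\<close> is torsion-free.

  It remains to see that \<open>ker B\<^sub>N = im A\<^sub>N\<close> implies \<open>ker A\<^sub>N = im B\<^sub>N\<close>. Counting lengths at a minimal
  prime gives \<open>n\<^sub>0 = n\<^sub>1\<close>. The submodule \<open>F\<close> of \<open>N\<close> corresponding to \<open>d R\<^sup>r\<close> is free, so both equalities
  hold for \<open>F\<close>, and \<open>N/F\<close> has finite length because \<open>R\<close> is one-dimensional. Additivity of length
  along \<open>A\<^sub>N\<close> and \<open>B\<^sub>N\<close>, applied to \<open>N\<^bsup>n\<^sub>1\<^esup>/F\<^bsup>n\<^sub>1\<^esup>\<close> and \<open>N\<^bsup>n\<^sub>0\<^esup>/F\<^bsup>n\<^sub>0\<^esup>\<close>, shows that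
  \<open>ker A\<^sub>N / im B\<^sub>N\<close> has length zero.
\<close>

section \<open>Module homomorphisms\<close>

text \<open>The two exactness conditions are not symmetric. Only the cokernel of A_N is the tensor
  product, so torsion-freeness yields ker B_N = im A_N and says nothing directly about the cokernel
  of B_N; the length count supplies the missing information. N has infinite length in general:
  dividing by the free lattice F makes the count finite, and exactness over F makes the terms coming
  from F match.

  The scalar a is found in the ideal of all s such that some endomorphism of R^(n_0) kills im A and
  induces multiplication by s on M. If M_P is free, such an s exists outside P; prime avoidance over
  the associated primes then gives a non-zero-divisor. Three successive liftings turn its
  endomorphism into U and W.

  Dimension one enters through primes: a minimal prime, where ranks can be compared, is the lower
  end of a chain of two primes, and a prime containing a non-zero-divisor is maximal, so R/dR has
  finite length.

  The definition of Tor fixes one unspecified resolution; passing to the periodic one needs the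
  comparison theorem, carried out with matrices acting on powers of N.\<close>

lemma mod_homI:
  assumes "\<And>x. x \<in> carrier M \<Longrightarrow> f x \<in> carrier N"
    and "\<And>x y. x \<in> carrier M \<Longrightarrow> y \<in> carrier M \<Longrightarrow> f (x \<oplus>\<^bsub>M\<^esub> y) = f x \<oplus>\<^bsub>N\<^esub> f y"
    and "\<And>a x. a \<in> carrier R \<Longrightarrow> x \<in> carrier M \<Longrightarrow> f (a \<odot>\<^bsub>M\<^esub> x) = a \<odot>\<^bsub>N\<^esub> f x"
  shows "f \<in> mod_hom R M N"
  using assms by (auto simp: mod_hom_def)

lemma
  assumes "f \<in> mod_hom R M N"
  shows mod_hom_closed: "x \<in> carrier M \<Longrightarrow> f x \<in> carrier N"
    and mod_hom_add: "x \<in> carrier M \<Longrightarrow> y \<in> carrier M \<Longrightarrow> f (x \<oplus>\<^bsub>M\<^esub> y) = f x \<oplus>\<^bsub>N\<^esub> f y"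
    and mod_hom_smult: "a \<in> carrier R \<Longrightarrow> x \<in> carrier M \<Longrightarrow> f (a \<odot>\<^bsub>M\<^esub> x) = a \<odot>\<^bsub>N\<^esub> f x"
  using assms by (auto simp: mod_hom_def)

lemma mod_hom_comp:
  assumes "f \<in> mod_hom R M N" "g \<in> mod_hom R L M"
  shows "(\<lambda>x. f (g x)) \<in> mod_hom R L N"
  by (rule mod_homI) (simp_all add: mod_hom_closed[OF assms(1)] mod_hom_closed[OF assms(2)]
      mod_hom_add[OF assms(1)] mod_hom_add[OF assms(2)] mod_hom_smult[OF assms(1)] mod_hom_smult[OF assms(2)])

lemma mod_hom_ident: "(\<lambda>x. x) \<in> mod_hom R M M"
  by (rule mod_homI) auto

text \<open>Preservation of zero is not part of \<open>mod_hom\<close>; linearity for the scalar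
  zero recovers it.\<close>

lemma mod_hom_zero:
  assumes "module R M" "module R N" "f \<in> mod_hom R M N"
  shows "f \<zero>\<^bsub>M\<^esub> = \<zero>\<^bsub>N\<^esub>"
proof -
  interpret M: module R M by fact
  interpret N: module R N by fact
  have "f (\<zero>\<^bsub>R\<^esub> \<odot>\<^bsub>M\<^esub> \<zero>\<^bsub>M\<^esub>) = \<zero>\<^bsub>R\<^esub> \<odot>\<^bsub>N\<^esub> f \<zero>\<^bsub>M\<^esub>"
    by (rule mod_hom_smult[OF assms(3)]) auto
  then show ?thesis
    by (simp add: mod_hom_closed[OF assms(3)])
qed

lemma mod_hom_a_inv:
  assumes "module R M" "module R N" "f \<in> mod_hom R M N" "x \<in> carrier M"
  shows "f (\<ominus>\<^bsub>M\<^esub> x) = \<ominus>\<^bsub>N\<^esub> f x"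
proof -
  interpret M: module R M by fact
  interpret N: module R N by fact
  have "f ((\<ominus>\<^bsub>R\<^esub> \<one>\<^bsub>R\<^esub>) \<odot>\<^bsub>M\<^esub> x) = (\<ominus>\<^bsub>R\<^esub> \<one>\<^bsub>R\<^esub>) \<odot>\<^bsub>N\<^esub> f x"
    by (rule mod_hom_smult[OF assms(3)]) (use assms(4) in auto)
  then show ?thesis
    using assms(4) mod_hom_closed[OF assms(3,4)] by (simp add: M.smult_l_minus N.smult_l_minus)
qed

lemma mod_hom_minus:
  assumes "module R M" "module R N" "f \<in> mod_hom R M N" "x \<in> carrier M" "y \<in> carrier M"
  shows "f (x \<ominus>\<^bsub>M\<^esub> y) = f x \<ominus>\<^bsub>N\<^esub> f y"
proof -
  interpret M: module R M by fact
  interpret N: module R N by fact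
  show ?thesis
    using assms(4,5) by (simp add: a_minus_def mod_hom_add[OF assms(3)] mod_hom_a_inv[OF assms(1-3)])
qed

lemma mod_hom_finsum:
  assumes "module R M" "module R N" "f \<in> mod_hom R M N" "finite A" "g \<in> A \<rightarrow> carrier M"
  shows "f (\<Oplus>\<^bsub>M\<^esub>i\<in>A. g i) = (\<Oplus>\<^bsub>N\<^esub>i\<in>A. f (g i))"
  using assms(4,5)
proof (induction A rule: finite_induct)
  interpret M: module R M by fact
  interpret N: module R N by fact
  case empty
  then show ?case using mod_hom_zero[OF assms(1-3)] by simp
next
  interpret M: module R M by fact
  interpret N: module R N by fact
  case (insert x F)
  then have "(\<lambda>i. f (g i)) \<in> F \<rightarrow> carrier N" "f (g x) \<in> carrier N"
    using mod_hom_closed[OF assms(3)] by auto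
  moreover have "g \<in> F \<rightarrow> carrier M" "g x \<in> carrier M"
    using insert.prems by auto
  ultimately show ?case
    using insert.IH insert.hyps by (simp add: mod_hom_add[OF assms(3)])
qed

lemma mod_hom_sum:
  assumes "module R N" "f \<in> mod_hom R M N" "g \<in> mod_hom R M N"
  shows "(\<lambda>x. f x \<oplus>\<^bsub>N\<^esub> g x) \<in> mod_hom R M N"
proof -
  interpret N: module R N by fact
  show ?thesis
    by (rule mod_homI) (auto simp: mod_hom_closed[OF assms(2)] mod_hom_closed[OF assms(3)]
        mod_hom_add[OF assms(2)] mod_hom_add[OF assms(3)] mod_hom_smult[OF assms(2)] mod_hom_smult[OF assms(3)]
        N.smult_r_distr N.add.m_ac)
qed

lemma mod_hom_scale:
  assumes "module R N" "f \<in> mod_hom R M N" "a \<in> carrier R"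
  shows "(\<lambda>x. a \<odot>\<^bsub>N\<^esub> f x) \<in> mod_hom R M N"
proof -
  interpret N: module R N by fact
  have smult_swap: "a \<odot>\<^bsub>N\<^esub> (b \<odot>\<^bsub>N\<^esub> x) = b \<odot>\<^bsub>N\<^esub> (a \<odot>\<^bsub>N\<^esub> x)" if "b \<in> carrier R" "x \<in> carrier N" for b x
    using that assms(3) N.R.m_comm N.smult_assoc1 by metis
  show ?thesis
    using assms(3) by (intro mod_homI) (auto simp: mod_hom_closed[OF assms(2)] mod_hom_add[OF assms(2)]
        mod_hom_smult[OF assms(2)] N.smult_r_distr smult_swap)
qed

lemma mod_hom_uminus:
  assumes "module R N" "f \<in> mod_hom R M N"
  shows "(\<lambda>x. \<ominus>\<^bsub>N\<^esub> f x) \<in> mod_hom R M N"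
proof -
  interpret N: module R N by fact
  show ?thesis
    by (intro mod_homI) (auto simp: mod_hom_closed[OF assms(2)] mod_hom_add[OF assms(2)]
        mod_hom_smult[OF assms(2)] N.smult_r_minus N.minus_add)
qed

lemma mod_hom_diff:
  assumes "module R N" "f \<in> mod_hom R M N" "g \<in> mod_hom R M N"
  shows "(\<lambda>x. f x \<ominus>\<^bsub>N\<^esub> g x) \<in> mod_hom R M N"
  unfolding a_minus_def by (rule mod_hom_sum mod_hom_uminus assms)+

section \<open>Images, preimages, kernels and sums of submodules\<close>

lemma submodule_image:
  assumes "module R M" "module R N" "f \<in> mod_hom R M N" "submodule H R M"
  shows "submodule (f ` H) R N"
proof -
  interpret M: module R M by fact
  interpret N: module R N by fact
  note H = M.submoduleE[OF assms(4)]
  have cl: "x \<in> H \<Longrightarrow> x \<in> carrier M" for x using H(1) by auto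
  have z: "\<zero>\<^bsub>M\<^esub> \<in> H" using assms(4) by (simp add: submodule_def subgroup_def)
  show ?thesis
  proof (rule N.submoduleI)
    show "\<zero>\<^bsub>N\<^esub> \<in> f ` H" using z mod_hom_zero[OF assms(1-3)] by (metis image_eqI)
  next
    fix a assume "a \<in> f ` H"
    then show "\<ominus>\<^bsub>N\<^esub> a \<in> f ` H" using H(3) cl mod_hom_a_inv[OF assms(1-3)] by (smt (verit) imageE imageI)
  next
    fix a b assume "a \<in> f ` H" "b \<in> f ` H"
    then show "a \<oplus>\<^bsub>N\<^esub> b \<in> f ` H" using H(5) cl mod_hom_add[OF assms(3)] by (smt (verit) imageE imageI)
  next
    fix a b assume "a \<in> carrier R" "b \<in> f ` H"
    then show "a \<odot>\<^bsub>N\<^esub> b \<in> f ` H" using H(4) cl mod_hom_smult[OF assms(3)] by (smt (verit) imageE imageI)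
  qed (use cl mod_hom_closed[OF assms(3)] in auto)
qed

lemma submodule_zero_mem: "submodule H R M \<Longrightarrow> \<zero>\<^bsub>M\<^esub> \<in> H"
  by (simp add: submodule_def subgroup_def)

lemma submodule_subset: "submodule H R M \<Longrightarrow> H \<subseteq> carrier M"
  by (simp add: submodule_def subgroup_def)

text \<open>Restricting the domain to a submodule \<open>H\<close> lets one statement cover
  intersections (\<open>f\<close> the identity), kernels (\<open>K\<close> zero) and kernels inside
  a submodule, which the length computations need.\<close>

lemma submodule_vimage:
  assumes "module R M" "module R N" "f \<in> mod_hom R M N" "submodule H R M" "submodule K R N"
  shows "submodule {x \<in> H. f x \<in> K} R M"
proof -
  interpret M: module R M by fact
  interpret N: module R N by fact
  note H = M.submoduleE[OF assms(4)] and K = N.submoduleE[OF assms(5)]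
  have cl: "x \<in> H \<Longrightarrow> x \<in> carrier M" for x using H(1) by auto
  show ?thesis
    by (rule M.submoduleI)
       (use H K cl submodule_zero_mem[OF assms(4)] submodule_zero_mem[OF assms(5)] in
         \<open>auto simp: mod_hom_zero[OF assms(1-3)] mod_hom_a_inv[OF assms(1-3)] mod_hom_add[OF assms(3)]
          mod_hom_smult[OF assms(3)]\<close>)
qed

lemma submodule_Int:
  assumes "module R M" "submodule H R M" "submodule K R M"
  shows "submodule (H \<inter> K) R M"
  using submodule_vimage[OF assms(1,1) mod_hom_ident assms(2,3)] by (simp add: Int_def)

lemma submodule_zero:
  assumes "module R M"
  shows "submodule {\<zero>\<^bsub>M\<^esub>} R M"
proof -
  interpret M: module R M by fact
  show ?thesis by (rule M.submoduleI) auto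
qed

lemma submodule_kernel:
  assumes "module R M" "module R N" "f \<in> mod_hom R M N"
  shows "submodule {x \<in> carrier M. f x = \<zero>\<^bsub>N\<^esub>} R M"
proof -
  interpret M: module R M by fact
  show ?thesis
    using submodule_vimage[OF assms M.carrier_is_submodule submodule_zero[OF assms(2)]] by simp
qed

lemma submodule_sum:
  assumes "module R M" "submodule H R M" "submodule K R M"
  shows "submodule {h \<oplus>\<^bsub>M\<^esub> k | h k. h \<in> H \<and> k \<in> K} R M"
proof -
  interpret M: module R M by fact
  note H = M.submoduleE[OF assms(2)] and K = M.submoduleE[OF assms(3)]
  have cl: "x \<in> H \<Longrightarrow> x \<in> carrier M" "x \<in> K \<Longrightarrow> x \<in> carrier M" for x using H(1) K(1) by auto
  show ?thesis
  proof (rule M.submoduleI)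
    show "\<zero>\<^bsub>M\<^esub> \<in> {h \<oplus>\<^bsub>M\<^esub> k | h k. h \<in> H \<and> k \<in> K}"
      using submodule_zero_mem[OF assms(2)] submodule_zero_mem[OF assms(3)]
      by (intro CollectI exI[of _ "\<zero>\<^bsub>M\<^esub>"]) simp
  next
    fix a assume "a \<in> {h \<oplus>\<^bsub>M\<^esub> k | h k. h \<in> H \<and> k \<in> K}"
    then obtain h k where "a = h \<oplus>\<^bsub>M\<^esub> k" "h \<in> H" "k \<in> K" by auto
    then show "\<ominus>\<^bsub>M\<^esub> a \<in> {h \<oplus>\<^bsub>M\<^esub> k | h k. h \<in> H \<and> k \<in> K}"
      using H(3) K(3) cl by (auto simp: M.M.minus_add)
  next
    fix a b assume "a \<in> {h \<oplus>\<^bsub>M\<^esub> k | h k. h \<in> H \<and> k \<in> K}" "b \<in> {h \<oplus>\<^bsub>M\<^esub> k | h k. h \<in> H \<and> k \<in> K}"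
    then obtain h k h' k' where "a = h \<oplus>\<^bsub>M\<^esub> k" "h \<in> H" "k \<in> K" "b = h' \<oplus>\<^bsub>M\<^esub> k'" "h' \<in> H" "k' \<in> K" by auto
    moreover from this have "a \<oplus>\<^bsub>M\<^esub> b = (h \<oplus>\<^bsub>M\<^esub> h') \<oplus>\<^bsub>M\<^esub> (k \<oplus>\<^bsub>M\<^esub> k')"
      using cl by (simp add: M.add.m_ac)
    ultimately show "a \<oplus>\<^bsub>M\<^esub> b \<in> {h \<oplus>\<^bsub>M\<^esub> k | h k. h \<in> H \<and> k \<in> K}"
      using H(5) K(5) by blast
  next
    fix a b assume "a \<in> carrier R" "b \<in> {h \<oplus>\<^bsub>M\<^esub> k | h k. h \<in> H \<and> k \<in> K}"
    moreover from this obtain h k where hk: "b = h \<oplus>\<^bsub>M\<^esub> k" "h \<in> H" "k \<in> K" by auto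
    ultimately have "a \<odot>\<^bsub>M\<^esub> b = (a \<odot>\<^bsub>M\<^esub> h) \<oplus>\<^bsub>M\<^esub> (a \<odot>\<^bsub>M\<^esub> k)"
      using cl by (simp add: M.smult_r_distr)
    then show "a \<odot>\<^bsub>M\<^esub> b \<in> {h \<oplus>\<^bsub>M\<^esub> k | h k. h \<in> H \<and> k \<in> K}"
      using H(4) K(4) hk(2,3) \<open>a \<in> carrier R\<close> by blast
  qed (use cl in auto)
qed

section \<open>Powers of a module\<close>

text \<open>Same extensional encoding as \<open>free_mod\<close>, so that the two agree literally
  over \<open>self_module R\<close>. It serves as the concrete model of the tensor product of R^n
  with M.\<close>

definition pow_mod :: "('a, 'b, 'm) module_scheme \<Rightarrow> nat \<Rightarrow> ('a, nat \<Rightarrow> 'b) module" where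
  "pow_mod M n = \<lparr>carrier = {..<n} \<rightarrow>\<^sub>E carrier M, monoid.mult = undefined, monoid.one = undefined,
     ring.zero = (\<lambda>i\<in>{..<n}. \<zero>\<^bsub>M\<^esub>),
     ring.add = (\<lambda>x y. \<lambda>i\<in>{..<n}. x i \<oplus>\<^bsub>M\<^esub> y i),
     module.smult = (\<lambda>a x. \<lambda>i\<in>{..<n}. a \<odot>\<^bsub>M\<^esub> x i)\<rparr>"

lemma free_mod_eq: "free_mod R n = pow_mod (self_module R) n"
  by (simp add: free_mod_def pow_mod_def self_module_def)

lemma self_module_simps [simp]:
  "carrier (self_module R) = carrier R" "\<zero>\<^bsub>self_module R\<^esub> = \<zero>\<^bsub>R\<^esub>"
  "x \<oplus>\<^bsub>self_module R\<^esub> y = x \<oplus>\<^bsub>R\<^esub> y" "a \<odot>\<^bsub>self_module R\<^esub> x = a \<otimes>\<^bsub>R\<^esub> x"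
  by (simp_all add: self_module_def)

lemma a_inv_self_module [simp]: "\<ominus>\<^bsub>self_module R\<^esub> x = \<ominus>\<^bsub>R\<^esub> x"
  by (simp add: a_inv_def m_inv_def self_module_def)

lemma finsum_self_module [simp]: "finsum (self_module R) f A = finsum R f A"
  by (simp add: finsum_def finprod_def self_module_def)

lemma module_self: "cring R \<Longrightarrow> module R (self_module R)"
proof -
  assume "cring R"
  then interpret cring R .
  show ?thesis
  proof (rule moduleI)
    show "abelian_group (self_module R)"
      by (rule abelian_groupI) (auto simp: a_ac intro: exI[of _ "\<ominus>\<^bsub>R\<^esub> _"] l_neg a_inv_closed intro!: bexI)
  qed (auto simp: l_distr r_distr m_assoc \<open>cring R\<close>)
qed

lemma pow_mod_carrier: "carrier (pow_mod M n) = {..<n} \<rightarrow>\<^sub>E carrier M"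
  by (simp add: pow_mod_def)

lemma pow_mod_simps:
  "\<zero>\<^bsub>pow_mod M n\<^esub> = (\<lambda>i\<in>{..<n}. \<zero>\<^bsub>M\<^esub>)"
  "x \<oplus>\<^bsub>pow_mod M n\<^esub> y = (\<lambda>i\<in>{..<n}. x i \<oplus>\<^bsub>M\<^esub> y i)"
  "a \<odot>\<^bsub>pow_mod M n\<^esub> x = (\<lambda>i\<in>{..<n}. a \<odot>\<^bsub>M\<^esub> x i)"
  by (simp_all add: pow_mod_def)

lemma pow_mod_nth:
  assumes "i < n"
  shows "\<zero>\<^bsub>pow_mod M n\<^esub> i = \<zero>\<^bsub>M\<^esub>"
  "(x \<oplus>\<^bsub>pow_mod M n\<^esub> y) i = x i \<oplus>\<^bsub>M\<^esub> y i"
  "(a \<odot>\<^bsub>pow_mod M n\<^esub> x) i = a \<odot>\<^bsub>M\<^esub> x i"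
  using assms by (simp_all add: pow_mod_def)

lemma pow_mod_nth_closed: "x \<in> carrier (pow_mod M n) \<Longrightarrow> i < n \<Longrightarrow> x i \<in> carrier M"
  by (auto simp: pow_mod_carrier)

lemma pow_mod_memI: "x \<in> extensional {..<n} \<Longrightarrow> (\<And>i. i < n \<Longrightarrow> x i \<in> carrier M) \<Longrightarrow> x \<in> carrier (pow_mod M n)"
  by (auto simp: pow_mod_carrier PiE_def)

lemma pow_mod_eqI:
  assumes "x \<in> carrier (pow_mod M n)" "y \<in> carrier (pow_mod M n)" "\<And>i. i < n \<Longrightarrow> x i = y i"
  shows "x = y"
  using assms by (intro PiE_ext[of _ "{..<n}" "\<lambda>_. carrier M"]) (auto simp: pow_mod_carrier)

lemma module_pow_mod:
  assumes "module R M"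
  shows "module R (pow_mod M n)"
proof -
  interpret M: module R M by fact
  have "abelian_group (pow_mod M n)"
  proof (rule abelian_groupI)
    fix x assume "x \<in> carrier (pow_mod M n)"
    then show "\<exists>y\<in>carrier (pow_mod M n). y \<oplus>\<^bsub>pow_mod M n\<^esub> x = \<zero>\<^bsub>pow_mod M n\<^esub>"
      by (intro bexI[of _ "\<lambda>i\<in>{..<n}. \<ominus>\<^bsub>M\<^esub> x i"])
         (auto simp: pow_mod_def M.M.l_neg PiE_iff intro!: restrict_ext)
  next
    fix x assume "x \<in> carrier (pow_mod M n)"
    then show "\<zero>\<^bsub>pow_mod M n\<^esub> \<oplus>\<^bsub>pow_mod M n\<^esub> x = x"
      by (intro pow_mod_eqI[of _ M n]) (auto simp: pow_mod_def PiE_iff)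
  qed (auto simp: pow_mod_def M.M.a_ac PiE_iff intro!: restrict_ext)
  then show ?thesis
  proof (intro moduleI)
    fix x assume "x \<in> carrier (pow_mod M n)"
    then show "\<one>\<^bsub>R\<^esub> \<odot>\<^bsub>pow_mod M n\<^esub> x = x"
      by (intro pow_mod_eqI[of _ M n]) (auto simp: pow_mod_def PiE_iff)
  qed (auto simp: pow_mod_def PiE_iff M.smult_l_distr M.smult_r_distr M.smult_assoc1 M.is_cring intro!: restrict_ext)
qed

lemma module_free_mod: "cring R \<Longrightarrow> module R (free_mod R n)"
  by (simp add: free_mod_eq module_pow_mod module_self)

text \<open>The inverse of an additive group is given by a description, so its coordinates are read
  off from multiplication by -1.\<close>

lemma pow_mod_a_inv:
  assumes "module R M" "x \<in> carrier (pow_mod M n)" "i < n"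
  shows "(\<ominus>\<^bsub>pow_mod M n\<^esub> x) i = \<ominus>\<^bsub>M\<^esub> x i"
proof -
  interpret M: module R M by fact
  interpret P: module R "pow_mod M n" using assms(1) by (rule module_pow_mod)
  have "(\<ominus>\<^bsub>R\<^esub> \<one>\<^bsub>R\<^esub>) \<odot>\<^bsub>pow_mod M n\<^esub> x = \<ominus>\<^bsub>pow_mod M n\<^esub> x"
    using assms(2) by (simp add: P.smult_l_minus)
  then have "(\<ominus>\<^bsub>pow_mod M n\<^esub> x) i = (\<ominus>\<^bsub>R\<^esub> \<one>\<^bsub>R\<^esub>) \<odot>\<^bsub>M\<^esub> x i"
    using assms(3) by (metis pow_mod_nth(3))
  then show ?thesis
    using pow_mod_nth_closed[OF assms(2,3)] by (simp add: M.smult_l_minus)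
qed

text \<open>Evaluation at \<open>i\<close> is linear and therefore commutes with finite
  sums.\<close>

lemma pow_mod_finsum:
  assumes "module R M" "finite A" "f \<in> A \<rightarrow> carrier (pow_mod M n)" "i < n"
  shows "(\<Oplus>\<^bsub>pow_mod M n\<^esub>a\<in>A. f a) i = (\<Oplus>\<^bsub>M\<^esub>a\<in>A. f a i)"
proof -
  interpret M: module R M by fact
  have "(\<lambda>x. x i) \<in> mod_hom R (pow_mod M n) M"
    by (rule mod_homI) (use assms(4) in \<open>auto simp: pow_mod_nth intro: pow_mod_nth_closed\<close>)
  from mod_hom_finsum[OF module_pow_mod[OF assms(1)] assms(1) this assms(2,3)] show ?thesis .
qed

section \<open>Extension of linear maps between free modules\<close>

definition unit_vec :: "('a, 'r) ring_scheme \<Rightarrow> nat \<Rightarrow> nat \<Rightarrow> nat \<Rightarrow> 'a" where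
  "unit_vec R n j = (\<lambda>i\<in>{..<n}. if i = j then \<one>\<^bsub>R\<^esub> else \<zero>\<^bsub>R\<^esub>)"

lemma unit_vec_nth: "i < n \<Longrightarrow> unit_vec R n j i = (if i = j then \<one>\<^bsub>R\<^esub> else \<zero>\<^bsub>R\<^esub>)"
  by (simp add: unit_vec_def)

lemma unit_vec_closed: "cring R \<Longrightarrow> unit_vec R n j \<in> carrier (free_mod R n)"
proof -
  assume "cring R"
  then interpret cring R .
  show ?thesis by (auto simp: free_mod_def unit_vec_def)
qed

lemma (in module) finsum_single:
  assumes "finite A" "j \<in> A" "f \<in> A \<rightarrow> carrier M"
  shows "(\<Oplus>\<^bsub>M\<^esub>i\<in>A. (if i = j then \<one>\<^bsub>R\<^esub> else \<zero>\<^bsub>R\<^esub>) \<odot>\<^bsub>M\<^esub> f i) = f j"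
proof -
  have "(\<Oplus>\<^bsub>M\<^esub>i\<in>A. (if i = j then \<one>\<^bsub>R\<^esub> else \<zero>\<^bsub>R\<^esub>) \<odot>\<^bsub>M\<^esub> f i) = (\<Oplus>\<^bsub>M\<^esub>i\<in>A. if j = i then f i else \<zero>\<^bsub>M\<^esub>)"
    using assms by (intro M.finsum_cong') (auto simp: Pi_def)
  also have "\<dots> = f j"
    using M.finsum_singleton[OF assms(2,1,3)] .
  finally show ?thesis .
qed

text \<open>Read as a function of \<open>x\<close>, this is the homomorphism out of R^n that sends
  the \<open>j\<close>-th unit vector to \<open>v j\<close>.\<close>

definition lin_comb :: "('a, 'b, 'm) module_scheme \<Rightarrow> nat \<Rightarrow> (nat \<Rightarrow> 'b) \<Rightarrow> (nat \<Rightarrow> 'a) \<Rightarrow> 'b" where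
  "lin_comb M n v x = (\<Oplus>\<^bsub>M\<^esub>j\<in>{..<n}. x j \<odot>\<^bsub>M\<^esub> v j)"

lemma free_mod_nth:
  assumes "i < n"
  shows "\<zero>\<^bsub>free_mod R n\<^esub> i = \<zero>\<^bsub>R\<^esub>"
    "(x \<oplus>\<^bsub>free_mod R n\<^esub> y) i = x i \<oplus>\<^bsub>R\<^esub> y i"
    "(a \<odot>\<^bsub>free_mod R n\<^esub> x) i = a \<otimes>\<^bsub>R\<^esub> x i"
  using assms by (simp_all add: free_mod_def)

lemma free_mod_nth_closed: "x \<in> carrier (free_mod R n) \<Longrightarrow> i < n \<Longrightarrow> x i \<in> carrier R"
  by (auto simp: free_mod_def)

lemma free_mod_eqI:
  assumes "x \<in> carrier (free_mod R n)" "y \<in> carrier (free_mod R n)" "\<And>i. i < n \<Longrightarrow> x i = y i"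
  shows "x = y"
  using pow_mod_eqI[OF assms[unfolded free_mod_eq]] .

lemma lin_comb_hom:
  assumes "module R M" "\<And>j. j < n \<Longrightarrow> v j \<in> carrier M"
  shows "lin_comb M n v \<in> mod_hom R (free_mod R n) M"
proof -
  interpret M: module R M by fact
  show ?thesis
  proof (rule mod_homI)
    fix x assume "x \<in> carrier (free_mod R n)"
    then show "lin_comb M n v x \<in> carrier M"
      unfolding lin_comb_def using assms(2) by (intro M.M.finsum_closed) (auto dest: free_mod_nth_closed)
  next
    fix x y assume xy: "x \<in> carrier (free_mod R n)" "y \<in> carrier (free_mod R n)"
    have "lin_comb M n v (x \<oplus>\<^bsub>free_mod R n\<^esub> y) = (\<Oplus>\<^bsub>M\<^esub>j\<in>{..<n}. x j \<odot>\<^bsub>M\<^esub> v j \<oplus>\<^bsub>M\<^esub> y j \<odot>\<^bsub>M\<^esub> v j)"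
      unfolding lin_comb_def using assms(2) free_mod_nth_closed[OF xy(1)] free_mod_nth_closed[OF xy(2)]
      by (intro M.M.finsum_cong') (auto simp: free_mod_nth M.smult_l_distr)
    also have "\<dots> = lin_comb M n v x \<oplus>\<^bsub>M\<^esub> lin_comb M n v y"
      unfolding lin_comb_def using assms(2) free_mod_nth_closed[OF xy(1)] free_mod_nth_closed[OF xy(2)]
      by (intro M.M.finsum_addf) auto
    finally show "lin_comb M n v (x \<oplus>\<^bsub>free_mod R n\<^esub> y) = lin_comb M n v x \<oplus>\<^bsub>M\<^esub> lin_comb M n v y" .
  next
    fix a x assume ax: "a \<in> carrier R" "x \<in> carrier (free_mod R n)"
    have "a \<odot>\<^bsub>M\<^esub> lin_comb M n v x = (\<Oplus>\<^bsub>M\<^esub>j\<in>{..<n}. a \<odot>\<^bsub>M\<^esub> (x j \<odot>\<^bsub>M\<^esub> v j))"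
      unfolding lin_comb_def using assms(2) free_mod_nth_closed[OF ax(2)] ax(1)
      by (intro M.finsum_smult_ldistr) auto
    also have "\<dots> = lin_comb M n v (a \<odot>\<^bsub>free_mod R n\<^esub> x)"
      unfolding lin_comb_def using assms(2) free_mod_nth_closed[OF ax(2)] ax(1)
      by (intro M.M.finsum_cong') (auto simp: free_mod_nth M.smult_assoc1)
    finally show "lin_comb M n v (a \<odot>\<^bsub>free_mod R n\<^esub> x) = a \<odot>\<^bsub>M\<^esub> lin_comb M n v x" ..
  qed
qed

lemma lin_comb_unit_vec:
  assumes "module R M" "\<And>j. j < n \<Longrightarrow> v j \<in> carrier M" "j < n"
  shows "lin_comb M n v (unit_vec R n j) = v j"
proof -
  interpret M: module R M by fact
  have "lin_comb M n v (unit_vec R n j) = (\<Oplus>\<^bsub>M\<^esub>i\<in>{..<n}. (if i = j then \<one>\<^bsub>R\<^esub> else \<zero>\<^bsub>R\<^esub>) \<odot>\<^bsub>M\<^esub> v i)"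
    unfolding lin_comb_def using assms(2) by (intro M.M.finsum_cong') (auto simp: unit_vec_nth)
  also have "\<dots> = v j"
    using assms(2,3) by (intro M.finsum_single) auto
  finally show ?thesis .
qed

lemma free_mod_expand:
  assumes "cring R" "x \<in> carrier (free_mod R n)"
  shows "lin_comb (free_mod R n) n (unit_vec R n) x = x"
proof -
  interpret cring R by fact
  interpret S: module R "self_module R" by (simp add: module_self assms)
  interpret F: module R "free_mod R n" by (simp add: module_free_mod assms)
  have u: "unit_vec R n j \<in> carrier (free_mod R n)" for j by (rule unit_vec_closed[OF assms(1)])
  have cl: "(\<lambda>j. x j \<odot>\<^bsub>free_mod R n\<^esub> unit_vec R n j) \<in> {..<n} \<rightarrow> carrier (free_mod R n)"
    using assms(2) u by (auto dest: free_mod_nth_closed)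
  show ?thesis
  proof (rule free_mod_eqI[OF _ assms(2)])
    show "lin_comb (free_mod R n) n (unit_vec R n) x \<in> carrier (free_mod R n)"
      unfolding lin_comb_def using cl by (rule F.M.finsum_closed)
    fix i assume i: "i < n"
    have "lin_comb (free_mod R n) n (unit_vec R n) x i = (\<Oplus>\<^bsub>R\<^esub>j\<in>{..<n}. (x j \<odot>\<^bsub>free_mod R n\<^esub> unit_vec R n j) i)"
      unfolding lin_comb_def using pow_mod_finsum[OF module_self[OF assms(1)] _ cl[unfolded free_mod_eq] i]
      by (simp add: free_mod_eq)
    also have "\<dots> = (\<Oplus>\<^bsub>R\<^esub>j\<in>{..<n}. if i = j then x j else \<zero>\<^bsub>R\<^esub>)"
      by (rule finsum_cong') (use i assms(2) in \<open>auto simp: free_mod_nth unit_vec_nth dest: free_mod_nth_closed\<close>)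
    also have "\<dots> = x i"
      by (rule finsum_singleton) (use i assms(2) in \<open>auto dest: free_mod_nth_closed\<close>)
    finally show "lin_comb (free_mod R n) n (unit_vec R n) x i = x i" .
  qed
qed

lemma hom_free_eq:
  assumes "module R M" "f \<in> mod_hom R (free_mod R n) M" "x \<in> carrier (free_mod R n)"
  shows "f x = lin_comb M n (\<lambda>j. f (unit_vec R n j)) x"
proof -
  interpret M: module R M by fact
  interpret F: module R "free_mod R n" by (simp add: module_free_mod M.is_cring)
  have u: "unit_vec R n j \<in> carrier (free_mod R n)" for j by (rule unit_vec_closed[OF M.is_cring])
  have cl: "(\<lambda>j. x j \<odot>\<^bsub>free_mod R n\<^esub> unit_vec R n j) \<in> {..<n} \<rightarrow> carrier (free_mod R n)"
    using assms(3) u by (auto dest: free_mod_nth_closed)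
  have "f x = f (lin_comb (free_mod R n) n (unit_vec R n) x)"
    by (simp add: free_mod_expand[OF M.is_cring assms(3)])
  also have "\<dots> = (\<Oplus>\<^bsub>M\<^esub>j\<in>{..<n}. f (x j \<odot>\<^bsub>free_mod R n\<^esub> unit_vec R n j))"
    unfolding lin_comb_def by (rule mod_hom_finsum[OF F.module_axioms assms(1,2) _ cl]) simp
  also have "\<dots> = lin_comb M n (\<lambda>j. f (unit_vec R n j)) x"
    unfolding lin_comb_def
    by (rule M.M.finsum_cong') (use u assms(3) in \<open>auto simp: mod_hom_smult[OF assms(2)] mod_hom_closed[OF assms(2)] dest: free_mod_nth_closed\<close>)
  finally show ?thesis .
qed

lemma hom_free_ext:
  assumes "module R M" "f \<in> mod_hom R (free_mod R n) M" "g \<in> mod_hom R (free_mod R n) M"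
    "\<And>j. j < n \<Longrightarrow> f (unit_vec R n j) = g (unit_vec R n j)" "x \<in> carrier (free_mod R n)"
  shows "f x = g x"
proof -
  interpret M: module R M by fact
  have u: "unit_vec R n j \<in> carrier (free_mod R n)" for j by (rule unit_vec_closed[OF M.is_cring])
  have "f x = lin_comb M n (\<lambda>j. f (unit_vec R n j)) x"
    by (rule hom_free_eq[OF assms(1,2,5)])
  also have "\<dots> = lin_comb M n (\<lambda>j. g (unit_vec R n j)) x"
    unfolding lin_comb_def
    by (rule M.M.finsum_cong') (use u assms(4,5) in \<open>auto simp: mod_hom_closed[OF assms(3)] dest: free_mod_nth_closed\<close>)
  also have "\<dots> = g x"
    by (rule hom_free_eq[OF assms(1,3,5), symmetric])
  finally show ?thesis .
qed

text \<open>Projectivity of R^n: preimages of the images of the unit vectors are chosen and extended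
  linearly. Containment of images replaces surjectivity of \<open>g\<close>, because most liftings
  below go into a kernel that is known to be an image.\<close>

lemma free_mod_lift:
  assumes "module R L" "module R M" "f \<in> mod_hom R (free_mod R n) M" "g \<in> mod_hom R L M"
    "f ` carrier (free_mod R n) \<subseteq> g ` carrier L"
  obtains h where "h \<in> mod_hom R (free_mod R n) L" "\<And>x. x \<in> carrier (free_mod R n) \<Longrightarrow> g (h x) = f x"
proof -
  interpret M: module R M by fact
  have u: "unit_vec R n j \<in> carrier (free_mod R n)" for j by (rule unit_vec_closed[OF M.is_cring])
  then have "\<forall>j. \<exists>v. v \<in> carrier L \<and> g v = f (unit_vec R n j)"
    using assms(5) by (metis image_subset_iff imageE)
  then obtain v where v: "\<And>j. v j \<in> carrier L" "\<And>j. g (v j) = f (unit_vec R n j)"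
    by metis
  have hom: "lin_comb L n v \<in> mod_hom R (free_mod R n) L"
    by (rule lin_comb_hom[OF assms(1)]) (rule v)
  show ?thesis
  proof (rule that[OF hom])
    fix x assume "x \<in> carrier (free_mod R n)"
    then show "g (lin_comb L n v x) = f x"
      by (rule hom_free_ext[OF assms(2) mod_hom_comp[OF assms(4) hom] assms(3), rotated])
         (simp add: lin_comb_unit_vec[OF assms(1)] v)
  qed
qed

text \<open>\<open>hom_ext M m n f\<close> is the map \<open>M\<^sup>n \<rightarrow> M\<^sup>m\<close> given by the matrix of \<open>f : R\<^sup>n \<rightarrow> R\<^sup>m\<close>, that is,
  \<open>f \<otimes> M\<close> up to the identification of \<open>R\<^sup>k \<otimes> M\<close> with \<open>M\<^sup>k\<close>.\<close>

definition hom_ext :: "('a, 'r) ring_scheme \<Rightarrow> ('a, 'b, 'm) module_scheme \<Rightarrow> nat \<Rightarrow> nat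
    \<Rightarrow> ((nat \<Rightarrow> 'a) \<Rightarrow> nat \<Rightarrow> 'a) \<Rightarrow> (nat \<Rightarrow> 'b) \<Rightarrow> nat \<Rightarrow> 'b" where
  "hom_ext R M m n f y = (\<lambda>i\<in>{..<m}. \<Oplus>\<^bsub>M\<^esub>j\<in>{..<n}. f (unit_vec R n j) i \<odot>\<^bsub>M\<^esub> y j)"

section \<open>Functoriality of the matrix maps on powers of a module\<close>

context module
begin

lemma smult_commute:
  assumes "a \<in> carrier R" "b \<in> carrier R" "x \<in> carrier M"
  shows "a \<odot>\<^bsub>M\<^esub> (b \<odot>\<^bsub>M\<^esub> x) = b \<odot>\<^bsub>M\<^esub> (a \<odot>\<^bsub>M\<^esub> x)"
  using assms m_comm smult_assoc1 by metis

lemma hom_entry_closed: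
  assumes "f \<in> mod_hom R (free_mod R n) (free_mod R m)" "i < m"
  shows "f (unit_vec R n j) i \<in> carrier R"
  using mod_hom_closed[OF assms(1) unit_vec_closed[OF is_cring]] assms(2)
  by (auto dest: free_mod_nth_closed)

lemma hom_ext_nth: "i < m \<Longrightarrow> hom_ext R M m n f y i = (\<Oplus>\<^bsub>M\<^esub>j\<in>{..<n}. f (unit_vec R n j) i \<odot>\<^bsub>M\<^esub> y j)"
  by (simp add: hom_ext_def)

lemma hom_ext_closed:
  assumes "f \<in> mod_hom R (free_mod R n) (free_mod R m)" "y \<in> carrier (pow_mod M n)"
  shows "hom_ext R M m n f y \<in> carrier (pow_mod M m)"
  using assms by (intro pow_mod_memI)
    (auto simp: hom_ext_def intro!: M.finsum_closed hom_entry_closed dest: pow_mod_nth_closed)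

lemma hom_ext_hom:
  assumes "f \<in> mod_hom R (free_mod R n) (free_mod R m)"
  shows "hom_ext R M m n f \<in> mod_hom R (pow_mod M n) (pow_mod M m)"
proof (rule mod_homI)
  fix x y assume xy: "x \<in> carrier (pow_mod M n)" "y \<in> carrier (pow_mod M n)"
  interpret P: module R "pow_mod M n" by (rule module_pow_mod[OF module_axioms])
  interpret Q: module R "pow_mod M m" by (rule module_pow_mod[OF module_axioms])
  show "hom_ext R M m n f (x \<oplus>\<^bsub>pow_mod M n\<^esub> y) = hom_ext R M m n f x \<oplus>\<^bsub>pow_mod M m\<^esub> hom_ext R M m n f y"
  proof (rule pow_mod_eqI)
    fix i assume i: "i < m"
    have "hom_ext R M m n f (x \<oplus>\<^bsub>pow_mod M n\<^esub> y) i
       = (\<Oplus>\<^bsub>M\<^esub>j\<in>{..<n}. f (unit_vec R n j) i \<odot>\<^bsub>M\<^esub> x j \<oplus>\<^bsub>M\<^esub> f (unit_vec R n j) i \<odot>\<^bsub>M\<^esub> y j)"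
      unfolding hom_ext_nth[OF i] using xy
      by (intro M.finsum_cong') (auto simp: pow_mod_nth smult_r_distr hom_entry_closed[OF assms i] pow_mod_nth_closed[OF xy(1)] pow_mod_nth_closed[OF xy(2)])
    also have "\<dots> = hom_ext R M m n f x i \<oplus>\<^bsub>M\<^esub> hom_ext R M m n f y i"
      unfolding hom_ext_nth[OF i] using xy
      by (intro M.finsum_addf) (auto simp: hom_entry_closed[OF assms i] dest: pow_mod_nth_closed)
    finally show "hom_ext R M m n f (x \<oplus>\<^bsub>pow_mod M n\<^esub> y) i = (hom_ext R M m n f x \<oplus>\<^bsub>pow_mod M m\<^esub> hom_ext R M m n f y) i"
      by (simp add: pow_mod_nth i)
  qed (use xy hom_ext_closed[OF assms] in auto)
next
  fix a y assume ay: "a \<in> carrier R" "y \<in> carrier (pow_mod M n)"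
  interpret P: module R "pow_mod M n" by (rule module_pow_mod[OF module_axioms])
  interpret Q: module R "pow_mod M m" by (rule module_pow_mod[OF module_axioms])
  show "hom_ext R M m n f (a \<odot>\<^bsub>pow_mod M n\<^esub> y) = a \<odot>\<^bsub>pow_mod M m\<^esub> hom_ext R M m n f y"
  proof (rule pow_mod_eqI)
    fix i assume i: "i < m"
    have "hom_ext R M m n f (a \<odot>\<^bsub>pow_mod M n\<^esub> y) i = (\<Oplus>\<^bsub>M\<^esub>j\<in>{..<n}. a \<odot>\<^bsub>M\<^esub> (f (unit_vec R n j) i \<odot>\<^bsub>M\<^esub> y j))"
      unfolding hom_ext_nth[OF i] using ay
      by (intro M.finsum_cong') (auto simp: pow_mod_nth smult_commute hom_entry_closed[OF assms i] pow_mod_nth_closed[OF ay(2)])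
    also have "\<dots> = a \<odot>\<^bsub>M\<^esub> hom_ext R M m n f y i"
      unfolding hom_ext_nth[OF i] using ay
      by (intro finsum_smult_ldistr[symmetric]) (auto simp: hom_entry_closed[OF assms i] dest: pow_mod_nth_closed)
    finally show "hom_ext R M m n f (a \<odot>\<^bsub>pow_mod M n\<^esub> y) i = (a \<odot>\<^bsub>pow_mod M m\<^esub> hom_ext R M m n f y) i"
      by (simp add: pow_mod_nth i)
  qed (use ay hom_ext_closed[OF assms] in auto)
qed (rule hom_ext_closed[OF assms])

lemma finsum_smult_rdistr:
  assumes "finite A" "f \<in> A \<rightarrow> carrier R" "x \<in> carrier M"
  shows "(\<Oplus>\<^bsub>R\<^esub>i\<in>A. f i) \<odot>\<^bsub>M\<^esub> x = (\<Oplus>\<^bsub>M\<^esub>i\<in>A. f i \<odot>\<^bsub>M\<^esub> x)"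
  using assms(1,2) by (induction A rule: finite_induct) (use assms(3) in \<open>auto simp: Pi_def smult_l_distr\<close>)

lemma finsum_swap:
  assumes "finite A" "finite B" "\<And>i j. i \<in> A \<Longrightarrow> j \<in> B \<Longrightarrow> f i j \<in> carrier M"
  shows "(\<Oplus>\<^bsub>M\<^esub>i\<in>A. \<Oplus>\<^bsub>M\<^esub>j\<in>B. f i j) = (\<Oplus>\<^bsub>M\<^esub>j\<in>B. \<Oplus>\<^bsub>M\<^esub>i\<in>A. f i j)"
  using assms(1,3)
proof (induction A rule: finite_induct)
  case (insert a A)
  have "(\<Oplus>\<^bsub>M\<^esub>i\<in>insert a A. \<Oplus>\<^bsub>M\<^esub>j\<in>B. f i j) = (\<Oplus>\<^bsub>M\<^esub>j\<in>B. f a j) \<oplus>\<^bsub>M\<^esub> (\<Oplus>\<^bsub>M\<^esub>j\<in>B. \<Oplus>\<^bsub>M\<^esub>i\<in>A. f i j)"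
    using insert by (subst M.finsum_insert) (auto intro!: M.finsum_closed)
  also have "\<dots> = (\<Oplus>\<^bsub>M\<^esub>j\<in>B. f a j \<oplus>\<^bsub>M\<^esub> (\<Oplus>\<^bsub>M\<^esub>i\<in>A. f i j))"
    using insert by (intro M.finsum_addf[symmetric]) (auto intro!: M.finsum_closed)
  also have "\<dots> = (\<Oplus>\<^bsub>M\<^esub>j\<in>B. \<Oplus>\<^bsub>M\<^esub>i\<in>insert a A. f i j)"
    using insert by (intro M.finsum_cong') (auto intro!: M.finsum_closed)
  finally show ?case .
qed simp

text \<open>Matrix multiplication: the entries of the composite are expanded through the unit
  vectors of the middle module, and the two summations are interchanged.\<close>

lemma hom_ext_comp:
  assumes f: "f \<in> mod_hom R (free_mod R n) (free_mod R m)" and g: "g \<in> mod_hom R (free_mod R p) (free_mod R n)"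
    and y: "y \<in> carrier (pow_mod M p)"
  shows "hom_ext R M m n f (hom_ext R M n p g y) = hom_ext R M m p (\<lambda>x. f (g x)) y"
proof (rule pow_mod_eqI)
  fix i assume i: "i < m"
  have u: "unit_vec R k j \<in> carrier (free_mod R k)" for k j by (rule unit_vec_closed[OF is_cring])
  have ue: "f (unit_vec R n j) i \<in> carrier R" for j by (rule hom_entry_closed[OF f i])
  have ge: "k < n \<Longrightarrow> g (unit_vec R p j) k \<in> carrier R" for j k by (rule hom_entry_closed[OF g])
  have ye: "j < p \<Longrightarrow> y j \<in> carrier M" for j using y by (rule pow_mod_nth_closed)
  have fg: "f (g (unit_vec R p j)) i = (\<Oplus>\<^bsub>R\<^esub>k\<in>{..<n}. f (unit_vec R n k) i \<otimes>\<^bsub>R\<^esub> g (unit_vec R p j) k)" for j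
  proof -
    have gc: "g (unit_vec R p j) \<in> carrier (free_mod R n)" by (rule mod_hom_closed[OF g u])
    have "f (g (unit_vec R p j)) = lin_comb (free_mod R m) n (\<lambda>j. f (unit_vec R n j)) (g (unit_vec R p j))"
      by (rule hom_free_eq[OF module_free_mod[OF is_cring] f gc])
    then have "f (g (unit_vec R p j)) i = (\<Oplus>\<^bsub>free_mod R m\<^esub>k\<in>{..<n}. g (unit_vec R p j) k \<odot>\<^bsub>free_mod R m\<^esub> f (unit_vec R n k)) i"
      by (simp add: lin_comb_def)
    also have "\<dots> = (\<Oplus>\<^bsub>self_module R\<^esub>k\<in>{..<n}. (g (unit_vec R p j) k \<odot>\<^bsub>free_mod R m\<^esub> f (unit_vec R n k)) i)"
      unfolding free_mod_eq
    proof (rule pow_mod_finsum[OF module_self[OF is_cring] _ _ i])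
      show "(\<lambda>k. g (unit_vec R p j) k \<odot>\<^bsub>pow_mod (self_module R) m\<^esub> f (unit_vec R n k)) \<in> {..<n} \<rightarrow> carrier (pow_mod (self_module R) m)"
        using module.smult_closed[OF module_free_mod[OF is_cring]] mod_hom_closed[OF f u] ge
        by (auto simp: free_mod_eq)
    qed simp
    also have "\<dots> = (\<Oplus>\<^bsub>R\<^esub>k\<in>{..<n}. f (unit_vec R n k) i \<otimes>\<^bsub>R\<^esub> g (unit_vec R p j) k)"
      unfolding finsum_self_module
      by (rule R.finsum_cong') (use i ue ge in \<open>auto simp: free_mod_nth m_comm\<close>)
    finally show ?thesis .
  qed
  have "hom_ext R M m n f (hom_ext R M n p g y) i
      = (\<Oplus>\<^bsub>M\<^esub>k\<in>{..<n}. f (unit_vec R n k) i \<odot>\<^bsub>M\<^esub> (\<Oplus>\<^bsub>M\<^esub>j\<in>{..<p}. g (unit_vec R p j) k \<odot>\<^bsub>M\<^esub> y j))"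
    unfolding hom_ext_nth[OF i]
    by (rule M.finsum_cong') (auto simp: hom_ext_nth ue ge ye intro!: smult_closed M.finsum_closed)
  also have "\<dots> = (\<Oplus>\<^bsub>M\<^esub>k\<in>{..<n}. \<Oplus>\<^bsub>M\<^esub>j\<in>{..<p}. (f (unit_vec R n k) i \<otimes>\<^bsub>R\<^esub> g (unit_vec R p j) k) \<odot>\<^bsub>M\<^esub> y j)"
    by (intro M.finsum_cong' refl, use ue ge ye in \<open>auto intro!: M.finsum_closed\<close>)
       (subst finsum_smult_ldistr, auto intro!: M.finsum_cong' simp: ue ge ye smult_assoc1)
  also have "\<dots> = (\<Oplus>\<^bsub>M\<^esub>j\<in>{..<p}. \<Oplus>\<^bsub>M\<^esub>k\<in>{..<n}. (f (unit_vec R n k) i \<otimes>\<^bsub>R\<^esub> g (unit_vec R p j) k) \<odot>\<^bsub>M\<^esub> y j)"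
    by (rule finsum_swap) (use ue ge ye in auto)
  also have "\<dots> = (\<Oplus>\<^bsub>M\<^esub>j\<in>{..<p}. f (g (unit_vec R p j)) i \<odot>\<^bsub>M\<^esub> y j)"
    unfolding fg
    by (intro M.finsum_cong' refl finsum_smult_rdistr[symmetric]) (use ue ge ye in \<open>auto intro!: R.finsum_closed\<close>)
  finally show "hom_ext R M m n f (hom_ext R M n p g y) i = hom_ext R M m p (\<lambda>x. f (g x)) y i"
    by (simp add: hom_ext_nth[OF i])
next
  show "hom_ext R M m n f (hom_ext R M n p g y) \<in> carrier (pow_mod M m)"
    by (rule hom_ext_closed[OF f hom_ext_closed[OF g y]])
  show "hom_ext R M m p (\<lambda>x. f (g x)) y \<in> carrier (pow_mod M m)"
    by (rule hom_ext_closed[OF mod_hom_comp[OF f g] y])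
qed

text \<open>Only values on unit vectors enter the matrix, so functions that differ outside the
  carrier act alike.\<close>

lemma hom_ext_cong:
  assumes "\<And>x. x \<in> carrier (free_mod R n) \<Longrightarrow> f x = g x"
  shows "hom_ext R M m n f y = hom_ext R M m n g y"
  unfolding hom_ext_def using assms unit_vec_closed[OF is_cring] by presburger

lemma hom_ext_sum:
  assumes f: "f \<in> mod_hom R (free_mod R n) (free_mod R m)" and g: "g \<in> mod_hom R (free_mod R n) (free_mod R m)"
    and y: "y \<in> carrier (pow_mod M n)"
  shows "hom_ext R M m n (\<lambda>x. f x \<oplus>\<^bsub>free_mod R m\<^esub> g x) y = hom_ext R M m n f y \<oplus>\<^bsub>pow_mod M m\<^esub> hom_ext R M m n g y"
proof (rule pow_mod_eqI)
  interpret P: module R "pow_mod M m" by (rule module_pow_mod[OF module_axioms])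
  fix i assume i: "i < m"
  have "hom_ext R M m n (\<lambda>x. f x \<oplus>\<^bsub>free_mod R m\<^esub> g x) y i
       = (\<Oplus>\<^bsub>M\<^esub>j\<in>{..<n}. f (unit_vec R n j) i \<odot>\<^bsub>M\<^esub> y j \<oplus>\<^bsub>M\<^esub> g (unit_vec R n j) i \<odot>\<^bsub>M\<^esub> y j)"
    unfolding hom_ext_nth[OF i] using y
    by (intro M.finsum_cong') (auto simp: free_mod_nth i smult_l_distr hom_entry_closed[OF f i] hom_entry_closed[OF g i] dest: pow_mod_nth_closed)
  also have "\<dots> = hom_ext R M m n f y i \<oplus>\<^bsub>M\<^esub> hom_ext R M m n g y i"
    unfolding hom_ext_nth[OF i] using y
    by (intro M.finsum_addf) (auto simp: hom_entry_closed[OF f i] hom_entry_closed[OF g i] dest: pow_mod_nth_closed)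
  finally show "hom_ext R M m n (\<lambda>x. f x \<oplus>\<^bsub>free_mod R m\<^esub> g x) y i = (hom_ext R M m n f y \<oplus>\<^bsub>pow_mod M m\<^esub> hom_ext R M m n g y) i"
    by (simp add: pow_mod_nth i)
next
  interpret P: module R "pow_mod M m" by (rule module_pow_mod[OF module_axioms])
  show "hom_ext R M m n f y \<oplus>\<^bsub>pow_mod M m\<^esub> hom_ext R M m n g y \<in> carrier (pow_mod M m)"
    using hom_ext_closed f g y by simp
  show "hom_ext R M m n (\<lambda>x. f x \<oplus>\<^bsub>free_mod R m\<^esub> g x) y \<in> carrier (pow_mod M m)"
    by (rule hom_ext_closed[OF mod_hom_sum[OF module_free_mod[OF is_cring] f g] y])
qed

lemma hom_ext_scalar:
  assumes a: "a \<in> carrier R" and y: "y \<in> carrier (pow_mod M n)"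
  shows "hom_ext R M n n (\<lambda>x. a \<odot>\<^bsub>free_mod R n\<^esub> x) y = a \<odot>\<^bsub>pow_mod M n\<^esub> y"
proof (rule pow_mod_eqI)
  interpret P: module R "pow_mod M n" by (rule module_pow_mod[OF module_axioms])
  interpret F: module R "free_mod R n" by (rule module_free_mod[OF is_cring])
  have hom: "(\<lambda>x. a \<odot>\<^bsub>free_mod R n\<^esub> x) \<in> mod_hom R (free_mod R n) (free_mod R n)"
    by (rule mod_hom_scale[OF F.module_axioms mod_hom_ident a])
  fix i assume i: "i < n"
  have "hom_ext R M n n (\<lambda>x. a \<odot>\<^bsub>free_mod R n\<^esub> x) y i
       = (\<Oplus>\<^bsub>M\<^esub>j\<in>{..<n}. (if j = i then \<one>\<^bsub>R\<^esub> else \<zero>\<^bsub>R\<^esub>) \<odot>\<^bsub>M\<^esub> (a \<odot>\<^bsub>M\<^esub> y j))"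
    unfolding hom_ext_nth[OF i] using y a i
    by (intro M.finsum_cong') (auto simp: free_mod_nth unit_vec_nth dest: pow_mod_nth_closed)
  also have "\<dots> = a \<odot>\<^bsub>M\<^esub> y i"
    by (rule finsum_single) (use a y i in \<open>auto dest: pow_mod_nth_closed\<close>)
  finally show "hom_ext R M n n (\<lambda>x. a \<odot>\<^bsub>free_mod R n\<^esub> x) y i = (a \<odot>\<^bsub>pow_mod M n\<^esub> y) i"
    by (simp add: pow_mod_nth i)
next
  interpret P: module R "pow_mod M n" by (rule module_pow_mod[OF module_axioms])
  interpret F: module R "free_mod R n" by (rule module_free_mod[OF is_cring])
  show "a \<odot>\<^bsub>pow_mod M n\<^esub> y \<in> carrier (pow_mod M n)" using a y by simp
  show "hom_ext R M n n (\<lambda>x. a \<odot>\<^bsub>free_mod R n\<^esub> x) y \<in> carrier (pow_mod M n)"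
    by (rule hom_ext_closed[OF mod_hom_scale[OF F.module_axioms mod_hom_ident a] y])
qed

lemma hom_ext_id:
  assumes y: "y \<in> carrier (pow_mod M n)"
  shows "hom_ext R M n n (\<lambda>x. x) y = y"
proof -
  interpret P: module R "pow_mod M n" by (rule module_pow_mod[OF module_axioms])
  interpret F: module R "free_mod R n" by (rule module_free_mod[OF is_cring])
  have "hom_ext R M n n (\<lambda>x. x) y = hom_ext R M n n (\<lambda>x. \<one>\<^bsub>R\<^esub> \<odot>\<^bsub>free_mod R n\<^esub> x) y"
    by (rule hom_ext_cong) simp
  then show ?thesis
    using hom_ext_scalar[OF R.one_closed y] y by simp
qed

lemma hom_ext_zero:
  assumes "\<And>x. x \<in> carrier (free_mod R n) \<Longrightarrow> f x = \<zero>\<^bsub>free_mod R m\<^esub>" and y: "y \<in> carrier (pow_mod M n)"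
  shows "hom_ext R M m n f y = \<zero>\<^bsub>pow_mod M m\<^esub>"
proof -
  have "(\<Oplus>\<^bsub>M\<^esub>j\<in>{..<n}. f (unit_vec R n j) i \<odot>\<^bsub>M\<^esub> y j) = \<zero>\<^bsub>M\<^esub>" if "i < m" for i
  proof -
    have "(\<Oplus>\<^bsub>M\<^esub>j\<in>{..<n}. f (unit_vec R n j) i \<odot>\<^bsub>M\<^esub> y j) = (\<Oplus>\<^bsub>M\<^esub>j\<in>{..<n}. \<zero>\<^bsub>M\<^esub>)"
      by (rule M.finsum_cong') (use that y assms(1)[OF unit_vec_closed[OF is_cring]] in
        \<open>auto simp: free_mod_nth dest: pow_mod_nth_closed\<close>)
    then show ?thesis by simp
  qed
  then show ?thesis by (auto simp: hom_ext_def pow_mod_simps intro!: restrict_ext)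
qed

end

text \<open>Over the ring itself the matrix of \<open>f\<close> acts as \<open>f\<close>. This turns
  kernel identities for \<open>A\<close> and \<open>B\<close> into exactness statements with
  coefficients in R.\<close>

lemma hom_ext_self:
  assumes "cring R" "f \<in> mod_hom R (free_mod R n) (free_mod R m)" "x \<in> carrier (free_mod R n)"
  shows "hom_ext R (self_module R) m n f x = f x"
proof -
  interpret S: module R "self_module R" by (rule module_self[OF assms(1)])
  note FM = module_free_mod[OF assms(1)]
  note comp = S.hom_ext_closed[OF assms(2), unfolded free_mod_eq[symmetric]]
  have u: "unit_vec R k j \<in> carrier (free_mod R k)" for k j by (rule unit_vec_closed[OF assms(1)])
  show ?thesis
  proof (rule hom_free_ext[OF FM S.hom_ext_hom[OF assms(2), folded free_mod_eq] assms(2) _ assms(3)])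
    fix j assume j: "j < n"
    show "hom_ext R (self_module R) m n f (unit_vec R n j) = f (unit_vec R n j)"
    proof (rule free_mod_eqI[OF comp[OF u] mod_hom_closed[OF assms(2) u]])
      fix i assume i: "i < m"
      have "hom_ext R (self_module R) m n f (unit_vec R n j) i
        = (\<Oplus>\<^bsub>self_module R\<^esub>k\<in>{..<n}. (if k = j then \<one>\<^bsub>R\<^esub> else \<zero>\<^bsub>R\<^esub>) \<odot>\<^bsub>self_module R\<^esub> f (unit_vec R n k) i)"
        unfolding S.hom_ext_nth[OF i]
        by (rule S.M.finsum_cong') (auto simp: unit_vec_nth S.hom_entry_closed[OF assms(2) i])
      also have "\<dots> = f (unit_vec R n j) i"
        by (rule S.finsum_single) (use j in \<open>auto simp: S.hom_entry_closed[OF assms(2) i]\<close>)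
      finally show "hom_ext R (self_module R) m n f (unit_vec R n j) i = f (unit_vec R n j) i" .
    qed
  qed
qed

section \<open>Tensor products\<close>

lemma finprod_hom:
  assumes "comm_group G" "comm_group H" "h \<in> hom G H" "finite A" "f \<in> A \<rightarrow> carrier G"
  shows "h (finprod G f A) = finprod H (\<lambda>i. h (f i)) A"
  using assms(4,5)
proof (induction A rule: finite_induct)
  interpret G: comm_group G by fact
  interpret H: comm_group H by fact
  interpret h: group_hom G H h using assms(3) by unfold_locales
  case empty
  then show ?case by simp
next
  interpret G: comm_group G by fact
  interpret H: comm_group H by fact
  interpret h: group_hom G H h using assms(3) by unfold_locales
  case (insert a A)
  moreover have "f \<in> A \<rightarrow> carrier G" "f a \<in> carrier G" "(\<lambda>i. h (f i)) \<in> A \<rightarrow> carrier H" "h (f a) \<in> carrier H"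
    using insert.prems h.hom_closed by (auto simp: Pi_iff)
  ultimately show ?case by simp
qed

locale module_pair = M: module R M + N: module R N
  for R :: "('a, 'r) ring_scheme" and M :: "('a, 'b, 'm) module_scheme" and N :: "('a, 'c, 'n) module_scheme"
begin

abbreviation "FA \<equiv> free_Abelian_group (carrier M \<times> carrier N)"

text \<open>The generators of \<open>tensor_relations\<close>, named so that maps on formal sums can
  be tested on them.\<close>

definition gens :: "('b \<times> 'c \<Rightarrow>\<^sub>0 int) set" where
  "gens = {frag_of (x \<oplus>\<^bsub>M\<^esub> x', y) - frag_of (x, y) - frag_of (x', y) | x x' y.
          x \<in> carrier M \<and> x' \<in> carrier M \<and> y \<in> carrier N} \<union>
      {frag_of (x, y \<oplus>\<^bsub>N\<^esub> y') - frag_of (x, y) - frag_of (x, y') | x y y'.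
          x \<in> carrier M \<and> y \<in> carrier N \<and> y' \<in> carrier N} \<union>
      {frag_of (a \<odot>\<^bsub>M\<^esub> x, y) - frag_of (x, a \<odot>\<^bsub>N\<^esub> y) | a x y.
          a \<in> carrier R \<and> x \<in> carrier M \<and> y \<in> carrier N}"

lemma tensor_relations_eq: "tensor_relations R M N = generate FA gens"
  by (simp add: tensor_relations_def gens_def)

lemma frag_closed: "x \<in> carrier M \<Longrightarrow> y \<in> carrier N \<Longrightarrow> frag_of (x, y) \<in> carrier FA"
  by simp

lemma frag_diff_closed: "c \<in> carrier FA \<Longrightarrow> d \<in> carrier FA \<Longrightarrow> c - d \<in> carrier FA"
  using keys_diff[of c d] by auto

lemma gens_subset: "gens \<subseteq> carrier FA"
  unfolding gens_def by (auto simp del: carrier_free_Abelian_group_iff intro!: frag_diff_closed frag_closed)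

lemma subgroup_relations: "subgroup (tensor_relations R M N) FA"
  unfolding tensor_relations_eq by (rule group.generate_is_subgroup) (use gens_subset in auto)

lemma normal_relations: "tensor_relations R M N \<lhd> FA"
  by (simp add: comm_group.normal_iff_subgroup[OF abelian_free_Abelian_group] subgroup_relations)

lemma comm_group_tensor: "comm_group (tensor_group R M N)"
  unfolding tensor_group_def
  by (rule comm_group.abelian_FactGroup[OF abelian_free_Abelian_group subgroup_relations])

definition coset :: "('b \<times> 'c \<Rightarrow>\<^sub>0 int) \<Rightarrow> ('b \<times> 'c \<Rightarrow>\<^sub>0 int) set" where
  "coset c = tensor_relations R M N #>\<^bsub>FA\<^esub> c"

definition tens :: "'b \<Rightarrow> 'c \<Rightarrow> ('b \<times> 'c \<Rightarrow>\<^sub>0 int) set" where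
  "tens x y = coset (frag_of (x, y))"

lemma tensor_simps:
  "carrier (tensor R M N) = carrier (tensor_group R M N)"
  "\<zero>\<^bsub>tensor R M N\<^esub> = \<one>\<^bsub>tensor_group R M N\<^esub>"
  "u \<oplus>\<^bsub>tensor R M N\<^esub> v = u \<otimes>\<^bsub>tensor_group R M N\<^esub> v"
  by (simp_all add: tensor_def)

lemma abelian_group_tensor: "abelian_group (tensor R M N)"
proof -
  interpret G: comm_group "tensor_group R M N" by (rule comm_group_tensor)
  show ?thesis
    by (rule abelian_groupI) (auto simp: tensor_simps G.m_ac intro: G.l_inv_ex)
qed

sublocale T: abelian_group "tensor R M N"
  by (rule abelian_group_tensor)

lemma carrier_tensor: "carrier (tensor R M N) = coset ` carrier FA"
  by (auto simp: tensor_simps tensor_group_def carrier_FactGroup coset_def)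

lemma coset_closed: "c \<in> carrier FA \<Longrightarrow> coset c \<in> carrier (tensor R M N)"
  by (auto simp: carrier_tensor)

lemma coset_add: "c \<in> carrier FA \<Longrightarrow> d \<in> carrier FA \<Longrightarrow> coset (c + d) = coset c \<oplus>\<^bsub>tensor R M N\<^esub> coset d"
  using hom_mult[OF normal.r_coset_hom_Mod[OF normal_relations]]
  by (simp add: tensor_simps coset_def tensor_group_def)

lemma coset_eq_zero:
  assumes "c \<in> carrier FA"
  shows "coset c = \<zero>\<^bsub>tensor R M N\<^esub> \<longleftrightarrow> c \<in> tensor_relations R M N"
proof -
  interpret F: group FA by simp
  have "tensor_relations R M N #>\<^bsub>FA\<^esub> c = tensor_relations R M N \<longleftrightarrow> c \<in> tensor_relations R M N"
    using F.coset_join1[OF _ assms subgroup_relations] F.coset_join2[OF assms subgroup_relations]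
      subgroup.subset[OF subgroup_relations] by blast
  then show ?thesis
    by (simp add: tensor_simps tensor_group_def coset_def)
qed

lemma coset_diff:
  assumes "c \<in> carrier FA" "d \<in> carrier FA"
  shows "coset (c - d) = coset c \<ominus>\<^bsub>tensor R M N\<^esub> coset d"
proof -
  have "coset (c - d) \<oplus>\<^bsub>tensor R M N\<^esub> coset d = coset c"
    using coset_add[OF frag_diff_closed[OF assms] assms(2)] by simp
  then show ?thesis
    using coset_closed frag_diff_closed assms
    by (metis T.add.inv_solve_right a_minus_def)
qed

lemma coset_eq_iff:
  assumes "c \<in> carrier FA" "d \<in> carrier FA"
  shows "coset c = coset d \<longleftrightarrow> c - d \<in> tensor_relations R M N"
  using coset_eq_zero[OF frag_diff_closed[OF assms]] coset_diff[OF assms] coset_closed assms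
  by (metis T.add.inv_closed T.add.inv_inv T.minus_equality T.r_neg a_minus_def)

section \<open>Pure tensors and the universal property\<close>

lemma tens_closed: "x \<in> carrier M \<Longrightarrow> y \<in> carrier N \<Longrightarrow> tens x y \<in> carrier (tensor R M N)"
  unfolding tens_def by (rule coset_closed) simp

lemma gens_rel: "g \<in> gens \<Longrightarrow> g \<in> tensor_relations R M N"
  unfolding tensor_relations_eq by (rule generate.incl)

lemma tens_add_left:
  assumes "x \<in> carrier M" "x' \<in> carrier M" "y \<in> carrier N"
  shows "tens (x \<oplus>\<^bsub>M\<^esub> x') y = tens x y \<oplus>\<^bsub>tensor R M N\<^esub> tens x' y"
proof -
  have "frag_of (x \<oplus>\<^bsub>M\<^esub> x', y) - frag_of (x, y) - frag_of (x', y) \<in> tensor_relations R M N"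
    by (rule gens_rel) (use assms in \<open>auto simp: gens_def\<close>)
  then have "coset (frag_of (x \<oplus>\<^bsub>M\<^esub> x', y)) = coset (frag_of (x, y) + frag_of (x', y))"
    using assms subsetD[OF keys_add] by (subst coset_eq_iff) (force simp: algebra_simps)+
  also have "\<dots> = tens x y \<oplus>\<^bsub>tensor R M N\<^esub> tens x' y"
    unfolding tens_def by (rule coset_add) (use assms in auto)
  finally show ?thesis by (simp add: tens_def)
qed

lemma tens_add_right:
  assumes "x \<in> carrier M" "y \<in> carrier N" "y' \<in> carrier N"
  shows "tens x (y \<oplus>\<^bsub>N\<^esub> y') = tens x y \<oplus>\<^bsub>tensor R M N\<^esub> tens x y'"
proof -
  have "frag_of (x, y \<oplus>\<^bsub>N\<^esub> y') - frag_of (x, y) - frag_of (x, y') \<in> tensor_relations R M N"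
    by (rule gens_rel) (use assms in \<open>auto simp: gens_def\<close>)
  then have "coset (frag_of (x, y \<oplus>\<^bsub>N\<^esub> y')) = coset (frag_of (x, y) + frag_of (x, y'))"
    using assms subsetD[OF keys_add] by (subst coset_eq_iff) (force simp: algebra_simps)+
  also have "\<dots> = tens x y \<oplus>\<^bsub>tensor R M N\<^esub> tens x y'"
    unfolding tens_def by (rule coset_add) (use assms in auto)
  finally show ?thesis by (simp add: tens_def)
qed

lemma tens_balanced:
  assumes "a \<in> carrier R" "x \<in> carrier M" "y \<in> carrier N"
  shows "tens (a \<odot>\<^bsub>M\<^esub> x) y = tens x (a \<odot>\<^bsub>N\<^esub> y)"
proof -
  have "frag_of (a \<odot>\<^bsub>M\<^esub> x, y) - frag_of (x, a \<odot>\<^bsub>N\<^esub> y) \<in> tensor_relations R M N"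
    by (rule gens_rel) (use assms in \<open>auto simp: gens_def\<close>)
  then show ?thesis
    unfolding tens_def using assms by (subst coset_eq_iff) auto
qed

lemma tens_hom_left: "y \<in> carrier N \<Longrightarrow> (\<lambda>x. tens x y) \<in> hom (add_monoid M) (add_monoid (tensor R M N))"
  by (rule homI) (auto simp: tens_closed tens_add_left)

lemma tens_finsum_left:
  assumes "finite A" "f \<in> A \<rightarrow> carrier M" "y \<in> carrier N"
  shows "tens (\<Oplus>\<^bsub>M\<^esub>i\<in>A. f i) y = (\<Oplus>\<^bsub>tensor R M N\<^esub>i\<in>A. tens (f i) y)"
  using finprod_hom[OF M.M.a_comm_group T.a_comm_group tens_hom_left[OF assms(3)] assms(1), of f] assms(2)
  by (simp add: finsum_def)

lemma tens_zero_left: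
  assumes "y \<in> carrier N" shows "tens \<zero>\<^bsub>M\<^esub> y = \<zero>\<^bsub>tensor R M N\<^esub>"
  using tens_finsum_left[of "{}" "\<lambda>_. \<zero>\<^bsub>M\<^esub>" y] assms by simp

lemma tens_minus_left:
  assumes "x \<in> carrier M" "y \<in> carrier N" shows "tens (\<ominus>\<^bsub>M\<^esub> x) y = \<ominus>\<^bsub>tensor R M N\<^esub> tens x y"
proof -
  have "tens (\<ominus>\<^bsub>M\<^esub> x) y \<oplus>\<^bsub>tensor R M N\<^esub> tens x y = tens (\<ominus>\<^bsub>M\<^esub> x \<oplus>\<^bsub>M\<^esub> x) y"
    by (rule tens_add_left[symmetric]) (use assms in auto)
  then show ?thesis
    using assms by (simp add: M.M.l_neg tens_zero_left T.minus_equality tens_closed)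
qed

text \<open>Pure tensors generate additively without extra cases for zero and negatives, since both
  are again pure: zero is the tensor of two zeros, and a sign moves into the left factor.\<close>

lemma tensor_induct [consumes 1, case_names tens add]:
  assumes "u \<in> carrier (tensor R M N)"
    and "\<And>x y. x \<in> carrier M \<Longrightarrow> y \<in> carrier N \<Longrightarrow> P (tens x y)"
    and "\<And>u v. u \<in> carrier (tensor R M N) \<Longrightarrow> v \<in> carrier (tensor R M N) \<Longrightarrow> P u \<Longrightarrow> P v
            \<Longrightarrow> P (u \<oplus>\<^bsub>tensor R M N\<^esub> v)"
  shows "P u"
proof -
  obtain c where c: "c \<in> carrier FA" "u = coset c"
    using assms(1) by (auto simp: carrier_tensor)
  \<comment> \<open>Induction on formal sums proceeds by differences, so the property has to be
    carried along for the negative as well.\<close>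
  have "P (coset c) \<and> P (\<ominus>\<^bsub>tensor R M N\<^esub> coset c)"
    using c(1)[unfolded carrier_free_Abelian_group_iff]
  proof (induction c rule: free_Abelian_group_induct[consumes 1, case_names 1 2 3])
    case 1
    have "coset 0 = \<zero>\<^bsub>tensor R M N\<^esub>"
      using coset_eq_zero[of 0] subgroup.one_closed[OF subgroup_relations] by simp
    moreover have "\<zero>\<^bsub>tensor R M N\<^esub> = tens \<zero>\<^bsub>M\<^esub> \<zero>\<^bsub>N\<^esub>"
      by (simp add: tens_zero_left)
    moreover have "\<ominus>\<^bsub>tensor R M N\<^esub> \<zero>\<^bsub>tensor R M N\<^esub> = \<zero>\<^bsub>tensor R M N\<^esub>"
      by (rule T.minus_equality) auto
    ultimately show ?case
      using assms(2)[of "\<zero>\<^bsub>M\<^esub>" "\<zero>\<^bsub>N\<^esub>"] M.M.zero_closed N.M.zero_closed by metis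
  next
    case (2 c d)
    then have cd: "coset c \<in> carrier (tensor R M N)" "coset d \<in> carrier (tensor R M N)"
      by (auto intro: coset_closed)
    have "coset (c - d) = coset c \<oplus>\<^bsub>tensor R M N\<^esub> \<ominus>\<^bsub>tensor R M N\<^esub> coset d"
      using 2 by (simp add: coset_diff a_minus_def)
    moreover from this have "\<ominus>\<^bsub>tensor R M N\<^esub> coset (c - d) = \<ominus>\<^bsub>tensor R M N\<^esub> coset c \<oplus>\<^bsub>tensor R M N\<^esub> coset d"
      using cd by (simp add: T.minus_add)
    ultimately show ?case
      using assms(3) cd 2 by simp
  next
    case (3 p)
    then obtain x y where p: "p = (x, y)" "x \<in> carrier M" "y \<in> carrier N" by auto
    then have "\<ominus>\<^bsub>tensor R M N\<^esub> coset (frag_of p) = tens (\<ominus>\<^bsub>M\<^esub> x) y"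
      by (simp add: tens_minus_left tens_def[symmetric])
    then show ?case
      using assms(2)[OF p(2,3)] assms(2)[OF M.M.a_inv_closed[OF p(2)] p(3)] p(1) by (simp add: tens_def)
  qed
  then show ?thesis using c(2) by simp
qed

text \<open>The biadditive map extends to formal sums, kills the generating relations and so factors
  through the quotient. The target is only a commutative group, because it will be a factor group of
  \<open>pow_mod N n\<close> in one application and the total ring of fractions in another.\<close>

lemma tensor_universal:
  assumes "comm_group G"
    and closed: "\<And>x y. x \<in> carrier M \<Longrightarrow> y \<in> carrier N \<Longrightarrow> \<beta> x y \<in> carrier G"
    and left: "\<And>x x' y. x \<in> carrier M \<Longrightarrow> x' \<in> carrier M \<Longrightarrow> y \<in> carrier N \<Longrightarrow> \<beta> (x \<oplus>\<^bsub>M\<^esub> x') y = \<beta> x y \<otimes>\<^bsub>G\<^esub> \<beta> x' y"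
    and right: "\<And>x y y'. x \<in> carrier M \<Longrightarrow> y \<in> carrier N \<Longrightarrow> y' \<in> carrier N \<Longrightarrow> \<beta> x (y \<oplus>\<^bsub>N\<^esub> y') = \<beta> x y \<otimes>\<^bsub>G\<^esub> \<beta> x y'"
    and balanced: "\<And>a x y. a \<in> carrier R \<Longrightarrow> x \<in> carrier M \<Longrightarrow> y \<in> carrier N \<Longrightarrow> \<beta> (a \<odot>\<^bsub>M\<^esub> x) y = \<beta> x (a \<odot>\<^bsub>N\<^esub> y)"
  obtains \<Psi> where "\<Psi> \<in> hom (add_monoid (tensor R M N)) G"
    "\<And>x y. x \<in> carrier M \<Longrightarrow> y \<in> carrier N \<Longrightarrow> \<Psi> (tens x y) = \<beta> x y"
proof -
  interpret G: comm_group G by fact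
  have "(\<lambda>(x, y). \<beta> x y) ` (carrier M \<times> carrier N) \<subseteq> carrier G"
    using closed by auto
  then obtain h where h: "h \<in> hom FA G" "\<And>p. p \<in> carrier M \<times> carrier N \<Longrightarrow> h (frag_of p) = (\<lambda>(x, y). \<beta> x y) p"
    by (rule G.free_Abelian_group_universal) blast
  interpret h: group_hom FA G h
    using h(1) by (simp add: group_hom_def group_hom_axioms_def)
  have hb: "h (frag_of (x, y)) = \<beta> x y" if "x \<in> carrier M" "y \<in> carrier N" for x y
    using h(2) that by simp
  have hd: "h (c - d) = h c \<otimes>\<^bsub>G\<^esub> inv\<^bsub>G\<^esub> h d" if "c \<in> carrier FA" "d \<in> carrier FA" for c d
  proof -
    have "h (c - d) = h (c \<otimes>\<^bsub>FA\<^esub> inv\<^bsub>FA\<^esub> d)" using that by simp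
    also have "\<dots> = h c \<otimes>\<^bsub>G\<^esub> inv\<^bsub>G\<^esub> h d"
      using that h.hom_mult[OF that(1)] h.hom_inv[OF that(2)] h.G.inv_closed[OF that(2)] by metis
    finally show ?thesis .
  qed
  have cancel: "a \<otimes>\<^bsub>G\<^esub> b \<otimes>\<^bsub>G\<^esub> inv\<^bsub>G\<^esub> a \<otimes>\<^bsub>G\<^esub> inv\<^bsub>G\<^esub> b = \<one>\<^bsub>G\<^esub>" if "a \<in> carrier G" "b \<in> carrier G" for a b
  proof -
    have "a \<otimes>\<^bsub>G\<^esub> b \<otimes>\<^bsub>G\<^esub> inv\<^bsub>G\<^esub> a = b"
      using that by (metis G.inv_closed G.m_assoc G.m_comm G.r_inv G.r_one)
    then show ?thesis using that by simp
  qed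
  have ker: "h g = \<one>\<^bsub>G\<^esub>" if "g \<in> gens" for g
    using that unfolding gens_def
  proof (elim UnE CollectE exE conjE)
    fix x x' y assume g: "g = frag_of (x \<oplus>\<^bsub>M\<^esub> x', y) - frag_of (x, y) - frag_of (x', y)" and x: "x \<in> carrier M" "x' \<in> carrier M" "y \<in> carrier N"
    note fc = frag_closed[OF M.M.a_closed[OF x(1,2)] x(3)] frag_closed[OF x(1,3)] frag_closed[OF x(2,3)]
    show "h g = \<one>\<^bsub>G\<^esub>"
      unfolding g hd[OF frag_diff_closed[OF fc(1,2)] fc(3)] hd[OF fc(1,2)] using x
      by (simp add: hb left closed cancel)
  next
    fix x y' y assume g: "g = frag_of (x, y \<oplus>\<^bsub>N\<^esub> y') - frag_of (x, y) - frag_of (x, y')" and x: "x \<in> carrier M" "y \<in> carrier N" "y' \<in> carrier N"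
    note fc = frag_closed[OF x(1) N.M.a_closed[OF x(2,3)]] frag_closed[OF x(1,2)] frag_closed[OF x(1,3)]
    show "h g = \<one>\<^bsub>G\<^esub>"
      unfolding g hd[OF frag_diff_closed[OF fc(1,2)] fc(3)] hd[OF fc(1,2)] using x
      by (simp add: hb right closed cancel)
  next
    fix a x y assume g: "g = frag_of (a \<odot>\<^bsub>M\<^esub> x, y) - frag_of (x, a \<odot>\<^bsub>N\<^esub> y)" and x: "a \<in> carrier R" "x \<in> carrier M" "y \<in> carrier N"
    show "h g = \<one>\<^bsub>G\<^esub>"
      unfolding g using x by (subst hd) (simp_all add: hb balanced closed)
  qed
  have "tensor_relations R M N \<subseteq> kernel FA G h"
    unfolding tensor_relations_eq
    by (rule h.G.generate_subgroup_incl) (use subsetD[OF gens_subset] ker h.subgroup_kernel in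
      \<open>auto simp: kernel_def simp del: carrier_free_Abelian_group_iff\<close>)
  then obtain \<Psi> where \<Psi>: "\<Psi> \<in> hom (FA Mod tensor_relations R M N) G"
      "\<And>c. c \<in> carrier FA \<Longrightarrow> \<Psi> (tensor_relations R M N #>\<^bsub>FA\<^esub> c) = h c"
    using h.FactGroup_universal_kernel[OF normal_relations] by blast
  show ?thesis
  proof (rule that)
    show "\<Psi> \<in> hom (add_monoid (tensor R M N)) G" using \<Psi>(1)
      by (simp add: hom_def tensor_simps tensor_group_def)
    fix x y assume "x \<in> carrier M" "y \<in> carrier N"
    then show "\<Psi> (tens x y) = \<beta> x y" using \<Psi>(2) hb by (simp add: tens_def coset_def)
  qed
qed

end

section \<open>Functoriality of the tensor product\<close>

lemma module_pairI: "module R M \<Longrightarrow> module R N \<Longrightarrow> module_pair R M N"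
  by (simp add: module_pair_def)

text \<open>\<open>tensor_push\<close> is a union over all representatives. The union collapses to a
  single coset because the induced map on formal sums carries generating relations to generating
  relations.\<close>

lemma tensor_push_coset:
  assumes "module_pair R M N" "module_pair R M' N'" "f \<in> mod_hom R M M'" "g \<in> mod_hom R N N'"
    and c: "c \<in> carrier (free_Abelian_group (carrier M \<times> carrier N))"
  shows "tensor_push R M' N' (\<lambda>(x, y). (f x, g y)) (module_pair.coset R M N c)
     = module_pair.coset R M' N' (frag_extend (frag_of \<circ> (\<lambda>(x, y). (f x, g y))) c)"
    and "frag_extend (frag_of \<circ> (\<lambda>(x, y). (f x, g y))) c \<in> carrier (free_Abelian_group (carrier M' \<times> carrier N'))"
proof -
  interpret P: module_pair R M N by fact
  interpret P': module_pair R M' N' by fact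
  let ?\<Phi> = "frag_extend (frag_of \<circ> (\<lambda>(x, y). (f x, g y)))"
  have f: "x \<in> carrier M \<Longrightarrow> f x \<in> carrier M'" for x by (rule mod_hom_closed[OF assms(3)])
  have g: "x \<in> carrier N \<Longrightarrow> g x \<in> carrier N'" for x by (rule mod_hom_closed[OF assms(4)])
  have cl: "?\<Phi> c \<in> carrier P'.FA" if "c \<in> carrier P.FA" for c
  proof -
    have "(\<Union>x\<in>Poly_Mapping.keys c. Poly_Mapping.keys ((frag_of \<circ> (\<lambda>(x, y). (f x, g y))) x)) \<subseteq> carrier M' \<times> carrier N'"
    proof (rule UN_least)
      fix p assume "p \<in> Poly_Mapping.keys c"
      then have "p \<in> carrier M \<times> carrier N" using that by auto
      then show "Poly_Mapping.keys ((frag_of \<circ> (\<lambda>(x, y). (f x, g y))) p) \<subseteq> carrier M' \<times> carrier N'"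
        using f g by (cases p) auto
    qed
    then show ?thesis by (simp only: carrier_free_Abelian_group_iff subset_trans[OF keys_frag_extend])
  qed
  have gens: "?\<Phi> c \<in> P'.gens" if "c \<in> P.gens" for c
    using that unfolding P.gens_def
  proof (elim UnE CollectE exE conjE)
    fix x x' y assume "c = frag_of (x \<oplus>\<^bsub>M\<^esub> x', y) - frag_of (x, y) - frag_of (x', y)" and x: "x \<in> carrier M" "x' \<in> carrier M" "y \<in> carrier N"
    then have "?\<Phi> c = frag_of (f x \<oplus>\<^bsub>M'\<^esub> f x', g y) - frag_of (f x, g y) - frag_of (f x', g y)"
      by (simp add: frag_extend_diff mod_hom_add[OF assms(3)])
    then show "?\<Phi> c \<in> P'.gens" using x f g unfolding P'.gens_def by blast
  next
    fix x y' y assume "c = frag_of (x, y \<oplus>\<^bsub>N\<^esub> y') - frag_of (x, y) - frag_of (x, y')" and x: "x \<in> carrier M" "y \<in> carrier N" "y' \<in> carrier N"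
    then have "?\<Phi> c = frag_of (f x, g y \<oplus>\<^bsub>N'\<^esub> g y') - frag_of (f x, g y) - frag_of (f x, g y')"
      by (simp add: frag_extend_diff mod_hom_add[OF assms(4)])
    then show "?\<Phi> c \<in> P'.gens" using x f g unfolding P'.gens_def by blast
  next
    fix a x y assume "c = frag_of (a \<odot>\<^bsub>M\<^esub> x, y) - frag_of (x, a \<odot>\<^bsub>N\<^esub> y)" and x: "a \<in> carrier R" "x \<in> carrier M" "y \<in> carrier N"
    then have "?\<Phi> c = frag_of (a \<odot>\<^bsub>M'\<^esub> f x, g y) - frag_of (f x, a \<odot>\<^bsub>N'\<^esub> g y)"
      by (simp add: frag_extend_diff mod_hom_smult[OF assms(3)] mod_hom_smult[OF assms(4)])
    then show "?\<Phi> c \<in> P'.gens" using x f g unfolding P'.gens_def by blast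
  qed
  have rel: "?\<Phi> t \<in> tensor_relations R M' N'" if "t \<in> tensor_relations R M N" for t
    using that unfolding P.tensor_relations_eq
  proof (induction t rule: generate.induct)
    case one
    then show ?case using subgroup.one_closed[OF P'.subgroup_relations] by simp
  next
    case (incl h)
    then show ?case using gens P'.gens_rel by blast
  next
    case (inv h)
    then have h: "h \<in> carrier P.FA" using P.gens_subset by blast
    then have "?\<Phi> (inv\<^bsub>P.FA\<^esub> h) = inv\<^bsub>P'.FA\<^esub> (?\<Phi> h)"
      using cl[OF h] by (simp add: frag_extend_minus)
    then show ?case
      using subgroup.m_inv_closed[OF P'.subgroup_relations P'.gens_rel[OF gens[OF inv]]] by (simp only:)
  next
    case (eng h1 h2)
    then show ?case
      using subgroup.m_closed[OF P'.subgroup_relations] by (simp add: frag_extend_add)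
  qed
  show "?\<Phi> c \<in> carrier P'.FA" by (rule cl[OF c])
  \<comment> \<open>Two representatives of a class differ by a relation, and relations are mapped to
    relations.\<close>
  have U: "P'.coset (?\<Phi> d) = P'.coset (?\<Phi> c)" if "d \<in> P.coset c" for d
  proof -
    obtain t where t: "t \<in> tensor_relations R M N" "d = t + c"
      using \<open>d \<in> P.coset c\<close> by (auto simp: P.coset_def r_coset_def)
    have "d \<in> carrier P.FA"
      using subgroup.mem_carrier[OF P.subgroup_relations t(1)] c t(2) keys_add[of t c] by auto
    moreover have "?\<Phi> d - ?\<Phi> c = ?\<Phi> t" by (simp add: t(2) frag_extend_add)
    ultimately show ?thesis
      using rel[OF t(1)] cl c by (metis P'.coset_eq_iff)
  qed
  have "c \<in> P.coset c"
    using group.rcos_self[OF group_free_Abelian_group c P.subgroup_relations] by (simp add: P.coset_def)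
  then show "tensor_push R M' N' (\<lambda>(x, y). (f x, g y)) (P.coset c) = P'.coset (?\<Phi> c)"
    using U unfolding tensor_push_def P'.coset_def[symmetric] by blast
qed

lemma
  assumes "module_pair R M N" "module_pair R M' N'" "f \<in> mod_hom R M M'" "g \<in> mod_hom R N N'"
  defines "F \<equiv> tensor_push R M' N' (\<lambda>(x, y). (f x, g y))"
  shows tensor_push_hom: "F \<in> hom (add_monoid (tensor R M N)) (add_monoid (tensor R M' N'))"
    and tensor_push_tens: "x \<in> carrier M \<Longrightarrow> y \<in> carrier N \<Longrightarrow>
       F (module_pair.tens R M N x y) = module_pair.tens R M' N' (f x) (g y)"
proof -
  interpret P: module_pair R M N by fact
  interpret P': module_pair R M' N' by fact
  note push = tensor_push_coset[OF assms(1-4), folded F_def]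
  show "F \<in> hom (add_monoid (tensor R M N)) (add_monoid (tensor R M' N'))"
  proof (rule homI; simp)
    fix u assume "u \<in> carrier (tensor R M N)"
    then show "F u \<in> carrier (tensor R M' N')"
      unfolding P.carrier_tensor using push P'.coset_closed by auto
  next
    fix u v assume "u \<in> carrier (tensor R M N)" "v \<in> carrier (tensor R M N)"
    then obtain c d where cd: "c \<in> carrier P.FA" "u = P.coset c" "d \<in> carrier P.FA" "v = P.coset d"
      unfolding P.carrier_tensor by auto
    have "c + d \<in> carrier P.FA" using cd(1,3) keys_add[of c d] by auto
    then show "F (u \<oplus>\<^bsub>tensor R M N\<^esub> v) = F u \<oplus>\<^bsub>tensor R M' N'\<^esub> F v"
      using cd by (simp only: P.coset_add[symmetric] push frag_extend_add P'.coset_add)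
  qed
  show "F (P.tens x y) = P'.tens (f x) (g y)" if "x \<in> carrier M" "y \<in> carrier N"
    unfolding P.tens_def using push(1)[OF P.frag_closed[OF that]] by (simp add: P'.tens_def)
qed

lemma (in module_pair)
  assumes "a \<in> carrier R"
  shows tensor_smult_hom: "(\<lambda>u. a \<odot>\<^bsub>tensor R M N\<^esub> u) \<in> hom (add_monoid (tensor R M N)) (add_monoid (tensor R M N))"
    and tensor_smult_tens: "x \<in> carrier M \<Longrightarrow> y \<in> carrier N \<Longrightarrow> a \<odot>\<^bsub>tensor R M N\<^esub> tens x y = tens (a \<odot>\<^bsub>M\<^esub> x) y"
  using tensor_push_hom[OF module_pair_axioms module_pair_axioms mod_hom_scale[OF M.module_axioms mod_hom_ident assms] mod_hom_ident]
    tensor_push_tens[OF module_pair_axioms module_pair_axioms mod_hom_scale[OF M.module_axioms mod_hom_ident assms] mod_hom_ident]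
  by (auto simp: tensor_def)

section \<open>Tensor products and presentations\<close>

lemma add_monoid_hom_zero:
  assumes "abelian_group G" "abelian_group H" "h \<in> hom (add_monoid G) (add_monoid H)"
  shows "h \<zero>\<^bsub>G\<^esub> = \<zero>\<^bsub>H\<^esub>"
  using hom_one[OF assms(3) abelian_group.a_group[OF assms(1)] abelian_group.a_group[OF assms(2)]]
  by simp

text \<open>The coordinates of the pure tensor of \<open>x\<close> and \<open>y\<close> when the
  tensor product of R^n with N is identified with N^n.\<close>

definition outer :: "('a, 'c, 'n) module_scheme \<Rightarrow> nat \<Rightarrow> (nat \<Rightarrow> 'a) \<Rightarrow> 'c \<Rightarrow> nat \<Rightarrow> 'c" where
  "outer N n x y = (\<lambda>i\<in>{..<n}. x i \<odot>\<^bsub>N\<^esub> y)"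

context module
begin

lemma outer_nth: "i < n \<Longrightarrow> outer M n x y i = x i \<odot>\<^bsub>M\<^esub> y"
  by (simp add: outer_def)

lemma outer_closed: "x \<in> carrier (free_mod R n) \<Longrightarrow> y \<in> carrier M \<Longrightarrow> outer M n x y \<in> carrier (pow_mod M n)"
  by (rule pow_mod_memI) (auto simp: outer_def dest: free_mod_nth_closed)

lemma outer_add_left:
  assumes "x \<in> carrier (free_mod R n)" "x' \<in> carrier (free_mod R n)" "y \<in> carrier M"
  shows "outer M n (x \<oplus>\<^bsub>free_mod R n\<^esub> x') y = outer M n x y \<oplus>\<^bsub>pow_mod M n\<^esub> outer M n x' y"
  using free_mod_nth_closed[OF assms(1)] free_mod_nth_closed[OF assms(2)] assms(3)
  by (auto simp: outer_def pow_mod_simps free_mod_nth smult_l_distr intro!: restrict_ext)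

lemma outer_add_right:
  assumes "x \<in> carrier (free_mod R n)" "y \<in> carrier M" "y' \<in> carrier M"
  shows "outer M n x (y \<oplus>\<^bsub>M\<^esub> y') = outer M n x y \<oplus>\<^bsub>pow_mod M n\<^esub> outer M n x y'"
  using free_mod_nth_closed[OF assms(1)] assms(2,3)
  by (auto simp: outer_def pow_mod_simps smult_r_distr intro!: restrict_ext)

lemma outer_smult:
  assumes "a \<in> carrier R" "x \<in> carrier (free_mod R n)" "y \<in> carrier M"
  shows "outer M n (a \<odot>\<^bsub>free_mod R n\<^esub> x) y = outer M n x (a \<odot>\<^bsub>M\<^esub> y)"
proof -
  have "(a \<otimes>\<^bsub>R\<^esub> x i) \<odot>\<^bsub>M\<^esub> y = x i \<odot>\<^bsub>M\<^esub> (a \<odot>\<^bsub>M\<^esub> y)" if "i < n" for i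
    using assms free_mod_nth_closed[OF assms(2) that] smult_assoc1 smult_commute by metis
  then show ?thesis
    by (auto simp: outer_def free_mod_nth intro!: restrict_ext)
qed

text \<open>In coordinates: applying f to the first factor of a pure tensor is the action of its
  matrix. It places the tensors arising from relations of M in the image of
  \<open>hom_ext\<close>.\<close>

lemma outer_image:
  assumes f: "f \<in> mod_hom R (free_mod R n) (free_mod R m)" and w: "w \<in> carrier (free_mod R n)" and y: "y \<in> carrier M"
  shows "outer M m (f w) y = hom_ext R M m n f (outer M n w y)"
proof (rule pow_mod_eqI)
  show "outer M m (f w) y \<in> carrier (pow_mod M m)"
    by (rule outer_closed[OF mod_hom_closed[OF f w] y])
  show "hom_ext R M m n f (outer M n w y) \<in> carrier (pow_mod M m)"
    by (rule hom_ext_closed[OF f outer_closed[OF w y]])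
  interpret S: module R "self_module R" by (rule module_self[OF is_cring])
  fix i assume i: "i < m"
  have we: "j < n \<Longrightarrow> w j \<in> carrier R" for j using free_mod_nth_closed[OF w] .
  have fe: "f (unit_vec R n j) i \<in> carrier R" for j by (rule hom_entry_closed[OF f i])
  have "f w i = hom_ext R (self_module R) m n f w i" by (simp add: hom_ext_self[OF is_cring f w])
  also have "\<dots> = (\<Oplus>\<^bsub>R\<^esub>j\<in>{..<n}. f (unit_vec R n j) i \<otimes>\<^bsub>R\<^esub> w j)"
    by (simp add: S.hom_ext_nth[OF i])
  finally have "f w i \<odot>\<^bsub>M\<^esub> y = (\<Oplus>\<^bsub>M\<^esub>j\<in>{..<n}. (f (unit_vec R n j) i \<otimes>\<^bsub>R\<^esub> w j) \<odot>\<^bsub>M\<^esub> y)"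
    using we fe y by (simp add: finsum_smult_rdistr)
  also have "\<dots> = hom_ext R M m n f (outer M n w y) i"
    unfolding hom_ext_nth[OF i] using we fe y
    by (intro M.finsum_cong') (auto simp: outer_nth smult_assoc1)
  finally show "outer M m (f w) y i = hom_ext R M m n f (outer M n w y) i"
    by (simp add: outer_nth i)
qed

text \<open>Decomposition of the matrix action by columns, the form in which it can be compared with
  tensors of images of unit vectors.\<close>

lemma hom_ext_outer:
  assumes f: "f \<in> mod_hom R (free_mod R n) (free_mod R m)" and y: "y \<in> carrier (pow_mod M n)"
  shows "hom_ext R M m n f y = (\<Oplus>\<^bsub>pow_mod M m\<^esub>j\<in>{..<n}. outer M m (f (unit_vec R n j)) (y j))"
proof (rule pow_mod_eqI[OF hom_ext_closed[OF f y]])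
  interpret P: module R "pow_mod M m" by (rule module_pow_mod[OF module_axioms])
  have cl: "(\<lambda>j. outer M m (f (unit_vec R n j)) (y j)) \<in> {..<n} \<rightarrow> carrier (pow_mod M m)"
    using y by (auto intro!: outer_closed mod_hom_closed[OF f] unit_vec_closed[OF is_cring] dest: pow_mod_nth_closed)
  show "(\<Oplus>\<^bsub>pow_mod M m\<^esub>j\<in>{..<n}. outer M m (f (unit_vec R n j)) (y j)) \<in> carrier (pow_mod M m)"
    using cl by (rule P.M.finsum_closed)
  fix i assume i: "i < m"
  show "hom_ext R M m n f y i = (\<Oplus>\<^bsub>pow_mod M m\<^esub>j\<in>{..<n}. outer M m (f (unit_vec R n j)) (y j)) i"
    by (simp add: pow_mod_finsum[OF module_axioms _ cl i] hom_ext_nth i outer_nth)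
qed

lemma outer_unit_sum:
  assumes y: "y \<in> carrier (pow_mod M n)"
  shows "(\<Oplus>\<^bsub>pow_mod M n\<^esub>j\<in>{..<n}. outer M n (unit_vec R n j) (y j)) = y"
  using hom_ext_outer[OF mod_hom_ident y] hom_ext_id[OF y] by simp

end

context module_pair
begin

text \<open>For \<open>\<epsilon> : R\<^sup>n \<rightarrow> M\<close>, the map \<open>\<epsilon> \<otimes> N\<close> on \<open>R\<^sup>n \<otimes> N = N\<^sup>n\<close>.\<close>

definition tens_vec :: "nat \<Rightarrow> ((nat \<Rightarrow> 'a) \<Rightarrow> 'b) \<Rightarrow> (nat \<Rightarrow> 'c) \<Rightarrow> ('b \<times> 'c \<Rightarrow>\<^sub>0 int) set" where
  "tens_vec n \<epsilon> y = (\<Oplus>\<^bsub>tensor R M N\<^esub>i\<in>{..<n}. tens (\<epsilon> (unit_vec R n i)) (y i))"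

context
  fixes n \<epsilon>
  assumes \<epsilon>: "\<epsilon> \<in> mod_hom R (free_mod R n) M"
begin

lemma eps_unit_closed: "\<epsilon> (unit_vec R n i) \<in> carrier M"
  by (rule mod_hom_closed[OF \<epsilon> unit_vec_closed[OF M.is_cring]])

lemma tens_vec_terms: "y \<in> carrier (pow_mod N n) \<Longrightarrow> (\<lambda>i. tens (\<epsilon> (unit_vec R n i)) (y i)) \<in> {..<n} \<rightarrow> carrier (tensor R M N)"
  by (auto intro!: tens_closed eps_unit_closed dest: pow_mod_nth_closed)

lemma tens_vec_closed: "y \<in> carrier (pow_mod N n) \<Longrightarrow> tens_vec n \<epsilon> y \<in> carrier (tensor R M N)"
  unfolding tens_vec_def by (rule T.finsum_closed[OF tens_vec_terms])

lemma tens_vec_hom: "tens_vec n \<epsilon> \<in> hom (add_monoid (pow_mod N n)) (add_monoid (tensor R M N))"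
proof (rule homI; simp)
  fix x y assume xy: "x \<in> carrier (pow_mod N n)" "y \<in> carrier (pow_mod N n)"
  have "tens_vec n \<epsilon> (x \<oplus>\<^bsub>pow_mod N n\<^esub> y) = (\<Oplus>\<^bsub>tensor R M N\<^esub>i\<in>{..<n}. tens (\<epsilon> (unit_vec R n i)) (x i) \<oplus>\<^bsub>tensor R M N\<^esub> tens (\<epsilon> (unit_vec R n i)) (y i))"
    unfolding tens_vec_def using tens_vec_terms[OF xy(1)] tens_vec_terms[OF xy(2)] xy
    by (intro T.finsum_cong') (auto simp: pow_mod_nth Pi_iff tens_add_right eps_unit_closed pow_mod_nth_closed)
  also have "\<dots> = tens_vec n \<epsilon> x \<oplus>\<^bsub>tensor R M N\<^esub> tens_vec n \<epsilon> y"
    unfolding tens_vec_def by (rule T.finsum_addf[OF tens_vec_terms[OF xy(1)] tens_vec_terms[OF xy(2)]])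
  finally show "tens_vec n \<epsilon> (x \<oplus>\<^bsub>pow_mod N n\<^esub> y) = tens_vec n \<epsilon> x \<oplus>\<^bsub>tensor R M N\<^esub> tens_vec n \<epsilon> y" .
qed (rule tens_vec_closed)

lemma tens_vec_finsum:
  assumes "finite A" "f \<in> A \<rightarrow> carrier (pow_mod N n)"
  shows "tens_vec n \<epsilon> (\<Oplus>\<^bsub>pow_mod N n\<^esub>i\<in>A. f i) = (\<Oplus>\<^bsub>tensor R M N\<^esub>i\<in>A. tens_vec n \<epsilon> (f i))"
proof -
  interpret P: module R "pow_mod N n" by (rule module_pow_mod[OF N.module_axioms])
  show ?thesis
    using finprod_hom[OF P.M.a_comm_group T.a_comm_group tens_vec_hom assms(1), of f] assms(2)
    by (simp add: finsum_def)
qed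

lemma tens_vec_smult:
  assumes "a \<in> carrier R" "y \<in> carrier (pow_mod N n)"
  shows "a \<odot>\<^bsub>tensor R M N\<^esub> tens_vec n \<epsilon> y = tens_vec n \<epsilon> (a \<odot>\<^bsub>pow_mod N n\<^esub> y)"
proof -
  have "a \<odot>\<^bsub>tensor R M N\<^esub> tens_vec n \<epsilon> y = (\<Oplus>\<^bsub>tensor R M N\<^esub>i\<in>{..<n}. a \<odot>\<^bsub>tensor R M N\<^esub> tens (\<epsilon> (unit_vec R n i)) (y i))"
    using finprod_hom[OF T.a_comm_group T.a_comm_group tensor_smult_hom[OF assms(1)], of "{..<n}"] tens_vec_terms[OF assms(2)]
    by (simp add: finsum_def tens_vec_def)
  also have "\<dots> = tens_vec n \<epsilon> (a \<odot>\<^bsub>pow_mod N n\<^esub> y)"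
    unfolding tens_vec_def using assms
    by (intro T.finsum_cong')
       (auto simp: tensor_smult_tens tens_balanced pow_mod_nth eps_unit_closed pow_mod_nth_closed intro!: tens_closed)
  finally show ?thesis .
qed

text \<open>Expand \<open>x\<close> in unit vectors and move its coefficients across the tensor
  sign.\<close>

lemma tens_eq_tens_vec:
  assumes x: "x \<in> carrier (free_mod R n)" and y: "y \<in> carrier N"
  shows "tens (\<epsilon> x) y = tens_vec n \<epsilon> (outer N n x y)"
proof -
  have xe: "j < n \<Longrightarrow> x j \<in> carrier R" for j using free_mod_nth_closed[OF x] .
  have "tens (\<epsilon> x) y = tens (\<Oplus>\<^bsub>M\<^esub>j\<in>{..<n}. x j \<odot>\<^bsub>M\<^esub> \<epsilon> (unit_vec R n j)) y"
    by (simp add: hom_free_eq[OF M.module_axioms \<epsilon> x, unfolded lin_comb_def, symmetric])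
  also have "\<dots> = (\<Oplus>\<^bsub>tensor R M N\<^esub>j\<in>{..<n}. tens (x j \<odot>\<^bsub>M\<^esub> \<epsilon> (unit_vec R n j)) y)"
    by (rule tens_finsum_left) (use xe eps_unit_closed y in auto)
  also have "\<dots> = tens_vec n \<epsilon> (outer N n x y)"
    unfolding tens_vec_def using xe eps_unit_closed y
    by (intro T.finsum_cong') (auto simp: N.outer_nth tens_balanced intro!: tens_closed)
  finally show ?thesis .
qed

lemma tens_vec_hom_ext:
  assumes A: "A \<in> mod_hom R (free_mod R p) (free_mod R n)" and z: "z \<in> carrier (pow_mod N p)"
  shows "tens_vec n \<epsilon> (hom_ext R N n p A z) = (\<Oplus>\<^bsub>tensor R M N\<^esub>j\<in>{..<p}. tens (\<epsilon> (A (unit_vec R p j))) (z j))"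
proof -
  have u: "A (unit_vec R p j) \<in> carrier (free_mod R n)" for j
    by (rule mod_hom_closed[OF A unit_vec_closed[OF M.is_cring]])
  have "tens_vec n \<epsilon> (hom_ext R N n p A z) = (\<Oplus>\<^bsub>tensor R M N\<^esub>j\<in>{..<p}. tens_vec n \<epsilon> (outer N n (A (unit_vec R p j)) (z j)))"
    unfolding N.hom_ext_outer[OF A z]
    by (rule tens_vec_finsum) (use u z in \<open>auto intro!: N.outer_closed dest: pow_mod_nth_closed\<close>)
  also have "\<dots> = (\<Oplus>\<^bsub>tensor R M N\<^esub>j\<in>{..<p}. tens (\<epsilon> (A (unit_vec R p j))) (z j))"
    using u z mod_hom_closed[OF \<epsilon> u]
    by (intro T.finsum_cong') (auto simp: tens_eq_tens_vec pow_mod_nth_closed intro!: tens_closed tens_vec_closed N.outer_closed)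
  finally show ?thesis .
qed

lemma tens_vec_surj:
  assumes surj: "\<epsilon> ` carrier (free_mod R n) = carrier M" and u: "u \<in> carrier (tensor R M N)"
  obtains y where "y \<in> carrier (pow_mod N n)" "u = tens_vec n \<epsilon> y"
proof -
  interpret P: module R "pow_mod N n" by (rule module_pow_mod[OF N.module_axioms])
  have "\<exists>y\<in>carrier (pow_mod N n). u = tens_vec n \<epsilon> y"
    using u
  proof (induction u rule: tensor_induct)
    case (tens m y)
    then obtain x where "x \<in> carrier (free_mod R n)" "m = \<epsilon> x" using surj by (metis imageE)
    then show ?case using tens_eq_tens_vec[of x y] tens(2) N.outer_closed by blast
  next
    case (add u v)
    then show ?case using hom_mult[OF tens_vec_hom] P.M.a_closed
      by (metis monoid.simps(1) partial_object.simps(1))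
  qed
  then show ?thesis using that by blast
qed

text \<open>Right exactness of tensoring with N, for the presentation of M by \<open>A\<close>. The
  hard direction constructs a map backwards, from the tensor product to N^n modulo the image of the
  matrix of \<open>A\<close>, by sending the tensor of \<open>\<epsilon> z\<close> and
  \<open>y\<close> to the class of \<open>outer N n z y\<close>.\<close>

lemma tens_vec_kernel:
  assumes surj: "\<epsilon> ` carrier (free_mod R n) = carrier M"
    and A: "A \<in> mod_hom R (free_mod R p) (free_mod R n)"
    and ker: "A ` carrier (free_mod R p) = a_kernel (free_mod R n) M \<epsilon>"
    and y: "y \<in> carrier (pow_mod N n)"
  shows "tens_vec n \<epsilon> y = \<zero>\<^bsub>tensor R M N\<^esub> \<longleftrightarrow> y \<in> hom_ext R N n p A ` carrier (pow_mod N p)"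
proof
  assume "y \<in> hom_ext R N n p A ` carrier (pow_mod N p)"
  then obtain z where z: "z \<in> carrier (pow_mod N p)" "y = hom_ext R N n p A z" by auto
  have "\<epsilon> (A (unit_vec R p j)) = \<zero>\<^bsub>M\<^esub>" for j
    using ker unit_vec_closed[OF M.is_cring, of p j] by (auto simp: a_kernel_def')
  then have "tens_vec n \<epsilon> y = (\<Oplus>\<^bsub>tensor R M N\<^esub>j\<in>{..<p}. \<zero>\<^bsub>tensor R M N\<^esub>)"
    unfolding z(2) tens_vec_hom_ext[OF A z(1)]
    by (intro T.finsum_cong') (auto simp: tens_zero_left pow_mod_nth_closed[OF z(1)])
  then show "tens_vec n \<epsilon> y = \<zero>\<^bsub>tensor R M N\<^esub>" by simp
next
  assume zero: "tens_vec n \<epsilon> y = \<zero>\<^bsub>tensor R M N\<^esub>"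
  interpret P: module R "pow_mod N n" by (rule module_pow_mod[OF N.module_axioms])
  interpret F: module R "free_mod R n" by (rule module_free_mod[OF M.is_cring])
  let ?P = "add_monoid (pow_mod N n)"
  define H where "H = hom_ext R N n p A ` carrier (pow_mod N p)"
  interpret PP: module R "pow_mod N p" by (rule module_pow_mod[OF N.module_axioms])
  have "submodule H R (pow_mod N n)"
    unfolding H_def by (rule submodule_image[OF PP.module_axioms P.module_axioms N.hom_ext_hom[OF A] PP.carrier_is_submodule])
  then have sub: "subgroup H ?P" by (simp add: submodule_def)
  have nH: "H \<lhd> ?P" by (simp add: comm_group.normal_iff_subgroup[OF P.M.a_comm_group] sub)
  define G where "G = ?P Mod H"
  define \<pi> where "\<pi> = (\<lambda>y. H #>\<^bsub>?P\<^esub> y)"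
  have Gc: "comm_group G" unfolding G_def by (rule comm_group.abelian_FactGroup[OF P.M.a_comm_group sub])
  have \<pi>: "\<pi> \<in> hom ?P G" unfolding \<pi>_def G_def by (rule normal.r_coset_hom_Mod[OF nH])
  have \<pi>c: "y \<in> carrier (pow_mod N n) \<Longrightarrow> \<pi> y \<in> carrier G" for y
    using hom_in_carrier[OF \<pi>] by simp
  have \<pi>m: "x \<in> carrier (pow_mod N n) \<Longrightarrow> y \<in> carrier (pow_mod N n) \<Longrightarrow> \<pi> (x \<oplus>\<^bsub>pow_mod N n\<^esub> y) = \<pi> x \<otimes>\<^bsub>G\<^esub> \<pi> y"
    for x y
    using hom_mult[OF \<pi>] by simp
  interpret G: comm_group G by (rule Gc)
  have \<pi>H: "\<pi> h = \<one>\<^bsub>G\<^esub>" if "h \<in> H" for h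
    using group.coset_join2[OF P.M.a_group _ sub that] subgroup.mem_carrier[OF sub that]
    by (simp add: \<pi>_def G_def)
  \<comment> \<open>An arbitrary choice of preimages, not a linear map; only its class modulo
    \<open>H\<close> will matter.\<close>
  define lift where "lift x = (SOME z. z \<in> carrier (free_mod R n) \<and> \<epsilon> z = x)" for x
  have lift: "lift x \<in> carrier (free_mod R n) \<and> \<epsilon> (lift x) = x" if "x \<in> carrier M" for x
  proof -
    have "\<exists>z. z \<in> carrier (free_mod R n) \<and> \<epsilon> z = x"
      using that by (auto simp flip: surj)
    from someI_ex[OF this] show ?thesis by (simp add: lift_def)
  qed
  define \<beta> where "\<beta> x y = \<pi> (outer N n (lift x) y)" for x y
  \<comment> \<open>Independence of the choice: two preimages of the same element differ by some
    \<open>A w\<close>, whose contribution lies in \<open>H\<close>. This also yields biadditivity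
    of \<open>\<beta>\<close>.\<close>
  have \<beta>: "\<beta> (\<epsilon> z) y = \<pi> (outer N n z y)" if z: "z \<in> carrier (free_mod R n)" and y: "y \<in> carrier N"
    for z y
  proof -
    have ez: "\<epsilon> z \<in> carrier M" by (rule mod_hom_closed[OF \<epsilon> z])
    let ?l = "lift (\<epsilon> z)"
    have l: "?l \<in> carrier (free_mod R n)" "\<epsilon> ?l = \<epsilon> z" using lift[OF ez] by auto
    have d: "?l \<ominus>\<^bsub>free_mod R n\<^esub> z \<in> carrier (free_mod R n)" using l z by simp
    have "\<epsilon> (?l \<ominus>\<^bsub>free_mod R n\<^esub> z) = \<zero>\<^bsub>M\<^esub>"
      using ez l mod_hom_minus[OF F.module_axioms M.module_axioms \<epsilon> l(1) z]
      by (simp add: a_minus_def M.M.r_neg)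
    then have "?l \<ominus>\<^bsub>free_mod R n\<^esub> z \<in> A ` carrier (free_mod R p)"
      using d ker by (auto simp: a_kernel_def')
    then obtain w where w: "w \<in> carrier (free_mod R p)" "?l \<ominus>\<^bsub>free_mod R n\<^esub> z = A w" by auto
    have h: "outer N n (A w) y \<in> H"
      unfolding N.outer_image[OF A w(1) y] H_def using N.outer_closed[OF w(1) y] by auto
    have "?l = z \<oplus>\<^bsub>free_mod R n\<^esub> A w"
      using l z unfolding w(2)[symmetric] a_minus_def
      by (subst F.M.a_lcomm) (auto simp: F.M.r_neg)
    then have "outer N n ?l y = outer N n z y \<oplus>\<^bsub>pow_mod N n\<^esub> outer N n (A w) y"
      using N.outer_add_left[OF z _ y] d w(2) by simp
    then show ?thesis
      using \<pi>H[OF h] \<pi>m[OF N.outer_closed[OF z y] subgroup.mem_carrier[OF sub h, simplified]] \<pi>c[OF N.outer_closed[OF z y]]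
      by (simp add: \<beta>_def)
  qed
  obtain \<Psi> where \<Psi>: "\<Psi> \<in> hom (add_monoid (tensor R M N)) G"
    "\<And>x y. x \<in> carrier M \<Longrightarrow> y \<in> carrier N \<Longrightarrow> \<Psi> (tens x y) = \<beta> x y"
  proof (rule tensor_universal[OF Gc, of \<beta>])
    fix x y assume "x \<in> carrier M" "y \<in> carrier N"
    then show "\<beta> x y \<in> carrier G" unfolding \<beta>_def using lift by (intro \<pi>c N.outer_closed) auto
  next
    fix x x' y assume x: "x \<in> carrier M" "x' \<in> carrier M" and y: "y \<in> carrier N"
    obtain z z' where z: "z \<in> carrier (free_mod R n)" "x = \<epsilon> z" "z' \<in> carrier (free_mod R n)" "x' = \<epsilon> z'"
      using x lift by metis
    have "\<beta> (x \<oplus>\<^bsub>M\<^esub> x') y = \<beta> (\<epsilon> (z \<oplus>\<^bsub>free_mod R n\<^esub> z')) y" using z by (simp add: mod_hom_add[OF \<epsilon>])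
    also have "\<dots> = \<beta> x y \<otimes>\<^bsub>G\<^esub> \<beta> x' y"
      using z y by (simp add: \<beta> N.outer_add_left \<pi>m N.outer_closed)
    finally show "\<beta> (x \<oplus>\<^bsub>M\<^esub> x') y = \<beta> x y \<otimes>\<^bsub>G\<^esub> \<beta> x' y" .
  next
    fix x y y' assume x: "x \<in> carrier M" and y: "y \<in> carrier N" "y' \<in> carrier N"
    then show "\<beta> x (y \<oplus>\<^bsub>N\<^esub> y') = \<beta> x y \<otimes>\<^bsub>G\<^esub> \<beta> x y'"
      unfolding \<beta>_def using lift[OF x] by (simp add: N.outer_add_right \<pi>m N.outer_closed)
  next
    fix a x y assume a: "a \<in> carrier R" and x: "x \<in> carrier M" and y: "y \<in> carrier N"
    obtain z where z: "z \<in> carrier (free_mod R n)" "x = \<epsilon> z" using x lift by metis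
    have "\<beta> (a \<odot>\<^bsub>M\<^esub> x) y = \<beta> (\<epsilon> (a \<odot>\<^bsub>free_mod R n\<^esub> z)) y" using z a by (simp add: mod_hom_smult[OF \<epsilon>])
    also have "\<dots> = \<beta> x (a \<odot>\<^bsub>N\<^esub> y)" using z a y by (simp add: \<beta> N.outer_smult)
    finally show "\<beta> (a \<odot>\<^bsub>M\<^esub> x) y = \<beta> x (a \<odot>\<^bsub>N\<^esub> y)" .
  qed blast
  have u: "unit_vec R n i \<in> carrier (free_mod R n)" for i by (rule unit_vec_closed[OF M.is_cring])
  have cl: "(\<lambda>i. outer N n (unit_vec R n i) (y i)) \<in> {..<n} \<rightarrow> carrier (pow_mod N n)"
    using u y by (auto intro!: N.outer_closed dest: pow_mod_nth_closed)
  \<comment> \<open>Following \<open>tens_vec\<close> by \<open>\<Psi>\<close> gives back the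
    projection \<open>\<pi>\<close>, so a vanishing tensor forces \<open>y\<close> into
    \<open>H\<close>.\<close>
  have "\<Psi> (tens_vec n \<epsilon> y) = finprod G (\<lambda>i. \<Psi> (tens (\<epsilon> (unit_vec R n i)) (y i))) {..<n}"
    unfolding tens_vec_def finsum_def
    by (rule finprod_hom[OF T.a_comm_group Gc \<Psi>(1)]) (use tens_vec_terms[OF y] in auto)
  also have "\<dots> = finprod G (\<lambda>i. \<pi> (outer N n (unit_vec R n i) (y i))) {..<n}"
    by (rule G.finprod_cong') (use u y cl \<pi>c in \<open>auto simp: \<Psi>(2) \<beta> eps_unit_closed pow_mod_nth_closed Pi_iff\<close>)
  also have "\<dots> = \<pi> (\<Oplus>\<^bsub>pow_mod N n\<^esub>i\<in>{..<n}. outer N n (unit_vec R n i) (y i))"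
    unfolding finsum_def
    by (rule finprod_hom[OF P.M.a_comm_group Gc \<pi>, symmetric]) (use cl in auto)
  also have "\<dots> = \<pi> y" by (simp add: N.outer_unit_sum[OF y])
  finally have "\<pi> y = \<Psi> \<zero>\<^bsub>tensor R M N\<^esub>" by (simp add: zero)
  also have "\<dots> = \<one>\<^bsub>G\<^esub>"
    using hom_one[OF \<Psi>(1) T.a_group G.is_group] by simp
  finally have "H #>\<^bsub>?P\<^esub> y = H" by (simp add: \<pi>_def G_def)
  then show "y \<in> hom_ext R N n p A ` carrier (pow_mod N p)"
    using group.coset_join1[OF P.M.a_group _ _ sub, of y] y subgroup.subset[OF sub] unfolding H_def
    by auto
qed

end

end

section \<open>Tor over free resolutions\<close>

context
  fixes R :: "('a, 'r) ring_scheme" and N :: "('a, 'c, 'n) module_scheme"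
  assumes N: "module R N"
begin

interpretation N: module R N by (rule N)

lemma free_pair: "module_pair R (free_mod R n) N"
  by (rule module_pairI[OF module_free_mod[OF N.is_cring] N])

text \<open>The identification of N^n with the tensor product of R^n and N, obtained as the instance
  of \<open>tens_vec\<close> for the identity of R^n.\<close>

definition free_iso :: "nat \<Rightarrow> (nat \<Rightarrow> 'c) \<Rightarrow> ((nat \<Rightarrow> 'a) \<times> 'c \<Rightarrow>\<^sub>0 int) set" where
  "free_iso n = module_pair.tens_vec R (free_mod R n) N n (\<lambda>x. x)"

lemma free_iso_closed: "y \<in> carrier (pow_mod N n) \<Longrightarrow> free_iso n y \<in> carrier (tensor R (free_mod R n) N)"
  unfolding free_iso_def by (rule module_pair.tens_vec_closed[OF free_pair mod_hom_ident])

lemma free_iso_hom: "free_iso n \<in> hom (add_monoid (pow_mod N n)) (add_monoid (tensor R (free_mod R n) N))"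
  unfolding free_iso_def by (rule module_pair.tens_vec_hom[OF free_pair mod_hom_ident])

lemma free_iso_surj:
  assumes "u \<in> carrier (tensor R (free_mod R n) N)"
  obtains y where "y \<in> carrier (pow_mod N n)" "u = free_iso n y"
  unfolding free_iso_def by (rule module_pair.tens_vec_surj[OF free_pair mod_hom_ident _ assms]) auto

text \<open>The kernel criterion applied to R^n presented by itself without relations, that is, with
  the map from R^0 in the role of \<open>A\<close>.\<close>

lemma free_iso_eq_zero:
  assumes y: "y \<in> carrier (pow_mod N n)"
  shows "free_iso n y = \<zero>\<^bsub>tensor R (free_mod R n) N\<^esub> \<longleftrightarrow> y = \<zero>\<^bsub>pow_mod N n\<^esub>"
proof -
  interpret F: module R "free_mod R n" by (rule module_free_mod[OF N.is_cring])
  interpret F0: module R "free_mod R 0" by (rule module_free_mod[OF N.is_cring])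
  interpret P0: module R "pow_mod N 0" by (rule module_pow_mod[OF N])
  let ?A = "\<lambda>x :: nat \<Rightarrow> 'a. \<zero>\<^bsub>free_mod R n\<^esub>"
  have A: "?A \<in> mod_hom R (free_mod R 0) (free_mod R n)"
    by (rule mod_homI) auto
  have ker: "?A ` carrier (free_mod R 0) = a_kernel (free_mod R n) (free_mod R n) (\<lambda>x. x)"
    using F0.M.zero_closed F.M.zero_closed by (auto simp: a_kernel_def')
  have im: "hom_ext R N n 0 ?A ` carrier (pow_mod N 0) = {\<zero>\<^bsub>pow_mod N n\<^esub>}"
    using N.hom_ext_zero[of 0 ?A n] P0.M.zero_closed by auto
  show ?thesis
    using module_pair.tens_vec_kernel[OF free_pair mod_hom_ident _ A ker y] unfolding im free_iso_def
    by simp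
qed

lemma free_iso_inj:
  assumes "y \<in> carrier (pow_mod N n)" "z \<in> carrier (pow_mod N n)" "free_iso n y = free_iso n z"
  shows "y = z"
proof -
  interpret P: module R "pow_mod N n" by (rule module_pow_mod[OF N])
  interpret T: abelian_group "tensor R (free_mod R n) N"
    by (rule module_pair.abelian_group_tensor[OF free_pair])
  have "free_iso n ((y \<ominus>\<^bsub>pow_mod N n\<^esub> z) \<oplus>\<^bsub>pow_mod N n\<^esub> z) = free_iso n (y \<ominus>\<^bsub>pow_mod N n\<^esub> z) \<oplus>\<^bsub>tensor R (free_mod R n) N\<^esub> free_iso n z"
    using hom_mult[OF free_iso_hom, of "y \<ominus>\<^bsub>pow_mod N n\<^esub> z" n z] assms by simp
  moreover have yz: "(y \<ominus>\<^bsub>pow_mod N n\<^esub> z) \<oplus>\<^bsub>pow_mod N n\<^esub> z = y"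
    using assms by (simp add: a_minus_def P.M.a_assoc P.M.l_neg)
  ultimately have "free_iso n (y \<ominus>\<^bsub>pow_mod N n\<^esub> z) \<oplus>\<^bsub>tensor R (free_mod R n) N\<^esub> free_iso n z = free_iso n z"
    using assms(3) by simp
  then have "free_iso n (y \<ominus>\<^bsub>pow_mod N n\<^esub> z) = \<zero>\<^bsub>tensor R (free_mod R n) N\<^esub>"
    using T.add.r_cancel_one[OF free_iso_closed free_iso_closed] P.M.minus_closed assms(1,2) by simp
  then have "y \<ominus>\<^bsub>pow_mod N n\<^esub> z = \<zero>\<^bsub>pow_mod N n\<^esub>"
    using free_iso_eq_zero assms by simp
  then show ?thesis using yz assms by simp
qed

text \<open>Naturality of the identification: the differential of the tensored complex becomes the
  matrix map. Hence Tor can be computed entirely in powers of N.\<close>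

lemma free_iso_push:
  assumes d: "d \<in> mod_hom R (free_mod R p) (free_mod R n)" and y: "y \<in> carrier (pow_mod N p)"
  shows "tensor_push R (free_mod R n) N (\<lambda>(x, y). (d x, y)) (free_iso p y) = free_iso n (hom_ext R N n p d y)"
proof -
  interpret P: module_pair R "free_mod R p" N by (rule free_pair)
  interpret Q: module_pair R "free_mod R n" N by (rule free_pair)
  let ?F = "tensor_push R (free_mod R n) N (\<lambda>(x, y). (d x, y))"
  note push = tensor_push_hom[OF free_pair free_pair d mod_hom_ident] tensor_push_tens[OF free_pair free_pair d mod_hom_ident]
  have u: "unit_vec R p j \<in> carrier (free_mod R p)" for j by (rule unit_vec_closed[OF N.is_cring])
  have "?F (free_iso p y) = (\<Oplus>\<^bsub>tensor R (free_mod R n) N\<^esub>j\<in>{..<p}. ?F (P.tens (unit_vec R p j) (y j)))"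
    unfolding free_iso_def P.tens_vec_def finsum_def
    by (rule finprod_hom[OF P.T.a_comm_group Q.T.a_comm_group push(1)])
       (use P.tens_vec_terms[OF mod_hom_ident y] in auto)
  also have "\<dots> = (\<Oplus>\<^bsub>tensor R (free_mod R n) N\<^esub>j\<in>{..<p}. Q.tens (d (unit_vec R p j)) (y j))"
    using y u mod_hom_closed[OF d u]
    by (intro Q.T.finsum_cong') (auto simp: push(2) pow_mod_nth_closed intro!: Q.tens_closed)
  also have "\<dots> = free_iso n (hom_ext R N n p d y)"
    unfolding free_iso_def Q.tens_vec_hom_ext[OF mod_hom_ident d y] ..
  finally show ?thesis .
qed

text \<open>Exactness at \<open>N\<^sup>n\<close>, where \<open>e : R\<^sup>p \<rightarrow> R\<^sup>n\<close> and \<open>d : R\<^sup>n \<rightarrow> R\<^sup>m\<close>.\<close>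

definition exact_at :: "nat \<Rightarrow> nat \<Rightarrow> nat \<Rightarrow> ((nat \<Rightarrow> 'a) \<Rightarrow> nat \<Rightarrow> 'a) \<Rightarrow> ((nat \<Rightarrow> 'a) \<Rightarrow> nat \<Rightarrow> 'a) \<Rightarrow> bool" where
  "exact_at m n p d e \<longleftrightarrow> (\<forall>y\<in>carrier (pow_mod N n). hom_ext R N m n d y = \<zero>\<^bsub>pow_mod N m\<^esub> \<longrightarrow>
     y \<in> hom_ext R N n p e ` carrier (pow_mod N p))"

text \<open>Cycles modulo boundaries form a single coset exactly when all cycles are boundaries;
  this inclusion is then carried to powers of N by \<open>free_iso\<close>. The opposite inclusion
  is not part of \<open>exact_at\<close>.\<close>

lemma homology_trivial:
  fixes j
  assumes d: "\<And>k. d k \<in> mod_hom R (free_mod R (n (Suc k))) (free_mod R (n k))"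
  defines "H \<equiv> homology (\<lambda>k. tensor R (free_mod R (n k)) N)
       (\<lambda>k. tensor_push R (free_mod R (n k)) N (\<lambda>(x, y). (d k x, y))) (Suc j)"
  shows "carrier H = {\<zero>\<^bsub>H\<^esub>} \<longleftrightarrow> exact_at (n j) (n (Suc j)) (n (Suc (Suc j))) (d j) (d (Suc j))"
proof -
  let ?T = "\<lambda>k. tensor R (free_mod R (n k)) N"
  let ?\<delta> = "\<lambda>k. tensor_push R (free_mod R (n k)) N (\<lambda>(x, y). (d k x, y))"
  let ?K = "a_kernel (?T (Suc j)) (?T j) (?\<delta> j)"
  let ?I = "?\<delta> (Suc j) ` carrier (?T (Suc (Suc j)))"
  let ?C = "(?T (Suc j))\<lparr>carrier := ?K\<rparr>"
  interpret T1: abelian_group "?T (Suc j)" by (rule module_pair.abelian_group_tensor[OF free_pair])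
  interpret T0: abelian_group "?T j" by (rule module_pair.abelian_group_tensor[OF free_pair])
  interpret T2: abelian_group "?T (Suc (Suc j))" by (rule module_pair.abelian_group_tensor[OF free_pair])
  have push: "?\<delta> k \<in> hom (add_monoid (?T (Suc k))) (add_monoid (?T k))" for k
    by (rule tensor_push_hom[OF free_pair free_pair d mod_hom_ident])
  interpret h: group_hom "add_monoid (?T (Suc (Suc j)))" "add_monoid (?T (Suc j))" "?\<delta> (Suc j)"
    using push[of "Suc j"] T2.a_group T1.a_group by (simp add: group_hom_def group_hom_axioms_def)
  have subI: "subgroup ?I (add_monoid (?T (Suc j)))"
    using h.img_is_subgroup by simp
  have zK: "\<zero>\<^bsub>?T (Suc j)\<^esub> \<in> ?K"
    using add_monoid_hom_zero[OF T1.abelian_group_axioms T0.abelian_group_axioms push]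
    by (simp add: a_kernel_def')
  have Kc: "x \<in> ?K \<Longrightarrow> x \<in> carrier (?T (Suc j))" for x by (simp add: a_kernel_def')
  \<comment> \<open>The quotient is taken in the record restricted to cycles. Forming a coset uses
    only the addition, so the cosets may be formed in the full tensor group.\<close>
  have cH: "carrier H = (\<lambda>x. ?I #>\<^bsub>add_monoid (?T (Suc j))\<^esub> x) ` ?K"
    by (auto simp: H_def homology_def quot_module_def A_RCOSETS_def RCOSETS_def r_coset_def)
  have zH: "\<zero>\<^bsub>H\<^esub> = ?I" by (simp add: H_def homology_def quot_module_def)
  have c1: "carrier H = {\<zero>\<^bsub>H\<^esub>} \<longleftrightarrow> ?K \<subseteq> ?I"
  proof
    assume eq: "carrier H = {\<zero>\<^bsub>H\<^esub>}"
    show "?K \<subseteq> ?I"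
    proof
      fix x assume x: "x \<in> ?K"
      then have "?I #>\<^bsub>add_monoid (?T (Suc j))\<^esub> x = ?I" using eq unfolding cH zH by blast
      then show "x \<in> ?I"
        using group.rcos_self[OF T1.a_group _ subI, of x] Kc[OF x] by simp
    qed
  next
    assume "?K \<subseteq> ?I"
    then have "?I #>\<^bsub>add_monoid (?T (Suc j))\<^esub> x = ?I" if "x \<in> ?K" for x
      using group.coset_join2[OF T1.a_group _ subI, of x] Kc[OF that] that by auto
    then show "carrier H = {\<zero>\<^bsub>H\<^esub>}"
      unfolding cH zH using zK by auto
  qed
  also have "\<dots> \<longleftrightarrow> exact_at (n j) (n (Suc j)) (n (Suc (Suc j))) (d j) (d (Suc j))"
  proof
    assume sub: "?K \<subseteq> ?I"
    show "exact_at (n j) (n (Suc j)) (n (Suc (Suc j))) (d j) (d (Suc j))"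
      unfolding exact_at_def
    proof (intro ballI impI)
      fix y assume y: "y \<in> carrier (pow_mod N (n (Suc j)))"
        and z: "hom_ext R N (n j) (n (Suc j)) (d j) y = \<zero>\<^bsub>pow_mod N (n j)\<^esub>"
      have "?\<delta> j (free_iso (n (Suc j)) y) = \<zero>\<^bsub>?T j\<^esub>"
        unfolding free_iso_push[OF d y] z
        using free_iso_eq_zero z N.hom_ext_closed[OF d y] by simp
      then have "free_iso (n (Suc j)) y \<in> ?I"
        using sub free_iso_closed[OF y] by (auto simp: a_kernel_def')
      then obtain u where u: "u \<in> carrier (?T (Suc (Suc j)))" "free_iso (n (Suc j)) y = ?\<delta> (Suc j) u"
        by auto
      from free_iso_surj[OF u(1)] obtain w where w: "w \<in> carrier (pow_mod N (n (Suc (Suc j))))" "u = free_iso (n (Suc (Suc j))) w" .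
      have "y = hom_ext R N (n (Suc j)) (n (Suc (Suc j))) (d (Suc j)) w"
        by (rule free_iso_inj[OF y N.hom_ext_closed[OF d w(1)]]) (use u w free_iso_push[OF d w(1)] in simp)
      then show "y \<in> hom_ext R N (n (Suc j)) (n (Suc (Suc j))) (d (Suc j)) ` carrier (pow_mod N (n (Suc (Suc j))))"
        using w(1) by blast
    qed
  next
    assume ex: "exact_at (n j) (n (Suc j)) (n (Suc (Suc j))) (d j) (d (Suc j))"
    show "?K \<subseteq> ?I"
    proof
      fix u assume u: "u \<in> ?K"
      from free_iso_surj[OF Kc[OF u]] obtain y where y: "y \<in> carrier (pow_mod N (n (Suc j)))" "u = free_iso (n (Suc j)) y" .
      have "free_iso (n j) (hom_ext R N (n j) (n (Suc j)) (d j) y) = \<zero>\<^bsub>?T j\<^esub>"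
        using u y free_iso_push[OF d y(1)] by (simp add: a_kernel_def')
      then have "hom_ext R N (n j) (n (Suc j)) (d j) y = \<zero>\<^bsub>pow_mod N (n j)\<^esub>"
        using free_iso_eq_zero[OF N.hom_ext_closed[OF d y(1)]] by simp
      then obtain w where w: "w \<in> carrier (pow_mod N (n (Suc (Suc j))))" "y = hom_ext R N (n (Suc j)) (n (Suc (Suc j))) (d (Suc j)) w"
        using ex y(1) by (auto simp: exact_at_def)
      have "u = ?\<delta> (Suc j) (free_iso (n (Suc (Suc j))) w)"
        by (simp add: y(2) w(2) free_iso_push[OF d w(1)])
      then show "u \<in> ?I" using free_iso_closed[OF w(1)] by blast
    qed
  qed
  finally show ?thesis .
qed

end

section \<open>Length relative to a multiplicative set\<close>

locale mult_set = cring R for R :: "('a, 'r) ring_scheme" (structure) +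
  fixes S :: "'a set"
  assumes S_subset: "S \<subseteq> carrier R" and S_one: "\<one> \<in> S"
    and S_mult: "s \<in> S \<Longrightarrow> t \<in> S \<Longrightarrow> s \<otimes> t \<in> S"

text \<open>For a prime \<open>P\<close> and \<open>S = R - P\<close>, a pair \<open>C \<subseteq> K\<close> is \<open>big\<close> if and only if \<open>C\<^sub>P \<noteq> K\<^sub>P\<close>, so that
  \<open>len\<close> is the length of \<open>(K/H)\<^sub>P\<close> over \<open>R\<^sub>P\<close>. Working with chains in the unlocalized module
  avoids localizations and quotients.\<close>

definition big :: "'a set \<Rightarrow> ('a, 'b, 'm) module_scheme \<Rightarrow> 'b set \<Rightarrow> 'b set \<Rightarrow> bool" where
  "big S M H K \<longleftrightarrow> (\<exists>x\<in>K. \<forall>s\<in>S. s \<odot>\<^bsub>M\<^esub> x \<notin> H)"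

text \<open>The step from \<open>H\<close> to the first member need not be big, so \<open>n\<close>
  counts the steps of a chain between \<open>H\<close> and \<open>K\<close> that stay proper after
  localization. The slack at the bottom keeps images and preimages of towers inside the
  definition.\<close>

inductive tower :: "('a, 'r) ring_scheme \<Rightarrow> 'a set \<Rightarrow> ('a, 'b, 'm) module_scheme \<Rightarrow> 'b set \<Rightarrow> 'b set \<Rightarrow> nat \<Rightarrow> bool"
  for R S M H where
  tower_0: "submodule H R M \<Longrightarrow> submodule K R M \<Longrightarrow> H \<subseteq> K \<Longrightarrow> tower R S M H K 0"
| tower_Suc: "tower R S M H C n \<Longrightarrow> submodule K R M \<Longrightarrow> C \<subseteq> K \<Longrightarrow> big S M C K \<Longrightarrow> tower R S M H K (Suc n)"

definition len :: "('a, 'r) ring_scheme \<Rightarrow> 'a set \<Rightarrow> ('a, 'b, 'm) module_scheme \<Rightarrow> 'b set \<Rightarrow> 'b set \<Rightarrow> enat" where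
  "len R S M H K = Sup {enat n | n. tower R S M H K n}"

lemma submodule_mem_carrier: "submodule H R M \<Longrightarrow> x \<in> H \<Longrightarrow> x \<in> carrier M"
  using submodule_subset by blast

lemma big_mono: "big S M C K \<Longrightarrow> C' \<subseteq> C \<Longrightarrow> K \<subseteq> K' \<Longrightarrow> big S M C' K'"
  unfolding big_def by blast

lemma tower_submodule:
  assumes "tower R S M H K n"
  shows "submodule H R M" "submodule K R M" "H \<subseteq> K"
  using assms by (induction rule: tower.induct) auto

text \<open>Enlarging the upper end of the last step keeps that step big.\<close>

lemma tower_mono_right:
  assumes "tower R S M H K n" "submodule K' R M" "K \<subseteq> K'"
  shows "tower R S M H K' n"
  using assms(1)
proof (cases rule: tower.cases)
  case tower_0
  then show ?thesis using assms by (auto intro: tower.tower_0)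
next
  case (tower_Suc C m)
  then show ?thesis using assms tower.tower_Suc[of R S M H C m K'] big_mono[of S M C K C K'] by blast
qed

lemma tower_trans:
  assumes "tower R S M L K n" "tower R S M H L m"
  shows "tower R S M H K (m + n)"
  using assms
proof (induction rule: tower.induct)
  case (tower_0 K)
  then show ?case by (auto intro: tower_mono_right)
next
  case (tower_Suc C n K)
  then show ?case by (auto intro: tower.tower_Suc)
qed

text \<open>Transport of towers along an operation on submodules that respects big steps. It will be
  applied to adding a submodule, to preimages and to colon ideals.\<close>

lemma tower_map:
  assumes "tower R S M H K n"
    and "\<And>C. submodule C R M \<Longrightarrow> H \<subseteq> C \<Longrightarrow> C \<subseteq> K \<Longrightarrow> submodule (\<delta> C) R' N"
    and "\<And>C D. submodule C R M \<Longrightarrow> submodule D R M \<Longrightarrow> H \<subseteq> C \<Longrightarrow> C \<subseteq> D \<Longrightarrow> D \<subseteq> K \<Longrightarrow> \<delta> C \<subseteq> \<delta> D"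
    and "\<And>C D. submodule C R M \<Longrightarrow> submodule D R M \<Longrightarrow> H \<subseteq> C \<Longrightarrow> C \<subseteq> D \<Longrightarrow> D \<subseteq> K \<Longrightarrow> big S M C D \<Longrightarrow> big S N (\<delta> C) (\<delta> D)"
  shows "tower R' S N (\<delta> H) (\<delta> K) n"
  using assms
proof (induction rule: tower.induct)
  case (tower_0 K)
  then show ?case by (intro tower.tower_0) auto
next
  case (tower_Suc C n K)
  note C = tower_submodule[OF tower_Suc.hyps(1)]
  show ?case
  proof (rule tower.tower_Suc)
    show "tower R' S N (\<delta> H) (\<delta> C) n"
      using tower_Suc.hyps(3) by (intro tower_Suc.IH tower_Suc.prems) auto
    show "submodule (\<delta> K) R' N" using tower_Suc.hyps C by (intro tower_Suc.prems) auto
    show "\<delta> C \<subseteq> \<delta> K" using tower_Suc.hyps C by (intro tower_Suc.prems(2)) auto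
    show "big S N (\<delta> C) (\<delta> K)" using tower_Suc.hyps C by (intro tower_Suc.prems(3)) auto
  qed
qed

text \<open>If every big step stays big under at least one of two operations, the steps can be
  distributed between them. This bounds a length by a sum of two lengths without composition series
  or Jordan-Hoelder.\<close>

lemma tower_split:
  assumes "tower R S M H K n"
    and "\<And>C. submodule C R M \<Longrightarrow> H \<subseteq> C \<Longrightarrow> C \<subseteq> K \<Longrightarrow> submodule (\<alpha> C) R N"
    and "\<And>C. submodule C R M \<Longrightarrow> H \<subseteq> C \<Longrightarrow> C \<subseteq> K \<Longrightarrow> submodule (\<beta> C) R L"
    and "\<And>C D. submodule C R M \<Longrightarrow> submodule D R M \<Longrightarrow> H \<subseteq> C \<Longrightarrow> C \<subseteq> D \<Longrightarrow> D \<subseteq> K \<Longrightarrow> \<alpha> C \<subseteq> \<alpha> D \<and> \<beta> C \<subseteq> \<beta> D"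
    and "\<And>C D. submodule C R M \<Longrightarrow> submodule D R M \<Longrightarrow> H \<subseteq> C \<Longrightarrow> C \<subseteq> D \<Longrightarrow> D \<subseteq> K \<Longrightarrow> big S M C D
            \<Longrightarrow> big S N (\<alpha> C) (\<alpha> D) \<or> big S L (\<beta> C) (\<beta> D)"
  shows "\<exists>p q. tower R S N (\<alpha> H) (\<alpha> K) p \<and> tower R S L (\<beta> H) (\<beta> K) q \<and> n = p + q"
  using assms
proof (induction rule: tower.induct)
  case (tower_0 K)
  have m: "\<alpha> H \<subseteq> \<alpha> K" "\<beta> H \<subseteq> \<beta> K"
    using tower_0.prems(3)[of H K] tower_0.hyps by auto
  have "tower R S N (\<alpha> H) (\<alpha> K) 0"
    by (rule tower.tower_0[OF _ _ m(1)]) (use tower_0.hyps tower_0.prems(1) in auto)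
  moreover have "tower R S L (\<beta> H) (\<beta> K) 0"
    by (rule tower.tower_0[OF _ _ m(2)]) (use tower_0.hyps tower_0.prems(2) in auto)
  ultimately show ?case by force
next
  case (tower_Suc C n K)
  note C = tower_submodule[OF tower_Suc.hyps(1)]
  have "\<exists>p q. tower R S N (\<alpha> H) (\<alpha> C) p \<and> tower R S L (\<beta> H) (\<beta> C) q \<and> n = p + q"
    using tower_Suc.hyps(3) by (intro tower_Suc.IH tower_Suc.prems) auto
  then obtain p q where pq: "tower R S N (\<alpha> H) (\<alpha> C) p" "tower R S L (\<beta> H) (\<beta> C) q" "n = p + q" by auto
  have s: "submodule (\<alpha> K) R N" "submodule (\<beta> K) R L"
    using tower_Suc.hyps C by (auto intro: tower_Suc.prems)
  have m: "\<alpha> C \<subseteq> \<alpha> K" "\<beta> C \<subseteq> \<beta> K" using tower_Suc.hyps C tower_Suc.prems(3)[of C K] by auto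
  have "big S N (\<alpha> C) (\<alpha> K) \<or> big S L (\<beta> C) (\<beta> K)" using tower_Suc.hyps C
    by (intro tower_Suc.prems(4)) auto
  then show ?case
  proof
    assume "big S N (\<alpha> C) (\<alpha> K)"
    then have "tower R S N (\<alpha> H) (\<alpha> K) (Suc p)" using pq s m by (blast intro: tower.tower_Suc)
    moreover have "tower R S L (\<beta> H) (\<beta> K) q" using pq s m by (blast intro: tower_mono_right)
    ultimately show ?case using pq(3) by (intro exI[of _ "Suc p"] exI[of _ q]) simp
  next
    assume "big S L (\<beta> C) (\<beta> K)"
    then have "tower R S L (\<beta> H) (\<beta> K) (Suc q)" using pq s m by (blast intro: tower.tower_Suc)
    moreover have "tower R S N (\<alpha> H) (\<alpha> K) p" using pq s m by (blast intro: tower_mono_right)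
    ultimately show ?case using pq(3) by (intro exI[of _ p] exI[of _ "Suc q"]) simp
  qed
qed

text \<open>For finite \<open>l\<close> both sets are bounded, hence finite, so their suprema are
  attained and \<open>le\<close> applies to them.\<close>

lemma Sup_enat_add_le:
  fixes A B :: "enat set"
  assumes ne: "A \<noteq> {}" "B \<noteq> {}" and le: "\<And>a b. a \<in> A \<Longrightarrow> b \<in> B \<Longrightarrow> a + b \<le> l"
  shows "Sup A + Sup B \<le> l"
proof (cases l)
  case (enat k)
  have "Sup A \<in> A"
  proof -
    obtain b where "b \<in> B" using ne by auto
    then have "a \<le> enat k" if "a \<in> A" for a using le[OF that \<open>b \<in> B\<close>] enat
      by (metis le_iff_add order_trans)
    then have "finite A" by (intro finite_enat_bounded) auto
    then show ?thesis using ne(1) by (simp add: Sup_enat_def)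
  qed
  moreover have "Sup B \<in> B"
  proof -
    obtain a where "a \<in> A" using ne by auto
    then have "b \<le> enat k" if "b \<in> B" for b using le[OF \<open>a \<in> A\<close> that] enat
      by (metis add.commute le_iff_add order_trans)
    then have "finite B" by (intro finite_enat_bounded) auto
    then show ?thesis using ne(2) by (simp add: Sup_enat_def)
  qed
  ultimately show ?thesis by (rule le)
qed simp

lemma len_leI: "(\<And>n. tower R S M H K n \<Longrightarrow> enat n \<le> l) \<Longrightarrow> len R S M H K \<le> l"
  unfolding len_def by (rule Sup_least) auto

lemma tower_le_len: "tower R S M H K n \<Longrightarrow> enat n \<le> len R S M H K"
  unfolding len_def by (rule Sup_upper) auto

text \<open>Reduces a bound on a sum of lengths to pairs of towers; the towers of height zero
  provide the nonemptiness of both sets.\<close>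

lemma len_add_le:
  assumes "submodule H R M" "submodule K R M" "H \<subseteq> K" "submodule H' R' M'" "submodule K' R' M'" "H' \<subseteq> K'"
    and "\<And>m n. tower R S M H K m \<Longrightarrow> tower R' S' M' H' K' n \<Longrightarrow> enat (m + n) \<le> l"
  shows "len R S M H K + len R' S' M' H' K' \<le> l"
  unfolding len_def
proof (rule Sup_enat_add_le)
  show "{enat n |n. tower R S M H K n} \<noteq> {}" using tower_0[OF assms(1-3)] by blast
  show "{enat n |n. tower R' S' M' H' K' n} \<noteq> {}" using tower_0[OF assms(4-6)] by blast
qed (use assms(7) in auto)

section \<open>Additivity of length\<close>

context mult_set
begin

lemma SR: "s \<in> S \<Longrightarrow> s \<in> carrier R"
  using S_subset by auto

lemma len_refl:
  assumes "module R M" "submodule H R M"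
  shows "len R S M H H = 0"
proof -
  have "n = 0" if "tower R S M H K n" "K \<subseteq> H" for n K
    using that
  proof (induction rule: tower.induct)
    case (tower_Suc C n K)
    from \<open>big S M C K\<close> obtain x where "x \<in> K" "\<one> \<odot>\<^bsub>M\<^esub> x \<notin> C"
      using S_one by (auto simp: big_def)
    moreover have "x \<in> H" "H \<subseteq> C" "x \<in> carrier M"
      using \<open>x \<in> K\<close> tower_Suc tower_submodule[OF tower_Suc(1)] submodule_subset[OF assms(2)] by auto
    ultimately show ?case
      using module.smult_one[OF assms(1)] by auto
  qed simp
  then have "len R S M H H \<le> 0"
    by (intro len_leI) (auto simp: zero_enat_def)
  then show ?thesis by simp
qed

text \<open>Intersecting with \<open>L\<close> and adding \<open>L\<close> split a tower into one
  below and one above \<open>L\<close>; in the other direction towers are concatenated.\<close>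

lemma len_additive:
  assumes M: "module R M" and sub: "submodule H R M" "submodule L R M" "submodule K R M" and le: "H \<subseteq> L" "L \<subseteq> K"
  shows "len R S M H K = len R S M H L + len R S M L K"
proof (rule antisym)
  interpret M: module R M by fact
  note cl = submodule_mem_carrier
  show "len R S M H K \<le> len R S M H L + len R S M L K"
  proof (rule len_leI)
    fix n assume t: "tower R S M H K n"
    have "\<exists>p q. tower R S M (H \<inter> L) (K \<inter> L) p
        \<and> tower R S M {h \<oplus>\<^bsub>M\<^esub> k | h k. h \<in> H \<and> k \<in> L} {h \<oplus>\<^bsub>M\<^esub> k | h k. h \<in> K \<and> k \<in> L} q \<and> n = p + q"
    proof (rule tower_split[OF t])
      fix C D assume C: "submodule C R M" "submodule D R M" "H \<subseteq> C" "C \<subseteq> D" "D \<subseteq> K" and b: "big S M C D"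
      from b obtain x where x: "x \<in> D" "\<And>s. s \<in> S \<Longrightarrow> s \<odot>\<^bsub>M\<^esub> x \<notin> C" unfolding big_def by blast
      have xc: "x \<in> carrier M" by (rule cl[OF C(2) x(1)])
      show "big S M (C \<inter> L) (D \<inter> L) \<or> big S M {h \<oplus>\<^bsub>M\<^esub> k | h k. h \<in> C \<and> k \<in> L} {h \<oplus>\<^bsub>M\<^esub> k | h k. h \<in> D \<and> k \<in> L}"
      proof (rule ccontr)
        assume nb: "\<not> ?thesis"
        have "x = x \<oplus>\<^bsub>M\<^esub> \<zero>\<^bsub>M\<^esub>" using xc by simp
        then have "x \<in> {h \<oplus>\<^bsub>M\<^esub> k | h k. h \<in> D \<and> k \<in> L}"
          using x(1) submodule_zero_mem[OF sub(2)] by blast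
        \<comment> \<open>If the step is small after adding \<open>L\<close>, some multiple of
          \<open>x\<close> is \<open>c\<close> plus an element \<open>y\<close> of L, and
          \<open>y\<close> lies in \<open>D\<close>. If it is also small inside \<open>L\<close>, a
          multiple of \<open>y\<close> lies in \<open>C\<close>, and then so does a multiple of
          \<open>x\<close>.\<close>
        then obtain s c y where s: "s \<in> S" "s \<odot>\<^bsub>M\<^esub> x = c \<oplus>\<^bsub>M\<^esub> y" "c \<in> C" "y \<in> L"
          using nb unfolding big_def by blast
        have cy: "c \<in> carrier M" "y \<in> carrier M" using cl[OF C(1) s(3)] cl[OF sub(2) s(4)] by auto
        have "y = s \<odot>\<^bsub>M\<^esub> x \<oplus>\<^bsub>M\<^esub> \<ominus>\<^bsub>M\<^esub> c"
          unfolding s(2) M.M.a_comm[OF cy] using cy by (simp add: M.M.a_assoc M.M.r_neg)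
        moreover have "s \<odot>\<^bsub>M\<^esub> x \<oplus>\<^bsub>M\<^esub> \<ominus>\<^bsub>M\<^esub> c \<in> D"
          using M.submoduleE(3-5)[OF C(2)] SR s x(1) C(4) by blast
        ultimately obtain t where t: "t \<in> S" "t \<odot>\<^bsub>M\<^esub> y \<in> C"
          using nb s(4) unfolding big_def by blast
        have "(t \<otimes> s) \<odot>\<^bsub>M\<^esub> x = t \<odot>\<^bsub>M\<^esub> c \<oplus>\<^bsub>M\<^esub> t \<odot>\<^bsub>M\<^esub> y"
          using s(2) cy xc SR s(1) t(1) by (simp add: M.smult_assoc1 M.smult_r_distr)
        moreover have "\<dots> \<in> C" using M.submoduleE(4,5)[OF C(1)] SR s(3) t by blast
        ultimately show False using x(2)[OF S_mult[OF t(1) s(1)]] by simp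
      qed
    qed (blast intro: submodule_Int[OF M] submodule_sum[OF M] sub)+
    moreover have "H \<inter> L = H" "K \<inter> L = L" using le by auto
    moreover have "{h \<oplus>\<^bsub>M\<^esub> k | h k. h \<in> H \<and> k \<in> L} = L"
    proof
      show "{h \<oplus>\<^bsub>M\<^esub> k | h k. h \<in> H \<and> k \<in> L} \<subseteq> L" using M.submoduleE(5)[OF sub(2)] le by blast
      show "L \<subseteq> {h \<oplus>\<^bsub>M\<^esub> k | h k. h \<in> H \<and> k \<in> L}"
      proof
        fix x assume "x \<in> L"
        moreover from this have "x = \<zero>\<^bsub>M\<^esub> \<oplus>\<^bsub>M\<^esub> x" using cl[OF sub(2)] by simp
        ultimately show "x \<in> {h \<oplus>\<^bsub>M\<^esub> k | h k. h \<in> H \<and> k \<in> L}" using submodule_zero_mem[OF sub(1)] by blast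
      qed
    qed
    moreover have "{h \<oplus>\<^bsub>M\<^esub> k | h k. h \<in> K \<and> k \<in> L} = K"
    proof
      show "{h \<oplus>\<^bsub>M\<^esub> k | h k. h \<in> K \<and> k \<in> L} \<subseteq> K" using M.submoduleE(5)[OF sub(3)] le by blast
      show "K \<subseteq> {h \<oplus>\<^bsub>M\<^esub> k | h k. h \<in> K \<and> k \<in> L}"
      proof
        fix x assume "x \<in> K"
        moreover from this have "x = x \<oplus>\<^bsub>M\<^esub> \<zero>\<^bsub>M\<^esub>" using cl[OF sub(3)] by simp
        ultimately show "x \<in> {h \<oplus>\<^bsub>M\<^esub> k | h k. h \<in> K \<and> k \<in> L}" using submodule_zero_mem[OF sub(2)] by blast
      qed
    qed
    ultimately obtain p q where pq: "tower R S M H L p" "tower R S M L K q" "n = p + q" by auto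
    have "enat p + enat q \<le> len R S M H L + len R S M L K"
      by (intro add_mono tower_le_len pq)
    then show "enat n \<le> len R S M H L + len R S M L K"
      by (simp add: pq(3))
  qed
  show "len R S M H L + len R S M L K \<le> len R S M H K"
    by (rule len_add_le) (use sub le in \<open>auto intro: tower_le_len tower_trans\<close>)
qed

text \<open>Additivity along image and kernel, in relative form. A tower is split by taking images
  and kernels; conversely, a tower in the kernels, shifted by \<open>H\<close>, is placed below the
  preimage of a tower of images.\<close>

lemma len_hom:
  assumes M: "module R M" and N: "module R N" and f: "f \<in> mod_hom R M N"
    and sub: "submodule H R M" "submodule K R M" and le: "H \<subseteq> K"
  shows "len R S M H K = len R S N (f ` H) (f ` K)
     + len R S M {x \<in> H. f x = \<zero>\<^bsub>N\<^esub>} {x \<in> K. f x = \<zero>\<^bsub>N\<^esub>}"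
proof (rule antisym)
  interpret M: module R M by fact
  interpret N: module R N by fact
  note cl = submodule_mem_carrier
  have subk: "submodule {x \<in> C. f x = \<zero>\<^bsub>N\<^esub>} R M" if "submodule C R M" for C
    using submodule_vimage[OF M N f that submodule_zero[OF N]] by simp
  note subi = submodule_image[OF M N f]
  show "len R S M H K \<le> len R S N (f ` H) (f ` K) + len R S M {x \<in> H. f x = \<zero>\<^bsub>N\<^esub>} {x \<in> K. f x = \<zero>\<^bsub>N\<^esub>}"
  proof (rule len_leI)
    fix n assume t: "tower R S M H K n"
    have "\<exists>p q. tower R S N (f ` H) (f ` K) p
        \<and> tower R S M {x \<in> H. f x = \<zero>\<^bsub>N\<^esub>} {x \<in> K. f x = \<zero>\<^bsub>N\<^esub>} q \<and> n = p + q"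
    proof (rule tower_split[OF t])
      fix C D assume C: "submodule C R M" "submodule D R M" "H \<subseteq> C" "C \<subseteq> D" "D \<subseteq> K" and b: "big S M C D"
      from b obtain x where x: "x \<in> D" "\<And>s. s \<in> S \<Longrightarrow> s \<odot>\<^bsub>M\<^esub> x \<notin> C" unfolding big_def by blast
      have xc: "x \<in> carrier M" by (rule cl[OF C(2) x(1)])
      show "big S N (f ` C) (f ` D) \<or> big S M {x \<in> C. f x = \<zero>\<^bsub>N\<^esub>} {x \<in> D. f x = \<zero>\<^bsub>N\<^esub>}"
      proof (rule ccontr)
        assume nb: "\<not> ?thesis"
        then obtain s c where s: "s \<in> S" "s \<odot>\<^bsub>N\<^esub> f x = f c" "c \<in> C"
          using x(1) unfolding big_def by blast
        have cc: "c \<in> carrier M" by (rule cl[OF C(1) s(3)])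
        let ?y = "s \<odot>\<^bsub>M\<^esub> x \<oplus>\<^bsub>M\<^esub> \<ominus>\<^bsub>M\<^esub> c"
        have y: "?y \<in> D" using M.submoduleE(3-5)[OF C(2)] SR s x(1) C(4) by blast
        have "f ?y = f (s \<odot>\<^bsub>M\<^esub> x) \<oplus>\<^bsub>N\<^esub> \<ominus>\<^bsub>N\<^esub> f c"
          using xc cc SR[OF s(1)] by (simp add: mod_hom_add[OF f] mod_hom_a_inv[OF M N f])
        then have "f ?y = \<zero>\<^bsub>N\<^esub>"
          using s xc cc SR mod_hom_closed[OF f cc] by (simp add: mod_hom_smult[OF f] N.M.r_neg)
        then obtain t where t: "t \<in> S" "t \<odot>\<^bsub>M\<^esub> ?y \<in> C"
          using nb y unfolding big_def by blast
        have sx: "s \<odot>\<^bsub>M\<^esub> x = c \<oplus>\<^bsub>M\<^esub> ?y"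
          using xc cc SR[OF s(1)] by (subst M.M.a_lcomm) (auto simp: M.M.r_neg)
        have "(t \<otimes> s) \<odot>\<^bsub>M\<^esub> x = t \<odot>\<^bsub>M\<^esub> (s \<odot>\<^bsub>M\<^esub> x)"
          by (rule M.smult_assoc1[OF SR[OF t(1)] SR[OF s(1)] xc])
        also have "\<dots> = t \<odot>\<^bsub>M\<^esub> (c \<oplus>\<^bsub>M\<^esub> ?y)"
          by (rule arg_cong[OF sx])
        also have "\<dots> = t \<odot>\<^bsub>M\<^esub> c \<oplus>\<^bsub>M\<^esub> t \<odot>\<^bsub>M\<^esub> ?y"
          by (rule M.smult_r_distr[OF SR[OF t(1)] cc cl[OF C(2) y]])
        finally have "(t \<otimes> s) \<odot>\<^bsub>M\<^esub> x = t \<odot>\<^bsub>M\<^esub> c \<oplus>\<^bsub>M\<^esub> t \<odot>\<^bsub>M\<^esub> ?y" .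
        moreover have "t \<odot>\<^bsub>M\<^esub> c \<oplus>\<^bsub>M\<^esub> t \<odot>\<^bsub>M\<^esub> ?y \<in> C" using M.submoduleE(4,5)[OF C(1)] SR s(3) t by blast
        ultimately show False using x(2)[OF S_mult[OF t(1) s(1)]] by simp
      qed
    qed (auto intro: subk subi)
    then obtain p q where pq: "tower R S N (f ` H) (f ` K) p" "tower R S M {x \<in> H. f x = \<zero>\<^bsub>N\<^esub>} {x \<in> K. f x = \<zero>\<^bsub>N\<^esub>} q" "n = p + q" by auto
    have "enat p + enat q \<le> len R S N (f ` H) (f ` K) + len R S M {x \<in> H. f x = \<zero>\<^bsub>N\<^esub>} {x \<in> K. f x = \<zero>\<^bsub>N\<^esub>}"
      by (intro add_mono tower_le_len pq)
    then show "enat n \<le> len R S N (f ` H) (f ` K) + len R S M {x \<in> H. f x = \<zero>\<^bsub>N\<^esub>} {x \<in> K. f x = \<zero>\<^bsub>N\<^esub>}"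
      by (simp add: pq(3))
  qed
  show "len R S N (f ` H) (f ` K) + len R S M {x \<in> H. f x = \<zero>\<^bsub>N\<^esub>} {x \<in> K. f x = \<zero>\<^bsub>N\<^esub>} \<le> len R S M H K"
  proof (rule len_add_le)
    fix m n assume tm: "tower R S N (f ` H) (f ` K) m" and tn: "tower R S M {x \<in> H. f x = \<zero>\<^bsub>N\<^esub>} {x \<in> K. f x = \<zero>\<^bsub>N\<^esub>} n"
    define \<delta> where "\<delta> E = {h \<oplus>\<^bsub>M\<^esub> k | h k. h \<in> H \<and> k \<in> E}" for E
    define \<gamma> where "\<gamma> E = {x \<in> K. f x \<in> E}" for E
    \<comment> \<open>Adding \<open>H\<close> turns the kernel tower into one that starts at
      \<open>H\<close> itself.\<close>
    have \<delta>: "tower R S M (\<delta> {x \<in> H. f x = \<zero>\<^bsub>N\<^esub>}) (\<delta> {x \<in> K. f x = \<zero>\<^bsub>N\<^esub>}) n"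
    proof (rule tower_map[OF tn])
      fix C D assume C: "submodule C R M" "submodule D R M" "{x \<in> H. f x = \<zero>\<^bsub>N\<^esub>} \<subseteq> C" "C \<subseteq> D" "D \<subseteq> {x \<in> K. f x = \<zero>\<^bsub>N\<^esub>}"
        and b: "big S M C D"
      from b obtain x where x: "x \<in> D" "\<And>s. s \<in> S \<Longrightarrow> s \<odot>\<^bsub>M\<^esub> x \<notin> C" unfolding big_def by blast
      have xc: "x \<in> carrier M" by (rule cl[OF C(2) x(1)])
      have "x = \<zero>\<^bsub>M\<^esub> \<oplus>\<^bsub>M\<^esub> x" using xc by simp
      then have xD: "x \<in> \<delta> D" unfolding \<delta>_def using x(1) submodule_zero_mem[OF sub(1)] by blast
      \<comment> \<open>In a decomposition \<open>h\<close> plus \<open>c\<close> of the multiple,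
        \<open>h\<close> is a difference of elements of \<open>D\<close> and so lies in the kernel.
        Being also in \<open>H\<close>, it lies in \<open>C\<close>, which contains the kernel part
        of \<open>H\<close>.\<close>
      have "s \<odot>\<^bsub>M\<^esub> x \<notin> \<delta> C" if s: "s \<in> S" for s
      proof
        assume "s \<odot>\<^bsub>M\<^esub> x \<in> \<delta> C"
        then obtain h c where h: "s \<odot>\<^bsub>M\<^esub> x = h \<oplus>\<^bsub>M\<^esub> c" "h \<in> H" "c \<in> C" by (auto simp: \<delta>_def)
        have hc: "h \<in> carrier M" "c \<in> carrier M" using cl[OF sub(1) h(2)] cl[OF C(1) h(3)] by auto
        have "h = s \<odot>\<^bsub>M\<^esub> x \<oplus>\<^bsub>M\<^esub> \<ominus>\<^bsub>M\<^esub> c"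
          unfolding h(1) using hc by (simp add: M.M.a_assoc M.M.r_neg)
        moreover have "s \<odot>\<^bsub>M\<^esub> x \<oplus>\<^bsub>M\<^esub> \<ominus>\<^bsub>M\<^esub> c \<in> D"
          using M.submoduleE(3-5)[OF C(2)] SR s x(1) C(4) h(3) by blast
        ultimately have "h \<in> C" using C(3,5) h(2) by auto
        then have "s \<odot>\<^bsub>M\<^esub> x \<in> C" unfolding h(1) using M.submoduleE(5)[OF C(1)] h(3) by blast
        then show False using x(2) s by blast
      qed
      then show "big S M (\<delta> C) (\<delta> D)" using xD unfolding big_def by blast
    qed (auto simp: \<delta>_def intro: submodule_sum[OF M sub(1)])
    have H: "\<delta> {x \<in> H. f x = \<zero>\<^bsub>N\<^esub>} = H"
    proof
      show "\<delta> {x \<in> H. f x = \<zero>\<^bsub>N\<^esub>} \<subseteq> H" using M.submoduleE(5)[OF sub(1)] by (auto simp: \<delta>_def)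
      show "H \<subseteq> \<delta> {x \<in> H. f x = \<zero>\<^bsub>N\<^esub>}"
      proof
        fix x assume "x \<in> H"
        moreover from this have "x = x \<oplus>\<^bsub>M\<^esub> \<zero>\<^bsub>M\<^esub>" using cl[OF sub(1)] by simp
        ultimately show "x \<in> \<delta> {x \<in> H. f x = \<zero>\<^bsub>N\<^esub>}"
          unfolding \<delta>_def using submodule_zero_mem[OF sub(1)] mod_hom_zero[OF M N f] by blast
      qed
    qed
    have sg: "submodule (\<gamma> E) R M" if "submodule E R N" for E
      unfolding \<gamma>_def by (rule submodule_vimage[OF M N f sub(2) that])
    \<comment> \<open>This inclusion allows the two towers to be stacked: \<open>H\<close> plus the
      kernel part of \<open>K\<close> lies below the preimage of the image of
      \<open>H\<close>.\<close>
    have "\<delta> {x \<in> K. f x = \<zero>\<^bsub>N\<^esub>} \<subseteq> \<gamma> (f ` H)"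
    proof
      fix x assume "x \<in> \<delta> {x \<in> K. f x = \<zero>\<^bsub>N\<^esub>}"
      then obtain h k where x: "x = h \<oplus>\<^bsub>M\<^esub> k" "h \<in> H" "k \<in> K" "f k = \<zero>\<^bsub>N\<^esub>" by (auto simp: \<delta>_def)
      have hk: "h \<in> carrier M" "k \<in> carrier M" using cl[OF sub(1) x(2)] cl[OF sub(2) x(3)] by auto
      have "f x = f h" using x hk mod_hom_closed[OF f hk(1)] by (simp add: mod_hom_add[OF f])
      then show "x \<in> \<gamma> (f ` H)" unfolding \<gamma>_def using x M.submoduleE(5)[OF sub(2)] le by auto
    qed
    then have t1: "tower R S M H (\<gamma> (f ` H)) n"
      using tower_mono_right[OF \<delta>[unfolded H] sg[OF subi[OF sub(1)]]] by blast
    have "tower R S M (\<gamma> (f ` H)) (\<gamma> (f ` K)) m"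
    proof (rule tower_map[OF tm])
      fix C D assume C: "submodule C R N" "submodule D R N" "f ` H \<subseteq> C" "C \<subseteq> D" "D \<subseteq> f ` K" and b: "big S N C D"
      from b obtain x where x: "x \<in> D" "\<And>s. s \<in> S \<Longrightarrow> s \<odot>\<^bsub>N\<^esub> x \<notin> C" unfolding big_def by blast
      then obtain k where k: "k \<in> K" "x = f k" using C by blast
      have "f (s \<odot>\<^bsub>M\<^esub> k) = s \<odot>\<^bsub>N\<^esub> x" if "s \<in> S" for s
        using mod_hom_smult[OF f SR[OF that]] k cl[OF sub(2)] by auto
      then show "big S M (\<gamma> C) (\<gamma> D)" unfolding big_def \<gamma>_def using k x by auto
    qed (auto simp: \<gamma>_def[symmetric] intro: sg, auto simp: \<gamma>_def)
    then have "tower R S M (\<gamma> (f ` H)) K m"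
      using tower_mono_right[OF _ sub(2)] by (auto simp: \<gamma>_def)
    from tower_le_len[OF tower_trans[OF this t1]] show "enat (m + n) \<le> len R S M H K"
      by (simp add: add.commute)
  qed (use sub le in \<open>auto intro: subi subk\<close>)
qed

lemma len_inj:
  assumes M: "module R M" and N: "module R N" and f: "f \<in> mod_hom R M N" and inj: "inj_on f (carrier M)"
    and sub: "submodule H R M" "submodule K R M" and le: "H \<subseteq> K"
  shows "len R S N (f ` H) (f ` K) = len R S M H K"
proof -
  interpret M: module R M by fact
  have "{x \<in> C. f x = \<zero>\<^bsub>N\<^esub>} = {\<zero>\<^bsub>M\<^esub>}" if "submodule C R M" for C
  proof -
    have "x = \<zero>\<^bsub>M\<^esub>" if "x \<in> C" "f x = \<zero>\<^bsub>N\<^esub>" for x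
      by (rule inj_onD[OF inj])
         (use that mod_hom_zero[OF M N f] submodule_mem_carrier[OF \<open>submodule C R M\<close>] in auto)
    then show ?thesis
      using submodule_zero_mem[OF that] mod_hom_zero[OF M N f] by blast
  qed
  then show ?thesis
    using len_hom[OF M N f sub le] sub len_refl[OF M submodule_zero[OF M]] by simp
qed

end

lemma pow_sub_submodule:
  assumes "module R M" "submodule H R M"
  shows "submodule ({..<n} \<rightarrow>\<^sub>E H) R (pow_mod M n)"
proof -
  interpret M: module R M by fact
  interpret P: module R "pow_mod M n" using assms(1) by (rule module_pow_mod)
  note H = M.submoduleE[OF assms(2)]
  have cl: "x \<in> {..<n} \<rightarrow>\<^sub>E H \<Longrightarrow> x \<in> carrier (pow_mod M n)" for x
    using H(1) by (auto simp: pow_mod_carrier)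
  show ?thesis
  proof (rule P.submoduleI)
    show "\<zero>\<^bsub>pow_mod M n\<^esub> \<in> {..<n} \<rightarrow>\<^sub>E H" using submodule_zero_mem[OF assms(2)] by (auto simp: pow_mod_simps)
  next
    fix x assume x: "x \<in> {..<n} \<rightarrow>\<^sub>E H"
    have "\<ominus>\<^bsub>pow_mod M n\<^esub> x \<in> carrier (pow_mod M n)" using cl[OF x] by simp
    moreover have "(\<ominus>\<^bsub>pow_mod M n\<^esub> x) i \<in> H" if "i < n" for i
      using pow_mod_a_inv[OF assms(1) cl[OF x] that] H(3) x that by auto
    ultimately show "\<ominus>\<^bsub>pow_mod M n\<^esub> x \<in> {..<n} \<rightarrow>\<^sub>E H" by (auto simp: pow_mod_carrier PiE_iff)
  qed (use cl H in \<open>auto simp: pow_mod_simps PiE_iff\<close>)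
qed

context mult_set
begin

text \<open>Induction on \<open>n\<close> by projecting to the last coordinate: the image is a copy
  of the submodule and the kernel is the smaller power, embedded by \<open>j\<close> through padding
  with zero.\<close>

lemma len_pow:
  assumes M: "module R M" and sub: "submodule H R M" "submodule K R M" and le: "H \<subseteq> K"
  shows "len R S (pow_mod M n) ({..<n} \<rightarrow>\<^sub>E H) ({..<n} \<rightarrow>\<^sub>E K) = enat n * len R S M H K"
proof (induction n)
  case 0
  have "{..<0::nat} \<rightarrow>\<^sub>E H = {..<0} \<rightarrow>\<^sub>E K" by simp
  then show ?case
    using len_refl[OF module_pow_mod[OF M] pow_sub_submodule[OF M sub(1)], of 0]
    by (simp add: zero_enat_def[symmetric])
next
  case (Suc n)
  interpret M: module R M by fact
  interpret P: module R "pow_mod M n" using M by (rule module_pow_mod)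
  interpret Q: module R "pow_mod M (Suc n)" using M by (rule module_pow_mod)
  note subp = pow_sub_submodule[OF M]
  have f: "(\<lambda>x. x n) \<in> mod_hom R (pow_mod M (Suc n)) M"
    by (rule mod_homI) (auto simp: pow_mod_nth intro: pow_mod_nth_closed)
  define j where "j y = (\<lambda>i\<in>{..<Suc n}. if i < n then y i else \<zero>\<^bsub>M\<^esub>)" for y
  have j: "j \<in> mod_hom R (pow_mod M n) (pow_mod M (Suc n))"
    by (rule mod_homI) (auto simp: j_def pow_mod_def PiE_iff intro!: restrict_ext)
  have inj: "inj_on j (carrier (pow_mod M n))"
  proof (rule inj_onI)
    fix x y assume xy: "x \<in> carrier (pow_mod M n)" "y \<in> carrier (pow_mod M n)" "j x = j y"
    have "x i = y i" if "i < n" for i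
      using fun_cong[OF xy(3), of i] that by (simp add: j_def)
    then show "x = y" by (rule pow_mod_eqI[OF xy(1,2)])
  qed
  have im: "(\<lambda>x. x n) ` ({..<Suc n} \<rightarrow>\<^sub>E C) = C" if C: "submodule C R M" for C
  proof
    show "C \<subseteq> (\<lambda>x. x n) ` ({..<Suc n} \<rightarrow>\<^sub>E C)"
    proof
      fix c assume "c \<in> C"
      then show "c \<in> (\<lambda>x. x n) ` ({..<Suc n} \<rightarrow>\<^sub>E C)"
        by (intro image_eqI[of _ _ "\<lambda>i\<in>{..<Suc n}. c"]) auto
    qed
  qed auto
  have ker: "{x \<in> {..<Suc n} \<rightarrow>\<^sub>E C. x n = \<zero>\<^bsub>M\<^esub>} = j ` ({..<n} \<rightarrow>\<^sub>E C)" if C: "submodule C R M" for C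
  proof
    show "j ` ({..<n} \<rightarrow>\<^sub>E C) \<subseteq> {x \<in> {..<Suc n} \<rightarrow>\<^sub>E C. x n = \<zero>\<^bsub>M\<^esub>}"
    proof
      fix z assume "z \<in> j ` ({..<n} \<rightarrow>\<^sub>E C)"
      then obtain y where y: "y \<in> {..<n} \<rightarrow>\<^sub>E C" "z = j y" by blast
      have "(if i < n then y i else \<zero>\<^bsub>M\<^esub>) \<in> C" for i
        using PiE_mem[OF y(1), of i] submodule_zero_mem[OF C] by simp
      then show "z \<in> {x \<in> {..<Suc n} \<rightarrow>\<^sub>E C. x n = \<zero>\<^bsub>M\<^esub>}"
        unfolding y(2) j_def by (simp add: restrict_PiE_iff)
    qed
    show "{x \<in> {..<Suc n} \<rightarrow>\<^sub>E C. x n = \<zero>\<^bsub>M\<^esub>} \<subseteq> j ` ({..<n} \<rightarrow>\<^sub>E C)"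
    proof
      fix x assume x: "x \<in> {x \<in> {..<Suc n} \<rightarrow>\<^sub>E C. x n = \<zero>\<^bsub>M\<^esub>}"
      have "x = j (restrict x {..<n})"
      proof
        fix i show "x i = j (restrict x {..<n}) i"
        proof (cases "i < Suc n")
          case True
          then show ?thesis using x by (cases "i = n") (simp_all add: j_def)
        next
          case False
          then show ?thesis using x PiE_arb[of x "{..<Suc n}" "\<lambda>_. C" i] by (simp add: j_def)
        qed
      qed
      moreover have "restrict x {..<n} \<in> {..<n} \<rightarrow>\<^sub>E C" using x by (auto simp: PiE_iff)
      ultimately show "x \<in> j ` ({..<n} \<rightarrow>\<^sub>E C)" by blast
    qed
  qed
  have le': "{..<k} \<rightarrow>\<^sub>E H \<subseteq> {..<k} \<rightarrow>\<^sub>E K" for k :: nat using le by (intro PiE_mono) auto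
  have "len R S (pow_mod M (Suc n)) ({..<Suc n} \<rightarrow>\<^sub>E H) ({..<Suc n} \<rightarrow>\<^sub>E K)
     = len R S M H K + len R S (pow_mod M (Suc n)) (j ` ({..<n} \<rightarrow>\<^sub>E H)) (j ` ({..<n} \<rightarrow>\<^sub>E K))"
    using len_hom[OF Q.module_axioms M f subp[OF sub(1)] subp[OF sub(2)] le']
    unfolding im[OF sub(1)] im[OF sub(2)] ker[OF sub(1)] ker[OF sub(2)] .
  also have "\<dots> = len R S M H K + enat n * len R S M H K"
    using len_inj[OF P.module_axioms Q.module_axioms j inj subp[OF sub(1)] subp[OF sub(2)] le'] Suc.IH
    by simp
  also have "\<dots> = enat (Suc n) * len R S M H K"
    by (metis eSuc_enat mult_eSuc)
  finally show ?case .
qed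

end

section \<open>Noetherian rings\<close>

lemma primeideal_mult_notin:
  assumes "primeideal P R" "a \<in> carrier R" "b \<in> carrier R" "a \<notin> P" "b \<notin> P"
  shows "a \<otimes>\<^bsub>R\<^esub> b \<notin> P"
  using primeideal.I_prime[OF assms(1)] assms(2-5) by blast

section \<open>Ideals as submodules of the ring, and multiplicative sets\<close>

context cring
begin

interpretation S: module R "self_module R"
  by (rule module_self[OF is_cring])

text \<open>Bridge that makes lengths, images and preimages available for ideals.\<close>

lemma ideal_iff_submodule: "ideal I R \<longleftrightarrow> submodule I R (self_module R)"
proof
  assume "ideal I R"
  then interpret I: ideal I R .
  show "submodule I R (self_module R)"
    by (rule S.submoduleI) (use I.a_subset I.I_l_closed I.a_closed I.zero_closed I.a_inv_closed in auto)
next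
  assume s: "submodule I R (self_module R)"
  note E = S.submoduleE[OF s, simplified]
  have sub: "subgroup I (add_monoid R)"
    using E submodule_zero_mem[OF s] by unfold_locales (auto simp flip: a_inv_def)
  show "ideal I R"
  proof (rule idealI[OF ring_axioms sub])
    fix a x assume a: "a \<in> I" "x \<in> carrier R"
    show "x \<otimes> a \<in> I" using E(4) a by blast
    then show "a \<otimes> x \<in> I" using m_comm[of a x] a E(1) by auto
  qed
qed

lemma ideal_mem:
  assumes "ideal I R"
  shows "x \<in> I \<Longrightarrow> x \<in> carrier R" "\<zero> \<in> I" "x \<in> I \<Longrightarrow> y \<in> I \<Longrightarrow> x \<oplus> y \<in> I" "x \<in> I \<Longrightarrow> \<ominus> x \<in> I"
    "r \<in> carrier R \<Longrightarrow> x \<in> I \<Longrightarrow> r \<otimes> x \<in> I" "r \<in> carrier R \<Longrightarrow> x \<in> I \<Longrightarrow> x \<otimes> r \<in> I"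
proof -
  interpret I: ideal I R by fact
  show "x \<in> I \<Longrightarrow> x \<in> carrier R" "\<zero> \<in> I" "x \<in> I \<Longrightarrow> y \<in> I \<Longrightarrow> x \<oplus> y \<in> I" "x \<in> I \<Longrightarrow> \<ominus> x \<in> I"
    "r \<in> carrier R \<Longrightarrow> x \<in> I \<Longrightarrow> r \<otimes> x \<in> I" "r \<in> carrier R \<Longrightarrow> x \<in> I \<Longrightarrow> x \<otimes> r \<in> I"
    using I.a_subset I.I_l_closed I.I_r_closed I.a_closed I.zero_closed I.a_inv_closed by auto
qed

lemma ideal_adjoin:
  assumes "ideal I R" "a \<in> carrier R"
  defines "J \<equiv> {i \<oplus> (a \<otimes> r) | i r. i \<in> I \<and> r \<in> carrier R}"
  shows "ideal J R" "I \<subseteq> J" "a \<in> J"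
proof -
  have sa: "submodule ((\<lambda>r. a \<otimes> r) ` carrier R) R (self_module R)"
    using submodule_image[OF S.module_axioms S.module_axioms mod_hom_scale[OF S.module_axioms mod_hom_ident assms(2)] S.carrier_is_submodule]
    by simp
  have "J = {h \<oplus>\<^bsub>self_module R\<^esub> k | h k. h \<in> I \<and> k \<in> (\<lambda>r. a \<otimes> r) ` carrier R}"
    unfolding J_def by auto
  then show "ideal J R"
    using submodule_sum[OF S.module_axioms _ sa] assms(1) by (simp only: ideal_iff_submodule)
  show "I \<subseteq> J"
  proof
    fix i assume "i \<in> I"
    moreover from this have "i = i \<oplus> (a \<otimes> \<zero>)" using assms(2) ideal_mem(1)[OF assms(1)] by simp
    ultimately show "i \<in> J" unfolding J_def by blast
  qed
  have "a = \<zero> \<oplus> (a \<otimes> \<one>)" using assms(2) by simp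
  then show "a \<in> J" unfolding J_def using ideal_mem(2)[OF assms(1)] by blast
qed

lemma ideal_ann:
  assumes "x \<in> carrier R"
  shows "ideal {a \<in> carrier R. a \<otimes> x = \<zero>} R"
proof -
  have f: "(\<lambda>a. x \<otimes> a) \<in> mod_hom R (self_module R) (self_module R)"
    using mod_hom_scale[OF S.module_axioms mod_hom_ident assms] by simp
  have "{a \<in> carrier R. a \<otimes> x = \<zero>} = {a \<in> carrier (self_module R). x \<otimes> a = \<zero>\<^bsub>self_module R\<^esub>}"
    using assms by (auto simp: m_comm)
  then show ?thesis
    using submodule_kernel[OF S.module_axioms S.module_axioms f] by (simp only: ideal_iff_submodule)
qed

lemma mult_set_nonzerodivisors: "mult_set R (nonzerodivisors R)"
proof
  show "nonzerodivisors R \<subseteq> carrier R" "\<one> \<in> nonzerodivisors R"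
    by (auto simp: nonzerodivisors_def)
  fix s t assume "s \<in> nonzerodivisors R" "t \<in> nonzerodivisors R"
  then have st: "s \<in> carrier R" "t \<in> carrier R" "\<And>b. b \<in> carrier R \<Longrightarrow> s \<otimes> b = \<zero> \<Longrightarrow> b = \<zero>"
    "\<And>b. b \<in> carrier R \<Longrightarrow> t \<otimes> b = \<zero> \<Longrightarrow> b = \<zero>"
    unfolding nonzerodivisors_def by blast+
  have "b = \<zero>" if "b \<in> carrier R" "s \<otimes> t \<otimes> b = \<zero>" for b
    using st(3)[of "t \<otimes> b"] st(4)[of b] st(1,2) that by (simp add: m_assoc)
  then show "s \<otimes> t \<in> nonzerodivisors R"
    using st(1,2) by (simp add: nonzerodivisors_def)
qed

lemma mult_set_prime:
  assumes "primeideal P R"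
  shows "mult_set R (carrier R - P)"
proof
  interpret P: primeideal P R by fact
  show "\<one> \<in> carrier R - P"
    using P.I_notcarr P.one_imp_carrier by auto
  show "s \<otimes> t \<in> carrier R - P" if "s \<in> carrier R - P" "t \<in> carrier R - P" for s t
    using that P.I_prime by auto
qed auto

end

section \<open>The maximum condition and its consequences\<close>

locale noetherian_cring = cring R + noetherian_ring R for R :: "('a, 'r) ring_scheme" (structure)
begin

interpretation S: module R "self_module R"
  by (rule module_self[OF is_cring])

text \<open>A nonempty chain of ideals in a Noetherian ring contains its own union, so Zorn's lemma
  applies to an arbitrary predicate on ideals.\<close>

lemma ideal_maximal:
  assumes "A I\<^sub>0" "\<And>I. A I \<Longrightarrow> ideal I R"
  obtains I where "A I" "\<And>J. A J \<Longrightarrow> I \<subseteq> J \<Longrightarrow> J = I"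
proof -
  have "\<exists>M\<in>Collect A. \<forall>Z\<in>Collect A. M \<subseteq> Z \<longrightarrow> Z = M"
  proof (rule subset_Zorn_nonempty)
    fix C assume C: "C \<noteq> {}" "subset.chain (Collect A) C"
    then have "subset.chain {I. ideal I R} C" using assms(2) by (auto simp: pred_on.chain_def)
    from ideal_chain_is_trivial[OF C(1) this] show "\<Union>C \<in> Collect A"
      using C(2) by (auto simp: pred_on.chain_def)
  qed (use assms(1) in auto)
  then show ?thesis using that by blast
qed

text \<open>An ideal maximal among those that contain \<open>J\<close> and miss \<open>T\<close> is
  prime: adjoining either of two outside elements would meet \<open>T\<close>, and the product of
  the two meeting elements lies in \<open>T\<close> and, if the product of the outside elements is
  in \<open>Q\<close>, also in \<open>Q\<close>.\<close>

lemma prime_disjoint: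
  assumes T: "mult_set R T" and J: "ideal J R" "J \<inter> T = {}"
  obtains Q where "primeideal Q R" "J \<subseteq> Q" "Q \<inter> T = {}"
proof -
  interpret T: mult_set R T by fact
  define A where "A I \<longleftrightarrow> ideal I R \<and> J \<subseteq> I \<and> I \<inter> T = {}" for I
  have A: "A J" "\<And>I. A I \<Longrightarrow> ideal I R" using J by (auto simp: A_def)
  obtain Q where AQ: "A Q" and maxA: "\<And>I. A I \<Longrightarrow> Q \<subseteq> I \<Longrightarrow> I = Q"
    using ideal_maximal[of A, OF A] by blast
  have Q: "ideal Q R" "J \<subseteq> Q" "Q \<inter> T = {}" using AQ by (auto simp: A_def)
  note Qm = ideal_mem[OF Q(1)]
  have meet: "\<exists>q r. q \<in> Q \<and> r \<in> carrier R \<and> q \<oplus> (a \<otimes> r) \<in> T" if a: "a \<in> carrier R" "a \<notin> Q" for a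
  proof (rule ccontr)
    assume n: "\<not> ?thesis"
    note adj = ideal_adjoin[OF Q(1) a(1)]
    have "{i \<oplus> (a \<otimes> r) | i r. i \<in> Q \<and> r \<in> carrier R} \<inter> T = {}" using n by blast
    then have "A {i \<oplus> (a \<otimes> r) | i r. i \<in> Q \<and> r \<in> carrier R}"
      unfolding A_def using adj(1,2) Q(2) by (intro conjI) auto
    from maxA[OF this adj(2)] adj(3) a(2) show False by simp
  qed
  have "primeideal Q R"
  proof (rule primeidealI[OF Q(1) is_cring])
    show "carrier R \<noteq> Q" using Q(3) T.S_one by auto
    fix a b assume ab: "a \<in> carrier R" "b \<in> carrier R" "a \<otimes> b \<in> Q"
    show "a \<in> Q \<or> b \<in> Q"
    proof (rule ccontr)
      assume "\<not> (a \<in> Q \<or> b \<in> Q)"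
      then obtain q r q' r' where q: "q \<in> Q" "r \<in> carrier R" "q \<oplus> (a \<otimes> r) \<in> T" "q' \<in> Q" "r' \<in> carrier R" "q' \<oplus> (b \<otimes> r') \<in> T"
        using meet ab by meson
      have qc: "q \<in> carrier R" "q' \<in> carrier R" using q Qm(1) by auto
      have "(q \<oplus> (a \<otimes> r)) \<otimes> (q' \<oplus> (b \<otimes> r')) = (q' \<oplus> (b \<otimes> r')) \<otimes> q \<oplus> ((a \<otimes> r) \<otimes> q' \<oplus> (r \<otimes> r') \<otimes> (a \<otimes> b))"
        using qc q ab by algebra
      also have "\<dots> \<in> Q"
        using Qm(3)[OF Qm(5) Qm(3)[OF Qm(5) Qm(5)]] qc q ab T.SR by auto
      finally show False using T.S_mult[OF q(3,6)] Q(3) by blast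
    qed
  qed
  then show ?thesis using that Q by blast
qed

lemma proper_ideal_in_maximal:
  assumes "ideal I R" "I \<noteq> carrier R"
  obtains K where "maximalideal K R" "I \<subseteq> K"
proof -
  define A where "A J \<longleftrightarrow> ideal J R \<and> I \<subseteq> J \<and> J \<noteq> carrier R" for J
  have A: "A I" "\<And>J. A J \<Longrightarrow> ideal J R" using assms by (auto simp: A_def)
  obtain K where AK: "A K" and max: "\<And>J. A J \<Longrightarrow> K \<subseteq> J \<Longrightarrow> J = K"
    using ideal_maximal[of A, OF A] by blast
  have K: "ideal K R" "I \<subseteq> K" "K \<noteq> carrier R" using AK by (auto simp: A_def)
  have "maximalideal K R"
  proof (rule maximalidealI[OF K(1)])
    fix J assume "ideal J R" "K \<subseteq> J"
    then show "J = K \<or> J = carrier R" using max[of J] K(2) by (auto simp: A_def)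
  qed (use K(3) in auto)
  then show ?thesis using that K(2) by blast
qed

text \<open>The products of an element outside \<open>P\<close> with a non-zero-divisor form a
  multiplicative set without zero. A prime that misses it lies in \<open>P\<close>, so it equals
  \<open>P\<close> by minimality, and it contains no non-zero-divisor.\<close>

lemma minimal_prime_zero_divisors:
  assumes P: "primeideal P R" and min: "\<And>Q. primeideal Q R \<Longrightarrow> Q \<subseteq> P \<Longrightarrow> Q = P" and c: "c \<in> P"
  shows "c \<notin> nonzerodivisors R"
proof
  assume nz: "c \<in> nonzerodivisors R"
  interpret P: primeideal P R by fact
  interpret U: mult_set R "nonzerodivisors R" by (rule mult_set_nonzerodivisors)
  interpret V: mult_set R "carrier R - P" by (rule mult_set_prime[OF P])
  define T where "T = {s \<otimes> u | s u. s \<in> carrier R - P \<and> u \<in> nonzerodivisors R}"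
  have T: "mult_set R T"
  proof
    show "T \<subseteq> carrier R" unfolding T_def using U.S_subset by auto
    have "\<one> = \<one> \<otimes> \<one>" by simp
    then show "\<one> \<in> T" unfolding T_def using V.S_one U.S_one by blast
    fix x y assume "x \<in> T" "y \<in> T"
    then obtain s u t v where x: "x = s \<otimes> u" "s \<in> carrier R - P" "u \<in> nonzerodivisors R"
       "y = t \<otimes> v" "t \<in> carrier R - P" "v \<in> nonzerodivisors R" unfolding T_def by blast
    then have "x \<otimes> y = (s \<otimes> t) \<otimes> (u \<otimes> v)" using U.SR by (simp add: m_ac)
    then show "x \<otimes> y \<in> T" unfolding T_def using x V.S_mult U.S_mult by blast
  qed
  have "\<zero> \<notin> T"
  proof
    assume "\<zero> \<in> T"
    then obtain s u where su: "\<zero> = s \<otimes> u" "s \<in> carrier R - P" "u \<in> nonzerodivisors R" unfolding T_def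
      by blast
    then have "u \<otimes> s = \<zero>" using U.SR by (simp add: m_comm)
    then have "s = \<zero>" using su by (simp add: nonzerodivisors_def)
    then show False using su(2) P.zero_closed by blast
  qed
  then have z: "{\<zero>} \<inter> T = {}" by simp
  obtain Q where Q: "primeideal Q R" "Q \<inter> T = {}"
    using prime_disjoint[OF T zeroideal z] by blast
  interpret Q: primeideal Q R by (rule Q(1))
  have "Q \<subseteq> P"
  proof
    fix x assume x: "x \<in> Q"
    then have "x = x \<otimes> \<one>" using Q.a_subset by auto
    then show "x \<in> P" using x Q(2) Q.a_subset U.S_one unfolding T_def by blast
  qed
  then have "c \<in> Q" using min[OF Q(1)] c by simp
  moreover have "c = \<one> \<otimes> c" using c P.a_subset by auto
  then have "c \<in> T" unfolding T_def using V.S_one nz by blast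
  ultimately show False using Q(2) by blast
qed

text \<open>Noetherian induction replaces the theory of Artinian rings: take \<open>I\<close>
  maximal among the ideals over \<open>J\<close> of infinite colength at \<open>P\<close>. A prime
  \<open>I\<close> has colength at most one. If \<open>I\<close> is not prime, witnessed by
  \<open>a\<close> and \<open>b\<close>, then \<open>I\<close> plus \<open>(a)\<close> and the colon
  ideal of \<open>I\<close> by \<open>a\<close> are strictly larger, so both colengths are finite
  and they bound that of \<open>I\<close>.\<close>

lemma len_quotient_finite:
  assumes P: "primeideal P R" and J: "ideal J R"
    and only: "\<And>Q. primeideal Q R \<Longrightarrow> J \<subseteq> Q \<Longrightarrow> Q \<subseteq> P \<Longrightarrow> Q = P"
  shows "len R (carrier R - P) (self_module R) J (carrier R) < \<infinity>"
proof (rule ccontr)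
  let ?S = "carrier R - P" and ?M = "self_module R"
  interpret P: primeideal P R by fact
  interpret V: mult_set R ?S by (rule mult_set_prime[OF P])
  note car = S.carrier_is_submodule[simplified]
  assume "\<not> ?thesis"
  then have inf: "len R ?S ?M J (carrier R) = \<infinity>" by simp
  define A where "A I \<longleftrightarrow> ideal I R \<and> J \<subseteq> I \<and> len R ?S ?M I (carrier R) = \<infinity>" for I
  have A: "A J" "\<And>I. A I \<Longrightarrow> ideal I R" using J inf by (simp_all add: A_def)
  obtain I where AI: "A I" and maxA: "\<And>K. A K \<Longrightarrow> I \<subseteq> K \<Longrightarrow> K = I"
    using ideal_maximal[of A, OF A] by blast
  have I: "ideal I R" "J \<subseteq> I" "len R ?S ?M I (carrier R) = \<infinity>" using AI by (simp_all add: A_def)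
  have max: "K = I" if "ideal K R" "J \<subseteq> K" "len R ?S ?M K (carrier R) = \<infinity>" "I \<subseteq> K" for K
    using maxA[of K] that by (simp add: A_def)
  note Im = ideal_mem[OF I(1)]
  have sI: "submodule I R ?M" using I(1) by (simp add: ideal_iff_submodule)
  have IR: "I \<noteq> carrier R"
    using I(3) V.len_refl[OF S.module_axioms car] by auto
  show False
  proof (cases "primeideal I R")
    case prime: True
    \<comment> \<open>A big step can only start at a submodule that misses \<open>?S\<close>. Then
      \<open>I\<close> lies in \<open>P\<close>, so it equals \<open>P\<close> by
      \<open>only\<close>, and the step reaches an element outside \<open>P\<close>. Hence no second
      big step can follow.\<close>
    have "n \<le> 1 \<and> (n \<ge> 1 \<longrightarrow> K \<inter> ?S \<noteq> {})" if "tower R ?S ?M I K n" for K n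
      using that
    proof (induction rule: tower.induct)
      case (tower_Suc C n K)
      note C = tower_submodule[OF tower_Suc.hyps(1)]
      obtain x where x: "x \<in> K" "\<And>s. s \<in> ?S \<Longrightarrow> s \<otimes> x \<notin> C"
        using \<open>big _ _ C K\<close> by (auto simp: big_def)
      have xc: "x \<in> carrier R" using submodule_mem_carrier[OF tower_Suc.hyps(2) x(1)] by simp
      have "C \<inter> ?S = {}"
      proof (rule ccontr)
        assume "C \<inter> ?S \<noteq> {}"
        then obtain t where t: "t \<in> C" "t \<in> ?S" by blast
        then have "x \<otimes> t \<in> C" using ideal_mem(5)[of C x t] C(2) xc by (simp add: ideal_iff_submodule)
        then show False using x(2)[OF t(2)] xc t(2) by (simp add: m_comm)
      qed
      then have n: "n = 0" "I \<subseteq> P" using tower_Suc.IH C(3) Im(1) by auto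
      then have "I = P" using only[OF prime I(2)] by blast
      then have "x \<notin> P" using x(2)[OF V.S_one] xc C(3) by auto
      then show ?case using n(1) x(1) xc by auto
    qed auto
    then have "len R ?S ?M I (carrier R) \<le> enat 1"
      by (intro len_leI) auto
    then show False using I(3) by simp
  next
    case False
    then obtain a b where ab: "a \<in> carrier R" "b \<in> carrier R" "a \<otimes> b \<in> I" "a \<notin> I" "b \<notin> I"
      using primeidealI[OF I(1) is_cring] IR by blast
    define I' where "I' = {i \<oplus> (a \<otimes> r) | i r. i \<in> I \<and> r \<in> carrier R}"
    note adj = ideal_adjoin[OF I(1) ab(1), folded I'_def]
    have "J \<subseteq> I'" using adj(2) I(2) by blast
    then have f1: "len R ?S ?M I' (carrier R) \<noteq> \<infinity>"
      using max[OF adj(1)] adj(2,3) ab(4) by metis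
    \<comment> \<open>The colon ideal by \<open>a\<close>. Multiplication by \<open>a\<close> maps R
      onto \<open>I'\<close> modulo \<open>I\<close>, so pulling a tower from \<open>I\<close> to
      \<open>I'\<close> back along it gives a tower above \<open>\<delta> I\<close>.\<close>
    define \<delta> where "\<delta> C = {x \<in> carrier R. a \<otimes> x \<in> C}" for C
    have f: "(\<lambda>r. a \<otimes> r) \<in> mod_hom R ?M ?M"
      using mod_hom_scale[OF S.module_axioms mod_hom_ident ab(1)] by simp
    have sd: "submodule (\<delta> C) R ?M" if "submodule C R ?M" for C
      using submodule_vimage[OF S.module_axioms S.module_axioms f S.carrier_is_submodule that]
      by (simp add: \<delta>_def)
    have f2: "len R ?S ?M (\<delta> I) (carrier R) \<noteq> \<infinity>"
    proof
      assume inf: "len R ?S ?M (\<delta> I) (carrier R) = \<infinity>"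
      have "I \<subseteq> \<delta> I" using Im ab(1) by (auto simp: \<delta>_def)
      moreover have "ideal (\<delta> I) R" using sd[OF sI] by (simp add: ideal_iff_submodule)
      ultimately have "\<delta> I = I" using max[OF _ _ inf] I(2) by (metis subset_trans)
      moreover have "b \<in> \<delta> I" using ab by (simp add: \<delta>_def)
      ultimately show False using ab(5) by simp
    qed
    have "len R ?S ?M I I' \<le> len R ?S ?M (\<delta> I) (carrier R)"
    proof (rule len_leI)
      fix n assume t: "tower R ?S ?M I I' n"
      have "tower R ?S ?M (\<delta> I) (\<delta> I') n"
      proof (rule tower_map[OF t])
        fix C D assume C: "submodule C R ?M" "submodule D R ?M" "I \<subseteq> C" "C \<subseteq> D" "D \<subseteq> I'" and b: "big ?S ?M C D"
        have Ci: "ideal C R" "ideal D R" using C by (simp_all add: ideal_iff_submodule)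
        obtain x where x: "x \<in> D" "\<And>s. s \<in> ?S \<Longrightarrow> s \<otimes> x \<notin> C"
          using b by (auto simp: big_def)
        obtain i r where ir: "x = i \<oplus> (a \<otimes> r)" "i \<in> I" "r \<in> carrier R" using x(1) C(5) unfolding I'_def
          by blast
        have ic: "i \<in> carrier R" using Im(1) ir(2) .
        have "a \<otimes> r = x \<oplus> \<ominus> i" unfolding ir(1) using ic ir(3) ab(1) by algebra
        moreover have "x \<oplus> \<ominus> i \<in> D" using x(1) ir(2) C(3,4) by (intro ideal_mem(3,4)[OF Ci(2)]) auto
        ultimately have rD: "r \<in> \<delta> D" using ir(3) by (simp add: \<delta>_def)
        have "s \<otimes> r \<notin> \<delta> C" if s: "s \<in> ?S" for s
        proof
          assume "s \<otimes> r \<in> \<delta> C"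
          then have "a \<otimes> (s \<otimes> r) \<in> C" by (simp add: \<delta>_def)
          then have "s \<otimes> i \<oplus> a \<otimes> (s \<otimes> r) \<in> C"
            using s ir(2) C(3) ideal_mem(3)[OF Ci(1) ideal_mem(5)[OF Ci(1)]] by blast
          moreover have "s \<otimes> i \<oplus> a \<otimes> (s \<otimes> r) = s \<otimes> x"
            unfolding ir(1) using ic ir(3) ab(1) V.SR[OF s] by algebra
          ultimately show False using x(2)[OF s] by simp
        qed
        then show "big ?S ?M (\<delta> C) (\<delta> D)" using rD unfolding big_def by (intro bexI[of _ r]) auto
      qed (auto simp: \<delta>_def[symmetric] intro: sd, auto simp: \<delta>_def)
      then have "tower R ?S ?M (\<delta> I) (carrier R) n"
        by (rule tower_mono_right[OF _ car]) (auto simp: \<delta>_def)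
      then show "enat n \<le> len R ?S ?M (\<delta> I) (carrier R)" by (rule tower_le_len)
    qed
    then have "len R ?S ?M I I' \<noteq> \<infinity>" using f2 by (metis enat_ord_simps(4) order_le_less_trans)
    moreover have "len R ?S ?M I (carrier R) = len R ?S ?M I I' + len R ?S ?M I' (carrier R)"
      by (rule V.len_additive[OF S.module_axioms sI _ car adj(2)])
         (use adj(1) ideal_mem(1)[OF adj(1)] in \<open>auto simp: ideal_iff_submodule\<close>)
    ultimately show False using f1 I(3) by (metis plus_eq_infty_iff_enat)
  qed
qed

text \<open>Maximal annihilators of nonzero elements are prime, they cover the zero divisors, and
  there are finitely many of them. An ideal contained in none of them would, by prime avoidance,
  contain an element outside all of them, that is, a non-zero-divisor.\<close>

lemma ideal_in_associated_prime:
  assumes J: "ideal J R" "J \<inter> nonzerodivisors R = {}"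
  obtains P where "P \<in> ring_Ass R" "J \<subseteq> P"
proof -
  define ann where "ann x = {a \<in> carrier R. a \<otimes> x = \<zero>}" for x
  \<comment> \<open>The elements whose annihilator is maximal among annihilators of nonzero
    elements. Working with elements rather than with their annihilators lets finiteness come from a
    finite generating subset.\<close>
  define Z where "Z = {x \<in> carrier R. x \<noteq> \<zero> \<and> (\<forall>y\<in>carrier R. y \<noteq> \<zero> \<longrightarrow> ann x \<subseteq> ann y \<longrightarrow> ann y = ann x)}"
  have ann: "ideal (ann x) R" if "x \<in> carrier R" for x
    unfolding ann_def by (rule ideal_ann[OF that])
  have ex: "\<exists>x\<in>Z. ann y \<subseteq> ann x" if y: "y \<in> carrier R" "y \<noteq> \<zero>" for y
  proof -
    define A where "A I \<longleftrightarrow> (\<exists>z. I = ann z \<and> z \<in> carrier R \<and> z \<noteq> \<zero> \<and> ann y \<subseteq> ann z)" for I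
    have A: "A (ann y)" "\<And>I. A I \<Longrightarrow> ideal I R" using y ann by (auto simp: A_def)
    obtain I where I: "A I" "\<And>K. A K \<Longrightarrow> I \<subseteq> K \<Longrightarrow> K = I"
      using ideal_maximal[of A, OF A] by blast
    then obtain z where z: "I = ann z" "z \<in> carrier R" "z \<noteq> \<zero>" "ann y \<subseteq> ann z" by (auto simp: A_def)
    have "ann w = ann z" if "w \<in> carrier R" "w \<noteq> \<zero>" "ann z \<subseteq> ann w" for w
    proof -
      have "A (ann w)" using that z(4) by (auto simp: A_def)
      then show ?thesis using I(2)[of "ann w"] that z(1) by simp
    qed
    then have "z \<in> Z" using z by (auto simp: Z_def)
    then show ?thesis using z(4) by blast
  qed
  have prime: "primeideal (ann x) R" if x: "x \<in> Z" for x
  proof (rule primeidealI[OF ann is_cring])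
    show xc: "x \<in> carrier R" using x by (simp add: Z_def)
    have "\<one> \<notin> ann x" using x by (auto simp: Z_def ann_def)
    then show "carrier R \<noteq> ann x" by auto
    fix a b assume ab: "a \<in> carrier R" "b \<in> carrier R" "a \<otimes> b \<in> ann x"
    show "a \<in> ann x \<or> b \<in> ann x"
    proof (rule ccontr)
      assume n: "\<not> ?thesis"
      then have bx: "b \<otimes> x \<in> carrier R" "b \<otimes> x \<noteq> \<zero>" using ab xc by (auto simp: ann_def)
      have "c \<otimes> (b \<otimes> x) = b \<otimes> (c \<otimes> x)" if "c \<in> carrier R" for c
        using that ab xc by (simp add: m_lcomm)
      then have "ann x \<subseteq> ann (b \<otimes> x)" using ab xc by (auto simp: ann_def)
      then have "ann (b \<otimes> x) = ann x" using x bx by (auto simp: Z_def)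
      moreover have "a \<in> ann (b \<otimes> x)" using ab xc by (auto simp: ann_def m_assoc)
      ultimately show False using n by blast
    qed
  qed
  have Ass: "ann x \<in> ring_Ass R" if "x \<in> Z" for x
    using prime[OF that] that unfolding ring_Ass_def ann_def Z_def by blast
  have anti: "ann x = ann y" if "x \<in> Z" "y \<in> Z" "ann x \<subseteq> ann y" for x y
    using that by (auto simp: Z_def)
  have ZR: "Z \<subseteq> carrier R" by (auto simp: Z_def)
  \<comment> \<open>An ideal maximal among those generated by finite subsets of \<open>Z\<close>
    already contains all of \<open>Z\<close>.\<close>
  obtain F where F: "finite F" "F \<subseteq> Z" "Z \<subseteq> Idl F"
  proof -
    define A where "A I \<longleftrightarrow> (\<exists>F. I = Idl F \<and> finite F \<and> F \<subseteq> Z)" for I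
    have A: "A (Idl {})" "\<And>I. A I \<Longrightarrow> ideal I R"
      using genideal_ideal ZR by (auto simp: A_def)
    obtain I where I: "A I" "\<And>K. A K \<Longrightarrow> I \<subseteq> K \<Longrightarrow> K = I"
      using ideal_maximal[of A, OF A] by blast
    then obtain F where F: "I = Idl F" "finite F" "F \<subseteq> Z" by (auto simp: A_def)
    have "x \<in> Idl F" if "x \<in> Z" for x
    proof -
      have sub: "insert x F \<subseteq> carrier R" using that F ZR by blast
      have "A (Idl (insert x F))" unfolding A_def using F that by blast
      moreover have "I \<subseteq> Idl (insert x F)"
        unfolding F(1) using genideal_self[OF sub]
        by (intro genideal_minimal genideal_ideal[OF sub]) auto
      ultimately have "Idl (insert x F) = I" using I(2) by blast
      then show ?thesis using genideal_self[OF sub] F(1) by blast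
    qed
    then show ?thesis using that F by blast
  qed
  \<comment> \<open>Finiteness of the set of maximal annihilators. If \<open>ann x\<close> differed
    from all \<open>ann y\<close> with \<open>y\<close> in \<open>F\<close>, a product of elements
    of the latter would stay outside the prime \<open>ann x\<close>; but it kills \<open>F\<close>,
    hence the ideal generated by \<open>F\<close>, hence \<open>x\<close>.\<close>
  have cover: "\<exists>y\<in>F. ann x = ann y" if x: "x \<in> Z" for x
  proof (rule ccontr)
    assume n: "\<not> ?thesis"
    have "\<exists>a\<in>carrier R. a \<notin> ann x \<and> (\<forall>y\<in>G. a \<in> ann y)" if "finite G" "G \<subseteq> F" for G
      using that
    proof (induction G rule: finite_induct)
      case empty
      show ?case using primeideal.axioms(1)[OF prime[OF x]] primeideal.I_notcarr[OF prime[OF x]] ideal_mem(1)[OF ann] x ZR by blast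
    next
      case (insert y G)
      then obtain a where a: "a \<in> carrier R" "a \<notin> ann x" "\<forall>y\<in>G. a \<in> ann y" by auto
      have yZ: "y \<in> Z" using insert.prems F(2) by blast
      then have "\<not> ann y \<subseteq> ann x" using anti[OF yZ x] n insert.prems by auto
      then obtain b where b: "b \<in> ann y" "b \<notin> ann x" by blast
      have bc: "b \<in> carrier R" using b(1) by (simp add: ann_def)
      have "a \<otimes> b \<notin> ann x" using primeideal_mult_notin[OF prime[OF x] a(1) bc a(2) b(2)] .
      moreover have "a \<otimes> b \<in> ann y" using ideal_mem(5)[OF ann a(1) b(1)] yZ ZR by blast
      moreover have "a \<otimes> b \<in> ann z" if "z \<in> G" for z
        using ideal_mem(6)[OF ann bc, of z a] a(3) that insert.prems F(2) ZR by blast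
      ultimately show ?case using a(1) bc by blast
    qed
    from this[OF F(1)] obtain a where a: "a \<in> carrier R" "a \<notin> ann x" "\<forall>y\<in>F. a \<in> ann y" by blast
    have "F \<subseteq> {b \<in> carrier R. b \<otimes> a = \<zero>}"
      using a F(2) ZR by (auto simp: ann_def m_comm subset_iff)
    then have "Idl F \<subseteq> {b \<in> carrier R. b \<otimes> a = \<zero>}"
      by (rule genideal_minimal[OF ideal_ann[OF a(1)]])
    then show False using F(3) x a ZR by (auto simp: ann_def m_comm subset_iff)
  qed
  show ?thesis
  proof (rule ccontr)
    assume nthesis: "\<not> thesis"
    then have nsub: "\<not> J \<subseteq> ann x" if "x \<in> Z" for x using that Ass \<open>\<And>P. P \<in> ring_Ass R \<Longrightarrow> J \<subseteq> P \<Longrightarrow> thesis\<close>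
      by blast
    \<comment> \<open>Prime avoidance, one prime at a time: if the current element falls into the
      new prime, it is corrected by an element of \<open>J\<close> that lies in all earlier primes
      but not in the new one.\<close>
    have "\<exists>a\<in>J. \<forall>y\<in>G. a \<notin> ann y" if "finite G" "G \<subseteq> F" for G
      using that
    proof (induction G rule: finite_induct)
      case empty
      then show ?case using ideal_mem(2)[OF J(1)] by blast
    next
      case (insert x G)
      then obtain a where a: "a \<in> J" "\<forall>y\<in>G. a \<notin> ann y" by auto
      have xZ: "x \<in> Z" using insert.prems F(2) by blast
      show ?case
      \<comment> \<open>Different elements of \<open>F\<close> may have the same annihilator, in
        which case the new prime is already avoided.\<close>
      proof (cases "a \<in> ann x \<and> (\<forall>y\<in>G. ann y \<noteq> ann x)")
        case False
        then show ?thesis using a by (metis insert_iff)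
      next
        case True
        have "\<exists>b\<in>J. b \<notin> ann x \<and> (\<forall>y\<in>G'. b \<in> ann y)" if "finite G'" "G' \<subseteq> G" for G'
          using that
        proof (induction G' rule: finite_induct)
          case empty
          then show ?case using nsub[OF xZ] by blast
        next
          case (insert y G')
          then obtain b where b: "b \<in> J" "b \<notin> ann x" "\<forall>y\<in>G'. b \<in> ann y" by auto
          have yZ: "y \<in> Z" using insert.prems \<open>insert x G \<subseteq> F\<close> F(2) by blast
          have "\<not> ann y \<subseteq> ann x" using anti[OF yZ xZ] True insert.prems by auto
          then obtain c where c: "c \<in> ann y" "c \<notin> ann x" by blast
          have cc: "c \<in> carrier R" using c(1) by (simp add: ann_def)
          have bc: "b \<in> carrier R" using ideal_mem(1)[OF J(1) b(1)] .
          have "b \<otimes> c \<notin> ann x" using primeideal_mult_notin[OF prime[OF xZ] bc cc b(2) c(2)] .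
          moreover have "b \<otimes> c \<in> ann y" using ideal_mem(5)[OF ann bc c(1)] yZ ZR by blast
          moreover have "b \<otimes> c \<in> ann z" if "z \<in> G'" for z
            using ideal_mem(6)[OF ann cc, of z b] b(3) that insert.prems \<open>insert x G \<subseteq> F\<close> F(2) ZR
            by blast
          moreover have "b \<otimes> c \<in> J" using ideal_mem(6)[OF J(1) cc b(1)] .
          ultimately show ?case by blast
        qed
        from this[OF insert.hyps(1)] obtain b where b: "b \<in> J" "b \<notin> ann x" "\<forall>y\<in>G. b \<in> ann y" by blast
        have c: "a \<in> carrier R" "b \<in> carrier R" using ideal_mem(1)[OF J(1)] a b by auto
        have diff1: "b = (a \<oplus> b) \<oplus> \<ominus> a" and diff2: "a = (a \<oplus> b) \<oplus> \<ominus> b" using c by algebra+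
        have "a \<oplus> b \<notin> ann x"
        proof
          assume "a \<oplus> b \<in> ann x"
          then have "(a \<oplus> b) \<oplus> \<ominus> a \<in> ann x"
            using True ideal_mem(3,4)[OF ann] xZ ZR by blast
          then show False using b(2) diff1 by simp
        qed
        moreover have "a \<oplus> b \<notin> ann y" if "y \<in> G" for y
        proof
          assume "a \<oplus> b \<in> ann y"
          moreover have "y \<in> carrier R" using that insert.prems F(2) ZR by blast
          ultimately have "(a \<oplus> b) \<oplus> \<ominus> b \<in> ann y"
            using b(3) that ideal_mem(3,4)[OF ann] by blast
          then show False using a(2) that diff2 by simp
        qed
        moreover have "a \<oplus> b \<in> J" using ideal_mem(3)[OF J(1) a(1) b(1)] .
        ultimately show ?thesis by blast
      qed
    qed
    from this[OF F(1)] obtain a where a: "a \<in> J" "\<forall>y\<in>F. a \<notin> ann y" by blast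
    have ac: "a \<in> carrier R" using ideal_mem(1)[OF J(1) a(1)] .
    have "a \<notin> nonzerodivisors R" using J(2) a(1) by blast
    then obtain b where b: "b \<in> carrier R" "b \<noteq> \<zero>" "a \<otimes> b = \<zero>" using ac
      by (auto simp: nonzerodivisors_def)
    then obtain x where "x \<in> Z" "ann b \<subseteq> ann x" using ex by blast
    then obtain y where "y \<in> F" "ann b \<subseteq> ann y" using cover by metis
    moreover have "a \<in> ann b" using b ac by (simp add: ann_def)
    ultimately show False using a(2) by blast
  qed
qed

end

section \<open>One-dimensional local rings\<close>

locale dim_one_local = noetherian_cring R for R :: "('a, 'r) ring_scheme" (structure) +
  assumes loc: "local_ring R" and dim: "krull_dim R = 1"
begin

lemma no_chain_three:
  assumes "primeideal P R" "primeideal P' R" "primeideal P'' R" "P \<subset> P'" "P' \<subset> P''"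
  shows False
proof -
  define C where "C i = (if i = 0 then P else if i = 1 then P' else P'')" for i :: nat
  have "\<forall>i\<le>2. primeideal (C i) R" using assms by (auto simp: C_def)
  moreover have "\<forall>i<2. C i \<subset> C (Suc i)"
    using assms by (auto simp: C_def less_2_cases_iff)
  ultimately have "enat 2 \<le> krull_dim R"
    unfolding krull_dim_def by (intro Sup_upper) blast
  then show False by (simp add: dim one_enat_def)
qed

text \<open>Positive dimension provides a proper inclusion of primes; its lower member is minimal,
  since a smaller prime would give a chain of three.\<close>

lemma minimal_prime_exists:
  obtains P where "primeideal P R" "\<And>Q. primeideal Q R \<Longrightarrow> Q \<subseteq> P \<Longrightarrow> Q = P"
proof -
  let ?A = "{enat n | n. \<exists>P :: nat \<Rightarrow> 'a set. (\<forall>i\<le>n. primeideal (P i) R) \<and> (\<forall>i<n. P i \<subset> P (Suc i))}"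
  have "\<not> (\<forall>a\<in>?A. a \<le> 0)"
  proof
    assume "\<forall>a\<in>?A. a \<le> 0"
    then have "Sup ?A \<le> 0" by (intro Sup_least) blast
    then show False using dim by (simp add: krull_dim_def)
  qed
  then obtain n P where P: "\<forall>i\<le>n. primeideal (P i) R" "\<forall>i<n. P i \<subset> P (Suc i)" "\<not> enat n \<le> 0"
    by auto
  then have "n \<noteq> 0" by (auto simp: zero_enat_def)
  then have p: "primeideal (P 0) R" "primeideal (P (Suc 0)) R" "P 0 \<subset> P (Suc 0)" using P by auto
  show ?thesis
  proof (rule that[OF p(1)])
    fix Q assume "primeideal Q R" "Q \<subseteq> P 0"
    then show "Q = P 0" using no_chain_three[OF _ p(1,2) _ p(3)] by blast
  qed
qed

text \<open>The third property holds because a prime properly inside \<open>m\<close> is minimal in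
  dimension one, and minimal primes consist of zero divisors.\<close>

lemma local_maximal:
  obtains m where "primeideal m R" "\<And>I. ideal I R \<Longrightarrow> I \<noteq> carrier R \<Longrightarrow> I \<subseteq> m"
    "\<And>Q c. primeideal Q R \<Longrightarrow> c \<in> Q \<Longrightarrow> c \<in> nonzerodivisors R \<Longrightarrow> Q = m"
proof -
  obtain m where m: "maximalideal m R" and un: "\<And>I. maximalideal I R \<Longrightarrow> I = m"
    using loc unfolding local_ring_def by blast
  have pm: "primeideal m R" by (rule maximalideal_prime[OF m])
  have cont: "I \<subseteq> m" if "ideal I R" "I \<noteq> carrier R" for I
    using proper_ideal_in_maximal[OF that] un by metis
  have "Q = m" if Q: "primeideal Q R" "c \<in> Q" "c \<in> nonzerodivisors R" for Q c
  proof (rule ccontr)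
    assume "Q \<noteq> m"
    then have "Q \<subset> m"
      using cont[OF primeideal.axioms(1)[OF Q(1)]] primeideal.I_notcarr[OF Q(1)] by blast
    then have "Q' = Q" if "primeideal Q' R" "Q' \<subseteq> Q" for Q'
      using no_chain_three[OF that(1) Q(1) pm] that(2) by blast
    then show False using minimal_prime_zero_divisors[OF Q(1) _ Q(2)] Q(3) by blast
  qed
  then show ?thesis using that pm cont by blast
qed

end

section \<open>Comparison of resolutions\<close>

lemma
  assumes "free_resolution R M n d \<epsilon>"
  shows resolution_eps: "\<epsilon> \<in> mod_hom R (free_mod R (n 0)) M"
    and resolution_hom: "d k \<in> mod_hom R (free_mod R (n (Suc k))) (free_mod R (n k))"
    and resolution_surj: "\<epsilon> ` carrier (free_mod R (n 0)) = carrier M"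
    and resolution_eps_zero: "x \<in> carrier (free_mod R (n 1)) \<Longrightarrow> \<epsilon> (d 0 x) = \<zero>\<^bsub>M\<^esub>"
    and resolution_eps_exact: "y \<in> carrier (free_mod R (n 0)) \<Longrightarrow> \<epsilon> y = \<zero>\<^bsub>M\<^esub> \<Longrightarrow> y \<in> d 0 ` carrier (free_mod R (n 1))"
    and resolution_zero: "z \<in> carrier (free_mod R (n (Suc (Suc k)))) \<Longrightarrow> d k (d (Suc k) z) = \<zero>\<^bsub>free_mod R (n k)\<^esub>"
    and resolution_exact: "w \<in> carrier (free_mod R (n (Suc k))) \<Longrightarrow> d k w = \<zero>\<^bsub>free_mod R (n k)\<^esub>
        \<Longrightarrow> w \<in> d (Suc k) ` carrier (free_mod R (n (Suc (Suc k))))"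
  using assms unfolding free_resolution_def a_kernel_def' by blast+

text \<open>Degreewise lifting through the second resolution, started over the identity of
  M.\<close>

lemma chain_map_exists:
  assumes M: "module R M" and F: "free_resolution R M n d \<epsilon>" and G: "free_resolution R M p e \<eta>"
  obtains f where "\<And>k. f k \<in> mod_hom R (free_mod R (n k)) (free_mod R (p k))"
    "\<And>x. x \<in> carrier (free_mod R (n 0)) \<Longrightarrow> \<eta> (f 0 x) = \<epsilon> x"
    "\<And>k x. x \<in> carrier (free_mod R (n (Suc k))) \<Longrightarrow> e k (f (Suc k) x) = f k (d k x)"
proof -
  interpret M: module R M by fact
  note FM = module_free_mod[OF M.is_cring]
  \<comment> \<open>The second clause is exactly the containment of images required for the lifting
    in the next degree; the third records compatibility with the augmentations in degree zero.
    \<open>Q\<close> ties successive degrees together.\<close>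
  define P where "P k g \<longleftrightarrow> g \<in> mod_hom R (free_mod R (n k)) (free_mod R (p k))
     \<and> (\<forall>x\<in>carrier (free_mod R (n (Suc k))). g (d k x) \<in> e k ` carrier (free_mod R (p (Suc k))))
     \<and> (k = 0 \<longrightarrow> (\<forall>x\<in>carrier (free_mod R (n 0)). \<eta> (g x) = \<epsilon> x))" for k g
  define Q where "Q k g g' \<longleftrightarrow> (\<forall>x\<in>carrier (free_mod R (n (Suc k))). e k (g' x) = g (d k x))"
    for k and g g' :: "(nat \<Rightarrow> 'a) \<Rightarrow> nat \<Rightarrow> 'a"
  have "\<exists>f. \<forall>k. P k (f k) \<and> Q k (f k) (f (Suc k))"
  proof (rule dependent_nat_choice)
    obtain g where g: "g \<in> mod_hom R (free_mod R (n 0)) (free_mod R (p 0))"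
      "\<And>x. x \<in> carrier (free_mod R (n 0)) \<Longrightarrow> \<eta> (g x) = \<epsilon> x"
      by (rule free_mod_lift[OF FM M resolution_eps[OF F] resolution_eps[OF G]])
         (use resolution_surj[OF F] resolution_surj[OF G] in auto)
    have "g (d 0 x) \<in> e 0 ` carrier (free_mod R (p (Suc 0)))"
      if x: "x \<in> carrier (free_mod R (n (Suc 0)))" for x
    proof -
      have dx: "d 0 x \<in> carrier (free_mod R (n 0))" by (rule mod_hom_closed[OF resolution_hom[OF F] x])
      have "\<eta> (g (d 0 x)) = \<zero>\<^bsub>M\<^esub>" using g(2)[OF dx] resolution_eps_zero[OF F, of x] x by simp
      then show ?thesis using resolution_eps_exact[OF G mod_hom_closed[OF g(1) dx]] by simp
    qed
    then show "\<exists>g. P 0 g" using g unfolding P_def by blast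
  next
    fix g k assume P: "P k g"
    then have g: "g \<in> mod_hom R (free_mod R (n k)) (free_mod R (p k))" by (simp add: P_def)
    obtain g' where g': "g' \<in> mod_hom R (free_mod R (n (Suc k))) (free_mod R (p (Suc k)))"
      "\<And>x. x \<in> carrier (free_mod R (n (Suc k))) \<Longrightarrow> e k (g' x) = g (d k x)"
      by (rule free_mod_lift[OF FM FM mod_hom_comp[OF g resolution_hom[OF F]] resolution_hom[OF G]])
         (use P in \<open>auto simp: P_def\<close>)
    have "g' (d (Suc k) x) \<in> e (Suc k) ` carrier (free_mod R (p (Suc (Suc k))))"
      if x: "x \<in> carrier (free_mod R (n (Suc (Suc k))))" for x
    proof -
      have dx: "d (Suc k) x \<in> carrier (free_mod R (n (Suc k)))"
        by (rule mod_hom_closed[OF resolution_hom[OF F] x])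
      have "e k (g' (d (Suc k) x)) = \<zero>\<^bsub>free_mod R (p k)\<^esub>"
        using g'(2)[OF dx] resolution_zero[OF F x] mod_hom_zero[OF FM FM g] by simp
      then show ?thesis using resolution_exact[OF G mod_hom_closed[OF g'(1) dx]] by simp
    qed
    then have "P (Suc k) g'" using g' unfolding P_def by blast
    moreover have "Q k g g'" using g'(2) unfolding Q_def by blast
    ultimately show "\<exists>g'. P (Suc k) g' \<and> Q k g g'" by blast
  qed
  then obtain f where f: "\<And>k. P k (f k)" "\<And>k. Q k (f k) (f (Suc k))" by blast
  show ?thesis
  proof (rule that[of f])
    show "f k \<in> mod_hom R (free_mod R (n k)) (free_mod R (p k))" for k using f(1)[of k]
      by (simp add: P_def)
    show "\<eta> (f 0 x) = \<epsilon> x" if "x \<in> carrier (free_mod R (n 0))" for x using f(1)[of 0] that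
      by (simp add: P_def)
    show "e k (f (Suc k) x) = f k (d k x)" if "x \<in> carrier (free_mod R (n (Suc k)))" for k x
      using f(2)[of k] that by (simp add: Q_def)
  qed
qed

lemma (in abelian_group) diff_add_cancel: "x \<in> carrier G \<Longrightarrow> y \<in> carrier G \<Longrightarrow> (x \<ominus> y) \<oplus> y = x"
  by (simp add: a_minus_def a_assoc l_neg)

text \<open>A chain endomorphism \<open>u\<close> that induces zero on M is null-homotopic. The
  homotopy identity is stated in the degrees \<open>Suc k\<close>, where exactness is going to be
  transferred.\<close>

lemma homotopy_exists:
  assumes M: "module R M" and F: "free_resolution R M n d \<epsilon>"
    and u: "\<And>k. u k \<in> mod_hom R (free_mod R (n k)) (free_mod R (n k))"
    and ud: "\<And>k x. x \<in> carrier (free_mod R (n (Suc k))) \<Longrightarrow> d k (u (Suc k) x) = u k (d k x)"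
    and u0: "\<And>x. x \<in> carrier (free_mod R (n 0)) \<Longrightarrow> \<epsilon> (u 0 x) = \<zero>\<^bsub>M\<^esub>"
  obtains h where "\<And>k. h k \<in> mod_hom R (free_mod R (n k)) (free_mod R (n (Suc k)))"
    "\<And>k x. x \<in> carrier (free_mod R (n (Suc k))) \<Longrightarrow>
       u (Suc k) x = d (Suc k) (h (Suc k) x) \<oplus>\<^bsub>free_mod R (n (Suc k))\<^esub> h k (d k x)"
proof -
  interpret M: module R M by fact
  note FM = module_free_mod[OF M.is_cring]
  note d = resolution_hom[OF F]
  \<comment> \<open>\<open>u k\<close> and \<open>d k\<close> after \<open>g\<close> agree on
    boundaries, so that \<open>u (Suc k)\<close> minus \<open>g\<close> after \<open>d k\<close>
    takes values in cycles and can be lifted.\<close>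
  define P where "P k g \<longleftrightarrow> g \<in> mod_hom R (free_mod R (n k)) (free_mod R (n (Suc k)))
     \<and> (\<forall>x\<in>carrier (free_mod R (n (Suc k))). d k (g (d k x)) = u k (d k x))" for k g
  define Q where "Q k g g' \<longleftrightarrow> (\<forall>x\<in>carrier (free_mod R (n (Suc k))).
     d (Suc k) (g' x) = u (Suc k) x \<ominus>\<^bsub>free_mod R (n (Suc k))\<^esub> g (d k x))" for k g g'
  have "\<exists>f. \<forall>k. P k (f k) \<and> Q k (f k) (f (Suc k))"
  proof (rule dependent_nat_choice)
    obtain g where g: "g \<in> mod_hom R (free_mod R (n 0)) (free_mod R (n 1))"
      "\<And>x. x \<in> carrier (free_mod R (n 0)) \<Longrightarrow> d 0 (g x) = u 0 x"
    proof (rule free_mod_lift[OF FM FM u[of 0] d[of 0]])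
      show "u 0 ` carrier (free_mod R (n 0)) \<subseteq> d 0 ` carrier (free_mod R (n (Suc 0)))"
        using resolution_eps_exact[OF F mod_hom_closed[OF u[of 0]] u0] by auto
    qed auto
    then show "\<exists>g. P 0 g" unfolding P_def using mod_hom_closed[OF d[of 0]] by auto
  next
    fix g k assume P: "P k g"
    then have g: "g \<in> mod_hom R (free_mod R (n k)) (free_mod R (n (Suc k)))" by (simp add: P_def)
    interpret Fk: module R "free_mod R (n k)" by (rule FM)
    interpret Fk1: module R "free_mod R (n (Suc k))" by (rule FM)
    let ?w = "\<lambda>x. u (Suc k) x \<ominus>\<^bsub>free_mod R (n (Suc k))\<^esub> g (d k x)"
    have w: "?w \<in> mod_hom R (free_mod R (n (Suc k))) (free_mod R (n (Suc k)))"
      by (rule mod_hom_diff[OF FM u mod_hom_comp[OF g d]])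
    obtain g' where g': "g' \<in> mod_hom R (free_mod R (n (Suc k))) (free_mod R (n (Suc (Suc k))))"
      "\<And>x. x \<in> carrier (free_mod R (n (Suc k))) \<Longrightarrow> d (Suc k) (g' x) = ?w x"
    proof (rule free_mod_lift[OF FM FM w d[of "Suc k"]])
      show "?w ` carrier (free_mod R (n (Suc k))) \<subseteq> d (Suc k) ` carrier (free_mod R (n (Suc (Suc k))))"
      proof
        fix z assume "z \<in> ?w ` carrier (free_mod R (n (Suc k)))"
        then obtain x where x: "x \<in> carrier (free_mod R (n (Suc k)))" "z = ?w x" by auto
        have dx: "d k x \<in> carrier (free_mod R (n k))" by (rule mod_hom_closed[OF d x(1)])
        have "d k z = d k (u (Suc k) x) \<ominus>\<^bsub>free_mod R (n k)\<^esub> d k (g (d k x))"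
          unfolding x(2)
          by (rule mod_hom_minus[OF FM FM d mod_hom_closed[OF u x(1)] mod_hom_closed[OF g dx]])
        also have "\<dots> = \<zero>\<^bsub>free_mod R (n k)\<^esub>"
          using P x(1) ud[OF x(1)] mod_hom_closed[OF u dx] by (simp add: P_def a_minus_def Fk.M.r_neg)
        finally show "z \<in> d (Suc k) ` carrier (free_mod R (n (Suc (Suc k))))"
          using resolution_exact[OF F] x mod_hom_closed[OF w x(1)] by simp
      qed
    qed auto
    have "d (Suc k) (g' (d (Suc k) x)) = u (Suc k) (d (Suc k) x)"
      if x: "x \<in> carrier (free_mod R (n (Suc (Suc k))))" for x
    proof -
      have dx: "d (Suc k) x \<in> carrier (free_mod R (n (Suc k)))" by (rule mod_hom_closed[OF d x])
      have "g (d k (d (Suc k) x)) = \<zero>\<^bsub>free_mod R (n (Suc k))\<^esub>"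
        using resolution_zero[OF F x] mod_hom_zero[OF FM FM g] by simp
      then show ?thesis
        unfolding g'(2)[OF dx] using mod_hom_closed[OF u dx] Fk1.M.diff_add_cancel[OF mod_hom_closed[OF u dx] Fk1.M.zero_closed]
        by (simp add: a_minus_def)
    qed
    then show "\<exists>g'. P (Suc k) g' \<and> Q k g g'" using g' unfolding P_def Q_def by blast
  qed
  then obtain f where f: "\<And>k. P k (f k)" "\<And>k. Q k (f k) (f (Suc k))" by blast
  show ?thesis
  proof (rule that[of f])
    show h: "f k \<in> mod_hom R (free_mod R (n k)) (free_mod R (n (Suc k)))" for k using f(1)[of k]
      by (simp add: P_def)
    fix k x assume x: "x \<in> carrier (free_mod R (n (Suc k)))"
    interpret Fk1: module R "free_mod R (n (Suc k))" by (rule FM)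
    have "d (Suc k) (f (Suc k) x) = u (Suc k) x \<ominus>\<^bsub>free_mod R (n (Suc k))\<^esub> f k (d k x)"
      using f(2)[of k] x by (simp add: Q_def)
    then show "u (Suc k) x = d (Suc k) (f (Suc k) x) \<oplus>\<^bsub>free_mod R (n (Suc k))\<^esub> f k (d k x)"
      using Fk1.M.diff_add_cancel[OF mod_hom_closed[OF u x] mod_hom_closed[OF h mod_hom_closed[OF d x]]]
      by simp
  qed
qed

text \<open>The two resolutions are homotopy equivalent, and \<open>hom_ext\<close> preserves sums
  and composites. A cycle \<open>y\<close> is the sum of \<open>d h y\<close>, \<open>h d y\<close>
  and \<open>g f y\<close>: the first is a boundary, the second vanishes, and the third is a
  boundary because the other complex is exact at \<open>f y\<close>.\<close>

lemma resolution_exactness_transfer: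
  assumes M: "module R M" and N: "module R N" and F: "free_resolution R M n d \<epsilon>" and G: "free_resolution R M p e \<eta>"
    and ex: "\<And>k. exact_at R N (p k) (p (Suc k)) (p (Suc (Suc k))) (e k) (e (Suc k))"
  shows "exact_at R N (n k) (n (Suc k)) (n (Suc (Suc k))) (d k) (d (Suc k))"
proof -
  interpret M: module R M by fact
  interpret N: module R N by fact
  note FM = module_free_mod[OF M.is_cring]
  note d = resolution_hom[OF F] and e = resolution_hom[OF G]
  obtain f where f: "\<And>k. f k \<in> mod_hom R (free_mod R (n k)) (free_mod R (p k))"
    "\<And>x. x \<in> carrier (free_mod R (n 0)) \<Longrightarrow> \<eta> (f 0 x) = \<epsilon> x"
    "\<And>k x. x \<in> carrier (free_mod R (n (Suc k))) \<Longrightarrow> e k (f (Suc k) x) = f k (d k x)"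
    using chain_map_exists[OF M F G] by blast
  obtain g where g: "\<And>k. g k \<in> mod_hom R (free_mod R (p k)) (free_mod R (n k))"
    "\<And>x. x \<in> carrier (free_mod R (p 0)) \<Longrightarrow> \<epsilon> (g 0 x) = \<eta> x"
    "\<And>k x. x \<in> carrier (free_mod R (p (Suc k))) \<Longrightarrow> d k (g (Suc k) x) = g k (e k x)"
    using chain_map_exists[OF M G F] by blast
  define u where "u k x = x \<ominus>\<^bsub>free_mod R (n k)\<^esub> g k (f k x)" for k x
  have u: "u k \<in> mod_hom R (free_mod R (n k)) (free_mod R (n k))" for k
    unfolding u_def by (rule mod_hom_diff[OF FM mod_hom_ident mod_hom_comp[OF g(1) f(1)]])
  have gf: "g k (f k x) \<in> carrier (free_mod R (n k))" if "x \<in> carrier (free_mod R (n k))" for k x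
    by (rule mod_hom_closed[OF g(1) mod_hom_closed[OF f(1) that]])
  have ud: "d k (u (Suc k) x) = u k (d k x)" if x: "x \<in> carrier (free_mod R (n (Suc k)))" for k x
    unfolding u_def
    using mod_hom_minus[OF FM FM d x gf[OF x]] g(3)[OF mod_hom_closed[OF f(1) x]] f(3)[OF x] by simp
  have u0: "\<epsilon> (u 0 x) = \<zero>\<^bsub>M\<^esub>" if x: "x \<in> carrier (free_mod R (n 0))" for x
    unfolding u_def
    using mod_hom_minus[OF FM M resolution_eps[OF F] x gf[OF x]] g(2)[OF mod_hom_closed[OF f(1) x]] f(2)[OF x]
      mod_hom_closed[OF resolution_eps[OF F] x]
    by (simp add: a_minus_def M.M.r_neg)
  obtain h where h: "\<And>k. h k \<in> mod_hom R (free_mod R (n k)) (free_mod R (n (Suc k)))"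
    "\<And>k x. x \<in> carrier (free_mod R (n (Suc k))) \<Longrightarrow>
       u (Suc k) x = d (Suc k) (h (Suc k) x) \<oplus>\<^bsub>free_mod R (n (Suc k))\<^esub> h k (d k x)"
    using homotopy_exists[OF M F u ud u0] by blast
  let ?d = "\<lambda>k. hom_ext R N (n k) (n (Suc k)) (d k)" and ?e = "\<lambda>k. hom_ext R N (p k) (p (Suc k)) (e k)"
  let ?f = "\<lambda>k. hom_ext R N (p k) (n k) (f k)" and ?g = "\<lambda>k. hom_ext R N (n k) (p k) (g k)"
  let ?h = "\<lambda>k. hom_ext R N (n (Suc k)) (n k) (h k)"
  let ?P = "\<lambda>k. pow_mod N (n k)" and ?Q = "\<lambda>k. pow_mod N (p k)"
  note PM = module_pow_mod[OF N]
  show ?thesis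
    unfolding exact_at_def[OF N]
  proof (intro ballI impI)
    fix y assume y: "y \<in> carrier (?P (Suc k))" and dy: "?d k y = \<zero>\<^bsub>?P k\<^esub>"
    interpret P1: module R "?P (Suc k)" by (rule PM)
    interpret P2: module R "?P (Suc (Suc k))" by (rule PM)
    interpret F1: module R "free_mod R (n (Suc k))" by (rule FM)
    have w: "?f (Suc k) y \<in> carrier (?Q (Suc k))" by (rule N.hom_ext_closed[OF f(1) y])
    have "?e k (?f (Suc k) y) = hom_ext R N (p k) (n (Suc k)) (\<lambda>x. f k (d k x)) y"
      unfolding N.hom_ext_comp[OF e f(1) y] by (rule N.hom_ext_cong) (rule f(3))
    also have "\<dots> = ?f k (?d k y)" by (rule N.hom_ext_comp[OF f(1) d y, symmetric])
    also have "\<dots> = \<zero>\<^bsub>?Q k\<^esub>" unfolding dy by (rule mod_hom_zero[OF PM PM N.hom_ext_hom[OF f(1)]])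
    finally obtain v where v: "v \<in> carrier (?Q (Suc (Suc k)))" "?f (Suc k) y = ?e (Suc k) v"
      using ex[of k] w unfolding exact_at_def[OF N] by blast
    have "?g (Suc k) (?f (Suc k) y) = hom_ext R N (n (Suc k)) (p (Suc (Suc k))) (\<lambda>x. d (Suc k) (g (Suc (Suc k)) x)) v"
      unfolding v(2) N.hom_ext_comp[OF g(1) e v(1)] by (rule N.hom_ext_cong) (rule g(3)[symmetric])
    also have "\<dots> = ?d (Suc k) (?g (Suc (Suc k)) v)"
      by (rule N.hom_ext_comp[OF d g(1) v(1), symmetric])
    finally have gfy: "?g (Suc k) (?f (Suc k) y) = ?d (Suc k) (?g (Suc (Suc k)) v)" .
    have gv: "?g (Suc (Suc k)) v \<in> carrier (?P (Suc (Suc k)))" by (rule N.hom_ext_closed[OF g(1) v(1)])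
    have hy: "?h (Suc k) y \<in> carrier (?P (Suc (Suc k)))" by (rule N.hom_ext_closed[OF h(1) y])
    let ?id = "\<lambda>x. (d (Suc k) (h (Suc k) x) \<oplus>\<^bsub>free_mod R (n (Suc k))\<^esub> h k (d k x)) \<oplus>\<^bsub>free_mod R (n (Suc k))\<^esub> g (Suc k) (f (Suc k) x)"
    have id: "x = ?id x" if x: "x \<in> carrier (free_mod R (n (Suc k)))" for x
      using h(2)[OF x] F1.M.diff_add_cancel[OF x gf[OF x]] by (simp add: u_def)
    note homs = mod_hom_comp[OF d h(1)] mod_hom_comp[OF h(1) d] mod_hom_comp[OF g(1) f(1)]
    have "y = hom_ext R N (n (Suc k)) (n (Suc k)) (\<lambda>x. x) y" by (rule N.hom_ext_id[OF y, symmetric])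
    also have "\<dots> = hom_ext R N (n (Suc k)) (n (Suc k)) ?id y" by (rule N.hom_ext_cong) (rule id)
    also have "\<dots> = (hom_ext R N (n (Suc k)) (n (Suc k)) (\<lambda>x. d (Suc k) (h (Suc k) x)) y
         \<oplus>\<^bsub>?P (Suc k)\<^esub> hom_ext R N (n (Suc k)) (n (Suc k)) (\<lambda>x. h k (d k x)) y)
         \<oplus>\<^bsub>?P (Suc k)\<^esub> hom_ext R N (n (Suc k)) (n (Suc k)) (\<lambda>x. g (Suc k) (f (Suc k) x)) y"
      by (simp only: N.hom_ext_sum[OF mod_hom_sum[OF FM homs(1,2)] homs(3) y] N.hom_ext_sum[OF homs(1,2) y])
    also have "\<dots> = (?d (Suc k) (?h (Suc k) y) \<oplus>\<^bsub>?P (Suc k)\<^esub> ?h k (?d k y)) \<oplus>\<^bsub>?P (Suc k)\<^esub> ?g (Suc k) (?f (Suc k) y)"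
      by (simp only: N.hom_ext_comp[OF d h(1) y] N.hom_ext_comp[OF h(1) d y] N.hom_ext_comp[OF g(1) f(1) y])
    also have "?h k (?d k y) = \<zero>\<^bsub>?P (Suc k)\<^esub>"
      unfolding dy by (rule mod_hom_zero[OF PM PM N.hom_ext_hom[OF h(1)]])
    also have "?d (Suc k) (?h (Suc k) y) \<oplus>\<^bsub>?P (Suc k)\<^esub> \<zero>\<^bsub>?P (Suc k)\<^esub> = ?d (Suc k) (?h (Suc k) y)"
      using N.hom_ext_closed[OF d hy] by simp
    also have "?d (Suc k) (?h (Suc k) y) \<oplus>\<^bsub>?P (Suc k)\<^esub> ?g (Suc k) (?f (Suc k) y)
       = ?d (Suc k) (?h (Suc k) y \<oplus>\<^bsub>?P (Suc (Suc k))\<^esub> ?g (Suc (Suc k)) v)"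
      unfolding gfy by (rule mod_hom_add[OF N.hom_ext_hom[OF d] hy gv, symmetric])
    finally have "y = ?d (Suc k) (?h (Suc k) y \<oplus>\<^bsub>?P (Suc (Suc k))\<^esub> ?g (Suc (Suc k)) v)" .
    moreover have "?h (Suc k) y \<oplus>\<^bsub>?P (Suc (Suc k))\<^esub> ?g (Suc (Suc k)) v \<in> carrier (?P (Suc (Suc k)))"
      using hy gv by simp
    ultimately show "y \<in> ?d (Suc k) ` carrier (?P (Suc (Suc k)))" by (rule image_eqI)
  qed
qed

text \<open>\<open>Tor\<close> refers to a resolution selected by choice; the transfer in both
  directions replaces it by any given one.\<close>

lemma Tor_independent_iff:
  assumes M: "module R M" and N: "module R N" and F: "free_resolution R M n d \<epsilon>"
  shows "Tor_independent R M N \<longleftrightarrow> (\<forall>k. exact_at R N (n k) (n (Suc k)) (n (Suc (Suc k))) (d k) (d (Suc k)))"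
proof -
  obtain p e \<eta> where pe: "(SOME (n, d, \<epsilon>). free_resolution R M n d \<epsilon>) = (p, e, \<eta>)"
    by (metis surj_pair)
  have "(case (p, e, \<eta>) of (n, d, \<epsilon>) \<Rightarrow> free_resolution R M n d \<epsilon>)"
    unfolding pe[symmetric] by (rule someI[of _ "(n, d, \<epsilon>)"]) (simp add: F)
  then have G: "free_resolution R M p e \<eta>" by simp
  have all_ge_one: "(\<forall>i\<ge>1. P i) \<longleftrightarrow> (\<forall>k. P (Suc k))" for P :: "nat \<Rightarrow> bool"
    by (metis One_nat_def Suc_le_D Suc_le_mono le0)
  have "Tor_independent R M N \<longleftrightarrow> (\<forall>k. carrier (Tor R (Suc k) M N) = {\<zero>\<^bsub>Tor R (Suc k) M N\<^esub>})"
    unfolding Tor_independent_def by (rule all_ge_one)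
  also have "\<dots> \<longleftrightarrow> (\<forall>k. exact_at R N (p k) (p (Suc k)) (p (Suc (Suc k))) (e k) (e (Suc k)))"
    unfolding Tor_def pe Let_def prod.case homology_trivial[OF N, where d = e and n = p, OF resolution_hom[OF G]] ..
  also have "\<dots> \<longleftrightarrow> (\<forall>k. exact_at R N (n k) (n (Suc k)) (n (Suc (Suc k))) (d k) (d (Suc k)))"
  proof
    assume ex: "\<forall>k. exact_at R N (p k) (p (Suc k)) (p (Suc (Suc k))) (e k) (e (Suc k))"
    show "\<forall>k. exact_at R N (n k) (n (Suc k)) (n (Suc (Suc k))) (d k) (d (Suc k))"
      by (rule allI, rule resolution_exactness_transfer[OF M N F G], rule ex[rule_format])
  next
    assume ex: "\<forall>k. exact_at R N (n k) (n (Suc k)) (n (Suc (Suc k))) (d k) (d (Suc k))"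
    show "\<forall>k. exact_at R N (p k) (p (Suc k)) (p (Suc (Suc k))) (e k) (e (Suc k))"
      by (rule allI, rule resolution_exactness_transfer[OF M N G F], rule ex[rule_format])
  qed
  finally show ?thesis .
qed

section \<open>Two-periodic modules\<close>

text \<open>\<open>\<epsilon>\<close> and \<open>A\<close> are the augmentation and first
  differential of a resolution, and \<open>\<phi>\<close> embeds M into R^(n_1) as its second
  syzygy, the kernel of \<open>A\<close>. The composite \<open>B\<close> is the splice that closes
  the resolution into a cycle of period two.\<close>

locale periodic = M: module R M for R :: "('a, 'r) ring_scheme" and M :: "('a, 'b, 'm) module_scheme" +
  fixes n\<^sub>0 n\<^sub>1 :: nat and A B :: "(nat \<Rightarrow> 'a) \<Rightarrow> nat \<Rightarrow> 'a" and \<epsilon> :: "(nat \<Rightarrow> 'a) \<Rightarrow> 'b" and \<phi> :: "'b \<Rightarrow> nat \<Rightarrow> 'a"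
  assumes A: "A \<in> mod_hom R (free_mod R n\<^sub>1) (free_mod R n\<^sub>0)"
    and eps: "\<epsilon> \<in> mod_hom R (free_mod R n\<^sub>0) M"
    and \<phi>: "\<phi> \<in> mod_hom R M (free_mod R n\<^sub>1)" and \<phi>_inj: "inj_on \<phi> (carrier M)"
    and B_eq: "B = (\<lambda>x. \<phi> (\<epsilon> x))"
    and eps_surj: "\<epsilon> ` carrier (free_mod R n\<^sub>0) = carrier M"
    and A_image: "A ` carrier (free_mod R n\<^sub>1) = a_kernel (free_mod R n\<^sub>0) M \<epsilon>"
    and B_image: "B ` carrier (free_mod R n\<^sub>0) = a_kernel (free_mod R n\<^sub>1) (free_mod R n\<^sub>0) A"
begin

lemma B: "B \<in> mod_hom R (free_mod R n\<^sub>0) (free_mod R n\<^sub>1)"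
  unfolding B_eq by (rule mod_hom_comp[OF \<phi> eps])

text \<open>Injectivity of \<open>\<phi>\<close> makes \<open>B\<close> and
  \<open>\<epsilon>\<close> have the same kernel.\<close>

lemma B_kernel:
  assumes "x \<in> carrier (free_mod R n\<^sub>0)"
  shows "B x = \<zero>\<^bsub>free_mod R n\<^sub>1\<^esub> \<longleftrightarrow> x \<in> A ` carrier (free_mod R n\<^sub>1)"
proof -
  have "\<phi> (\<epsilon> x) = \<zero>\<^bsub>free_mod R n\<^sub>1\<^esub> \<longleftrightarrow> \<epsilon> x = \<zero>\<^bsub>M\<^esub>"
    using inj_onD[OF \<phi>_inj, of "\<epsilon> x" "\<zero>\<^bsub>M\<^esub>"] mod_hom_closed[OF eps assms]
      mod_hom_zero[OF M.module_axioms module_free_mod[OF M.is_cring] \<phi>] by auto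
  then show ?thesis unfolding A_image B_eq using assms by (simp add: a_kernel_def')
qed

lemma A_kernel:
  assumes "x \<in> carrier (free_mod R n\<^sub>1)"
  shows "A x = \<zero>\<^bsub>free_mod R n\<^sub>0\<^esub> \<longleftrightarrow> x \<in> B ` carrier (free_mod R n\<^sub>0)"
  unfolding B_image using assms by (simp add: a_kernel_def')

text \<open>Differentials out of odd degrees are \<open>A\<close>, those out of positive even
  degrees are \<open>B\<close>; exactness in each spot is one of the two kernel identities.\<close>

lemma periodic_resolution:
  "free_resolution R M (\<lambda>k. if even k then n\<^sub>0 else n\<^sub>1) (\<lambda>k. if even k then A else B) \<epsilon>"
proof -
  have "A ` carrier (free_mod R n\<^sub>1) = a_kernel (free_mod R n\<^sub>0) (free_mod R n\<^sub>1) B"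
    using B_kernel mod_hom_closed[OF A] by (auto simp: a_kernel_def')
  then show ?thesis
    unfolding free_resolution_def using A B eps eps_surj A_image B_image by auto
qed

lemma Tor_independent_periodic:
  assumes N: "module R N"
  shows "Tor_independent R M N \<longleftrightarrow> exact_at R N n\<^sub>0 n\<^sub>1 n\<^sub>0 A B \<and> exact_at R N n\<^sub>1 n\<^sub>0 n\<^sub>1 B A"
proof -
  have "(\<forall>k. exact_at R N (if even k then n\<^sub>0 else n\<^sub>1) (if even (Suc k) then n\<^sub>0 else n\<^sub>1) (if even (Suc (Suc k)) then n\<^sub>0 else n\<^sub>1)
       (if even k then A else B) (if even (Suc k) then A else B)) \<longleftrightarrow> exact_at R N n\<^sub>0 n\<^sub>1 n\<^sub>0 A B \<and> exact_at R N n\<^sub>1 n\<^sub>0 n\<^sub>1 B A"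
    (is "?l \<longleftrightarrow> ?r")
  proof
    assume l: ?l
    show ?r using l[rule_format, of 0] l[rule_format, of 1] by simp
  qed auto
  then show ?thesis
    unfolding Tor_independent_iff[OF M.module_axioms N periodic_resolution] .
qed

end

lemma two_periodic_periodic:
  assumes M: "module R M" and "two_periodic R M"
  obtains n\<^sub>0 n\<^sub>1 A B \<epsilon> \<phi> where "periodic R M n\<^sub>0 n\<^sub>1 A B \<epsilon> \<phi>"
proof -
  from assms(2)[unfolded two_periodic_def] obtain n d \<epsilon>
    where res: "minimal_free_resolution R M n d \<epsilon> \<and> mod_isomorphic R M (Suc_syzygy R n d 1)"
    by (elim exE)
  from res have F: "free_resolution R M n d \<epsilon>" unfolding minimal_free_resolution_def by (elim conjE)
  from res have iso: "mod_isomorphic R M (Suc_syzygy R n d 1)" by (rule conjunct2)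
  obtain \<phi> where \<phi>: "\<phi> \<in> mod_hom R M (Suc_syzygy R n d 1)" "bij_betw \<phi> (carrier M) (carrier (Suc_syzygy R n d 1))"
    using iso unfolding mod_isomorphic_def by blast
  have car: "carrier (Suc_syzygy R n d 1) = d 1 ` carrier (free_mod R (n 2))"
    by (simp add: Suc_syzygy_def numeral_2_eq_2)
  have d1: "d 1 \<in> mod_hom R (free_mod R (n 2)) (free_mod R (n 1))"
    using resolution_hom[OF F, of 1] by (simp add: numeral_2_eq_2)
  have "\<phi> \<in> mod_hom R M (free_mod R (n 1))"
  proof (rule mod_homI)
    show "\<phi> x \<in> carrier (free_mod R (n 1))" if "x \<in> carrier M" for x
      using mod_hom_closed[OF \<phi>(1) that] mod_hom_closed[OF d1] unfolding car by auto
    show "\<phi> (x \<oplus>\<^bsub>M\<^esub> y) = \<phi> x \<oplus>\<^bsub>free_mod R (n 1)\<^esub> \<phi> y" if "x \<in> carrier M" "y \<in> carrier M" for x y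
      using mod_hom_add[OF \<phi>(1) that] by (simp add: Suc_syzygy_def)
    show "\<phi> (a \<odot>\<^bsub>M\<^esub> x) = a \<odot>\<^bsub>free_mod R (n 1)\<^esub> \<phi> x" if "a \<in> carrier R" "x \<in> carrier M" for a x
      using mod_hom_smult[OF \<phi>(1) that] by (simp add: Suc_syzygy_def)
  qed
  \<comment> \<open>The index 1 denotes the second syzygy, the image of \<open>d 1\<close>, which by
    exactness is the kernel of \<open>d 0\<close>.\<close>
  moreover have "(\<lambda>x. \<phi> (\<epsilon> x)) ` carrier (free_mod R (n 0)) = a_kernel (free_mod R (n 1)) (free_mod R (n 0)) (d 0)"
  proof -
    have "(\<lambda>x. \<phi> (\<epsilon> x)) ` carrier (free_mod R (n 0)) = \<phi> ` carrier M"
      using resolution_surj[OF F] by (metis image_image)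
    also have "\<dots> = d 1 ` carrier (free_mod R (n 2))" using \<phi>(2) car by (simp add: bij_betw_def)
    also have "\<dots> = a_kernel (free_mod R (n 1)) (free_mod R (n 0)) (d 0)"
      using F unfolding free_resolution_def by (simp add: numeral_2_eq_2)
    finally show ?thesis .
  qed
  moreover have "inj_on \<phi> (carrier M)" using \<phi>(2) by (simp add: bij_betw_def)
  ultimately have "periodic R M (n 0) (n 1) (d 0) (\<lambda>x. \<phi> (\<epsilon> x)) \<epsilon> \<phi>"
    using M F unfolding free_resolution_def periodic_def periodic_axioms_def by simp
  then show ?thesis by (rule that)
qed

section \<open>Localization\<close>

lemma loc_module_simps:
  "carrier (loc_module R S M) = {mod_frac S M m s | m s. m \<in> carrier M \<and> s \<in> S}"
  "\<zero>\<^bsub>loc_module R S M\<^esub> = mod_frac S M \<zero>\<^bsub>M\<^esub> \<one>\<^bsub>R\<^esub>"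
  by (simp_all add: loc_module_def)

lemma loc_ring_simps:
  "carrier (loc_ring R S) = carrier (loc_module R S (self_module R))"
  "\<zero>\<^bsub>loc_ring R S\<^esub> = \<zero>\<^bsub>loc_module R S (self_module R)\<^esub>"
  "\<one>\<^bsub>loc_ring R S\<^esub> = mod_frac S (self_module R) \<one>\<^bsub>R\<^esub> \<one>\<^bsub>R\<^esub>"
  "x \<oplus>\<^bsub>loc_ring R S\<^esub> y = x \<oplus>\<^bsub>loc_module R S (self_module R)\<^esub> y"
  "x \<otimes>\<^bsub>loc_ring R S\<^esub> y = x \<odot>\<^bsub>loc_module R S (self_module R)\<^esub> y"
  by (simp_all add: loc_ring_def)

text \<open>The operations on fractions are unions over representatives; a constant family over
  nonempty index sets collapses to its value.\<close>

lemma UN_pair_const: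
  fixes C :: "'z set"
  assumes "(m, s) \<in> U" "(n, t) \<in> V" "\<And>m s n t. (m, s) \<in> U \<Longrightarrow> (n, t) \<in> V \<Longrightarrow> g m s n t = C"
  shows "(\<Union>(m, s)\<in>U. \<Union>(n, t)\<in>V. g m s n t) = C"
proof (rule Set.set_eqI)
  fix x
  have "x \<in> (\<Union>(m, s)\<in>U. \<Union>(n, t)\<in>V. g m s n t) \<longleftrightarrow> (\<exists>m s n t. (m, s) \<in> U \<and> (n, t) \<in> V \<and> x \<in> g m s n t)"
    by fast
  also have "\<dots> \<longleftrightarrow> x \<in> C" using assms by metis
  finally show "x \<in> (\<Union>(m, s)\<in>U. \<Union>(n, t)\<in>V. g m s n t) \<longleftrightarrow> x \<in> C" .
qed

locale localization = mult_set R S + M: module R M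
  for R :: "('a, 'r) ring_scheme" (structure) and S and M :: "('a, 'b, 'm) module_scheme"
begin

abbreviation "fr \<equiv> mod_frac S M"
abbreviation "loc \<equiv> loc_module R S M"

lemma fr_mem: "(n, t) \<in> fr m s \<longleftrightarrow> n \<in> carrier M \<and> t \<in> S \<and> (\<exists>u\<in>S. u \<odot>\<^bsub>M\<^esub> (t \<odot>\<^bsub>M\<^esub> m) = u \<odot>\<^bsub>M\<^esub> (s \<odot>\<^bsub>M\<^esub> n))"
  by (simp add: mod_frac_def)

lemma fr_self: "m \<in> carrier M \<Longrightarrow> s \<in> S \<Longrightarrow> (m, s) \<in> fr m s"
  using S_one by (auto simp: fr_mem)

text \<open>Transitivity of equality of fractions: the witness for \<open>(p, r)\<close> is the
  product of both given witnesses with the denominator \<open>s\<close>.\<close>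

lemma fr_subset:
  assumes "m \<in> carrier M" "s \<in> S" "n \<in> carrier M" "t \<in> S" "u \<in> S" "u \<odot>\<^bsub>M\<^esub> (t \<odot>\<^bsub>M\<^esub> m) = u \<odot>\<^bsub>M\<^esub> (s \<odot>\<^bsub>M\<^esub> n)"
  shows "fr m s \<subseteq> fr n t"
proof (rule subrelI)
  fix p r assume "(p, r) \<in> fr m s"
  then obtain v where p: "p \<in> carrier M" "r \<in> S" "v \<in> S" "v \<odot>\<^bsub>M\<^esub> (r \<odot>\<^bsub>M\<^esub> m) = v \<odot>\<^bsub>M\<^esub> (s \<odot>\<^bsub>M\<^esub> p)"
    by (auto simp: fr_mem)
  note car = assms(1,3) p(1) SR[OF assms(2)] SR[OF assms(4)] SR[OF assms(5)] SR[OF p(2)] SR[OF p(3)]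
  have "(v \<otimes> u \<otimes> s) \<odot>\<^bsub>M\<^esub> (r \<odot>\<^bsub>M\<^esub> n) = (v \<otimes> r) \<odot>\<^bsub>M\<^esub> (u \<odot>\<^bsub>M\<^esub> (s \<odot>\<^bsub>M\<^esub> n))"
    using car by (simp add: M.smult_assoc1[symmetric] m_ac)
  also have "\<dots> = (v \<otimes> r) \<odot>\<^bsub>M\<^esub> (u \<odot>\<^bsub>M\<^esub> (t \<odot>\<^bsub>M\<^esub> m))" by (simp only: assms(6))
  also have "\<dots> = (u \<otimes> t) \<odot>\<^bsub>M\<^esub> (v \<odot>\<^bsub>M\<^esub> (r \<odot>\<^bsub>M\<^esub> m))"
    using car by (simp add: M.smult_assoc1[symmetric] m_ac)
  also have "\<dots> = (u \<otimes> t) \<odot>\<^bsub>M\<^esub> (v \<odot>\<^bsub>M\<^esub> (s \<odot>\<^bsub>M\<^esub> p))" by (simp only: p(4))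
  also have "\<dots> = (v \<otimes> u \<otimes> s) \<odot>\<^bsub>M\<^esub> (t \<odot>\<^bsub>M\<^esub> p)"
    using car by (simp add: M.smult_assoc1[symmetric] m_ac)
  finally show "(p, r) \<in> fr n t"
    using p S_mult assms(2,5) by (auto simp: fr_mem)
qed

lemma fr_eq_iff:
  assumes "m \<in> carrier M" "s \<in> S" "n \<in> carrier M" "t \<in> S"
  shows "fr m s = fr n t \<longleftrightarrow> (\<exists>u\<in>S. u \<odot>\<^bsub>M\<^esub> (t \<odot>\<^bsub>M\<^esub> m) = u \<odot>\<^bsub>M\<^esub> (s \<odot>\<^bsub>M\<^esub> n))"
proof
  assume "fr m s = fr n t"
  then have "(n, t) \<in> fr m s" using fr_self assms by simp
  then show "\<exists>u\<in>S. u \<odot>\<^bsub>M\<^esub> (t \<odot>\<^bsub>M\<^esub> m) = u \<odot>\<^bsub>M\<^esub> (s \<odot>\<^bsub>M\<^esub> n)" by (simp add: fr_mem)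
next
  assume "\<exists>u\<in>S. u \<odot>\<^bsub>M\<^esub> (t \<odot>\<^bsub>M\<^esub> m) = u \<odot>\<^bsub>M\<^esub> (s \<odot>\<^bsub>M\<^esub> n)"
  then show "fr m s = fr n t" using fr_subset assms by (metis subset_antisym)
qed

lemma fr_eqI:
  assumes "m \<in> carrier M" "s \<in> S" "n \<in> carrier M" "t \<in> S" "t \<odot>\<^bsub>M\<^esub> m = s \<odot>\<^bsub>M\<^esub> n"
  shows "fr m s = fr n t"
  using fr_eq_iff[OF assms(1-4)] S_one assms(5) by auto

lemma fr_cancel: "m \<in> carrier M \<Longrightarrow> s \<in> S \<Longrightarrow> r \<in> S \<Longrightarrow> fr (r \<odot>\<^bsub>M\<^esub> m) (r \<otimes> s) = fr m s"
  using SR S_mult by (intro fr_eqI) (auto simp: M.smult_assoc1[symmetric] m_comm)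

lemma fr_closed: "m \<in> carrier M \<Longrightarrow> s \<in> S \<Longrightarrow> fr m s \<in> carrier loc"
  by (auto simp: loc_module_simps)

lemma loc_add_fr:
  assumes "m \<in> carrier M" "s \<in> S" "n \<in> carrier M" "t \<in> S"
  shows "fr m s \<oplus>\<^bsub>loc\<^esub> fr n t = fr (t \<odot>\<^bsub>M\<^esub> m \<oplus>\<^bsub>M\<^esub> s \<odot>\<^bsub>M\<^esub> n) (s \<otimes> t)"
proof -
  have eq: "fr (t' \<odot>\<^bsub>M\<^esub> m' \<oplus>\<^bsub>M\<^esub> s' \<odot>\<^bsub>M\<^esub> n') (s' \<otimes> t') = fr (t \<odot>\<^bsub>M\<^esub> m \<oplus>\<^bsub>M\<^esub> s \<odot>\<^bsub>M\<^esub> n) (s \<otimes> t)"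
    if "(m', s') \<in> fr m s" "(n', t') \<in> fr n t" for m' s' n' t'
  proof -
    from that obtain u v where u: "m' \<in> carrier M" "s' \<in> S" "u \<in> S" "u \<odot>\<^bsub>M\<^esub> (s' \<odot>\<^bsub>M\<^esub> m) = u \<odot>\<^bsub>M\<^esub> (s \<odot>\<^bsub>M\<^esub> m')"
      and v: "n' \<in> carrier M" "t' \<in> S" "v \<in> S" "v \<odot>\<^bsub>M\<^esub> (t' \<odot>\<^bsub>M\<^esub> n) = v \<odot>\<^bsub>M\<^esub> (t \<odot>\<^bsub>M\<^esub> n')"
      by (auto simp: fr_mem)
    note car = assms(1,3) u(1) v(1) SR[OF assms(2)] SR[OF assms(4)] SR[OF u(2)] SR[OF u(3)] SR[OF v(2)] SR[OF v(3)]
    have "(u \<otimes> v) \<odot>\<^bsub>M\<^esub> ((s \<otimes> t) \<odot>\<^bsub>M\<^esub> (t' \<odot>\<^bsub>M\<^esub> m' \<oplus>\<^bsub>M\<^esub> s' \<odot>\<^bsub>M\<^esub> n'))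
       = (v \<otimes> t \<otimes> t') \<odot>\<^bsub>M\<^esub> (u \<odot>\<^bsub>M\<^esub> (s \<odot>\<^bsub>M\<^esub> m')) \<oplus>\<^bsub>M\<^esub> (u \<otimes> s \<otimes> s') \<odot>\<^bsub>M\<^esub> (v \<odot>\<^bsub>M\<^esub> (t \<odot>\<^bsub>M\<^esub> n'))"
      using car by (simp add: M.smult_r_distr M.smult_assoc1[symmetric] m_ac)
    also have "\<dots> = (v \<otimes> t \<otimes> t') \<odot>\<^bsub>M\<^esub> (u \<odot>\<^bsub>M\<^esub> (s' \<odot>\<^bsub>M\<^esub> m)) \<oplus>\<^bsub>M\<^esub> (u \<otimes> s \<otimes> s') \<odot>\<^bsub>M\<^esub> (v \<odot>\<^bsub>M\<^esub> (t' \<odot>\<^bsub>M\<^esub> n))"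
      by (simp only: u(4) v(4))
    also have "\<dots> = (u \<otimes> v) \<odot>\<^bsub>M\<^esub> ((s' \<otimes> t') \<odot>\<^bsub>M\<^esub> (t \<odot>\<^bsub>M\<^esub> m \<oplus>\<^bsub>M\<^esub> s \<odot>\<^bsub>M\<^esub> n))"
      using car by (simp add: M.smult_r_distr M.smult_assoc1[symmetric] m_ac)
    finally have e: "(u \<otimes> v) \<odot>\<^bsub>M\<^esub> ((s \<otimes> t) \<odot>\<^bsub>M\<^esub> (t' \<odot>\<^bsub>M\<^esub> m' \<oplus>\<^bsub>M\<^esub> s' \<odot>\<^bsub>M\<^esub> n'))
       = (u \<otimes> v) \<odot>\<^bsub>M\<^esub> ((s' \<otimes> t') \<odot>\<^bsub>M\<^esub> (t \<odot>\<^bsub>M\<^esub> m \<oplus>\<^bsub>M\<^esub> s \<odot>\<^bsub>M\<^esub> n))" .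
    show ?thesis
      by (rule fr_eq_iff[THEN iffD2]) (use car e S_mult u v assms in auto)
  qed
  show ?thesis
    unfolding loc_module_def ring_record_simps
    by (rule UN_pair_const[OF fr_self[OF assms(1,2)] fr_self[OF assms(3,4)]]) (rule eq)
qed

text \<open>Together with common denominators, this reduces the additive laws of the localization to
  those of M.\<close>

lemma loc_add_fr_same:
  assumes "m \<in> carrier M" "s \<in> S" "n \<in> carrier M"
  shows "fr m s \<oplus>\<^bsub>loc\<^esub> fr n s = fr (m \<oplus>\<^bsub>M\<^esub> n) s"
  using loc_add_fr[OF assms(1,2,3,2)] fr_cancel[of "m \<oplus>\<^bsub>M\<^esub> n" s s] assms SR by (simp add: M.smult_r_distr)

lemma loc_zero: "s \<in> S \<Longrightarrow> fr \<zero>\<^bsub>M\<^esub> s = \<zero>\<^bsub>loc\<^esub>"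
  unfolding loc_module_simps using SR S_one by (intro fr_eqI) auto

lemma loc_common:
  assumes "x \<in> carrier loc" "y \<in> carrier loc"
  obtains m n s where "m \<in> carrier M" "n \<in> carrier M" "s \<in> S" "x = fr m s" "y = fr n s"
proof -
  obtain m s n t where xy: "m \<in> carrier M" "s \<in> S" "x = fr m s" "n \<in> carrier M" "t \<in> S" "y = fr n t"
    using assms by (auto simp: loc_module_simps)
  show ?thesis
    by (rule that[of "t \<odot>\<^bsub>M\<^esub> m" "s \<odot>\<^bsub>M\<^esub> n" "t \<otimes> s"])
       (use xy fr_cancel[of m s t] fr_cancel[of n t s] SR S_mult in \<open>auto simp: m_comm\<close>)
qed

lemma loc_common3:
  assumes "x \<in> carrier loc" "y \<in> carrier loc" "z \<in> carrier loc"
  obtains m n p s where "m \<in> carrier M" "n \<in> carrier M" "p \<in> carrier M" "s \<in> S" "x = fr m s" "y = fr n s" "z = fr p s"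
proof -
  obtain m n s where xy: "m \<in> carrier M" "n \<in> carrier M" "s \<in> S" "x = fr m s" "y = fr n s"
    using loc_common[OF assms(1,2)] .
  obtain p t where z: "p \<in> carrier M" "t \<in> S" "z = fr p t" using assms(3)
    by (auto simp: loc_module_simps)
  show ?thesis
    by (rule that[of "t \<odot>\<^bsub>M\<^esub> m" "t \<odot>\<^bsub>M\<^esub> n" "s \<odot>\<^bsub>M\<^esub> p" "t \<otimes> s"])
       (use xy z fr_cancel[of m s t] fr_cancel[of n s t] fr_cancel[of p t s] SR S_mult in \<open>auto simp: m_comm\<close>)
qed

lemma abelian_group_loc: "abelian_group loc"
proof (rule abelian_groupI)
  show "\<zero>\<^bsub>loc\<^esub> \<in> carrier loc" unfolding loc_module_simps using S_one by auto
  fix x y assume "x \<in> carrier loc" "y \<in> carrier loc"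
  from loc_common[OF this] obtain m n s where xy: "m \<in> carrier M" "n \<in> carrier M" "s \<in> S" "x = fr m s" "y = fr n s" .
  then show "x \<oplus>\<^bsub>loc\<^esub> y \<in> carrier loc" "x \<oplus>\<^bsub>loc\<^esub> y = y \<oplus>\<^bsub>loc\<^esub> x"
    by (simp_all add: loc_add_fr_same fr_closed M.M.a_comm)
  fix z assume "z \<in> carrier loc"
  from loc_common3[OF \<open>x \<in> carrier loc\<close> \<open>y \<in> carrier loc\<close> this] obtain m n p s
    where "m \<in> carrier M" "n \<in> carrier M" "p \<in> carrier M" "s \<in> S" "x = fr m s" "y = fr n s" "z = fr p s" .
  then show "x \<oplus>\<^bsub>loc\<^esub> y \<oplus>\<^bsub>loc\<^esub> z = x \<oplus>\<^bsub>loc\<^esub> (y \<oplus>\<^bsub>loc\<^esub> z)"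
    by (simp add: loc_add_fr_same M.M.a_assoc)
next
  fix x assume "x \<in> carrier loc"
  then obtain m s where x: "m \<in> carrier M" "s \<in> S" "x = fr m s" by (auto simp: loc_module_simps)
  have "\<zero>\<^bsub>loc\<^esub> = fr \<zero>\<^bsub>M\<^esub> s" using loc_zero[OF x(2)] by simp
  then show "\<zero>\<^bsub>loc\<^esub> \<oplus>\<^bsub>loc\<^esub> x = x" using x by (simp add: loc_add_fr_same)
  have "fr (\<ominus>\<^bsub>M\<^esub> m) s \<oplus>\<^bsub>loc\<^esub> x = \<zero>\<^bsub>loc\<^esub>"
    using x loc_zero[OF x(2)] by (simp add: loc_add_fr_same M.M.l_neg)
  then show "\<exists>y\<in>carrier loc. y \<oplus>\<^bsub>loc\<^esub> x = \<zero>\<^bsub>loc\<^esub>" using x fr_closed by blast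
qed

lemma loc_smult_fr:
  assumes "a \<in> carrier R" "s \<in> S" "m \<in> carrier M" "t \<in> S"
  shows "mod_frac S (self_module R) a s \<odot>\<^bsub>loc\<^esub> fr m t = fr (a \<odot>\<^bsub>M\<^esub> m) (s \<otimes> t)"
proof -
  have eq: "fr (a' \<odot>\<^bsub>M\<^esub> m') (s' \<otimes> t') = fr (a \<odot>\<^bsub>M\<^esub> m) (s \<otimes> t)"
    if "(a', s') \<in> mod_frac S (self_module R) a s" "(m', t') \<in> fr m t" for a' s' m' t'
  proof -
    from that obtain u v where u: "a' \<in> carrier R" "s' \<in> S" "u \<in> S" "u \<otimes> (s' \<otimes> a) = u \<otimes> (s \<otimes> a')"
      and v: "m' \<in> carrier M" "t' \<in> S" "v \<in> S" "v \<odot>\<^bsub>M\<^esub> (t' \<odot>\<^bsub>M\<^esub> m) = v \<odot>\<^bsub>M\<^esub> (t \<odot>\<^bsub>M\<^esub> m')"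
      by (auto simp: mod_frac_def)
    note car = assms(1,3) u(1) v(1) SR[OF assms(2)] SR[OF assms(4)] SR[OF u(2)] SR[OF u(3)] SR[OF v(2)] SR[OF v(3)]
    have "(u \<otimes> v) \<odot>\<^bsub>M\<^esub> ((s \<otimes> t) \<odot>\<^bsub>M\<^esub> (a' \<odot>\<^bsub>M\<^esub> m'))
       = (u \<otimes> (s \<otimes> a')) \<odot>\<^bsub>M\<^esub> (v \<odot>\<^bsub>M\<^esub> (t \<odot>\<^bsub>M\<^esub> m'))"
      using car by (simp add: M.smult_assoc1[symmetric] m_ac)
    also have "\<dots> = (u \<otimes> (s' \<otimes> a)) \<odot>\<^bsub>M\<^esub> (v \<odot>\<^bsub>M\<^esub> (t' \<odot>\<^bsub>M\<^esub> m))"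
      by (simp only: u(4) v(4))
    also have "\<dots> = (u \<otimes> v) \<odot>\<^bsub>M\<^esub> ((s' \<otimes> t') \<odot>\<^bsub>M\<^esub> (a \<odot>\<^bsub>M\<^esub> m))"
      using car by (simp add: M.smult_assoc1[symmetric] m_ac)
    finally have e: "(u \<otimes> v) \<odot>\<^bsub>M\<^esub> ((s \<otimes> t) \<odot>\<^bsub>M\<^esub> (a' \<odot>\<^bsub>M\<^esub> m')) = (u \<otimes> v) \<odot>\<^bsub>M\<^esub> ((s' \<otimes> t') \<odot>\<^bsub>M\<^esub> (a \<odot>\<^bsub>M\<^esub> m))" .
    show ?thesis
      by (rule fr_eq_iff[THEN iffD2]) (use car e S_mult u v assms in auto)
  qed
  have "(a, s) \<in> mod_frac S (self_module R) a s"
    using assms(1,2) S_one by (auto simp: mod_frac_def)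
  then show ?thesis
    unfolding loc_module_def module.simps
    by (rule UN_pair_const[OF _ fr_self[OF assms(3,4)]]) (rule eq)
qed

end

section \<open>The ring of fractions and clearing of denominators\<close>

context mult_set
begin

lemma localization_self: "localization R S (self_module R)"
  by (simp add: localization_def mult_set_axioms module_self is_cring)

sublocale L: localization R S "self_module R"
  by (rule localization_self)

lemma loc_ring_mult_fr:
  assumes "a \<in> carrier R" "s \<in> S" "b \<in> carrier R" "t \<in> S"
  shows "L.fr a s \<otimes>\<^bsub>loc_ring R S\<^esub> L.fr b t = L.fr (a \<otimes> b) (s \<otimes> t)"
  using L.loc_smult_fr[OF assms(1,2) _ assms(4), of b] assms(3) by (simp add: loc_ring_simps)

lemma loc_ring_obtain:
  assumes "x \<in> carrier (loc_ring R S)"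
  obtains a s where "a \<in> carrier R" "s \<in> S" "x = L.fr a s"
  using assms by (auto simp: loc_ring_simps loc_module_simps)

lemma fr_ring_closed: "a \<in> carrier R \<Longrightarrow> s \<in> S \<Longrightarrow> L.fr a s \<in> carrier (loc_ring R S)"
  using L.fr_closed by (simp add: loc_ring_simps)

lemma loc_ring_add_fr_same:
  "a \<in> carrier R \<Longrightarrow> s \<in> S \<Longrightarrow> b \<in> carrier R \<Longrightarrow> L.fr a s \<oplus>\<^bsub>loc_ring R S\<^esub> L.fr b s = L.fr (a \<oplus> b) s"
  using L.loc_add_fr_same[of a s b] by (simp add: loc_ring_simps)

lemma cring_loc_ring: "cring (loc_ring R S)"
proof (rule cringI)
  interpret G: abelian_group "loc_module R S (self_module R)" by (rule L.abelian_group_loc)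
  show "abelian_group (loc_ring R S)"
    by (rule abelian_groupI) (auto simp: loc_ring_simps G.a_ac intro: G.l_neg)
  show "Group.comm_monoid (loc_ring R S)"
  proof (rule comm_monoidI)
    show "\<one>\<^bsub>loc_ring R S\<^esub> \<in> carrier (loc_ring R S)"
      unfolding loc_ring_simps(3) using S_one by (intro fr_ring_closed) auto
    fix x y assume "x \<in> carrier (loc_ring R S)" "y \<in> carrier (loc_ring R S)"
    then obtain a s b t where xy: "a \<in> carrier R" "s \<in> S" "x = L.fr a s" "b \<in> carrier R" "t \<in> S" "y = L.fr b t"
      by (meson loc_ring_obtain)
    then show "x \<otimes>\<^bsub>loc_ring R S\<^esub> y \<in> carrier (loc_ring R S)" "x \<otimes>\<^bsub>loc_ring R S\<^esub> y = y \<otimes>\<^bsub>loc_ring R S\<^esub> x"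
      using SR S_mult by (simp_all add: loc_ring_mult_fr fr_ring_closed m_comm)
    fix z assume "z \<in> carrier (loc_ring R S)"
    then obtain c r where z: "c \<in> carrier R" "r \<in> S" "z = L.fr c r" by (meson loc_ring_obtain)
    show "x \<otimes>\<^bsub>loc_ring R S\<^esub> y \<otimes>\<^bsub>loc_ring R S\<^esub> z = x \<otimes>\<^bsub>loc_ring R S\<^esub> (y \<otimes>\<^bsub>loc_ring R S\<^esub> z)"
      using xy z SR S_mult by (simp add: loc_ring_mult_fr m_assoc)
  next
    fix x assume "x \<in> carrier (loc_ring R S)"
    then obtain a s where x: "a \<in> carrier R" "s \<in> S" "x = L.fr a s" by (meson loc_ring_obtain)
    then show "\<one>\<^bsub>loc_ring R S\<^esub> \<otimes>\<^bsub>loc_ring R S\<^esub> x = x"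
      using SR S_one by (simp add: loc_ring_mult_fr loc_ring_simps(3))
  qed
  fix x y z assume xy: "x \<in> carrier (loc_ring R S)" "y \<in> carrier (loc_ring R S)" and z: "z \<in> carrier (loc_ring R S)"
  from L.loc_common[OF xy[unfolded loc_ring_simps(1)]] obtain a b s
    where ab: "a \<in> carrier R" "b \<in> carrier R" "s \<in> S" "x = L.fr a s" "y = L.fr b s" by auto
  from z obtain c r where c: "c \<in> carrier R" "r \<in> S" "z = L.fr c r" by (meson loc_ring_obtain)
  show "(x \<oplus>\<^bsub>loc_ring R S\<^esub> y) \<otimes>\<^bsub>loc_ring R S\<^esub> z = x \<otimes>\<^bsub>loc_ring R S\<^esub> z \<oplus>\<^bsub>loc_ring R S\<^esub> y \<otimes>\<^bsub>loc_ring R S\<^esub> z"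
    using ab c SR S_mult by (simp add: loc_ring_add_fr_same loc_ring_mult_fr l_distr)
qed

lemma fr_ring_eq_iff:
  assumes "a \<in> carrier R" "s \<in> S" "b \<in> carrier R" "t \<in> S"
  shows "L.fr a s = L.fr b t \<longleftrightarrow> (\<exists>u\<in>S. u \<otimes> (t \<otimes> a) = u \<otimes> (s \<otimes> b))"
  using L.fr_eq_iff[of a s b t] assms by simp

text \<open>Conditions stable under multiples are met simultaneously by the product of the
  individual witnesses. Denominators of finitely many fractions are always cleared in this
  way.\<close>

lemma common_multiple:
  assumes "finite K" "\<And>k. k \<in> K \<Longrightarrow> \<exists>t\<in>S. Q k t"
    and "\<And>k t r. k \<in> K \<Longrightarrow> t \<in> S \<Longrightarrow> r \<in> S \<Longrightarrow> Q k t \<Longrightarrow> Q k (r \<otimes> t)"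
  shows "\<exists>t\<in>S. \<forall>k\<in>K. Q k t"
  using assms
proof (induction K rule: finite_induct)
  case empty
  then show ?case using S_one by auto
next
  case (insert x K)
  then have "\<exists>t\<in>S. \<forall>k\<in>K. Q k t" by blast
  then obtain t where t: "t \<in> S" "\<forall>k\<in>K. Q k t" by blast
  obtain r where r: "r \<in> S" "Q x r" using insert.prems(1)[of x] by blast
  have "Q k (r \<otimes> t)" if "k \<in> K" for k using insert.prems(2)[of k t r] t r that by blast
  moreover have "Q x (r \<otimes> t)"
    using insert.prems(2)[of x r t] t r SR m_comm[of t r] by auto
  ultimately show ?case using S_mult[OF r(1) t(1)] by blast
qed

end

context localization
begin

lemma fr_minus: "m \<in> carrier M \<Longrightarrow> s \<in> S \<Longrightarrow> \<ominus>\<^bsub>loc\<^esub> fr m s = fr (\<ominus>\<^bsub>M\<^esub> m) s"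
proof -
  assume ms: "m \<in> carrier M" "s \<in> S"
  interpret G: abelian_group loc by (rule abelian_group_loc)
  show ?thesis
    by (rule G.minus_equality) (use ms loc_zero in \<open>auto simp: loc_add_fr_same M.M.l_neg fr_closed\<close>)
qed

lemma fr_hom: "(\<lambda>m. fr m \<one>) \<in> hom (add_monoid M) (add_monoid loc)"
  using S_one by (intro homI) (simp_all add: fr_closed loc_add_fr_same)

end

section \<open>Generic freeness and generic splitting\<close>

context localization
begin

text \<open>\<open>m b\<close> is a numerator of the basis element \<open>b\<close> of \<open>S\<^sup>-\<^sup>1M\<close>; spanning and independence are
  stated with denominators cleared.\<close>

lemma free_localization:
  assumes free: "free_module (loc_ring R S) loc"
  obtains B :: "('b \<times> 'a) set set" and m where "\<And>b. b \<in> B \<Longrightarrow> m b \<in> carrier M"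
    "\<And>y. y \<in> carrier M \<Longrightarrow> \<exists>t\<in>S. \<exists>A c. finite A \<and> A \<subseteq> B \<and> c \<in> B \<rightarrow> carrier R \<and> (\<forall>b\<in>B - A. c b = \<zero>)
        \<and> t \<odot>\<^bsub>M\<^esub> y = (\<Oplus>\<^bsub>M\<^esub>b\<in>A. c b \<odot>\<^bsub>M\<^esub> m b)"
    "\<And>A d. finite A \<Longrightarrow> A \<subseteq> B \<Longrightarrow> d \<in> A \<rightarrow> carrier R \<Longrightarrow> (\<Oplus>\<^bsub>M\<^esub>b\<in>A. d b \<odot>\<^bsub>M\<^esub> m b) = \<zero>\<^bsub>M\<^esub>
        \<Longrightarrow> \<exists>t\<in>S. \<forall>b\<in>A. t \<otimes> d b = \<zero>"
proof -
  interpret G: abelian_group loc by (rule abelian_group_loc)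
  obtain B where B: "B \<subseteq> carrier loc" "mod_span (loc_ring R S) loc B = carrier loc" "lin_indep (loc_ring R S) loc B"
    using free unfolding free_module_def by blast
  have "\<forall>b. \<exists>m s. b \<in> B \<longrightarrow> m \<in> carrier M \<and> s \<in> S \<and> b = fr m s"
    using B(1) unfolding loc_module_simps by blast
  then obtain m s where ms: "\<And>b. b \<in> B \<Longrightarrow> m b \<in> carrier M" "\<And>b. b \<in> B \<Longrightarrow> s b \<in> S" "\<And>b. b \<in> B \<Longrightarrow> b = fr (m b) (s b)"
    by metis
  \<comment> \<open>The coefficients are given on all of \<open>B\<close> and vanish off
    \<open>A\<close>, so the support can be enlarged before two combinations are added.\<close>
  define comb where "comb A t y \<longleftrightarrow> (\<exists>c. c \<in> B \<rightarrow> carrier R \<and> (\<forall>b\<in>B - A. c b = \<zero>)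
     \<and> t \<odot>\<^bsub>M\<^esub> y = (\<Oplus>\<^bsub>M\<^esub>b\<in>A. c b \<odot>\<^bsub>M\<^esub> m b))" for A t y
  have comb_mono: "comb A' t y" if "comb A t y" "A \<subseteq> A'" "A' \<subseteq> B" "finite A'" for A A' t y
  proof -
    note h = that
    obtain c where c: "c \<in> B \<rightarrow> carrier R" "\<forall>b\<in>B - A. c b = \<zero>" "t \<odot>\<^bsub>M\<^esub> y = (\<Oplus>\<^bsub>M\<^esub>b\<in>A. c b \<odot>\<^bsub>M\<^esub> m b)"
      using h(1) unfolding comb_def by blast
    have "(\<Oplus>\<^bsub>M\<^esub>b\<in>A. c b \<odot>\<^bsub>M\<^esub> m b) = (\<Oplus>\<^bsub>M\<^esub>b\<in>A'. c b \<odot>\<^bsub>M\<^esub> m b)"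
    proof (rule M.M.add.finprod_mono_neutral_cong_left[OF that(4,2)])
      have cl: "c b \<in> carrier R" "m b \<in> carrier M" if "b \<in> A'" for b
        using c(1) ms(1) h(3) that by auto
      then show "(\<lambda>b. c b \<odot>\<^bsub>M\<^esub> m b) \<in> A' \<rightarrow> carrier M" by auto
      show "c b \<odot>\<^bsub>M\<^esub> m b = \<zero>\<^bsub>M\<^esub>" if "b \<in> A' - A" for b
        using c(2) cl that h(3) by auto
    qed auto
    then show ?thesis unfolding comb_def using c that(2) by (intro exI[of _ c]) auto
  qed
  have comb_smult: "comb A (r \<otimes> t) y"
    if "comb A t y" "r \<in> carrier R" "A \<subseteq> B" "finite A" "t \<in> carrier R" "y \<in> carrier M" for A t y r
  proof -
    note h = that
    obtain c where c: "c \<in> B \<rightarrow> carrier R" "\<forall>b\<in>B - A. c b = \<zero>" "t \<odot>\<^bsub>M\<^esub> y = (\<Oplus>\<^bsub>M\<^esub>b\<in>A. c b \<odot>\<^bsub>M\<^esub> m b)"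
      using h(1) unfolding comb_def by blast
    have cl: "\<And>b. b \<in> A \<Longrightarrow> c b \<in> carrier R" "\<And>b. b \<in> A \<Longrightarrow> m b \<in> carrier M" using c(1) ms(1) that(3) by auto
    have "(r \<otimes> t) \<odot>\<^bsub>M\<^esub> y = r \<odot>\<^bsub>M\<^esub> (\<Oplus>\<^bsub>M\<^esub>b\<in>A. c b \<odot>\<^bsub>M\<^esub> m b)" using that c(3) by (simp add: M.smult_assoc1)
    also have "\<dots> = (\<Oplus>\<^bsub>M\<^esub>b\<in>A. r \<odot>\<^bsub>M\<^esub> (c b \<odot>\<^bsub>M\<^esub> m b))"
      by (rule M.finsum_smult_ldistr) (use that cl in auto)
    also have "\<dots> = (\<Oplus>\<^bsub>M\<^esub>b\<in>A. (r \<otimes> c b) \<odot>\<^bsub>M\<^esub> m b)"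
      by (rule M.M.finsum_cong') (use that cl in \<open>auto simp: M.smult_assoc1\<close>)
    finally show ?thesis unfolding comb_def using c that(2) by (intro exI[of _ "\<lambda>b. r \<otimes> c b"]) auto
  qed
  have comb_swap: "comb A t (r \<odot>\<^bsub>M\<^esub> y)"
    if "comb A (r \<otimes> t) y" "r \<in> carrier R" "t \<in> carrier R" "y \<in> carrier M" for A t y r
    using that by (simp add: comb_def M.smult_assoc1[symmetric] m_comm)
  have comb_add: "comb A t (y \<oplus>\<^bsub>M\<^esub> y')"
    if "comb A t y" "comb A t y'" "A \<subseteq> B" "t \<in> carrier R" "y \<in> carrier M" "y' \<in> carrier M" for A t y y'
  proof -
    note h = that
    obtain c where c: "c \<in> B \<rightarrow> carrier R" "\<forall>b\<in>B - A. c b = \<zero>" "t \<odot>\<^bsub>M\<^esub> y = (\<Oplus>\<^bsub>M\<^esub>b\<in>A. c b \<odot>\<^bsub>M\<^esub> m b)"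
      using h(1) unfolding comb_def by blast
    obtain c' where c': "c' \<in> B \<rightarrow> carrier R" "\<forall>b\<in>B - A. c' b = \<zero>" "t \<odot>\<^bsub>M\<^esub> y' = (\<Oplus>\<^bsub>M\<^esub>b\<in>A. c' b \<odot>\<^bsub>M\<^esub> m b)"
      using h(2) unfolding comb_def by blast
    have cl: "\<And>b. b \<in> A \<Longrightarrow> c b \<in> carrier R" "\<And>b. b \<in> A \<Longrightarrow> c' b \<in> carrier R" "\<And>b. b \<in> A \<Longrightarrow> m b \<in> carrier M"
      using c(1) c'(1) ms(1) that(3) by auto
    have "t \<odot>\<^bsub>M\<^esub> (y \<oplus>\<^bsub>M\<^esub> y') = (\<Oplus>\<^bsub>M\<^esub>b\<in>A. c b \<odot>\<^bsub>M\<^esub> m b) \<oplus>\<^bsub>M\<^esub> (\<Oplus>\<^bsub>M\<^esub>b\<in>A. c' b \<odot>\<^bsub>M\<^esub> m b)"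
      using that c(3) c'(3) by (simp add: M.smult_r_distr)
    also have "\<dots> = (\<Oplus>\<^bsub>M\<^esub>b\<in>A. c b \<odot>\<^bsub>M\<^esub> m b \<oplus>\<^bsub>M\<^esub> c' b \<odot>\<^bsub>M\<^esub> m b)"
      by (rule M.M.finsum_addf[symmetric]) (use cl in auto)
    also have "\<dots> = (\<Oplus>\<^bsub>M\<^esub>b\<in>A. (c b \<oplus> c' b) \<odot>\<^bsub>M\<^esub> m b)"
      by (rule M.M.finsum_cong') (use cl in \<open>auto simp: M.smult_l_distr\<close>)
    finally show ?thesis unfolding comb_def using c c' by (intro exI[of _ "\<lambda>b. c b \<oplus> c' b"]) auto
  qed
  \<comment> \<open>Elements with a multiple by \<open>S\<close> in the span of the numerators.
    Their fractions form a submodule that contains the basis, hence exhaust the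
    localization.\<close>
  define L where "L = {y \<in> carrier M. \<exists>t\<in>S. \<exists>A. finite A \<and> A \<subseteq> B \<and> comb A t y}"
  have L_add: "y \<oplus>\<^bsub>M\<^esub> y' \<in> L" if "y \<in> L" "y' \<in> L" for y y'
  proof -
    obtain t A where t: "t \<in> S" "finite A" "A \<subseteq> B" "comb A t y" "y \<in> carrier M" using \<open>y \<in> L\<close>
      by (auto simp: L_def)
    obtain t' A' where t': "t' \<in> S" "finite A'" "A' \<subseteq> B" "comb A' t' y'" "y' \<in> carrier M" using \<open>y' \<in> L\<close>
      by (auto simp: L_def)
    have "comb (A \<union> A') (t' \<otimes> t) y" by (rule comb_smult[OF comb_mono[OF t(4)]]) (use t t' SR in auto)
    moreover have "comb (A \<union> A') (t \<otimes> t') y'"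
      by (rule comb_smult[OF comb_mono[OF t'(4)]]) (use t t' SR in auto)
    ultimately have "comb (A \<union> A') (t \<otimes> t') (y \<oplus>\<^bsub>M\<^esub> y')"
      using comb_add[of "A \<union> A'" "t \<otimes> t'" y y'] t t' SR by (simp add: m_comm)
    then show ?thesis unfolding L_def using t t' S_mult
      by (intro CollectI conjI bexI[of _ "t \<otimes> t'"] exI[of _ "A \<union> A'"]) auto
  qed
  have L_smult: "r \<odot>\<^bsub>M\<^esub> y \<in> L" if "r \<in> carrier R" "y \<in> L" for r y
  proof -
    obtain t A where t: "t \<in> S" "finite A" "A \<subseteq> B" "comb A t y" "y \<in> carrier M" using \<open>y \<in> L\<close>
      by (auto simp: L_def)
    have "comb A t (r \<odot>\<^bsub>M\<^esub> y)"
      by (rule comb_swap[OF comb_smult[OF t(4)]]) (use t that SR in auto)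
    then show ?thesis unfolding L_def using t that by blast
  qed
  have L_zero: "\<zero>\<^bsub>M\<^esub> \<in> L"
  proof -
    have "comb {} \<one> \<zero>\<^bsub>M\<^esub>" unfolding comb_def by (intro exI[of _ "\<lambda>_. \<zero>"]) auto
    then show ?thesis unfolding L_def using S_one by blast
  qed
  have L_m: "m b \<in> L" if b: "b \<in> B" for b
  proof -
    have "comb {b} \<one> (m b)"
      unfolding comb_def using ms(1)[OF b] by (intro exI[of _ "\<lambda>x. if x = b then \<one> else \<zero>"]) auto
    then show ?thesis unfolding L_def using S_one ms(1)[OF b] b by blast
  qed
  have L_car: "y \<in> carrier M" if "y \<in> L" for y using that by (simp add: L_def)
  define H where "H = {fr y s | y s. y \<in> L \<and> s \<in> S}"
  have HI: "fr y s \<in> H" if "y \<in> L" "s \<in> S" for y s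
    using that unfolding H_def by blast
  have "submodule H (loc_ring R S) loc"
  proof (intro submodule.intro subgroup.intro submodule_axioms.intro)
    show "H \<subseteq> carrier (add_monoid loc)" unfolding H_def using L_car fr_closed by auto
  next
    fix x y assume "x \<in> H" "y \<in> H"
    then obtain p s q t where pq: "p \<in> L" "s \<in> S" "x = fr p s" "q \<in> L" "t \<in> S" "y = fr q t"
      unfolding H_def by blast
    then have "x \<oplus>\<^bsub>loc\<^esub> y = fr (t \<odot>\<^bsub>M\<^esub> p \<oplus>\<^bsub>M\<^esub> s \<odot>\<^bsub>M\<^esub> q) (s \<otimes> t)" using L_car by (simp add: loc_add_fr)
    then show "x \<otimes>\<^bsub>add_monoid loc\<^esub> y \<in> H"
      using HI[OF L_add[OF L_smult L_smult] S_mult] pq SR by simp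
  next
    show "\<one>\<^bsub>add_monoid loc\<^esub> \<in> H" using HI[OF L_zero S_one] by (simp add: loc_module_simps(2))
  next
    fix x assume "x \<in> H"
    then obtain p s where p: "p \<in> L" "s \<in> S" "x = fr p s" unfolding H_def by blast
    have "\<ominus>\<^bsub>M\<^esub> p = (\<ominus> \<one>) \<odot>\<^bsub>M\<^esub> p" using L_car[OF p(1)] by (simp add: M.smult_l_minus)
    then have "\<ominus>\<^bsub>M\<^esub> p \<in> L" using L_smult[OF _ p(1), of "\<ominus> \<one>"] by simp
    then show "inv\<^bsub>add_monoid loc\<^esub> x \<in> H"
      using fr_minus[OF L_car[OF p(1)] p(2)] HI[OF _ p(2)] p(3) unfolding a_inv_def by metis
  next
    fix c x assume "c \<in> carrier (loc_ring R S)" "x \<in> H"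
    moreover from this(2) obtain p t where p: "p \<in> L" "t \<in> S" "x = fr p t" unfolding H_def by blast
    moreover from calculation(1) obtain a s where c: "a \<in> carrier R" "s \<in> S" "c = L.fr a s"
      by (meson loc_ring_obtain)
    ultimately have "c \<odot>\<^bsub>loc\<^esub> x = fr (a \<odot>\<^bsub>M\<^esub> p) (s \<otimes> t)" using L_car by (simp add: loc_smult_fr)
    then show "c \<odot>\<^bsub>loc\<^esub> x \<in> H" using HI[OF L_smult[OF c(1) p(1)] S_mult[OF c(2) p(2)]] by simp
  qed
  moreover have "B \<subseteq> H" unfolding H_def using ms L_m by blast
  ultimately have HL: "carrier loc \<subseteq> H" unfolding B(2)[symmetric] mod_span_def by blast
  have span: "\<exists>t\<in>S. \<exists>A. finite A \<and> A \<subseteq> B \<and> comb A t y" if y: "y \<in> carrier M" for y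
  proof -
    have "fr y \<one> \<in> H" using HL fr_closed[OF y S_one] by blast
    then obtain p s where p: "p \<in> L" "s \<in> S" "fr y \<one> = fr p s" unfolding H_def by blast
    then obtain u where u: "u \<in> S" "u \<odot>\<^bsub>M\<^esub> (s \<odot>\<^bsub>M\<^esub> y) = u \<odot>\<^bsub>M\<^esub> (\<one> \<odot>\<^bsub>M\<^esub> p)"
      using fr_eq_iff[OF y S_one L_car[OF p(1)] p(2)] by blast
    have "u \<odot>\<^bsub>M\<^esub> p \<in> L" using L_smult p(1) u(1) SR by blast
    then have "u \<odot>\<^bsub>M\<^esub> (s \<odot>\<^bsub>M\<^esub> y) \<in> L" using u(2) L_car[OF p(1)] by simp
    then obtain t A where t: "t \<in> S" "finite A" "A \<subseteq> B" "comb A t (u \<odot>\<^bsub>M\<^esub> (s \<odot>\<^bsub>M\<^esub> y))" by (auto simp: L_def)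
    then have "comb A (t \<otimes> u \<otimes> s) y"
      using u(1) p(2) y SR by (simp add: comb_def M.smult_assoc1)
    then show ?thesis using t(2,3) S_mult[OF S_mult[OF t(1) u(1)] p(2)] by blast
  qed
  have indep: "\<exists>t\<in>S. \<forall>b\<in>A. t \<otimes> d b = \<zero>"
    if A: "finite A" "A \<subseteq> B" "d \<in> A \<rightarrow> carrier R" "(\<Oplus>\<^bsub>M\<^esub>b\<in>A. d b \<odot>\<^bsub>M\<^esub> m b) = \<zero>\<^bsub>M\<^esub>" for A d
  proof -
    have mA: "b \<in> A \<Longrightarrow> m b \<in> carrier M" "b \<in> A \<Longrightarrow> s b \<in> S" "b \<in> A \<Longrightarrow> s b \<in> carrier R" "b \<in> A \<Longrightarrow> d b \<in> carrier R" for b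
      using A ms SR by auto
    \<comment> \<open>Multiplying the coefficient of \<open>b\<close> by its denominator
      \<open>s b\<close> converts a relation among numerators into one among basis elements.\<close>
    let ?e = "\<lambda>b. L.fr (d b \<otimes> s b) \<one>"
    have eb: "?e b \<odot>\<^bsub>loc\<^esub> b = fr (d b \<odot>\<^bsub>M\<^esub> m b) \<one>" if b: "b \<in> A" for b
    proof -
      have "?e b \<odot>\<^bsub>loc\<^esub> fr (m b) (s b) = fr ((d b \<otimes> s b) \<odot>\<^bsub>M\<^esub> m b) (\<one> \<otimes> s b)"
        by (rule loc_smult_fr) (use mA[OF b] S_one in auto)
      also have "\<dots> = fr (s b \<odot>\<^bsub>M\<^esub> (d b \<odot>\<^bsub>M\<^esub> m b)) (s b \<otimes> \<one>)"
        using mA[OF b] by (simp add: M.smult_assoc1[symmetric] m_comm)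
      also have "\<dots> = fr (d b \<odot>\<^bsub>M\<^esub> m b) \<one>"
        by (rule fr_cancel) (use mA[OF b] S_one in auto)
      finally show ?thesis using ms(3)[of b] A(2) b by auto
    qed
    have "(\<Oplus>\<^bsub>loc\<^esub>b\<in>A. ?e b \<odot>\<^bsub>loc\<^esub> b) = (\<Oplus>\<^bsub>loc\<^esub>b\<in>A. fr (d b \<odot>\<^bsub>M\<^esub> m b) \<one>)"
      by (rule G.finsum_cong') (use eb mA S_one in \<open>auto intro: fr_closed\<close>)
    also have "\<dots> = fr (\<Oplus>\<^bsub>M\<^esub>b\<in>A. d b \<odot>\<^bsub>M\<^esub> m b) \<one>"
      using finprod_hom[OF M.M.a_comm_group G.a_comm_group fr_hom A(1), of "\<lambda>b. d b \<odot>\<^bsub>M\<^esub> m b"] mA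
      by (simp add: finsum_def)
    finally have "(\<Oplus>\<^bsub>loc\<^esub>b\<in>A. ?e b \<odot>\<^bsub>loc\<^esub> b) = \<zero>\<^bsub>loc\<^esub>"
      by (simp add: A(4) loc_zero[OF S_one])
    moreover have "?e \<in> A \<rightarrow> carrier (loc_ring R S)"
      using mA S_one by (auto intro: fr_ring_closed)
    ultimately have e0: "\<forall>b\<in>A. ?e b = \<zero>\<^bsub>loc_ring R S\<^esub>"
      using B(3) A(1,2) unfolding lin_indep_def by blast
    have "\<exists>t\<in>S. t \<otimes> d b = \<zero>" if b: "b \<in> A" for b
    proof -
      have "L.fr (d b \<otimes> s b) \<one> = L.fr \<zero> \<one>"
        using e0 b by (simp add: loc_ring_simps loc_module_simps)
      then obtain u where u: "u \<in> S" "u \<otimes> (\<one> \<otimes> (d b \<otimes> s b)) = u \<otimes> (\<one> \<otimes> \<zero>)"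
        using fr_ring_eq_iff[of "d b \<otimes> s b" \<one> \<zero> \<one>] mA[OF b] S_one by auto
      then have "(u \<otimes> s b) \<otimes> d b = \<zero>"
        using mA[OF b] SR[OF u(1)] by (simp add: m_ac)
      then show ?thesis using S_mult[OF u(1)] mA(2)[OF b] by blast
    qed
    then show ?thesis
      using mA SR by (intro common_multiple[OF A(1)]) (auto simp: m_assoc)
  qed
  show ?thesis
  proof (rule that[of B m])
    fix y assume "y \<in> carrier M"
    from span[OF this] obtain t A where t: "t \<in> S" "finite A" "A \<subseteq> B" "comb A t y" by blast
    from t(4) obtain c where "c \<in> B \<rightarrow> carrier R" "\<forall>b\<in>B - A. c b = \<zero>" "t \<odot>\<^bsub>M\<^esub> y = (\<Oplus>\<^bsub>M\<^esub>b\<in>A. c b \<odot>\<^bsub>M\<^esub> m b)"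
      unfolding comb_def by blast
    with t(1-3) show "\<exists>t\<in>S. \<exists>A c. finite A \<and> A \<subseteq> B \<and> c \<in> B \<rightarrow> carrier R \<and> (\<forall>b\<in>B - A. c b = \<zero>)
        \<and> t \<odot>\<^bsub>M\<^esub> y = (\<Oplus>\<^bsub>M\<^esub>b\<in>A. c b \<odot>\<^bsub>M\<^esub> m b)"
      by blast
  qed (rule ms(1) indep; assumption)+
qed

end

lemma mod_hom_finsum_pointwise:
  assumes N: "module R N" and "finite A" and f: "\<And>b. b \<in> A \<Longrightarrow> f b \<in> mod_hom R M N"
  shows "(\<lambda>x. \<Oplus>\<^bsub>N\<^esub>b\<in>A. f b x) \<in> mod_hom R M N"
proof (rule mod_homI)
  interpret N: module R N by fact
  have cl: "(\<lambda>b. f b x) \<in> A \<rightarrow> carrier N" if "x \<in> carrier M" for x using mod_hom_closed[OF f that] by auto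
  fix x assume x: "x \<in> carrier M"
  show "(\<Oplus>\<^bsub>N\<^esub>b\<in>A. f b x) \<in> carrier N" using cl[OF x] by (rule N.M.finsum_closed)
  fix y assume y: "y \<in> carrier M"
  have "(\<Oplus>\<^bsub>N\<^esub>b\<in>A. f b (x \<oplus>\<^bsub>M\<^esub> y)) = (\<Oplus>\<^bsub>N\<^esub>b\<in>A. f b x \<oplus>\<^bsub>N\<^esub> f b y)"
    using cl[OF x] cl[OF y] by (intro N.M.finsum_cong') (auto simp: mod_hom_add[OF f x y])
  then show "(\<Oplus>\<^bsub>N\<^esub>b\<in>A. f b (x \<oplus>\<^bsub>M\<^esub> y)) = (\<Oplus>\<^bsub>N\<^esub>b\<in>A. f b x) \<oplus>\<^bsub>N\<^esub> (\<Oplus>\<^bsub>N\<^esub>b\<in>A. f b y)"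
    using N.M.finsum_addf[OF cl[OF x] cl[OF y]] by simp
next
  interpret N: module R N by fact
  fix a x assume ax: "a \<in> carrier R" "x \<in> carrier M"
  have cl: "(\<lambda>b. f b x) \<in> A \<rightarrow> carrier N" using mod_hom_closed[OF f ax(2)] by auto
  have "(\<Oplus>\<^bsub>N\<^esub>b\<in>A. f b (a \<odot>\<^bsub>M\<^esub> x)) = (\<Oplus>\<^bsub>N\<^esub>b\<in>A. a \<odot>\<^bsub>N\<^esub> f b x)"
    using cl ax(1) by (intro N.M.finsum_cong') (auto simp: mod_hom_smult[OF f ax])
  then show "(\<Oplus>\<^bsub>N\<^esub>b\<in>A. f b (a \<odot>\<^bsub>M\<^esub> x)) = a \<odot>\<^bsub>N\<^esub> (\<Oplus>\<^bsub>N\<^esub>b\<in>A. f b x)"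
    using N.finsum_smult_ldistr[OF \<open>finite A\<close> ax(1) cl] by simp
qed

text \<open>After localization \<open>\<epsilon>\<close> maps onto a free module and splits. With
  denominators cleared, a section followed back from \<open>\<epsilon>\<close> becomes an
  endomorphism \<open>\<rho>\<close> of R^n that acts on M as a scalar from \<open>S\<close>; it is
  built from lifts of finitely many basis numerators.\<close>

lemma (in localization) local_splitting:
  assumes free: "free_module (loc_ring R S) loc"
    and \<epsilon>: "\<epsilon> \<in> mod_hom R (free_mod R n) M" and surj: "\<epsilon> ` carrier (free_mod R n) = carrier M"
    and A: "A \<in> mod_hom R (free_mod R p) (free_mod R n)" and \<epsilon>A: "\<And>x. x \<in> carrier (free_mod R p) \<Longrightarrow> \<epsilon> (A x) = \<zero>\<^bsub>M\<^esub>"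
  shows "\<exists>s\<in>S. \<exists>\<rho>\<in>mod_hom R (free_mod R n) (free_mod R n).
     (\<forall>x\<in>carrier (free_mod R p). \<rho> (A x) = \<zero>\<^bsub>free_mod R n\<^esub>) \<and> (\<forall>x\<in>carrier (free_mod R n). \<epsilon> (\<rho> x) = s \<odot>\<^bsub>M\<^esub> \<epsilon> x)"
proof -
  interpret F: module R "free_mod R n" by (rule module_free_mod[OF is_cring])
  interpret Fp: module R "free_mod R p" by (rule module_free_mod[OF is_cring])
  note Se = module_self[OF is_cring]
  have u: "unit_vec R k j \<in> carrier (free_mod R k)" for k j by (rule unit_vec_closed[OF is_cring])
  from free_localization[OF free] obtain B :: "('b \<times> 'a) set set" and m where
    m: "\<And>b. b \<in> B \<Longrightarrow> m b \<in> carrier M"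
    and span: "\<And>y. y \<in> carrier M \<Longrightarrow> \<exists>t\<in>S. \<exists>A c. finite A \<and> A \<subseteq> B \<and> c \<in> B \<rightarrow> carrier R \<and> (\<forall>b\<in>B - A. c b = \<zero>)
        \<and> t \<odot>\<^bsub>M\<^esub> y = (\<Oplus>\<^bsub>M\<^esub>b\<in>A. c b \<odot>\<^bsub>M\<^esub> m b)"
    and indep: "\<And>A d. finite A \<Longrightarrow> A \<subseteq> B \<Longrightarrow> d \<in> A \<rightarrow> carrier R \<Longrightarrow> (\<Oplus>\<^bsub>M\<^esub>b\<in>A. d b \<odot>\<^bsub>M\<^esub> m b) = \<zero>\<^bsub>M\<^esub>
        \<Longrightarrow> \<exists>t\<in>S. \<forall>b\<in>A. t \<otimes> d b = \<zero>" by blast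
  let ?g = "\<lambda>j. \<epsilon> (unit_vec R n j)"
  have g: "?g j \<in> carrier M" for j by (rule mod_hom_closed[OF \<epsilon> u])
  obtain t0 A0 c0 where tac: "\<And>j. t0 j \<in> S" "\<And>j. finite (A0 j)" "\<And>j. A0 j \<subseteq> B" "\<And>j. c0 j \<in> B \<rightarrow> carrier R"
    "\<And>j. \<forall>b\<in>B - A0 j. c0 j b = \<zero>" "\<And>j. t0 j \<odot>\<^bsub>M\<^esub> ?g j = (\<Oplus>\<^bsub>M\<^esub>b\<in>A0 j. c0 j b \<odot>\<^bsub>M\<^esub> m b)"
  proof -
    define Z where "Z j t A c \<longleftrightarrow> t \<in> S \<and> finite A \<and> A \<subseteq> B \<and> c \<in> B \<rightarrow> carrier R \<and> (\<forall>b\<in>B - A. c b = \<zero>)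
        \<and> t \<odot>\<^bsub>M\<^esub> ?g j = (\<Oplus>\<^bsub>M\<^esub>b\<in>A. c b \<odot>\<^bsub>M\<^esub> m b)" for j t A c
    have "\<exists>t A c. Z j t A c" for j
      using span[OF g[of j]] unfolding Z_def by blast
    then obtain t0 A0 c0 where "\<And>j. Z j (t0 j) (A0 j) (c0 j)" by metis
    then show ?thesis using that[of t0 A0 c0] unfolding Z_def by blast
  qed
  define K where "K = (\<Union>j\<in>{..<n}. A0 j)"
  have K: "finite K" "K \<subseteq> B" unfolding K_def using tac(2,3) by auto
  have mK: "b \<in> K \<Longrightarrow> m b \<in> carrier M" for b using m K(2) by auto
  have "\<exists>t\<in>S. \<forall>j\<in>{..<n}. \<exists>c. c \<in> K \<rightarrow> carrier R \<and> t \<odot>\<^bsub>M\<^esub> ?g j = (\<Oplus>\<^bsub>M\<^esub>b\<in>K. c b \<odot>\<^bsub>M\<^esub> m b)"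
  proof (rule common_multiple)
    fix j assume j: "j \<in> {..<n}"
    have sub: "A0 j \<subseteq> K" unfolding K_def using j by auto
    have cK: "b \<in> K \<Longrightarrow> c0 j b \<in> carrier R" for b using tac(4)[of j] K(2) by auto
    have "(\<Oplus>\<^bsub>M\<^esub>b\<in>A0 j. c0 j b \<odot>\<^bsub>M\<^esub> m b) = (\<Oplus>\<^bsub>M\<^esub>b\<in>K. c0 j b \<odot>\<^bsub>M\<^esub> m b)"
    proof (rule M.M.add.finprod_mono_neutral_cong_left[OF K(1) sub])
      show "(\<lambda>b. c0 j b \<odot>\<^bsub>M\<^esub> m b) \<in> K \<rightarrow> carrier M" using cK mK by auto
      show "c0 j b \<odot>\<^bsub>M\<^esub> m b = \<zero>\<^bsub>M\<^esub>" if "b \<in> K - A0 j" for b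
        using tac(5)[of j] that K(2) mK[of b] by auto
    qed auto
    then show "\<exists>t\<in>S. \<exists>c. c \<in> K \<rightarrow> carrier R \<and> t \<odot>\<^bsub>M\<^esub> ?g j = (\<Oplus>\<^bsub>M\<^esub>b\<in>K. c b \<odot>\<^bsub>M\<^esub> m b)"
      using tac(1,6)[of j] cK by (intro bexI[of _ "t0 j"] exI[of _ "c0 j"]) auto
  next
    fix j t r assume t: "t \<in> S" "r \<in> S" and ex: "\<exists>c. c \<in> K \<rightarrow> carrier R \<and> t \<odot>\<^bsub>M\<^esub> ?g j = (\<Oplus>\<^bsub>M\<^esub>b\<in>K. c b \<odot>\<^bsub>M\<^esub> m b)"
    then obtain c where c: "c \<in> K \<rightarrow> carrier R" "t \<odot>\<^bsub>M\<^esub> ?g j = (\<Oplus>\<^bsub>M\<^esub>b\<in>K. c b \<odot>\<^bsub>M\<^esub> m b)" by blast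
    have cK: "b \<in> K \<Longrightarrow> c b \<in> carrier R" for b using c(1) by auto
    have "(r \<otimes> t) \<odot>\<^bsub>M\<^esub> ?g j = r \<odot>\<^bsub>M\<^esub> (\<Oplus>\<^bsub>M\<^esub>b\<in>K. c b \<odot>\<^bsub>M\<^esub> m b)"
      using t g SR by (simp add: M.smult_assoc1 c(2))
    also have "\<dots> = (\<Oplus>\<^bsub>M\<^esub>b\<in>K. r \<odot>\<^bsub>M\<^esub> (c b \<odot>\<^bsub>M\<^esub> m b))"
      by (rule M.finsum_smult_ldistr[OF K(1)]) (use t SR cK mK in auto)
    also have "\<dots> = (\<Oplus>\<^bsub>M\<^esub>b\<in>K. (r \<otimes> c b) \<odot>\<^bsub>M\<^esub> m b)"
      by (rule M.M.finsum_cong') (use t SR cK mK in \<open>auto simp: M.smult_assoc1\<close>)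
    finally show "\<exists>c. c \<in> K \<rightarrow> carrier R \<and> (r \<otimes> t) \<odot>\<^bsub>M\<^esub> ?g j = (\<Oplus>\<^bsub>M\<^esub>b\<in>K. c b \<odot>\<^bsub>M\<^esub> m b)"
      using t SR cK by (intro exI[of _ "\<lambda>b. r \<otimes> c b"]) auto
  qed simp
  then obtain t where t: "t \<in> S"
    and "\<forall>j\<in>{..<n}. \<exists>c. c \<in> K \<rightarrow> carrier R \<and> t \<odot>\<^bsub>M\<^esub> ?g j = (\<Oplus>\<^bsub>M\<^esub>b\<in>K. c b \<odot>\<^bsub>M\<^esub> m b)" by blast
  then obtain c where c: "\<And>j b. j < n \<Longrightarrow> b \<in> K \<Longrightarrow> c j b \<in> carrier R"
    "\<And>j. j < n \<Longrightarrow> t \<odot>\<^bsub>M\<^esub> ?g j = (\<Oplus>\<^bsub>M\<^esub>b\<in>K. c j b \<odot>\<^bsub>M\<^esub> m b)"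
    by (auto simp: Ball_def lessThan_iff Pi_iff) metis
  have "\<forall>b. \<exists>w. b \<in> K \<longrightarrow> w \<in> carrier (free_mod R n) \<and> \<epsilon> w = m b"
    using mK surj by (metis imageE)
  then obtain w where w: "\<And>b. b \<in> K \<Longrightarrow> w b \<in> carrier (free_mod R n)" "\<And>b. b \<in> K \<Longrightarrow> \<epsilon> (w b) = m b" by metis
  \<comment> \<open>Up to denominators, the coordinate function of the basis element
    \<open>b\<close> composed with \<open>\<epsilon>\<close>. It is prescribed on unit vectors, so
    it is a homomorphism, but it may fail to vanish on the image of \<open>A\<close>.\<close>
  define \<delta> where "\<delta> b = lin_comb (self_module R) n (\<lambda>j. c j b)" for b
  have \<delta>: "\<delta> b \<in> mod_hom R (free_mod R n) (self_module R)" if "b \<in> K" for b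
    unfolding \<delta>_def using c(1) that by (intro lin_comb_hom[OF Se]) simp
  have \<delta>c: "\<delta> b x \<in> carrier R" if "b \<in> K" "x \<in> carrier (free_mod R n)" for b x
    using mod_hom_closed[OF \<delta>[OF that(1)] that(2)] by simp
  have \<delta>u: "\<delta> b (unit_vec R n j) = c j b" if "b \<in> K" "j < n" for b j
    unfolding \<delta>_def using c(1) that by (intro lin_comb_unit_vec[OF Se]) simp_all
  define \<rho> where "\<rho> x = (\<Oplus>\<^bsub>free_mod R n\<^esub>b\<in>K. \<delta> b x \<odot>\<^bsub>free_mod R n\<^esub> w b)" for x
  have \<rho>: "\<rho> \<in> mod_hom R (free_mod R n) (free_mod R n)"
    unfolding \<rho>_def
  proof (rule mod_hom_finsum_pointwise[OF F.module_axioms K(1)])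
    fix b assume b: "b \<in> K"
    show "(\<lambda>x. \<delta> b x \<odot>\<^bsub>free_mod R n\<^esub> w b) \<in> mod_hom R (free_mod R n) (free_mod R n)"
      by (rule mod_homI) (use b w(1)[OF b] \<delta>c[OF b] in
        \<open>auto simp: mod_hom_add[OF \<delta>[OF b]] mod_hom_smult[OF \<delta>[OF b]] F.smult_l_distr F.smult_assoc1\<close>)
  qed
  have \<epsilon>\<rho>: "\<epsilon> (\<rho> x) = (\<Oplus>\<^bsub>M\<^esub>b\<in>K. \<delta> b x \<odot>\<^bsub>M\<^esub> m b)" if x: "x \<in> carrier (free_mod R n)" for x
  proof -
    have "\<epsilon> (\<rho> x) = (\<Oplus>\<^bsub>M\<^esub>b\<in>K. \<epsilon> (\<delta> b x \<odot>\<^bsub>free_mod R n\<^esub> w b))"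
      unfolding \<rho>_def by (rule mod_hom_finsum[OF F.module_axioms M.module_axioms \<epsilon> K(1)]) (use \<delta>c x w in auto)
    also have "\<dots> = (\<Oplus>\<^bsub>M\<^esub>b\<in>K. \<delta> b x \<odot>\<^bsub>M\<^esub> m b)"
      by (rule M.M.finsum_cong') (use \<delta>c x w mK in \<open>auto simp: mod_hom_smult[OF \<epsilon>]\<close>)
    finally show ?thesis .
  qed
  have \<epsilon>\<rho>t: "\<epsilon> (\<rho> x) = t \<odot>\<^bsub>M\<^esub> \<epsilon> x" if x: "x \<in> carrier (free_mod R n)" for x
  proof (rule hom_free_ext[OF M.module_axioms mod_hom_comp[OF \<epsilon> \<rho>] mod_hom_scale[OF M.module_axioms \<epsilon> SR[OF t]] _ x])
    fix j assume j: "j < n"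
    show "\<epsilon> (\<rho> (unit_vec R n j)) = t \<odot>\<^bsub>M\<^esub> ?g j"
      unfolding \<epsilon>\<rho>[OF u] c(2)[OF j] by (rule M.M.finsum_cong') (use \<delta>u j c(1) mK in auto)
  qed
  \<comment> \<open>The coefficients at a column of \<open>A\<close> express zero in M, so
    independence lets an element of \<open>S\<close> kill them. One such element serves all columns
    and repairs \<open>\<rho>\<close>.\<close>
  have "\<exists>r\<in>S. \<forall>k\<in>{..<p}. r \<odot>\<^bsub>free_mod R n\<^esub> \<rho> (A (unit_vec R p k)) = \<zero>\<^bsub>free_mod R n\<^esub>"
  proof (rule common_multiple)
    fix k assume "k \<in> {..<p}"
    let ?x = "A (unit_vec R p k)"
    have x: "?x \<in> carrier (free_mod R n)" by (rule mod_hom_closed[OF A u])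
    have "(\<Oplus>\<^bsub>M\<^esub>b\<in>K. \<delta> b ?x \<odot>\<^bsub>M\<^esub> m b) = \<zero>\<^bsub>M\<^esub>"
      using \<epsilon>\<rho>[OF x] \<epsilon>\<rho>t[OF x] \<epsilon>A[OF u] SR[OF t] by simp
    then obtain r where r: "r \<in> S" "\<forall>b\<in>K. r \<otimes> \<delta> b ?x = \<zero>"
      using indep[OF K, of "\<lambda>b. \<delta> b ?x"] \<delta>c x by auto
    have "r \<odot>\<^bsub>free_mod R n\<^esub> \<rho> ?x = (\<Oplus>\<^bsub>free_mod R n\<^esub>b\<in>K. r \<odot>\<^bsub>free_mod R n\<^esub> (\<delta> b ?x \<odot>\<^bsub>free_mod R n\<^esub> w b))"
      unfolding \<rho>_def by (rule F.finsum_smult_ldistr[OF K(1) SR[OF r(1)]]) (use \<delta>c x w in auto)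
    also have "\<dots> = (\<Oplus>\<^bsub>free_mod R n\<^esub>b\<in>K. \<zero>\<^bsub>free_mod R n\<^esub>)"
      by (rule F.M.finsum_cong') (use \<delta>c x w r SR in \<open>auto simp: F.smult_assoc1[symmetric]\<close>)
    finally show "\<exists>r\<in>S. r \<odot>\<^bsub>free_mod R n\<^esub> \<rho> ?x = \<zero>\<^bsub>free_mod R n\<^esub>" using r(1) by auto
  next
    fix k r q assume "r \<in> S" "q \<in> S" "r \<odot>\<^bsub>free_mod R n\<^esub> \<rho> (A (unit_vec R p k)) = \<zero>\<^bsub>free_mod R n\<^esub>"
    then show "(q \<otimes> r) \<odot>\<^bsub>free_mod R n\<^esub> \<rho> (A (unit_vec R p k)) = \<zero>\<^bsub>free_mod R n\<^esub>"
      using mod_hom_closed[OF \<rho> mod_hom_closed[OF A u]] SR by (simp add: F.smult_assoc1)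
  qed simp
  then obtain r where r: "r \<in> S" "\<And>k. k < p \<Longrightarrow> r \<odot>\<^bsub>free_mod R n\<^esub> \<rho> (A (unit_vec R p k)) = \<zero>\<^bsub>free_mod R n\<^esub>"
    by auto
  let ?\<rho> = "\<lambda>x. r \<odot>\<^bsub>free_mod R n\<^esub> \<rho> x"
  have \<rho>r: "?\<rho> \<in> mod_hom R (free_mod R n) (free_mod R n)"
    by (rule mod_hom_scale[OF F.module_axioms \<rho> SR[OF r(1)]])
  have z: "(\<lambda>x. \<zero>\<^bsub>free_mod R n\<^esub>) \<in> mod_hom R (free_mod R p) (free_mod R n)"
    by (rule mod_homI) auto
  have "?\<rho> (A x) = \<zero>\<^bsub>free_mod R n\<^esub>" if x: "x \<in> carrier (free_mod R p)" for x
    by (rule hom_free_ext[OF F.module_axioms mod_hom_comp[OF \<rho>r A] z r(2) x])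
  moreover have "\<epsilon> (?\<rho> x) = (r \<otimes> t) \<odot>\<^bsub>M\<^esub> \<epsilon> x" if x: "x \<in> carrier (free_mod R n)" for x
    using mod_hom_smult[OF \<epsilon> SR[OF r(1)] mod_hom_closed[OF \<rho> x]] \<epsilon>\<rho>t[OF x] mod_hom_closed[OF \<epsilon> x] SR[OF r(1)] SR[OF t]
    by (simp add: M.smult_assoc1)
  ultimately show ?thesis
    by (intro bexI[OF _ S_mult[OF r(1) t]] bexI[OF _ \<rho>r] conjI ballI)
qed

lemma (in periodic) generic_splitting:
  assumes noeth: "noetherian_cring R" and gf: "generically_free R M"
  obtains a U W where "a \<in> nonzerodivisors R" "U \<in> mod_hom R (free_mod R n\<^sub>0) (free_mod R n\<^sub>1)"
    "W \<in> mod_hom R (free_mod R n\<^sub>1) (free_mod R n\<^sub>0)"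
    "\<And>x. x \<in> carrier (free_mod R n\<^sub>0) \<Longrightarrow> a \<odot>\<^bsub>free_mod R n\<^sub>0\<^esub> x = A (U x) \<oplus>\<^bsub>free_mod R n\<^sub>0\<^esub> W (B x)"
proof -
  note is_cring = M.is_cring
  interpret F0: module R "free_mod R n\<^sub>0" by (rule module_free_mod[OF is_cring])
  interpret F1: module R "free_mod R n\<^sub>1" by (rule module_free_mod[OF is_cring])
  interpret Se: module R "self_module R" by (rule module_self[OF is_cring])
  have epsA: "\<epsilon> (A x) = \<zero>\<^bsub>M\<^esub>" if "x \<in> carrier (free_mod R n\<^sub>1)" for x
    using A_image that by (auto simp: a_kernel_def')
  define G where "G s \<rho> \<longleftrightarrow> \<rho> \<in> mod_hom R (free_mod R n\<^sub>0) (free_mod R n\<^sub>0)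
     \<and> (\<forall>x\<in>carrier (free_mod R n\<^sub>1). \<rho> (A x) = \<zero>\<^bsub>free_mod R n\<^sub>0\<^esub>) \<and> (\<forall>x\<in>carrier (free_mod R n\<^sub>0). \<epsilon> (\<rho> x) = s \<odot>\<^bsub>M\<^esub> \<epsilon> x)" for s \<rho>
  \<comment> \<open>An ideal, because the admissible endomorphisms can be scaled and added.\<close>
  define J where "J = {s \<in> carrier R. \<exists>\<rho>. G s \<rho>}"
  have ec: "x \<in> carrier (free_mod R n\<^sub>0) \<Longrightarrow> \<epsilon> x \<in> carrier M" for x by (rule mod_hom_closed[OF eps])
  have smul: "r \<otimes>\<^bsub>R\<^esub> s \<in> J" if r: "r \<in> carrier R" and s: "s \<in> J" for r s
  proof -
    obtain \<rho> where \<rho>: "G s \<rho>" "s \<in> carrier R" using s by (auto simp: J_def)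
    have h: "\<rho> \<in> mod_hom R (free_mod R n\<^sub>0) (free_mod R n\<^sub>0)" using \<rho> by (simp add: G_def)
    have "G (r \<otimes>\<^bsub>R\<^esub> s) (\<lambda>x. r \<odot>\<^bsub>free_mod R n\<^sub>0\<^esub> \<rho> x)"
      unfolding G_def using \<rho> r mod_hom_scale[OF F0.module_axioms h r] ec mod_hom_closed[OF h]
      by (auto simp: G_def mod_hom_smult[OF eps] M.smult_assoc1)
    then show ?thesis unfolding J_def using r \<rho>(2) by blast
  qed
  have sadd: "r \<oplus>\<^bsub>R\<^esub> s \<in> J" if r: "r \<in> J" and s: "s \<in> J" for r s
  proof -
    obtain \<rho> where \<rho>: "G s \<rho>" "s \<in> carrier R" using s by (auto simp: J_def)
    obtain \<sigma> where \<sigma>: "G r \<sigma>" "r \<in> carrier R" using r by (auto simp: J_def)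
    have h: "\<rho> \<in> mod_hom R (free_mod R n\<^sub>0) (free_mod R n\<^sub>0)" using \<rho> by (simp add: G_def)
    have h': "\<sigma> \<in> mod_hom R (free_mod R n\<^sub>0) (free_mod R n\<^sub>0)" using \<sigma> by (simp add: G_def)
    have "G (r \<oplus>\<^bsub>R\<^esub> s) (\<lambda>x. \<sigma> x \<oplus>\<^bsub>free_mod R n\<^sub>0\<^esub> \<rho> x)"
      unfolding G_def using \<rho> \<sigma> mod_hom_sum[OF F0.module_axioms h' h] ec mod_hom_closed[OF h] mod_hom_closed[OF h']
      by (auto simp: G_def mod_hom_add[OF eps] M.smult_l_distr)
    then show ?thesis unfolding J_def using \<sigma>(2) \<rho>(2) by blast
  qed
  have zJ: "\<zero>\<^bsub>R\<^esub> \<in> J"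
  proof -
    have "(\<lambda>x. \<zero>\<^bsub>free_mod R n\<^sub>0\<^esub>) \<in> mod_hom R (free_mod R n\<^sub>0) (free_mod R n\<^sub>0)" by (rule mod_homI) auto
    then have "G \<zero>\<^bsub>R\<^esub> (\<lambda>x. \<zero>\<^bsub>free_mod R n\<^sub>0\<^esub>)"
      unfolding G_def using ec mod_hom_zero[OF F0.module_axioms M.module_axioms eps] by auto
    then show ?thesis unfolding J_def by blast
  qed
  have "submodule J R (self_module R)"
  proof (rule Se.submoduleI)
    show "J \<subseteq> carrier (self_module R)" by (auto simp: J_def)
    show "\<zero>\<^bsub>self_module R\<^esub> \<in> J" using zJ by simp
    fix s assume s: "s \<in> J"
    then have "(\<ominus>\<^bsub>R\<^esub> \<one>\<^bsub>R\<^esub>) \<otimes>\<^bsub>R\<^esub> s = \<ominus>\<^bsub>R\<^esub> s" by (simp add: J_def M.R.l_minus)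
    then show "\<ominus>\<^bsub>self_module R\<^esub> s \<in> J" using smul[OF _ s, of "\<ominus>\<^bsub>R\<^esub> \<one>\<^bsub>R\<^esub>"] by simp
  qed (simp_all add: smul sadd)
  then have J: "ideal J R" by (simp add: cring.ideal_iff_submodule[OF is_cring])
  \<comment> \<open>Otherwise \<open>J\<close> lies in an associated prime \<open>P\<close>, while
    freeness of M at \<open>P\<close> puts an element outside \<open>P\<close> into
    \<open>J\<close>.\<close>
  have "J \<inter> nonzerodivisors R \<noteq> {}"
  proof
    assume "J \<inter> nonzerodivisors R = {}"
    from noetherian_cring.ideal_in_associated_prime[OF noeth J this] obtain P where P: "P \<in> ring_Ass R" "J \<subseteq> P" .
    have pP: "primeideal P R" using P(1) by (simp add: ring_Ass_def)
    interpret loc: localization R "carrier R - P" M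
      unfolding localization_def using cring.mult_set_prime[OF is_cring pP] M.module_axioms by blast
    have "free_module (loc_ring R (carrier R - P)) (loc_module R (carrier R - P) M)"
      using gf P(1) by (simp add: generically_free_def)
    from loc.local_splitting[OF this eps eps_surj A epsA]
    obtain s \<rho> where "s \<in> carrier R - P" "G s \<rho>" unfolding G_def by blast
    then have "s \<in> J" "s \<notin> P" by (auto simp: J_def)
    then show False using P(2) by blast
  qed
  then obtain a \<rho> where a: "a \<in> nonzerodivisors R" "a \<in> carrier R" and G: "G a \<rho>" by (auto simp: J_def)
  have \<rho>: "\<rho> \<in> mod_hom R (free_mod R n\<^sub>0) (free_mod R n\<^sub>0)" using G by (simp add: G_def)
  have Ac: "x \<in> carrier (free_mod R n\<^sub>1) \<Longrightarrow> A x \<in> carrier (free_mod R n\<^sub>0)" for x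
    by (rule mod_hom_closed[OF A])
  have Bc: "x \<in> carrier (free_mod R n\<^sub>0) \<Longrightarrow> B x \<in> carrier (free_mod R n\<^sub>1)" for x
    by (rule mod_hom_closed[OF B])
  have B\<rho>: "B (\<rho> x) = a \<odot>\<^bsub>free_mod R n\<^sub>1\<^esub> B x" if x: "x \<in> carrier (free_mod R n\<^sub>0)" for x
    using G x mod_hom_smult[OF \<phi> a(2) ec[OF x]] by (simp add: G_def B_eq)
  note sc0 = mod_hom_scale[OF F0.module_axioms mod_hom_ident a(2)]
  note sc1 = mod_hom_scale[OF F1.module_axioms mod_hom_ident a(2)]
  have AB: "A (B x) = \<zero>\<^bsub>free_mod R n\<^sub>0\<^esub>" if "x \<in> carrier (free_mod R n\<^sub>0)" for x
    using A_kernel[OF Bc[OF that]] that by blast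
  have diff0: "x = y \<oplus>\<^bsub>free_mod R n\<^sub>0\<^esub> z"
    if "y = x \<ominus>\<^bsub>free_mod R n\<^sub>0\<^esub> z" "x \<in> carrier (free_mod R n\<^sub>0)" "z \<in> carrier (free_mod R n\<^sub>0)" for x y z
    using F0.M.diff_add_cancel[OF that(2,3)] that(1) by simp
  \<comment> \<open>Since \<open>B \<rho> = a B\<close>, the difference of \<open>a\<close> and
    \<open>\<rho>\<close> has values in the kernel of \<open>B\<close> and lifts to
    \<open>A U\<close>. As \<open>\<rho>\<close> kills the image of \<open>A\<close>, this gives
    \<open>A U A = a A\<close>.\<close>
  let ?f = "\<lambda>x. a \<odot>\<^bsub>free_mod R n\<^sub>0\<^esub> x \<ominus>\<^bsub>free_mod R n\<^sub>0\<^esub> \<rho> x"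
  have f: "?f \<in> mod_hom R (free_mod R n\<^sub>0) (free_mod R n\<^sub>0)"
    by (rule mod_hom_diff[OF F0.module_axioms sc0 \<rho>])
  obtain U where U: "U \<in> mod_hom R (free_mod R n\<^sub>0) (free_mod R n\<^sub>1)" "\<And>x. x \<in> carrier (free_mod R n\<^sub>0) \<Longrightarrow> A (U x) = ?f x"
  proof (rule free_mod_lift[OF F1.module_axioms F0.module_axioms f A])
    show "?f ` carrier (free_mod R n\<^sub>0) \<subseteq> A ` carrier (free_mod R n\<^sub>1)"
    proof (rule image_subsetI)
      fix x assume x: "x \<in> carrier (free_mod R n\<^sub>0)"
      have "B (?f x) = B (a \<odot>\<^bsub>free_mod R n\<^sub>0\<^esub> x) \<ominus>\<^bsub>free_mod R n\<^sub>1\<^esub> B (\<rho> x)"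
        using x a mod_hom_closed[OF \<rho> x]
        by (intro mod_hom_minus[OF F0.module_axioms F1.module_axioms B]) auto
      also have "\<dots> = \<zero>\<^bsub>free_mod R n\<^sub>1\<^esub>"
        using x a Bc[OF x] by (simp add: B\<rho> mod_hom_smult[OF B] a_minus_def F1.M.r_neg)
      finally show "?f x \<in> A ` carrier (free_mod R n\<^sub>1)" using B_kernel[OF mod_hom_closed[OF f x]] by simp
    qed
  qed auto
  have AUA: "A (U (A x)) = a \<odot>\<^bsub>free_mod R n\<^sub>0\<^esub> A x" if x: "x \<in> carrier (free_mod R n\<^sub>1)" for x
  proof -
    have "\<rho> (A x) = \<zero>\<^bsub>free_mod R n\<^sub>0\<^esub>" using G x by (simp add: G_def)
    then have "A (U (A x)) = a \<odot>\<^bsub>free_mod R n\<^sub>0\<^esub> A x \<ominus>\<^bsub>free_mod R n\<^sub>0\<^esub> \<zero>\<^bsub>free_mod R n\<^sub>0\<^esub>" using U(2)[OF Ac[OF x]]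
      by simp
    then show ?thesis
      using diff0[of "A (U (A x))" "a \<odot>\<^bsub>free_mod R n\<^sub>0\<^esub> A x" "\<zero>\<^bsub>free_mod R n\<^sub>0\<^esub>"] a(2) Ac[OF x]
        mod_hom_closed[OF A mod_hom_closed[OF U(1) Ac[OF x]]] by simp
  qed
  \<comment> \<open>By the previous identity \<open>a - U A\<close> has values in the kernel of
    \<open>A\<close> and lifts to \<open>B W\<close>; composing with \<open>B\<close> gives
    \<open>B W B = a B\<close>.\<close>
  let ?g = "\<lambda>x. a \<odot>\<^bsub>free_mod R n\<^sub>1\<^esub> x \<ominus>\<^bsub>free_mod R n\<^sub>1\<^esub> U (A x)"
  have UA: "(\<lambda>x. U (A x)) \<in> mod_hom R (free_mod R n\<^sub>1) (free_mod R n\<^sub>1)" by (rule mod_hom_comp[OF U(1) A])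
  have g: "?g \<in> mod_hom R (free_mod R n\<^sub>1) (free_mod R n\<^sub>1)"
    by (rule mod_hom_diff[OF F1.module_axioms sc1 UA])
  obtain W where W: "W \<in> mod_hom R (free_mod R n\<^sub>1) (free_mod R n\<^sub>0)" "\<And>x. x \<in> carrier (free_mod R n\<^sub>1) \<Longrightarrow> B (W x) = ?g x"
  proof (rule free_mod_lift[OF F0.module_axioms F1.module_axioms g B])
    show "?g ` carrier (free_mod R n\<^sub>1) \<subseteq> B ` carrier (free_mod R n\<^sub>0)"
    proof (rule image_subsetI)
      fix x assume x: "x \<in> carrier (free_mod R n\<^sub>1)"
      have "A (?g x) = A (a \<odot>\<^bsub>free_mod R n\<^sub>1\<^esub> x) \<ominus>\<^bsub>free_mod R n\<^sub>0\<^esub> A (U (A x))"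
        using x a mod_hom_closed[OF UA x]
        by (intro mod_hom_minus[OF F1.module_axioms F0.module_axioms A]) auto
      also have "\<dots> = \<zero>\<^bsub>free_mod R n\<^sub>0\<^esub>"
        using x a Ac[OF x] by (simp add: AUA mod_hom_smult[OF A] a_minus_def F0.M.r_neg)
      finally show "?g x \<in> B ` carrier (free_mod R n\<^sub>0)" using A_kernel[OF mod_hom_closed[OF g x]] by simp
    qed
  qed auto
  have BWB: "B (W (B x)) = a \<odot>\<^bsub>free_mod R n\<^sub>1\<^esub> B x" if x: "x \<in> carrier (free_mod R n\<^sub>0)" for x
  proof -
    have "U (A (B x)) = \<zero>\<^bsub>free_mod R n\<^sub>1\<^esub>"
      using AB[OF x] mod_hom_zero[OF F0.module_axioms F1.module_axioms U(1)] by simp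
    then have "B (W (B x)) = a \<odot>\<^bsub>free_mod R n\<^sub>1\<^esub> B x \<ominus>\<^bsub>free_mod R n\<^sub>1\<^esub> \<zero>\<^bsub>free_mod R n\<^sub>1\<^esub>" using W(2)[OF Bc[OF x]]
      by simp
    then show ?thesis
      using F1.M.diff_add_cancel[of "a \<odot>\<^bsub>free_mod R n\<^sub>1\<^esub> B x" "\<zero>\<^bsub>free_mod R n\<^sub>1\<^esub>"] a(2) Bc[OF x]
        mod_hom_closed[OF B mod_hom_closed[OF W(1) Bc[OF x]]] by simp
  qed
  \<comment> \<open>Now \<open>a - W B\<close> has values in the kernel of \<open>B\<close>, and its
    lift \<open>A V\<close> is the required decomposition: \<open>V\<close>, not the auxiliary
    \<open>U\<close>, is the map handed out.\<close>
  let ?h = "\<lambda>x. a \<odot>\<^bsub>free_mod R n\<^sub>0\<^esub> x \<ominus>\<^bsub>free_mod R n\<^sub>0\<^esub> W (B x)"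
  have WB: "(\<lambda>x. W (B x)) \<in> mod_hom R (free_mod R n\<^sub>0) (free_mod R n\<^sub>0)" by (rule mod_hom_comp[OF W(1) B])
  have h: "?h \<in> mod_hom R (free_mod R n\<^sub>0) (free_mod R n\<^sub>0)"
    by (rule mod_hom_diff[OF F0.module_axioms sc0 WB])
  obtain V where V: "V \<in> mod_hom R (free_mod R n\<^sub>0) (free_mod R n\<^sub>1)" "\<And>x. x \<in> carrier (free_mod R n\<^sub>0) \<Longrightarrow> A (V x) = ?h x"
  proof (rule free_mod_lift[OF F1.module_axioms F0.module_axioms h A])
    show "?h ` carrier (free_mod R n\<^sub>0) \<subseteq> A ` carrier (free_mod R n\<^sub>1)"
    proof (rule image_subsetI)
      fix x assume x: "x \<in> carrier (free_mod R n\<^sub>0)"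
      have "B (?h x) = B (a \<odot>\<^bsub>free_mod R n\<^sub>0\<^esub> x) \<ominus>\<^bsub>free_mod R n\<^sub>1\<^esub> B (W (B x))"
        using x a mod_hom_closed[OF WB x]
        by (intro mod_hom_minus[OF F0.module_axioms F1.module_axioms B]) auto
      also have "\<dots> = \<zero>\<^bsub>free_mod R n\<^sub>1\<^esub>"
        using x a Bc[OF x] by (simp add: BWB mod_hom_smult[OF B] a_minus_def F1.M.r_neg)
      finally show "?h x \<in> A ` carrier (free_mod R n\<^sub>1)" using B_kernel[OF mod_hom_closed[OF h x]] by simp
    qed
  qed auto
  show ?thesis
  proof (rule that[OF a(1) V(1) W(1)])
    fix x assume x: "x \<in> carrier (free_mod R n\<^sub>0)"
    show "a \<odot>\<^bsub>free_mod R n\<^sub>0\<^esub> x = A (V x) \<oplus>\<^bsub>free_mod R n\<^sub>0\<^esub> W (B x)"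
      by (rule diff0[OF V(2)[OF x]]) (use x a(2) mod_hom_closed[OF WB x] in auto)
  qed
qed

section \<open>Modules with rank\<close>

lemma restrict_scalars_simps:
  "carrier (restrict_scalars \<tau> Q) = carrier Q" "\<zero>\<^bsub>restrict_scalars \<tau> Q\<^esub> = \<zero>\<^bsub>Q\<^esub>"
  "x \<oplus>\<^bsub>restrict_scalars \<tau> Q\<^esub> y = x \<oplus>\<^bsub>Q\<^esub> y" "a \<odot>\<^bsub>restrict_scalars \<tau> Q\<^esub> x = \<tau> a \<otimes>\<^bsub>Q\<^esub> x"
  by (simp_all add: restrict_scalars_def)

lemma module_restrict_scalars:
  assumes "cring R" "cring Q" "\<tau> \<in> ring_hom R Q"
  shows "module R (restrict_scalars \<tau> Q)"
proof -
  interpret R: cring R by fact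
  interpret Q: cring Q by fact
  have ab: "abelian_group (restrict_scalars \<tau> Q)"
    by (rule abelian_groupI) (auto simp: restrict_scalars_simps Q.a_ac intro: Q.l_neg)
  show ?thesis
    by (rule moduleI)
       (use assms ab in \<open>auto simp: restrict_scalars_simps ring_hom_closed[OF assms(3)] ring_hom_add[OF assms(3)]
         ring_hom_mult[OF assms(3)] ring_hom_one[OF assms(3)] Q.l_distr Q.r_distr Q.m_assoc\<close>)
qed

lemma base_change_simps:
  "carrier (base_change R \<tau> Q N) = carrier (tensor R N (restrict_scalars \<tau> Q))"
  "\<zero>\<^bsub>base_change R \<tau> Q N\<^esub> = \<zero>\<^bsub>tensor R N (restrict_scalars \<tau> Q)\<^esub>"
  "u \<oplus>\<^bsub>base_change R \<tau> Q N\<^esub> v = u \<oplus>\<^bsub>tensor R N (restrict_scalars \<tau> Q)\<^esub> v"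
  "q \<odot>\<^bsub>base_change R \<tau> Q N\<^esub> u = tensor_push R N (restrict_scalars \<tau> Q) (\<lambda>(x, t). (x, q \<otimes>\<^bsub>Q\<^esub> t)) u"
  by (simp_all add: base_change_def tensor_def)

context mult_set
begin

lemma loc_ring_hom: "(\<lambda>a. L.fr a \<one>) \<in> ring_hom R (loc_ring R S)"
  using S_one by (intro ring_hom_memI) (auto simp: fr_ring_closed loc_ring_mult_fr loc_ring_add_fr_same loc_ring_simps(3))

lemma fr_unit: "s \<in> S \<Longrightarrow> L.fr s \<one> \<otimes>\<^bsub>loc_ring R S\<^esub> L.fr \<one> s = \<one>\<^bsub>loc_ring R S\<^esub>"
  using S_one SR L.fr_cancel[of \<one> \<one> s] by (simp add: loc_ring_mult_fr loc_ring_simps(3))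

lemma fr_ring_cancel_left:
  assumes s: "s \<in> S" and x: "x \<in> carrier (loc_ring R S)" "L.fr s \<one> \<otimes>\<^bsub>loc_ring R S\<^esub> x = \<zero>\<^bsub>loc_ring R S\<^esub>"
  shows "x = \<zero>\<^bsub>loc_ring R S\<^esub>"
proof -
  interpret Q: cring "loc_ring R S" by (rule cring_loc_ring)
  have u: "L.fr \<one> s \<in> carrier (loc_ring R S)" "L.fr s \<one> \<in> carrier (loc_ring R S)"
    using s S_one SR by (auto intro: fr_ring_closed)
  have "x = (L.fr s \<one> \<otimes>\<^bsub>loc_ring R S\<^esub> L.fr \<one> s) \<otimes>\<^bsub>loc_ring R S\<^esub> x" using x(1) by (simp add: fr_unit[OF s])
  also have "\<dots> = L.fr \<one> s \<otimes>\<^bsub>loc_ring R S\<^esub> (L.fr s \<one> \<otimes>\<^bsub>loc_ring R S\<^esub> x)" using u x(1) by (simp add: Q.m_ac)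
  also have "\<dots> = \<zero>\<^bsub>loc_ring R S\<^esub>" using u x(2) by simp
  finally show ?thesis .
qed

end

text \<open>Rank gives a map \<open>g\<close> from N to Q^r, where Q is the total ring of fractions,
  and torsionlessness makes it injective. A common denominator \<open>c\<close> for the generators
  moves it into R^r; since N spans Q^r over Q, some non-zero-divisor multiple of each unit vector is
  in the image.\<close>

lemma rank_lattice:
  assumes R: "cring R" and N: "module R N" and fg: "finitely_generated R N"
    and tl: "torsionless R N" and rk: "has_rank R N"
  obtains r h d where "h \<in> mod_hom R N (free_mod R r)" "inj_on h (carrier N)" "d \<in> nonzerodivisors R"
    "\<And>x. x \<in> carrier (free_mod R r) \<Longrightarrow> d \<odot>\<^bsub>free_mod R r\<^esub> x \<in> h ` carrier N"
proof -
  interpret R: cring R by (rule R)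
  interpret N: module R N by (rule N)
  define S where "S = nonzerodivisors R"
  interpret S: mult_set R S unfolding S_def by (rule R.mult_set_nonzerodivisors)
  define Q where "Q = loc_ring R S"
  interpret Q: cring Q unfolding Q_def by (rule S.cring_loc_ring)
  define \<tau> where "\<tau> a = S.L.fr a \<one>\<^bsub>R\<^esub>" for a
  have tQ: "total_fractions R = Q" by (simp add: total_fractions_def Q_def S_def)
  have t\<tau>: "to_total_fractions R = \<tau>" by (simp add: to_total_fractions_def \<tau>_def S_def fun_eq_iff)
  have \<tau>: "\<tau> \<in> ring_hom R Q" using S.loc_ring_hom unfolding \<tau>_def Q_def .
  note \<tau>c = ring_hom_closed[OF \<tau>] and \<tau>m = ring_hom_mult[OF \<tau>] and \<tau>a = ring_hom_add[OF \<tau>] and \<tau>1 = ring_hom_one[OF \<tau>]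
  have \<tau>0: "\<tau> \<zero>\<^bsub>R\<^esub> = \<zero>\<^bsub>Q\<^esub>" by (simp add: \<tau>_def Q_def loc_ring_simps loc_module_simps)
  \<comment> \<open>Denominators are non-zero-divisors, so R embeds into its total ring of
    fractions.\<close>
  have \<tau>inj: "a = b" if ab: "a \<in> carrier R" "b \<in> carrier R" "\<tau> a = \<tau> b" for a b
  proof -
    obtain u where u: "u \<in> S" "u \<otimes>\<^bsub>R\<^esub> (\<one>\<^bsub>R\<^esub> \<otimes>\<^bsub>R\<^esub> a) = u \<otimes>\<^bsub>R\<^esub> (\<one>\<^bsub>R\<^esub> \<otimes>\<^bsub>R\<^esub> b)"
      using S.fr_ring_eq_iff[of a "\<one>\<^bsub>R\<^esub>" b "\<one>\<^bsub>R\<^esub>"] ab S.S_one unfolding \<tau>_def by blast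
    have "u \<otimes>\<^bsub>R\<^esub> (a \<ominus>\<^bsub>R\<^esub> b) = \<zero>\<^bsub>R\<^esub>"
      using u ab S.SR[OF u(1)] by (simp add: a_minus_def R.r_distr R.r_minus R.r_neg)
    moreover have "a \<ominus>\<^bsub>R\<^esub> b \<in> carrier R" using ab by simp
    ultimately have "a \<ominus>\<^bsub>R\<^esub> b = \<zero>\<^bsub>R\<^esub>" using u(1) unfolding S_def nonzerodivisors_def by blast
    then show ?thesis using R.diff_add_cancel[OF ab(1,2)] ab by simp
  qed
  have \<tau>cancel: "x = \<zero>\<^bsub>Q\<^esub>" if "s \<in> S" "x \<in> carrier Q" "\<tau> s \<otimes>\<^bsub>Q\<^esub> x = \<zero>\<^bsub>Q\<^esub>" for s x
    using S.fr_ring_cancel_left that unfolding \<tau>_def Q_def by blast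
  have frac: "\<exists>s\<in>S. \<exists>a\<in>carrier R. \<tau> s \<otimes>\<^bsub>Q\<^esub> x = \<tau> a" if x: "x \<in> carrier Q" for x
  proof -
    obtain a s where as: "a \<in> carrier R" "s \<in> S" "x = S.L.fr a s" using S.loc_ring_obtain x
      unfolding Q_def by metis
    have "\<tau> s \<otimes>\<^bsub>Q\<^esub> x = S.L.fr (s \<otimes>\<^bsub>R\<^esub> a) (\<one>\<^bsub>R\<^esub> \<otimes>\<^bsub>R\<^esub> s)"
      unfolding \<tau>_def Q_def as(3) by (rule S.loc_ring_mult_fr) (use as S.SR S.S_one in auto)
    also have "\<dots> = \<tau> a"
      using S.L.fr_cancel[of a "\<one>\<^bsub>R\<^esub>" s] as S.SR S.S_one by (simp add: \<tau>_def)
    finally show ?thesis using as by blast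
  qed
  define QR where "QR = restrict_scalars \<tau> Q"
  interpret P: module_pair R N QR
    unfolding QR_def by (rule module_pairI[OF N module_restrict_scalars[OF R Q.is_cring \<tau>]])
  have QRs: "carrier QR = carrier Q" "\<zero>\<^bsub>QR\<^esub> = \<zero>\<^bsub>Q\<^esub>" "x \<oplus>\<^bsub>QR\<^esub> y = x \<oplus>\<^bsub>Q\<^esub> y" "a \<odot>\<^bsub>QR\<^esub> x = \<tau> a \<otimes>\<^bsub>Q\<^esub> x" for x y a
    by (simp_all add: QR_def restrict_scalars_simps)
  let ?BC = "base_change R \<tau> Q N"
  obtain r \<psi> where \<psi>: "\<psi> \<in> mod_hom Q ?BC (free_mod Q r)" "bij_betw \<psi> (carrier ?BC) (carrier (free_mod Q r))"
    using rk unfolding has_rank_def mod_isomorphic_def tQ t\<tau> by blast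
  note bc = base_change_simps[of R \<tau> Q N, folded QR_def]
  have act: "q \<odot>\<^bsub>?BC\<^esub> P.tens y t = P.tens y (q \<otimes>\<^bsub>Q\<^esub> t)" if "q \<in> carrier Q" "y \<in> carrier N" "t \<in> carrier Q"
    for q y t
  proof -
    have qh: "(\<lambda>t. q \<otimes>\<^bsub>Q\<^esub> t) \<in> mod_hom R QR QR"
      by (rule mod_homI) (use that \<tau>c in \<open>auto simp: QRs Q.r_distr Q.m_lcomm\<close>)
    show ?thesis
      unfolding bc using tensor_push_tens[OF P.module_pair_axioms P.module_pair_axioms mod_hom_ident qh, of y t] that
      by (simp add: QRs)
  qed
  have act_add: "q \<odot>\<^bsub>?BC\<^esub> (u \<oplus>\<^bsub>tensor R N QR\<^esub> v) = q \<odot>\<^bsub>?BC\<^esub> u \<oplus>\<^bsub>tensor R N QR\<^esub> q \<odot>\<^bsub>?BC\<^esub> v"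
    if "q \<in> carrier Q" "u \<in> carrier (tensor R N QR)" "v \<in> carrier (tensor R N QR)" for q u v
  proof -
    have qh: "(\<lambda>t. q \<otimes>\<^bsub>Q\<^esub> t) \<in> mod_hom R QR QR"
      by (rule mod_homI) (use that \<tau>c in \<open>auto simp: QRs Q.r_distr Q.m_lcomm\<close>)
    show ?thesis
      unfolding bc using hom_mult[OF tensor_push_hom[OF P.module_pair_axioms P.module_pair_axioms mod_hom_ident qh], of u v] that
      by simp
  qed
  have act_mult: "p \<odot>\<^bsub>?BC\<^esub> (q \<odot>\<^bsub>?BC\<^esub> u) = (p \<otimes>\<^bsub>Q\<^esub> q) \<odot>\<^bsub>?BC\<^esub> u \<and> q \<odot>\<^bsub>?BC\<^esub> u \<in> carrier (tensor R N QR)"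
    if pq: "p \<in> carrier Q" "q \<in> carrier Q" and u: "u \<in> carrier (tensor R N QR)" for p q u
    using u
  proof (induction u rule: P.tensor_induct)
    case (tens x y)
    then show ?case using pq by (simp add: act QRs P.tens_closed Q.m_assoc)
  next
    case (add u v)
    then show ?case using pq by (simp add: act_add)
  qed
  define \<iota> where "\<iota> y = P.tens y \<one>\<^bsub>Q\<^esub>" for y
  have \<iota>c: "\<iota> y \<in> carrier (tensor R N QR)" if "y \<in> carrier N" for y
    unfolding \<iota>_def using that by (intro P.tens_closed) (auto simp: QRs)
  have \<iota>a: "\<iota> (x \<oplus>\<^bsub>N\<^esub> y) = \<iota> x \<oplus>\<^bsub>tensor R N QR\<^esub> \<iota> y" if "x \<in> carrier N" "y \<in> carrier N" for x y
    unfolding \<iota>_def using that by (intro P.tens_add_left) (auto simp: QRs)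
  have \<iota>s: "\<iota> (a \<odot>\<^bsub>N\<^esub> y) = \<tau> a \<odot>\<^bsub>?BC\<^esub> \<iota> y" if "a \<in> carrier R" "y \<in> carrier N" for a y
    unfolding \<iota>_def using that \<tau>c by (subst act) (auto simp: P.tens_balanced QRs)
  define g where "g y = \<psi> (\<iota> y)" for y
  have \<psi>c: "\<psi> u \<in> carrier (free_mod Q r)" if "u \<in> carrier (tensor R N QR)" for u
    using mod_hom_closed[OF \<psi>(1)] that by (simp add: bc)
  have gc: "g y \<in> carrier (free_mod Q r)" if "y \<in> carrier N" for y
    unfolding g_def using \<psi>c \<iota>c that by blast
  have gi: "g y i \<in> carrier Q" if "y \<in> carrier N" "i < r" for y i
    using free_mod_nth_closed[OF gc[OF that(1)] that(2)] .
  have ga: "g (x \<oplus>\<^bsub>N\<^esub> y) = g x \<oplus>\<^bsub>free_mod Q r\<^esub> g y" if "x \<in> carrier N" "y \<in> carrier N" for x y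
    unfolding g_def using that \<iota>c \<iota>a mod_hom_add[OF \<psi>(1), unfolded bc] by simp
  have gs: "g (a \<odot>\<^bsub>N\<^esub> y) = \<tau> a \<odot>\<^bsub>free_mod Q r\<^esub> g y" if "a \<in> carrier R" "y \<in> carrier N" for a y
    unfolding g_def using that \<iota>c \<iota>s \<tau>c mod_hom_smult[OF \<psi>(1), of "\<tau> a" "\<iota> y"] by (simp add: bc(1))
  have gai: "g (x \<oplus>\<^bsub>N\<^esub> y) i = g x i \<oplus>\<^bsub>Q\<^esub> g y i" if "x \<in> carrier N" "y \<in> carrier N" "i < r" for x y i
    using ga[OF that(1,2)] that(3) by (simp add: free_mod_nth)
  have gsi: "g (a \<odot>\<^bsub>N\<^esub> y) i = \<tau> a \<otimes>\<^bsub>Q\<^esub> g y i" if "a \<in> carrier R" "y \<in> carrier N" "i < r" for a y i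
    using gs[OF that(1,2)] that(3) by (simp add: free_mod_nth)
  interpret FQ: module Q "free_mod Q r" by (rule module_free_mod[OF Q.is_cring])
  have g0: "g y = \<zero>\<^bsub>free_mod Q r\<^esub>" if y: "y \<in> carrier N" "\<And>i. i < r \<Longrightarrow> g y i = \<zero>\<^bsub>Q\<^esub>" for y
    by (rule free_mod_eqI[OF gc[OF y(1)] FQ.M.zero_closed]) (simp add: y(2) free_mod_nth)
  have ginj: "y = \<zero>\<^bsub>N\<^esub>" if y: "y \<in> carrier N" and gy: "g y = \<zero>\<^bsub>free_mod Q r\<^esub>" for y
  proof -
    have "\<psi> \<zero>\<^bsub>tensor R N QR\<^esub> \<oplus>\<^bsub>free_mod Q r\<^esub> \<psi> \<zero>\<^bsub>tensor R N QR\<^esub> = \<psi> \<zero>\<^bsub>tensor R N QR\<^esub>"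
      using mod_hom_add[OF \<psi>(1), of "\<zero>\<^bsub>tensor R N QR\<^esub>" "\<zero>\<^bsub>tensor R N QR\<^esub>"] by (simp add: bc(1,3))
    then have "\<psi> \<zero>\<^bsub>tensor R N QR\<^esub> = \<zero>\<^bsub>free_mod Q r\<^esub>"
      using \<psi>c[OF P.T.zero_closed] by simp
    then have \<iota>0: "\<iota> y = \<zero>\<^bsub>tensor R N QR\<^esub>"
      using gy inj_onD[OF bij_betw_imp_inj_on[OF \<psi>(2)], of "\<iota> y" "\<zero>\<^bsub>tensor R N QR\<^esub>"] \<iota>c[OF y]
      unfolding g_def bc by simp
    \<comment> \<open>A functional on N extends to the base change by \<open>\<tau> (f x)\<close>
      times \<open>t\<close>, so it vanishes on every element that becomes zero there. By
      torsionlessness such an element is zero.\<close>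
    have f0: "f y = \<zero>\<^bsub>R\<^esub>" if f: "f \<in> mod_hom R N (self_module R)" for f
    proof -
      have fc: "x \<in> carrier N \<Longrightarrow> f x \<in> carrier R" for x using mod_hom_closed[OF f] by simp
      obtain \<Psi> where \<Psi>: "\<Psi> \<in> hom (add_monoid (tensor R N QR)) (add_monoid Q)"
        "\<And>x t. x \<in> carrier N \<Longrightarrow> t \<in> carrier QR \<Longrightarrow> \<Psi> (P.tens x t) = \<tau> (f x) \<otimes>\<^bsub>Q\<^esub> t"
      proof (rule P.tensor_universal[OF Q.a_comm_group, of "\<lambda>x t. \<tau> (f x) \<otimes>\<^bsub>Q\<^esub> t"])
        fix a x t assume "a \<in> carrier R" "x \<in> carrier N" "t \<in> carrier QR"
        then show "\<tau> (f (a \<odot>\<^bsub>N\<^esub> x)) \<otimes>\<^bsub>Q\<^esub> t = \<tau> (f x) \<otimes>\<^bsub>Q\<^esub> (a \<odot>\<^bsub>QR\<^esub> t)"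
          using fc \<tau>c by (simp add: QRs mod_hom_smult[OF f] \<tau>m Q.m_ac)
      qed (use fc \<tau>c in \<open>auto simp: QRs mod_hom_add[OF f] \<tau>a Q.l_distr Q.r_distr\<close>)
      have "\<tau> (f y) = \<Psi> (\<iota> y)" unfolding \<iota>_def using \<Psi>(2)[OF y, of "\<one>\<^bsub>Q\<^esub>"] fc[OF y] \<tau>c by (simp add: QRs)
      also have "\<dots> = \<zero>\<^bsub>Q\<^esub>"
        unfolding \<iota>0 using add_monoid_hom_zero[OF P.T.abelian_group_axioms Q.abelian_group_axioms \<Psi>(1)] .
      finally show ?thesis using \<tau>inj[OF fc[OF y] R.zero_closed] \<tau>0 by simp
    qed
    have "bidual_map R N y = bidual_map R N \<zero>\<^bsub>N\<^esub>"
      unfolding bidual_map_def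
    proof (rule restrict_ext)
      fix f assume "f \<in> carrier (dual_module R N)"
      then have f: "f \<in> mod_hom R N (self_module R)" by (simp add: dual_module_def)
      show "f y = f \<zero>\<^bsub>N\<^esub>" using f0[OF f] mod_hom_zero[OF N module_self[OF R] f] by simp
    qed
    from inj_onD[OF tl[unfolded torsionless_def] this y N.M.zero_closed] show ?thesis .
  qed
  \<comment> \<open>The elements whose image has all coordinates in R after multiplication by
    \<open>c\<close>. As a submodule it is all of N once it contains the generators.\<close>
  define D where "D c = {y \<in> carrier N. \<forall>i<r. \<exists>a\<in>carrier R. \<tau> c \<otimes>\<^bsub>Q\<^esub> g y i = \<tau> a}" for c
  have D_sub: "submodule (D c) R N" if c: "c \<in> carrier R" for c
  proof -
    have D_smult: "a \<odot>\<^bsub>N\<^esub> y \<in> D c" if a: "a \<in> carrier R" and y: "y \<in> D c" for a y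
    proof -
      have "\<exists>e\<in>carrier R. \<tau> c \<otimes>\<^bsub>Q\<^esub> g (a \<odot>\<^bsub>N\<^esub> y) i = \<tau> e" if i: "i < r" for i
      proof -
        obtain b where b: "b \<in> carrier R" "\<tau> c \<otimes>\<^bsub>Q\<^esub> g y i = \<tau> b" using y i by (auto simp: D_def)
        have yc: "y \<in> carrier N" using y by (simp add: D_def)
        have "\<tau> c \<otimes>\<^bsub>Q\<^esub> g (a \<odot>\<^bsub>N\<^esub> y) i = \<tau> a \<otimes>\<^bsub>Q\<^esub> (\<tau> c \<otimes>\<^bsub>Q\<^esub> g y i)"
          using gsi[OF a yc i] gi[OF yc i] \<tau>c a c by (simp add: Q.m_lcomm)
        then show ?thesis using b a by (intro bexI[of _ "a \<otimes>\<^bsub>R\<^esub> b"]) (auto simp: \<tau>m)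
      qed
      then show ?thesis using a y by (simp add: D_def)
    qed
    show ?thesis
    proof (rule N.submoduleI)
      show "D c \<subseteq> carrier N" by (auto simp: D_def)
      have "\<exists>a\<in>carrier R. \<tau> c \<otimes>\<^bsub>Q\<^esub> g \<zero>\<^bsub>N\<^esub> i = \<tau> a" if i: "i < r" for i
        using gsi[of "\<zero>\<^bsub>R\<^esub>" "\<zero>\<^bsub>N\<^esub>" i] gi[of "\<zero>\<^bsub>N\<^esub>" i] i c \<tau>c by (intro bexI[of _ "\<zero>\<^bsub>R\<^esub>"]) (auto simp: \<tau>0)
      then show "\<zero>\<^bsub>N\<^esub> \<in> D c" by (simp add: D_def)
      fix y assume y: "y \<in> D c"
      then have "(\<ominus>\<^bsub>R\<^esub> \<one>\<^bsub>R\<^esub>) \<odot>\<^bsub>N\<^esub> y = \<ominus>\<^bsub>N\<^esub> y" by (simp add: D_def N.smult_l_minus)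
      then show "\<ominus>\<^bsub>N\<^esub> y \<in> D c" using D_smult[OF _ y, of "\<ominus>\<^bsub>R\<^esub> \<one>\<^bsub>R\<^esub>"] by simp
      fix x assume x: "x \<in> D c"
      have xy: "x \<in> carrier N" "y \<in> carrier N" using x y by (auto simp: D_def)
      have "\<exists>e\<in>carrier R. \<tau> c \<otimes>\<^bsub>Q\<^esub> g (x \<oplus>\<^bsub>N\<^esub> y) i = \<tau> e" if i: "i < r" for i
      proof -
        obtain b where b: "b \<in> carrier R" "\<tau> c \<otimes>\<^bsub>Q\<^esub> g y i = \<tau> b" using y i by (auto simp: D_def)
        obtain b' where b': "b' \<in> carrier R" "\<tau> c \<otimes>\<^bsub>Q\<^esub> g x i = \<tau> b'" using x i by (auto simp: D_def)
        have "\<tau> c \<otimes>\<^bsub>Q\<^esub> g (x \<oplus>\<^bsub>N\<^esub> y) i = \<tau> b' \<oplus>\<^bsub>Q\<^esub> \<tau> b"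
          using gai[OF xy i] gi[OF xy(1) i] gi[OF xy(2) i] \<tau>c[OF c] b b' by (simp add: Q.r_distr)
        then show ?thesis using b b' by (intro bexI[of _ "b' \<oplus>\<^bsub>R\<^esub> b"]) (auto simp: \<tau>a)
      qed
      then show "x \<oplus>\<^bsub>N\<^esub> y \<in> D c" using xy by (simp add: D_def)
    qed (rule D_smult)
  qed
  obtain G where G: "finite G" "G \<subseteq> carrier N" "mod_span R N G = carrier N"
    using fg unfolding finitely_generated_def by blast
  have "\<exists>c\<in>S. \<forall>p\<in>G \<times> {..<r}. \<exists>a\<in>carrier R. \<tau> c \<otimes>\<^bsub>Q\<^esub> g (fst p) (snd p) = \<tau> a"
  proof (rule S.common_multiple)
    show "finite (G \<times> {..<r})" using G(1) by simp
    fix p assume "p \<in> G \<times> {..<r}"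
    then have p: "fst p \<in> carrier N" "snd p < r" using G(2) by auto
    show "\<exists>c\<in>S. \<exists>a\<in>carrier R. \<tau> c \<otimes>\<^bsub>Q\<^esub> g (fst p) (snd p) = \<tau> a" by (rule frac[OF gi[OF p]])
    fix t s assume t: "t \<in> S" "s \<in> S" "\<exists>a\<in>carrier R. \<tau> t \<otimes>\<^bsub>Q\<^esub> g (fst p) (snd p) = \<tau> a"
    then obtain a where a: "a \<in> carrier R" "\<tau> t \<otimes>\<^bsub>Q\<^esub> g (fst p) (snd p) = \<tau> a" by blast
    have "\<tau> (s \<otimes>\<^bsub>R\<^esub> t) \<otimes>\<^bsub>Q\<^esub> g (fst p) (snd p) = \<tau> s \<otimes>\<^bsub>Q\<^esub> (\<tau> t \<otimes>\<^bsub>Q\<^esub> g (fst p) (snd p))"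
      using t S.SR \<tau>c gi[OF p] by (simp add: \<tau>m Q.m_assoc)
    then show "\<exists>a\<in>carrier R. \<tau> (s \<otimes>\<^bsub>R\<^esub> t) \<otimes>\<^bsub>Q\<^esub> g (fst p) (snd p) = \<tau> a"
      using a t S.SR by (intro bexI[of _ "s \<otimes>\<^bsub>R\<^esub> a"]) (auto simp: \<tau>m)
  qed
  then obtain c where c: "c \<in> S" and "\<forall>p\<in>G \<times> {..<r}. \<exists>a\<in>carrier R. \<tau> c \<otimes>\<^bsub>Q\<^esub> g (fst p) (snd p) = \<tau> a"
    by blast
  then have "G \<subseteq> D c" using G(2) unfolding D_def by fastforce
  then have "carrier N \<subseteq> D c"
    using G(3) D_sub[OF S.SR[OF c]] unfolding mod_span_def by blast
  then have "\<forall>y i. \<exists>a. y \<in> carrier N \<longrightarrow> i < r \<longrightarrow> a \<in> carrier R \<and> \<tau> c \<otimes>\<^bsub>Q\<^esub> g y i = \<tau> a"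
    unfolding D_def by blast
  then obtain h0 where h0: "\<And>y i. y \<in> carrier N \<Longrightarrow> i < r \<Longrightarrow> h0 y i \<in> carrier R"
    "\<And>y i. y \<in> carrier N \<Longrightarrow> i < r \<Longrightarrow> \<tau> c \<otimes>\<^bsub>Q\<^esub> g y i = \<tau> (h0 y i)" by metis
  define h where "h y = (\<lambda>i\<in>{..<r}. h0 y i)" for y
  have hc: "h y \<in> carrier (free_mod R r)" if "y \<in> carrier N" for y
    using h0(1)[OF that] by (auto simp: h_def free_mod_def)
  have hi: "\<tau> (h y i) = \<tau> c \<otimes>\<^bsub>Q\<^esub> g y i" if "y \<in> carrier N" "i < r" for y i
    using h0(2)[OF that] that(2) by (simp add: h_def)
  have hic: "h y i \<in> carrier R" if "y \<in> carrier N" "i < r" for y i using h0(1)[OF that] that(2)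
    by (simp add: h_def)
  interpret F: module R "free_mod R r" by (rule module_free_mod[OF R])
  have cR: "\<tau> c \<in> carrier Q" using \<tau>c[OF S.SR[OF c]] .
  have h: "h \<in> mod_hom R N (free_mod R r)"
  proof (rule mod_homI[OF hc])
    fix x y assume xy: "x \<in> carrier N" "y \<in> carrier N"
    show "h (x \<oplus>\<^bsub>N\<^esub> y) = h x \<oplus>\<^bsub>free_mod R r\<^esub> h y"
    proof (rule free_mod_eqI)
      fix i assume i: "i < r"
      have "\<tau> (h (x \<oplus>\<^bsub>N\<^esub> y) i) = \<tau> (h x i \<oplus>\<^bsub>R\<^esub> h y i)"
        using xy i cR by (simp add: hi hic gai gi \<tau>a Q.r_distr)
      then have "h (x \<oplus>\<^bsub>N\<^esub> y) i = h x i \<oplus>\<^bsub>R\<^esub> h y i" by (rule \<tau>inj[rotated 2]) (use xy i hic in auto)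
      then show "h (x \<oplus>\<^bsub>N\<^esub> y) i = (h x \<oplus>\<^bsub>free_mod R r\<^esub> h y) i" using i by (simp add: free_mod_nth)
    qed (use xy hc in auto)
  next
    fix a y assume ay: "a \<in> carrier R" "y \<in> carrier N"
    show "h (a \<odot>\<^bsub>N\<^esub> y) = a \<odot>\<^bsub>free_mod R r\<^esub> h y"
    proof (rule free_mod_eqI)
      fix i assume i: "i < r"
      have "\<tau> (h (a \<odot>\<^bsub>N\<^esub> y) i) = \<tau> (a \<otimes>\<^bsub>R\<^esub> h y i)"
        using ay i cR \<tau>c by (simp add: hi hic gsi gi \<tau>m Q.m_lcomm)
      then have "h (a \<odot>\<^bsub>N\<^esub> y) i = a \<otimes>\<^bsub>R\<^esub> h y i" by (rule \<tau>inj[rotated 2]) (use ay i hic in auto)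
      then show "h (a \<odot>\<^bsub>N\<^esub> y) i = (a \<odot>\<^bsub>free_mod R r\<^esub> h y) i" using i by (simp add: free_mod_nth)
    qed (use ay hc in auto)
  qed
  have inj: "inj_on h (carrier N)"
  proof (rule inj_onI)
    fix x y assume xy: "x \<in> carrier N" "y \<in> carrier N" "h x = h y"
    have d: "x \<ominus>\<^bsub>N\<^esub> y \<in> carrier N" using xy by simp
    have "h (x \<ominus>\<^bsub>N\<^esub> y) = \<zero>\<^bsub>free_mod R r\<^esub>"
      using mod_hom_minus[OF N F.module_axioms h xy(1,2)] xy hc by (simp add: a_minus_def F.M.r_neg)
    then have "\<tau> c \<otimes>\<^bsub>Q\<^esub> g (x \<ominus>\<^bsub>N\<^esub> y) i = \<zero>\<^bsub>Q\<^esub>" if "i < r" for i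
      using hi[OF d that] that by (simp add: free_mod_nth \<tau>0)
    then have "g (x \<ominus>\<^bsub>N\<^esub> y) i = \<zero>\<^bsub>Q\<^esub>" if "i < r" for i
      using \<tau>cancel[OF c gi[OF d that]] that by blast
    then have "x \<ominus>\<^bsub>N\<^esub> y = \<zero>\<^bsub>N\<^esub>" using ginj[OF d g0[OF d]] by blast
    then show "x = y" using N.M.diff_add_cancel[OF xy(1,2)] xy(2) by simp
  qed
  \<comment> \<open>Every element of the base change has a non-zero-divisor multiple coming from N;
    applied to preimages of unit vectors, this produces the lattice.\<close>
  have clear: "\<exists>s\<in>S. \<exists>y\<in>carrier N. \<tau> s \<odot>\<^bsub>?BC\<^esub> u = \<iota> y" if u: "u \<in> carrier (tensor R N QR)" for u
    using u
  proof (induction u rule: P.tensor_induct)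
    case (tens x t)
    then obtain s a where s: "s \<in> S" "a \<in> carrier R" "\<tau> s \<otimes>\<^bsub>Q\<^esub> t = \<tau> a" using frac[of t]
      by (auto simp: QRs)
    have "\<tau> s \<odot>\<^bsub>?BC\<^esub> P.tens x t = P.tens x (a \<odot>\<^bsub>QR\<^esub> \<one>\<^bsub>Q\<^esub>)"
      using tens s \<tau>c S.SR by (simp add: act QRs)
    also have "\<dots> = \<iota> (a \<odot>\<^bsub>N\<^esub> x)" unfolding \<iota>_def using tens s(2)
      by (subst P.tens_balanced) (auto simp: QRs)
    finally show ?case using s(1,2) tens(1) by blast
  next
    case (add u v)
    then obtain s y t z where s: "s \<in> S" "y \<in> carrier N" "\<tau> s \<odot>\<^bsub>?BC\<^esub> u = \<iota> y" "t \<in> S" "z \<in> carrier N" "\<tau> t \<odot>\<^bsub>?BC\<^esub> v = \<iota> z" by blast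
    have st: "s \<in> carrier R" "t \<in> carrier R" "\<tau> s \<in> carrier Q" "\<tau> t \<in> carrier Q" using s S.SR \<tau>c by auto
    have "\<tau> (s \<otimes>\<^bsub>R\<^esub> t) \<odot>\<^bsub>?BC\<^esub> (u \<oplus>\<^bsub>tensor R N QR\<^esub> v)
       = \<tau> t \<odot>\<^bsub>?BC\<^esub> (\<tau> s \<odot>\<^bsub>?BC\<^esub> u) \<oplus>\<^bsub>tensor R N QR\<^esub> \<tau> s \<odot>\<^bsub>?BC\<^esub> (\<tau> t \<odot>\<^bsub>?BC\<^esub> v)"
      using add(1,2) st by (simp add: \<tau>m act_add act_mult Q.m_comm[of "\<tau> t" "\<tau> s"])
    also have "\<dots> = \<iota> (t \<odot>\<^bsub>N\<^esub> y \<oplus>\<^bsub>N\<^esub> s \<odot>\<^bsub>N\<^esub> z)"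
      using s st by (simp add: \<iota>a \<iota>s)
    finally show ?case
      using S.S_mult[OF s(1,4)] st s by (intro bexI[of _ "s \<otimes>\<^bsub>R\<^esub> t"] bexI[of _ "t \<odot>\<^bsub>N\<^esub> y \<oplus>\<^bsub>N\<^esub> s \<odot>\<^bsub>N\<^esub> z"]) auto
  qed
  have "\<exists>d\<in>S. \<forall>i\<in>{..<r}. \<exists>y\<in>carrier N. h y = d \<odot>\<^bsub>free_mod R r\<^esub> unit_vec R r i"
  proof (rule S.common_multiple)
    fix i assume i: "i \<in> {..<r}"
    have uQ: "unit_vec Q r i \<in> carrier (free_mod Q r)" by (rule unit_vec_closed[OF Q.is_cring])
    then have "unit_vec Q r i \<in> \<psi> ` carrier (tensor R N QR)"
      using bij_betw_imp_surj_on[OF \<psi>(2)] by (simp add: bc(1))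
    then obtain u where u: "u \<in> carrier (tensor R N QR)" "\<psi> u = unit_vec Q r i"
      by (elim imageE) auto
    obtain s y where s: "s \<in> S" "y \<in> carrier N" "\<tau> s \<odot>\<^bsub>?BC\<^esub> u = \<iota> y" using clear[OF u(1)] by blast
    have sR: "s \<in> carrier R" "\<tau> s \<in> carrier Q" using s(1) S.SR \<tau>c by auto
    have gy: "g y = \<tau> s \<odot>\<^bsub>free_mod Q r\<^esub> unit_vec Q r i"
      unfolding g_def s(3)[symmetric] using mod_hom_smult[OF \<psi>(1) sR(2), of u] u by (simp add: bc(1))
    have ur: "unit_vec R r i \<in> carrier (free_mod R r)" by (rule unit_vec_closed[OF R])
    have csR: "c \<otimes>\<^bsub>R\<^esub> s \<in> carrier R" using sR S.SR[OF c] by simp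
    \<comment> \<open>The factor \<open>s\<close> brings the preimage of the unit vector into N, and
      \<open>c\<close> is the denominator built into \<open>h\<close>.\<close>
    have "h y = (c \<otimes>\<^bsub>R\<^esub> s) \<odot>\<^bsub>free_mod R r\<^esub> unit_vec R r i"
    proof (rule free_mod_eqI[OF hc[OF s(2)] F.smult_closed[OF csR ur]])
      fix k assume k: "k < r"
      have "\<tau> (h y k) = \<tau> ((c \<otimes>\<^bsub>R\<^esub> s) \<otimes>\<^bsub>R\<^esub> unit_vec R r i k)"
        using hi[OF s(2) k] k sR S.SR[OF c] cR
        by (simp add: gy free_mod_nth unit_vec_nth \<tau>m \<tau>0 \<tau>1)
      then have "h y k = (c \<otimes>\<^bsub>R\<^esub> s) \<otimes>\<^bsub>R\<^esub> unit_vec R r i k"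
        by (rule \<tau>inj[rotated 2]) (use hic[OF s(2) k] csR free_mod_nth_closed[OF ur k] in auto)
      then show "h y k = ((c \<otimes>\<^bsub>R\<^esub> s) \<odot>\<^bsub>free_mod R r\<^esub> unit_vec R r i) k" using k by (simp add: free_mod_nth)
    qed
    then show "\<exists>d\<in>S. \<exists>y\<in>carrier N. h y = d \<odot>\<^bsub>free_mod R r\<^esub> unit_vec R r i"
      using S.S_mult[OF c s(1)] s(2) by blast
  next
    fix i t q assume "t \<in> S" "q \<in> S" "\<exists>y\<in>carrier N. h y = t \<odot>\<^bsub>free_mod R r\<^esub> unit_vec R r i"
    moreover from this obtain y where y: "y \<in> carrier N" "h y = t \<odot>\<^bsub>free_mod R r\<^esub> unit_vec R r i" by blast
    ultimately have "h (q \<odot>\<^bsub>N\<^esub> y) = (q \<otimes>\<^bsub>R\<^esub> t) \<odot>\<^bsub>free_mod R r\<^esub> unit_vec R r i"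
      using S.SR unit_vec_closed[OF R, of r i] by (simp add: mod_hom_smult[OF h] F.smult_assoc1)
    then show "\<exists>y\<in>carrier N. h y = (q \<otimes>\<^bsub>R\<^esub> t) \<odot>\<^bsub>free_mod R r\<^esub> unit_vec R r i"
      using y(1) S.SR[OF \<open>q \<in> S\<close>] by blast
  qed simp
  then obtain d where d: "d \<in> S" "\<forall>i\<in>{..<r}. \<exists>y\<in>carrier N. h y = d \<odot>\<^bsub>free_mod R r\<^esub> unit_vec R r i" by blast
  then have "\<forall>i. \<exists>y. i < r \<longrightarrow> y \<in> carrier N \<and> h y = d \<odot>\<^bsub>free_mod R r\<^esub> unit_vec R r i" by auto
  then obtain v where v: "\<And>i. i < r \<Longrightarrow> v i \<in> carrier N" "\<And>i. i < r \<Longrightarrow> h (v i) = d \<odot>\<^bsub>free_mod R r\<^esub> unit_vec R r i" by metis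
  show ?thesis
  proof (rule that[OF h inj])
    show "d \<in> nonzerodivisors R" using d(1) by (simp add: S_def)
    fix x assume x: "x \<in> carrier (free_mod R r)"
    have l: "lin_comb N r v \<in> mod_hom R (free_mod R r) N" by (rule lin_comb_hom[OF N]) (rule v(1))
    have "h (lin_comb N r v x) = d \<odot>\<^bsub>free_mod R r\<^esub> x"
      by (rule hom_free_ext[OF F.module_axioms mod_hom_comp[OF h l] mod_hom_scale[OF F.module_axioms mod_hom_ident S.SR[OF d(1)]] _ x])
         (simp add: lin_comb_unit_vec[OF N] v)
    then show "d \<odot>\<^bsub>free_mod R r\<^esub> x \<in> h ` carrier N" using mod_hom_closed[OF l x] by (metis image_eqI)
  qed
qed

section \<open>Exactness and torsion\<close>

lemma pow_map_closed: "\<theta> \<in> mod_hom R M N \<Longrightarrow> y \<in> carrier (pow_mod M n) \<Longrightarrow> (\<lambda>j\<in>{..<n}. \<theta> (y j)) \<in> carrier (pow_mod N n)"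
  by (rule pow_mod_memI) (auto intro: mod_hom_closed dest: pow_mod_nth_closed)

text \<open>Entrywise application of a linear map commutes with matrices over R. It gives access to
  single coordinates of a power and carries exactness over to the free submodule of N.\<close>

lemma hom_ext_natural:
  assumes M: "module R M" and N: "module R N" and \<theta>: "\<theta> \<in> mod_hom R M N"
    and f: "f \<in> mod_hom R (free_mod R n) (free_mod R m)" and y: "y \<in> carrier (pow_mod M n)"
  shows "hom_ext R N m n f (\<lambda>j\<in>{..<n}. \<theta> (y j)) = (\<lambda>i\<in>{..<m}. \<theta> (hom_ext R M m n f y i))"
proof -
  interpret M: module R M by fact
  interpret N: module R N by fact
  have ye: "j < n \<Longrightarrow> y j \<in> carrier M" for j by (rule pow_mod_nth_closed[OF y])
  show ?thesis
  proof (rule pow_mod_eqI[OF N.hom_ext_closed[OF f pow_map_closed[OF \<theta> y]] pow_map_closed[OF \<theta> M.hom_ext_closed[OF f y]]])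
    fix i assume i: "i < m"
    have "\<theta> (hom_ext R M m n f y i) = (\<Oplus>\<^bsub>N\<^esub>j\<in>{..<n}. \<theta> (f (unit_vec R n j) i \<odot>\<^bsub>M\<^esub> y j))"
      unfolding M.hom_ext_nth[OF i]
      by (rule mod_hom_finsum[OF M N \<theta>]) (use ye M.hom_entry_closed[OF f i] in auto)
    also have "\<dots> = hom_ext R N m n f (\<lambda>j\<in>{..<n}. \<theta> (y j)) i"
      unfolding N.hom_ext_nth[OF i]
      by (rule N.M.finsum_cong') (use ye M.hom_entry_closed[OF f i] mod_hom_closed[OF \<theta>] in \<open>auto simp: mod_hom_smult[OF \<theta>]\<close>)
    finally show "hom_ext R N m n f (\<lambda>j\<in>{..<n}. \<theta> (y j)) i = (\<lambda>i\<in>{..<m}. \<theta> (hom_ext R M m n f y i)) i"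
      using i by simp
  qed
qed

text \<open>A system with coefficients in M^r is solved coordinate by coordinate, after exchanging
  the two indices.\<close>

lemma exact_at_pow:
  assumes M: "module R M" and d: "d \<in> mod_hom R (free_mod R n) (free_mod R m)"
    and e: "e \<in> mod_hom R (free_mod R p) (free_mod R n)" and ex: "exact_at R M m n p d e"
  shows "exact_at R (pow_mod M r) m n p d e"
  unfolding exact_at_def[OF module_pow_mod[OF M]]
proof (intro ballI impI)
  interpret M: module R M by fact
  interpret P: module R "pow_mod M r" by (rule module_pow_mod[OF M])
  have proj: "(\<lambda>x. x k) \<in> mod_hom R (pow_mod M r) M" if "k < r" for k
    by (rule mod_homI) (use that in \<open>auto simp: pow_mod_nth intro: pow_mod_nth_closed\<close>)
  fix y assume y: "y \<in> carrier (pow_mod (pow_mod M r) n)"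
    and dy: "hom_ext R (pow_mod M r) m n d y = \<zero>\<^bsub>pow_mod (pow_mod M r) m\<^esub>"
  have "\<exists>z. z \<in> carrier (pow_mod M p) \<and> (\<lambda>j\<in>{..<n}. y j k) = hom_ext R M n p e z" if k: "k < r" for k
  proof -
    have "hom_ext R M m n d (\<lambda>j\<in>{..<n}. y j k) = (\<lambda>i\<in>{..<m}. hom_ext R (pow_mod M r) m n d y i k)"
      by (rule hom_ext_natural[OF P.module_axioms M proj[OF k] d y])
    also have "\<dots> = \<zero>\<^bsub>pow_mod M m\<^esub>"
      unfolding dy using k by (auto simp: pow_mod_simps intro!: restrict_ext)
    finally show ?thesis
      using ex pow_map_closed[OF proj[OF k] y] unfolding exact_at_def[OF M] by blast
  qed
  then obtain z where z: "\<And>k. k < r \<Longrightarrow> z k \<in> carrier (pow_mod M p)"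
    "\<And>k. k < r \<Longrightarrow> (\<lambda>j\<in>{..<n}. y j k) = hom_ext R M n p e (z k)" by metis
  \<comment> \<open>The solutions for the separate coordinates \<open>k\<close> are transposed into
    one vector with entries in \<open>pow_mod M r\<close>.\<close>
  define w where "w = (\<lambda>j\<in>{..<p}. \<lambda>k\<in>{..<r}. z k j)"
  have w: "w \<in> carrier (pow_mod (pow_mod M r) p)"
    unfolding w_def by (intro pow_mod_memI) (use z(1) in \<open>auto dest: pow_mod_nth_closed\<close>)
  have "y = hom_ext R (pow_mod M r) n p e w"
  proof (rule pow_mod_eqI[OF y P.hom_ext_closed[OF e w]])
    fix i assume i: "i < n"
    show "y i = hom_ext R (pow_mod M r) n p e w i"
    proof (rule pow_mod_eqI[OF pow_mod_nth_closed[OF y i] pow_mod_nth_closed[OF P.hom_ext_closed[OF e w] i]])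
      fix k assume k: "k < r"
      have "(\<lambda>j\<in>{..<p}. w j k) = z k"
        by (rule pow_mod_eqI[OF pow_map_closed[OF proj[OF k] w] z(1)[OF k]]) (simp add: w_def k)
      then have "hom_ext R M n p e (z k) = (\<lambda>i\<in>{..<n}. hom_ext R (pow_mod M r) n p e w i k)"
        using hom_ext_natural[OF P.module_axioms M proj[OF k] e w] by simp
      then show "y i k = hom_ext R (pow_mod M r) n p e w i k"
        using fun_cong[OF z(2)[OF k], of i] i by simp
    qed
  qed
  then show "y \<in> hom_ext R (pow_mod M r) n p e ` carrier (pow_mod (pow_mod M r) p)" using w by blast
qed

context periodic
begin

text \<open>For coefficients in R these are the kernel identities for \<open>A\<close> and
  \<open>B\<close>; powers follow coordinatewise.\<close>

lemma exact_free:
  "exact_at R (free_mod R r) n\<^sub>0 n\<^sub>1 n\<^sub>0 A B" "exact_at R (free_mod R r) n\<^sub>1 n\<^sub>0 n\<^sub>1 B A"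
proof -
  note S = module_self[OF M.is_cring]
  have "exact_at R (self_module R) n\<^sub>0 n\<^sub>1 n\<^sub>0 A B"
    unfolding exact_at_def[OF S] free_mod_eq[symmetric]
    by (simp add: hom_ext_self[OF M.is_cring A] A_kernel) (auto simp: hom_ext_self[OF M.is_cring B])
  then show "exact_at R (free_mod R r) n\<^sub>0 n\<^sub>1 n\<^sub>0 A B" unfolding free_mod_eq
    by (rule exact_at_pow[OF S A B])
  have "exact_at R (self_module R) n\<^sub>1 n\<^sub>0 n\<^sub>1 B A"
    unfolding exact_at_def[OF S] free_mod_eq[symmetric]
    by (simp add: hom_ext_self[OF M.is_cring B] B_kernel) (auto simp: hom_ext_self[OF M.is_cring A])
  then show "exact_at R (free_mod R r) n\<^sub>1 n\<^sub>0 n\<^sub>1 B A" unfolding free_mod_eq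
    by (rule exact_at_pow[OF S B A])
qed

lemma AB_zero: "x \<in> carrier (free_mod R n\<^sub>0) \<Longrightarrow> A (B x) = \<zero>\<^bsub>free_mod R n\<^sub>0\<^esub>"
  using A_kernel mod_hom_closed[OF B] by blast

lemma BA_zero: "x \<in> carrier (free_mod R n\<^sub>1) \<Longrightarrow> B (A x) = \<zero>\<^bsub>free_mod R n\<^sub>1\<^esub>"
  using B_kernel mod_hom_closed[OF A] by blast

section \<open>Torsion of the tensor product in coordinates\<close>

context
  fixes N :: "('a, 'c, 'n) module_scheme"
  assumes N: "module R N"
begin

interpretation N: module R N by (rule N)

lemma AB_ext_zero:
  assumes "y \<in> carrier (pow_mod N n\<^sub>0)"
  shows "hom_ext R N n\<^sub>0 n\<^sub>1 A (hom_ext R N n\<^sub>1 n\<^sub>0 B y) = \<zero>\<^bsub>pow_mod N n\<^sub>0\<^esub>"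
  unfolding N.hom_ext_comp[OF A B assms] by (rule N.hom_ext_zero[OF AB_zero assms])

lemma BA_ext_zero:
  assumes "y \<in> carrier (pow_mod N n\<^sub>1)"
  shows "hom_ext R N n\<^sub>1 n\<^sub>0 B (hom_ext R N n\<^sub>0 n\<^sub>1 A y) = \<zero>\<^bsub>pow_mod N n\<^sub>1\<^esub>"
  unfolding N.hom_ext_comp[OF B A assms] by (rule N.hom_ext_zero[OF BA_zero assms])

text \<open>\<open>tens_vec\<close> exhibits the tensor product as the cokernel of the matrix of
  \<open>A\<close>, compatibly with scalars, so a torsion element is a vector with a
  non-zero-divisor multiple in the image.\<close>

lemma torsion_free_tensor_iff:
  "torsion_free R (tensor R M N) \<longleftrightarrow> (\<forall>y\<in>carrier (pow_mod N n\<^sub>0). \<forall>a\<in>nonzerodivisors R.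
     a \<odot>\<^bsub>pow_mod N n\<^sub>0\<^esub> y \<in> hom_ext R N n\<^sub>0 n\<^sub>1 A ` carrier (pow_mod N n\<^sub>1) \<longrightarrow>
     y \<in> hom_ext R N n\<^sub>0 n\<^sub>1 A ` carrier (pow_mod N n\<^sub>1))" (is "_ \<longleftrightarrow> ?r")
proof -
  interpret P: module_pair R M N by (rule module_pairI[OF M.module_axioms N])
  interpret PN: module R "pow_mod N n\<^sub>0" by (rule module_pow_mod[OF N])
  let ?\<sigma> = "P.tens_vec n\<^sub>0 \<epsilon>" and ?I = "hom_ext R N n\<^sub>0 n\<^sub>1 A ` carrier (pow_mod N n\<^sub>1)"
  note ker = P.tens_vec_kernel[OF eps eps_surj A A_image]
  have nz: "a \<in> nonzerodivisors R \<Longrightarrow> a \<in> carrier R" for a by (simp add: nonzerodivisors_def)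
  have smult: "a \<odot>\<^bsub>tensor R M N\<^esub> ?\<sigma> y = \<zero>\<^bsub>tensor R M N\<^esub> \<longleftrightarrow> a \<odot>\<^bsub>pow_mod N n\<^sub>0\<^esub> y \<in> ?I"
    if "a \<in> carrier R" "y \<in> carrier (pow_mod N n\<^sub>0)" for a y
    unfolding P.tens_vec_smult[OF eps that] by (rule ker) (use that in simp)
  \<comment> \<open>\<open>torsion_free\<close> is an equality of sets, so zero has to be shown to
    be torsion; the scalar one is a witness.\<close>
  have z: "\<zero>\<^bsub>tensor R M N\<^esub> \<in> torsion R (tensor R M N)"
    unfolding torsion_def
    using add_monoid_hom_zero[OF P.T.abelian_group_axioms P.T.abelian_group_axioms P.tensor_smult_hom[of "\<one>\<^bsub>R\<^esub>"]]
    by (auto simp: nonzerodivisors_def intro!: bexI[of _ "\<one>\<^bsub>R\<^esub>"])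
  show ?thesis
  proof
    assume tf: "torsion_free R (tensor R M N)"
    show ?r
    proof (intro ballI impI)
      fix y a assume y: "y \<in> carrier (pow_mod N n\<^sub>0)" and a: "a \<in> nonzerodivisors R" and ay: "a \<odot>\<^bsub>pow_mod N n\<^sub>0\<^esub> y \<in> ?I"
      then have "?\<sigma> y \<in> torsion R (tensor R M N)"
        unfolding torsion_def using smult[OF nz[OF a] y] P.tens_vec_closed[OF eps y] by blast
      then show "y \<in> ?I" using tf ker[OF y] unfolding torsion_free_def by blast
    qed
  next
    assume r: ?r
    have "u = \<zero>\<^bsub>tensor R M N\<^esub>" if u: "u \<in> torsion R (tensor R M N)" for u
    proof -
      obtain a where a: "a \<in> nonzerodivisors R" "a \<odot>\<^bsub>tensor R M N\<^esub> u = \<zero>\<^bsub>tensor R M N\<^esub>" and uc: "u \<in> carrier (tensor R M N)"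
        using u unfolding torsion_def by blast
      from P.tens_vec_surj[OF eps eps_surj uc] obtain y where y: "y \<in> carrier (pow_mod N n\<^sub>0)" "u = ?\<sigma> y" .
      then have "y \<in> ?I" using r a(1) smult[OF nz[OF a(1)] y(1)] a(2) by blast
      then show ?thesis using ker[OF y(1)] y(2) by blast
    qed
    then show "torsion_free R (tensor R M N)" unfolding torsion_free_def using z by blast
  qed
qed

end

section \<open>Equality of the two ranks and the length count\<close>

text \<open>At a minimal prime the ring has finite nonzero length \<open>l\<close>. Image and kernel
  of \<open>A\<close> are, by periodicity, kernel and image of \<open>B\<close>, so
  \<open>n\<^sub>1 * l\<close> and \<open>n\<^sub>0 * l\<close> are the same sum of two
  lengths.\<close>

lemma ranks_equal:
  assumes "dim_one_local R"
  shows "n\<^sub>0 = n\<^sub>1"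
proof -
  interpret D: dim_one_local R by (rule assms)
  obtain P where P: "primeideal P R" and min: "\<And>Q. primeideal Q R \<Longrightarrow> Q \<subseteq> P \<Longrightarrow> Q = P"
    using D.minimal_prime_exists by blast
  note cr = M.is_cring
  interpret V: mult_set R "carrier R - P" by (rule cring.mult_set_prime[OF cr P])
  note S = module_self[OF cr]
  interpret F0: module R "free_mod R n\<^sub>0" by (rule module_free_mod[OF cr])
  interpret F1: module R "free_mod R n\<^sub>1" by (rule module_free_mod[OF cr])
  let ?len = "len R (carrier R - P)"
  define l where "l = ?len (self_module R) {\<zero>\<^bsub>R\<^esub>} (carrier R)"
  have sz: "submodule {\<zero>\<^bsub>R\<^esub>} R (self_module R)" using submodule_zero[OF S] by simp
  have sc: "submodule (carrier R) R (self_module R)" using module.carrier_is_submodule[OF S] by simp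
  \<comment> \<open>Minimality of \<open>P\<close> is the hypothesis of the colength bound for the
    zero ideal.\<close>
  have "l < \<infinity>" unfolding l_def
    by (rule noetherian_cring.len_quotient_finite[OF _ P])
       (use min D.noetherian_cring_axioms sz in \<open>auto simp: cring.ideal_iff_submodule[OF cr]\<close>)
  moreover have "l \<noteq> 0"
  proof -
    have "s \<notin> {\<zero>\<^bsub>R\<^esub>}" if "s \<in> carrier R - P" for s
      using that cring.ideal_mem(2)[OF cr primeideal.axioms(1)[OF P]] by auto
    then have "big (carrier R - P) (self_module R) {\<zero>\<^bsub>R\<^esub>} (carrier R)"
      unfolding big_def by (intro bexI[of _ "\<one>\<^bsub>R\<^esub>"]) auto
    then have "tower R (carrier R - P) (self_module R) {\<zero>\<^bsub>R\<^esub>} (carrier R) (Suc 0)"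
      using tower_Suc[OF tower_0[OF sz sz subset_refl] sc] by simp
    from tower_le_len[OF this] show ?thesis unfolding l_def by (auto simp: zero_enat_def)
  qed
  ultimately obtain k where k: "l = enat k" "k \<noteq> 0" by (cases l) (auto simp: zero_enat_def)
  have zero_pow: "{..<n} \<rightarrow>\<^sub>E {\<zero>\<^bsub>R\<^esub>} = {\<zero>\<^bsub>free_mod R n\<^esub>}" for n
    by (auto simp: free_mod_def PiE_iff extensional_def fun_eq_iff)
  have car: "{..<n} \<rightarrow>\<^sub>E carrier R = carrier (free_mod R n)" for n by (simp add: free_mod_def)
  have lf: "?len (free_mod R n) {\<zero>\<^bsub>free_mod R n\<^esub>} (carrier (free_mod R n)) = enat n * l" for n
    using V.len_pow[OF S sz sc, of n] unfolding zero_pow car l_def free_mod_eq[symmetric] by simp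
  have A0: "A ` {\<zero>\<^bsub>free_mod R n\<^sub>1\<^esub>} = {\<zero>\<^bsub>free_mod R n\<^sub>0\<^esub>}" "{x \<in> {\<zero>\<^bsub>free_mod R n\<^sub>1\<^esub>}. A x = \<zero>\<^bsub>free_mod R n\<^sub>0\<^esub>} = {\<zero>\<^bsub>free_mod R n\<^sub>1\<^esub>}"
    using mod_hom_zero[OF F1.module_axioms F0.module_axioms A] by auto
  have B0: "B ` {\<zero>\<^bsub>free_mod R n\<^sub>0\<^esub>} = {\<zero>\<^bsub>free_mod R n\<^sub>1\<^esub>}" "{x \<in> {\<zero>\<^bsub>free_mod R n\<^sub>0\<^esub>}. B x = \<zero>\<^bsub>free_mod R n\<^sub>1\<^esub>} = {\<zero>\<^bsub>free_mod R n\<^sub>0\<^esub>}"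
    using mod_hom_zero[OF F0.module_axioms F1.module_axioms B] by auto
  have kA: "{x \<in> carrier (free_mod R n\<^sub>1). A x = \<zero>\<^bsub>free_mod R n\<^sub>0\<^esub>} = B ` carrier (free_mod R n\<^sub>0)"
    using A_kernel mod_hom_closed[OF B] by blast
  have kB: "{x \<in> carrier (free_mod R n\<^sub>0). B x = \<zero>\<^bsub>free_mod R n\<^sub>1\<^esub>} = A ` carrier (free_mod R n\<^sub>1)"
    using B_kernel mod_hom_closed[OF A] by blast
  have "enat n\<^sub>1 * l = ?len (free_mod R n\<^sub>0) {\<zero>\<^bsub>free_mod R n\<^sub>0\<^esub>} (A ` carrier (free_mod R n\<^sub>1))
     + ?len (free_mod R n\<^sub>1) {\<zero>\<^bsub>free_mod R n\<^sub>1\<^esub>} (B ` carrier (free_mod R n\<^sub>0))"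
    using V.len_hom[OF F1.module_axioms F0.module_axioms A submodule_zero[OF F1.module_axioms] F1.carrier_is_submodule]
    unfolding lf A0 kA by simp
  moreover have "enat n\<^sub>0 * l = ?len (free_mod R n\<^sub>1) {\<zero>\<^bsub>free_mod R n\<^sub>1\<^esub>} (B ` carrier (free_mod R n\<^sub>0))
     + ?len (free_mod R n\<^sub>0) {\<zero>\<^bsub>free_mod R n\<^sub>0\<^esub>} (A ` carrier (free_mod R n\<^sub>1))"
    using V.len_hom[OF F0.module_axioms F1.module_axioms B submodule_zero[OF F0.module_axioms] F0.carrier_is_submodule]
    unfolding lf B0 kB by simp
  ultimately have "enat n\<^sub>1 * l = enat n\<^sub>0 * l" by (simp add: add.commute)
  then show ?thesis using k by simp
qed

text \<open>With \<open>F\<close> the free submodule of N corresponding to \<open>d R^r\<close>, all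
  lengths are taken at the maximal ideal. The matrix of \<open>A\<close> contributes image length
  plus the length of its kernel over that of \<open>F\<close>; the matrix of \<open>B\<close>
  contributes the same image length plus the part of that kernel already in the image of
  \<open>B\<close>. Equal finite totals leave length zero for the rest.\<close>

lemma exact_lattice:
  assumes dim: "dim_one_local R" and N: "module R N"
    and h: "h \<in> mod_hom R N (free_mod R r)" and inj: "inj_on h (carrier N)" and d: "d \<in> nonzerodivisors R"
    and dh: "\<And>x. x \<in> carrier (free_mod R r) \<Longrightarrow> d \<odot>\<^bsub>free_mod R r\<^esub> x \<in> h ` carrier N"
    and exB: "exact_at R N n\<^sub>1 n\<^sub>0 n\<^sub>1 B A"
  shows "exact_at R N n\<^sub>0 n\<^sub>1 n\<^sub>0 A B"
proof -
  interpret D: dim_one_local R by (rule dim)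
  interpret N: module R N by (rule N)
  note cr = M.is_cring
  note S = module_self[OF cr]
  interpret Fr: module R "free_mod R r" by (rule module_free_mod[OF cr])
  interpret P0: module R "pow_mod N n\<^sub>0" by (rule module_pow_mod[OF N])
  interpret P1: module R "pow_mod N n\<^sub>1" by (rule module_pow_mod[OF N])
  obtain m where m: "primeideal m R" and mmax: "\<And>I. ideal I R \<Longrightarrow> I \<noteq> carrier R \<Longrightarrow> I \<subseteq> m"
    and mnz: "\<And>Q c. primeideal Q R \<Longrightarrow> c \<in> Q \<Longrightarrow> c \<in> nonzerodivisors R \<Longrightarrow> Q = m"
    using D.local_maximal by blast
  interpret V: mult_set R "carrier R - m" by (rule cring.mult_set_prime[OF cr m])
  let ?len = "len R (carrier R - m)"
  have dR: "d \<in> carrier R" using d by (simp add: nonzerodivisors_def)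
  let ?I = "PIdl\<^bsub>R\<^esub> d"
  have I: "ideal ?I R" by (rule cring.cgenideal_ideal[OF cr dR])
  have Ie: "?I = {x \<otimes>\<^bsub>R\<^esub> d | x. x \<in> carrier R}" by (simp add: cgenideal_def)
  have sI: "submodule ?I R (self_module R)" using I by (simp add: cring.ideal_iff_submodule[OF cr])
  have sc: "submodule (carrier R) R (self_module R)" using module.carrier_is_submodule[OF S] by simp
  have IR: "?I \<subseteq> carrier R" using cring.ideal_mem(1)[OF cr I] by blast
  \<comment> \<open>Only the maximal ideal contains the non-zero-divisor \<open>d\<close>, so the
    colength bound applies to the principal ideal of \<open>d\<close>.\<close>
  have fin: "?len (self_module R) ?I (carrier R) < \<infinity>"
  proof (rule noetherian_cring.len_quotient_finite[OF D.noetherian_cring_axioms m I])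
    fix Q assume Q: "primeideal Q R" "?I \<subseteq> Q"
    have "d \<in> ?I" using dR unfolding Ie by (intro CollectI exI[of _ "\<one>\<^bsub>R\<^esub>"]) simp
    then show "Q = m" using mnz[OF Q(1) _ d] Q(2) by blast
  qed
  have scd: "(\<lambda>x. d \<odot>\<^bsub>free_mod R r\<^esub> x) \<in> mod_hom R (free_mod R r) (free_mod R r)"
    by (rule mod_hom_scale[OF Fr.module_axioms mod_hom_ident dR])
  \<comment> \<open>Multiplication by \<open>d\<close> factored through \<open>h\<close>;
    \<open>\<theta>\<close> is injective and identifies R^r with \<open>F\<close>.\<close>
  obtain \<theta> where \<theta>: "\<theta> \<in> mod_hom R (free_mod R r) N" "\<And>x. x \<in> carrier (free_mod R r) \<Longrightarrow> h (\<theta> x) = d \<odot>\<^bsub>free_mod R r\<^esub> x"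
    by (rule free_mod_lift[OF N Fr.module_axioms scd h]) (use dh in auto)
  have \<theta>inj: "x = \<zero>\<^bsub>free_mod R r\<^esub>" if x: "x \<in> carrier (free_mod R r)" "\<theta> x = \<zero>\<^bsub>N\<^esub>" for x
  proof (rule free_mod_eqI[OF x(1) Fr.M.zero_closed])
    fix i assume i: "i < r"
    have "d \<odot>\<^bsub>free_mod R r\<^esub> x = \<zero>\<^bsub>free_mod R r\<^esub>"
      using \<theta>(2)[OF x(1)] x(2) mod_hom_zero[OF N Fr.module_axioms h] by simp
    then have "d \<otimes>\<^bsub>R\<^esub> x i = \<zero>\<^bsub>R\<^esub>" using i by (metis free_mod_nth(1,3))
    then show "x i = \<zero>\<^bsub>free_mod R r\<^esub> i"
      using d free_mod_nth_closed[OF x(1) i] i by (simp add: nonzerodivisors_def free_mod_nth)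
  qed
  define F where "F = \<theta> ` carrier (free_mod R r)"
  have sF: "submodule F R N" unfolding F_def
    by (rule submodule_image[OF Fr.module_axioms N \<theta>(1) Fr.carrier_is_submodule])
  have FN: "F \<subseteq> carrier N" using submodule_subset[OF sF] .
  \<comment> \<open>Inside R^r the submodule is a power of the principal ideal of \<open>d\<close>,
    so its colength is \<open>r\<close> times that of the ideal.\<close>
  have hF: "h ` F = {..<r} \<rightarrow>\<^sub>E ?I"
  proof
    show "h ` F \<subseteq> {..<r} \<rightarrow>\<^sub>E ?I"
    proof
      fix z assume "z \<in> h ` F"
      then obtain x where x: "x \<in> carrier (free_mod R r)" "z = d \<odot>\<^bsub>free_mod R r\<^esub> x" unfolding F_def
        using \<theta>(2) by auto
      have zc: "z \<in> carrier (free_mod R r)" unfolding x(2) by (rule Fr.smult_closed[OF dR x(1)])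
      have "z i \<in> ?I" if i: "i < r" for i
        unfolding Ie using i free_mod_nth_closed[OF x(1) i] dR
        by (intro CollectI exI[of _ "x i"]) (simp add: x(2) free_mod_nth M.R.m_comm)
      then show "z \<in> {..<r} \<rightarrow>\<^sub>E ?I" using zc by (simp add: free_mod_def PiE_iff)
    qed
    show "{..<r} \<rightarrow>\<^sub>E ?I \<subseteq> h ` F"
    proof
      fix z assume z: "z \<in> {..<r} \<rightarrow>\<^sub>E ?I"
      have "\<forall>i. \<exists>x. i < r \<longrightarrow> x \<in> carrier R \<and> z i = x \<otimes>\<^bsub>R\<^esub> d" using z unfolding Ie by blast
      then obtain x where x: "\<And>i. i < r \<Longrightarrow> x i \<in> carrier R" "\<And>i. i < r \<Longrightarrow> z i = x i \<otimes>\<^bsub>R\<^esub> d" by metis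
      have xc: "restrict x {..<r} \<in> carrier (free_mod R r)" using x(1) by (auto simp: free_mod_def)
      have "z = d \<odot>\<^bsub>free_mod R r\<^esub> restrict x {..<r}"
      proof (rule free_mod_eqI[OF _ Fr.smult_closed[OF dR xc]])
        show "z \<in> carrier (free_mod R r)" using z IR by (auto simp: free_mod_def PiE_iff)
        show "z i = (d \<odot>\<^bsub>free_mod R r\<^esub> restrict x {..<r}) i" if "i < r" for i
          using x[OF that] that dR by (simp add: free_mod_nth M.R.m_comm)
      qed
      then show "z \<in> h ` F" unfolding F_def using \<theta>(2)[OF xc] xc by (metis image_eqI)
    qed
  qed
  \<comment> \<open>N modulo \<open>F\<close> embeds in R^r modulo \<open>d R^r\<close>, whose
    length has just been seen to be finite in one coordinate.\<close>
  have lF: "?len N F (carrier N) \<noteq> \<infinity>"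
  proof -
    have subs: "submodule (h ` F) R (free_mod R r)" "submodule (h ` carrier N) R (free_mod R r)"
      by (rule submodule_image[OF N Fr.module_axioms h]; rule sF N.carrier_is_submodule)+
    have "?len (free_mod R r) (h ` F) (carrier (free_mod R r)) = enat r * ?len (self_module R) ?I (carrier R)"
      using V.len_pow[OF S sI sc IR, of r] by (simp add: hF free_mod_eq pow_mod_carrier)
    then have "?len (free_mod R r) (h ` F) (carrier (free_mod R r)) \<noteq> \<infinity>"
      using fin by auto
    moreover have "?len (free_mod R r) (h ` F) (carrier (free_mod R r))
       = ?len (free_mod R r) (h ` F) (h ` carrier N) + ?len (free_mod R r) (h ` carrier N) (carrier (free_mod R r))"
      by (rule V.len_additive[OF Fr.module_axioms subs Fr.carrier_is_submodule]) (use FN mod_hom_closed[OF h] in auto)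
    ultimately have "?len (free_mod R r) (h ` F) (h ` carrier N) \<noteq> \<infinity>"
      by (metis plus_eq_infty_iff_enat)
    then show ?thesis
      using V.len_inj[OF N Fr.module_axioms h inj sF N.carrier_is_submodule FN] by simp
  qed
  let ?A = "hom_ext R N n\<^sub>0 n\<^sub>1 A" and ?B = "hom_ext R N n\<^sub>1 n\<^sub>0 B"
  let ?G0 = "{..<n\<^sub>0} \<rightarrow>\<^sub>E F" and ?G1 = "{..<n\<^sub>1} \<rightarrow>\<^sub>E F"
  let ?L0 = "carrier (pow_mod N n\<^sub>0)" and ?L1 = "carrier (pow_mod N n\<^sub>1)"
  have G: "?G0 = (\<lambda>x. \<lambda>j\<in>{..<n\<^sub>0}. \<theta> (x j)) ` carrier (pow_mod (free_mod R r) n\<^sub>0)"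
       "?G1 = (\<lambda>x. \<lambda>j\<in>{..<n\<^sub>1}. \<theta> (x j)) ` carrier (pow_mod (free_mod R r) n\<^sub>1)"
  proof -
    have "{..<n} \<rightarrow>\<^sub>E F = (\<lambda>x. \<lambda>j\<in>{..<n}. \<theta> (x j)) ` carrier (pow_mod (free_mod R r) n)" for n :: nat
    proof
      show "(\<lambda>x. \<lambda>j\<in>{..<n}. \<theta> (x j)) ` carrier (pow_mod (free_mod R r) n) \<subseteq> {..<n} \<rightarrow>\<^sub>E F"
        unfolding F_def restrict_PiE_iff image_subset_iff by (blast dest: pow_mod_nth_closed)
      show "{..<n} \<rightarrow>\<^sub>E F \<subseteq> (\<lambda>x. \<lambda>j\<in>{..<n}. \<theta> (x j)) ` carrier (pow_mod (free_mod R r) n)"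
      proof
        fix y assume y: "y \<in> {..<n} \<rightarrow>\<^sub>E F"
        then have "\<forall>j. \<exists>x. j < n \<longrightarrow> x \<in> carrier (free_mod R r) \<and> y j = \<theta> x" unfolding F_def by blast
        then obtain x where x: "\<And>j. j < n \<Longrightarrow> x j \<in> carrier (free_mod R r)" "\<And>j. j < n \<Longrightarrow> y j = \<theta> (x j)"
          by metis
        have "y = (\<lambda>j\<in>{..<n}. \<theta> (restrict x {..<n} j))"
          by (rule PiE_ext[OF y]) (use x y in \<open>auto simp: F_def\<close>)
        moreover have "restrict x {..<n} \<in> carrier (pow_mod (free_mod R r) n)" using x(1)
          by (auto simp: pow_mod_carrier)
        ultimately show "y \<in> (\<lambda>x. \<lambda>j\<in>{..<n}. \<theta> (x j)) ` carrier (pow_mod (free_mod R r) n)" by blast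
      qed
    qed
    then show "?G0 = (\<lambda>x. \<lambda>j\<in>{..<n\<^sub>0}. \<theta> (x j)) ` carrier (pow_mod (free_mod R r) n\<^sub>0)"
       "?G1 = (\<lambda>x. \<lambda>j\<in>{..<n\<^sub>1}. \<theta> (x j)) ` carrier (pow_mod (free_mod R r) n\<^sub>1)" by blast+
  qed
  have \<theta>zero: "x = \<zero>\<^bsub>pow_mod (free_mod R r) n\<^esub>"
    if x: "x \<in> carrier (pow_mod (free_mod R r) n)" and z: "(\<lambda>j\<in>{..<n}. \<theta> (x j)) = \<zero>\<^bsub>pow_mod N n\<^esub>" for x n
  proof (rule pow_mod_eqI[OF x abelian_monoid.zero_closed])
    show "abelian_monoid (pow_mod (free_mod R r) n)"
      using module_pow_mod[OF Fr.module_axioms] by (auto simp: module_def abelian_group_def)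
    fix j assume j: "j < n"
    have "\<theta> (x j) = \<zero>\<^bsub>N\<^esub>" using fun_cong[OF z, of j] j by (simp add: pow_mod_nth)
    then show "x j = \<zero>\<^bsub>pow_mod (free_mod R r) n\<^esub> j" using \<theta>inj[OF pow_mod_nth_closed[OF x j]] j
      by (simp add: pow_mod_nth)
  qed
  \<comment> \<open>Exactness over R^r pulled along \<open>\<theta>\<close>: injectivity of
    \<open>\<theta>\<close> reflects vanishing, and a solution over R^r maps to one with entries in
    \<open>F\<close>.\<close>
  have exG: "{y \<in> {..<n} \<rightarrow>\<^sub>E F. hom_ext R N k n f y = \<zero>\<^bsub>pow_mod N k\<^esub>} \<subseteq> hom_ext R N n p e ` ({..<p} \<rightarrow>\<^sub>E F)"
    if f: "f \<in> mod_hom R (free_mod R n) (free_mod R k)" and e: "e \<in> mod_hom R (free_mod R p) (free_mod R n)"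
      and ex: "exact_at R (free_mod R r) k n p f e"
      and Gn: "{..<n} \<rightarrow>\<^sub>E F = (\<lambda>x. \<lambda>j\<in>{..<n}. \<theta> (x j)) ` carrier (pow_mod (free_mod R r) n)"
      and Gp: "{..<p} \<rightarrow>\<^sub>E F = (\<lambda>x. \<lambda>j\<in>{..<p}. \<theta> (x j)) ` carrier (pow_mod (free_mod R r) p)" for n k p f e
  proof
    fix y assume "y \<in> {y \<in> {..<n} \<rightarrow>\<^sub>E F. hom_ext R N k n f y = \<zero>\<^bsub>pow_mod N k\<^esub>}"
    then obtain x where x: "x \<in> carrier (pow_mod (free_mod R r) n)" "y = (\<lambda>j\<in>{..<n}. \<theta> (x j))"
      and z: "hom_ext R N k n f y = \<zero>\<^bsub>pow_mod N k\<^esub>" unfolding Gn by blast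
    have "hom_ext R (free_mod R r) k n f x = \<zero>\<^bsub>pow_mod (free_mod R r) k\<^esub>"
      by (rule \<theta>zero[OF Fr.hom_ext_closed[OF f x(1)]])
         (use z hom_ext_natural[OF Fr.module_axioms N \<theta>(1) f x(1)] x(2) in simp)
    then obtain w where w: "w \<in> carrier (pow_mod (free_mod R r) p)" "x = hom_ext R (free_mod R r) n p e w"
      using ex x(1) unfolding exact_at_def[OF Fr.module_axioms] by blast
    have "y = hom_ext R N n p e (\<lambda>j\<in>{..<p}. \<theta> (w j))"
      unfolding hom_ext_natural[OF Fr.module_axioms N \<theta>(1) e w(1)] x(2) w(2) ..
    then show "y \<in> hom_ext R N n p e ` ({..<p} \<rightarrow>\<^sub>E F)" unfolding Gp using w(1) by blast
  qed
  have clG: "hom_ext R N k n f y \<in> {..<k} \<rightarrow>\<^sub>E F"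
    if f: "f \<in> mod_hom R (free_mod R n) (free_mod R k)" and y: "y \<in> {..<n} \<rightarrow>\<^sub>E F"
      and Gn: "{..<n} \<rightarrow>\<^sub>E F = (\<lambda>x. \<lambda>j\<in>{..<n}. \<theta> (x j)) ` carrier (pow_mod (free_mod R r) n)"
      and Gk: "{..<k} \<rightarrow>\<^sub>E F = (\<lambda>x. \<lambda>j\<in>{..<k}. \<theta> (x j)) ` carrier (pow_mod (free_mod R r) k)" for n k f y
  proof -
    obtain x where x: "x \<in> carrier (pow_mod (free_mod R r) n)" "y = (\<lambda>j\<in>{..<n}. \<theta> (x j))" using y
      unfolding Gn by blast
    show ?thesis unfolding x(2) hom_ext_natural[OF Fr.module_axioms N \<theta>(1) f x(1)] Gk
      using Fr.hom_ext_closed[OF f x(1)] by blast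
  qed
  have G0L: "?G0 \<subseteq> ?L0" and G1L: "?G1 \<subseteq> ?L1" using FN by (auto simp: pow_mod_carrier)
  note sG0 = pow_sub_submodule[OF N sF, of n\<^sub>0] and sG1 = pow_sub_submodule[OF N sF, of n\<^sub>1]
  note hA = N.hom_ext_hom[OF A] and hB = N.hom_ext_hom[OF B]
  have e1: "{y \<in> ?G1. ?A y = \<zero>\<^bsub>pow_mod N n\<^sub>0\<^esub>} = ?B ` ?G0"
    using exG[OF A B exact_free(1) G(2,1)] clG[OF B _ G] AB_ext_zero[OF N] G0L by blast
  have e2: "{y \<in> ?G0. ?B y = \<zero>\<^bsub>pow_mod N n\<^sub>1\<^esub>} = ?A ` ?G1"
    using exG[OF B A exact_free(2) G(1,2)] clG[OF A _ G(2,1)] BA_ext_zero[OF N] G1L by blast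
  have e3: "{y \<in> ?L0. ?B y = \<zero>\<^bsub>pow_mod N n\<^sub>1\<^esub>} = ?A ` ?L1"
    using exB BA_ext_zero[OF N] N.hom_ext_closed[OF A] unfolding exact_at_def[OF N] by blast
  let ?K = "{y \<in> ?L1. ?A y = \<zero>\<^bsub>pow_mod N n\<^sub>0\<^esub>}"
  have BK: "?B ` ?L0 \<subseteq> ?K" using AB_ext_zero[OF N] N.hom_ext_closed[OF B] by blast
  have l1: "?len (pow_mod N n\<^sub>1) ?G1 ?L1 = ?len (pow_mod N n\<^sub>0) (?A ` ?G1) (?A ` ?L1) + ?len (pow_mod N n\<^sub>1) (?B ` ?G0) ?K"
    using V.len_hom[OF P1.module_axioms P0.module_axioms hA sG1 P1.carrier_is_submodule G1L]
    unfolding e1 .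
  have l0: "?len (pow_mod N n\<^sub>0) ?G0 ?L0 = ?len (pow_mod N n\<^sub>1) (?B ` ?G0) (?B ` ?L0) + ?len (pow_mod N n\<^sub>0) (?A ` ?G1) (?A ` ?L1)"
    using V.len_hom[OF P0.module_axioms P1.module_axioms hB sG0 P0.carrier_is_submodule G0L]
    unfolding e2 e3 .
  \<comment> \<open>The equality of the two ranks is what allows the two counts to be
    compared.\<close>
  have ll: "?len (pow_mod N n\<^sub>1) ?G1 ?L1 = ?len (pow_mod N n\<^sub>0) ?G0 ?L0"
    unfolding ranks_equal[OF dim] ..
  have lfin: "?len (pow_mod N n\<^sub>0) ?G0 ?L0 \<noteq> \<infinity>"
    using V.len_pow[OF N sF N.carrier_is_submodule FN, of n\<^sub>0] lF by (auto simp: pow_mod_carrier)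
  have sK: "submodule ?K R (pow_mod N n\<^sub>1)"
    by (rule submodule_kernel[OF P1.module_axioms P0.module_axioms hA])
  have sBL: "submodule (?B ` ?L0) R (pow_mod N n\<^sub>1)"
    by (rule submodule_image[OF P0.module_axioms P1.module_axioms hB P0.carrier_is_submodule])
  have sBG: "submodule (?B ` ?G0) R (pow_mod N n\<^sub>1)"
    by (rule submodule_image[OF P0.module_axioms P1.module_axioms hB sG0])
  have lK: "?len (pow_mod N n\<^sub>1) (?B ` ?G0) ?K = ?len (pow_mod N n\<^sub>1) (?B ` ?G0) (?B ` ?L0) + ?len (pow_mod N n\<^sub>1) (?B ` ?L0) ?K"
    by (rule V.len_additive[OF P1.module_axioms sBG sBL sK _ BK]) (use G0L in auto)
  \<comment> \<open>Here \<open>a\<close> and \<open>y\<close> stand for the image lengths of the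
    two matrices and \<open>z\<close> for the length of the kernel modulo image under test.
    Subtraction in \<open>enat\<close> is valid only because the total \<open>x\<close> is
    finite.\<close>
  have cancel: "z = 0" if "x \<noteq> \<infinity>" "x = a + (y + z)" "x = y + a" for x a y z :: enat
    using that by (cases a; cases y; cases z) (auto simp: zero_enat_def)
  have K0: "?len (pow_mod N n\<^sub>1) (?B ` ?L0) ?K = 0"
    by (rule cancel[OF lfin _ l0]) (use l1 ll lK in simp)
  show ?thesis
    unfolding exact_at_def[OF N]
  proof (intro ballI impI)
    fix y assume y: "y \<in> ?L1" "?A y = \<zero>\<^bsub>pow_mod N n\<^sub>0\<^esub>"
    show "y \<in> ?B ` ?L0"
    proof (rule ccontr)
      assume ny: "y \<notin> ?B ` ?L0"
      \<comment> \<open>Elements outside the maximal ideal are units, so a step is big at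
        \<open>m\<close> as soon as it is proper. Length zero thus means equality of the submodules
        themselves.\<close>
      have "s \<odot>\<^bsub>pow_mod N n\<^sub>1\<^esub> y \<notin> ?B ` ?L0" if s: "s \<in> carrier R - m" for s
      proof
        assume sy: "s \<odot>\<^bsub>pow_mod N n\<^sub>1\<^esub> y \<in> ?B ` ?L0"
        have sR: "s \<in> carrier R" using s by simp
        have "s \<in> PIdl\<^bsub>R\<^esub> s" by (rule ring.cgenideal_self[OF M.R.ring_axioms sR])
        then have "PIdl\<^bsub>R\<^esub> s = carrier R"
          using mmax[OF cring.cgenideal_ideal[OF cr sR]] s by blast
        then obtain t where t: "t \<in> carrier R" "\<one>\<^bsub>R\<^esub> = t \<otimes>\<^bsub>R\<^esub> s"
          using M.R.one_closed unfolding cgenideal_def by blast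
        have "t \<odot>\<^bsub>pow_mod N n\<^sub>1\<^esub> (s \<odot>\<^bsub>pow_mod N n\<^sub>1\<^esub> y) = y"
          using t sR y(1) by (simp add: P1.smult_assoc1[symmetric] flip: t(2))
        then show False using P1.submoduleE(4)[OF sBL t(1) sy] ny by simp
      qed
      then have "big (carrier R - m) (pow_mod N n\<^sub>1) (?B ` ?L0) ?K" unfolding big_def using y by blast
      then have "tower R (carrier R - m) (pow_mod N n\<^sub>1) (?B ` ?L0) ?K (Suc 0)"
        by (rule tower_Suc[OF tower_0[OF sBL sBL subset_refl] sK BK])
      from tower_le_len[OF this] show False unfolding K0 by (simp add: zero_enat_def)
    qed
  qed
qed

end

theorem theorem4:
  fixes R :: "('a, 'r) ring_scheme"
    and M :: "('a, 'b, 'm) module_scheme"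
    and N :: "('a, 'c, 'n) module_scheme"
  assumes "noetherian_ring R" and "local_ring R" and "krull_dim R = 1"
    and "module R M" and "finitely_generated R M" and "generically_free R M"
    and "two_periodic R M"
    and "module R N" and "finitely_generated R N" and "torsionless R N" and "has_rank R N"
  shows "torsion_free R (tensor R M N) \<longleftrightarrow> Tor_independent R M N"
proof -
  have R: "cring R" using assms(2) by (simp add: local_ring_def)
  have noeth: "noetherian_cring R" using R assms(1) by (simp add: noetherian_cring_def)
  then have dim: "dim_one_local R" using assms(2,3)
    by (simp add: dim_one_local_def dim_one_local_axioms_def)
  note N = assms(8)
  obtain n\<^sub>0 n\<^sub>1 A B \<epsilon> \<phi> where "periodic R M n\<^sub>0 n\<^sub>1 A B \<epsilon> \<phi>"
    using two_periodic_periodic[OF assms(4,7)] by blast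
  then interpret periodic R M n\<^sub>0 n\<^sub>1 A B \<epsilon> \<phi> .
  interpret N: module R N by (rule N)
  interpret P0: module R "pow_mod N n\<^sub>0" by (rule module_pow_mod[OF N])
  interpret P1: module R "pow_mod N n\<^sub>1" by (rule module_pow_mod[OF N])
  obtain r h d where h: "h \<in> mod_hom R N (free_mod R r)" "inj_on h (carrier N)" "d \<in> nonzerodivisors R"
    "\<And>x. x \<in> carrier (free_mod R r) \<Longrightarrow> d \<odot>\<^bsub>free_mod R r\<^esub> x \<in> h ` carrier N"
    by (rule rank_lattice[OF R N assms(9-11)]) (rule that)
  interpret Fr: module R "free_mod R r" by (rule module_free_mod[OF R])
  let ?A = "hom_ext R N n\<^sub>0 n\<^sub>1 A" and ?B = "hom_ext R N n\<^sub>1 n\<^sub>0 B"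
  have nz: "a \<in> nonzerodivisors R \<Longrightarrow> a \<in> carrier R" for a by (simp add: nonzerodivisors_def)
  \<comment> \<open>Torsion-freeness of N is inherited from R^r through the embedding
    \<open>h\<close>.\<close>
  have N_tf: "y = \<zero>\<^bsub>N\<^esub>" if a: "a \<in> nonzerodivisors R" and y: "y \<in> carrier N" "a \<odot>\<^bsub>N\<^esub> y = \<zero>\<^bsub>N\<^esub>" for a y
  proof -
    have "a \<odot>\<^bsub>free_mod R r\<^esub> h y = \<zero>\<^bsub>free_mod R r\<^esub>"
      using mod_hom_smult[OF h(1) nz[OF a] y(1)] y(2) mod_hom_zero[OF N Fr.module_axioms h(1)] by simp
    then have "a \<otimes>\<^bsub>R\<^esub> h y i = \<zero>\<^bsub>R\<^esub>" if "i < r" for i using that by (metis free_mod_nth(1,3))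
    then have "h y i = \<zero>\<^bsub>R\<^esub>" if "i < r" for i
      using a free_mod_nth_closed[OF mod_hom_closed[OF h(1) y(1)] that] that
      by (simp add: nonzerodivisors_def)
    then have "h y = \<zero>\<^bsub>free_mod R r\<^esub>"
      by (intro free_mod_eqI[OF mod_hom_closed[OF h(1) y(1)] Fr.M.zero_closed]) (simp add: free_mod_nth)
    then show ?thesis
      using inj_onD[OF h(2), of y "\<zero>\<^bsub>N\<^esub>"] y(1) mod_hom_zero[OF N Fr.module_axioms h(1)] by simp
  qed
  \<comment> \<open>Torsion-freeness accounts for exactness at N^(n_0) alone; the condition at
    N^(n_1) is then supplied by the lattice argument.\<close>
  have "torsion_free R (tensor R M N) \<longleftrightarrow> exact_at R N n\<^sub>1 n\<^sub>0 n\<^sub>1 B A"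
  proof
    assume "torsion_free R (tensor R M N)"
    then have tf: "y \<in> ?A ` carrier (pow_mod N n\<^sub>1)"
      if "y \<in> carrier (pow_mod N n\<^sub>0)" "a \<in> nonzerodivisors R"
      "a \<odot>\<^bsub>pow_mod N n\<^sub>0\<^esub> y \<in> ?A ` carrier (pow_mod N n\<^sub>1)" for y a
      using that unfolding torsion_free_tensor_iff[OF N] by blast
    obtain a U W where a: "a \<in> nonzerodivisors R" and U: "U \<in> mod_hom R (free_mod R n\<^sub>0) (free_mod R n\<^sub>1)"
      and W: "W \<in> mod_hom R (free_mod R n\<^sub>1) (free_mod R n\<^sub>0)"
      and split: "\<And>x. x \<in> carrier (free_mod R n\<^sub>0) \<Longrightarrow> a \<odot>\<^bsub>free_mod R n\<^sub>0\<^esub> x = A (U x) \<oplus>\<^bsub>free_mod R n\<^sub>0\<^esub> W (B x)"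
      using generic_splitting[OF noeth assms(6)] by blast
    show "exact_at R N n\<^sub>1 n\<^sub>0 n\<^sub>1 B A"
      unfolding exact_at_def[OF N]
    proof (intro ballI impI)
      fix y assume y: "y \<in> carrier (pow_mod N n\<^sub>0)" and By: "?B y = \<zero>\<^bsub>pow_mod N n\<^sub>1\<^esub>"
      \<comment> \<open>The decomposition of \<open>a\<close> with coefficients in N: the term
        through \<open>W\<close> vanishes on the kernel of \<open>B\<close>, so \<open>a\<close>
        times the kernel lies in the image of \<open>A\<close>.\<close>
      have "a \<odot>\<^bsub>pow_mod N n\<^sub>0\<^esub> y = hom_ext R N n\<^sub>0 n\<^sub>0 (\<lambda>x. a \<odot>\<^bsub>free_mod R n\<^sub>0\<^esub> x) y"
        by (rule N.hom_ext_scalar[OF nz[OF a] y, symmetric])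
      also have "\<dots> = hom_ext R N n\<^sub>0 n\<^sub>0 (\<lambda>x. A (U x) \<oplus>\<^bsub>free_mod R n\<^sub>0\<^esub> W (B x)) y"
        by (rule N.hom_ext_cong) (rule split)
      also have "\<dots> = ?A (hom_ext R N n\<^sub>1 n\<^sub>0 U y) \<oplus>\<^bsub>pow_mod N n\<^sub>0\<^esub> hom_ext R N n\<^sub>0 n\<^sub>1 W (?B y)"
        by (simp only: N.hom_ext_sum[OF mod_hom_comp[OF A U] mod_hom_comp[OF W B] y] N.hom_ext_comp[OF A U y] N.hom_ext_comp[OF W B y])
      also have "\<dots> = ?A (hom_ext R N n\<^sub>1 n\<^sub>0 U y)"
        unfolding By using mod_hom_zero[OF P1.module_axioms P0.module_axioms N.hom_ext_hom[OF W]]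
          N.hom_ext_closed[OF A N.hom_ext_closed[OF U y]] by simp
      finally show "y \<in> ?A ` carrier (pow_mod N n\<^sub>1)"
        using tf[OF y a] N.hom_ext_closed[OF U y] by blast
    qed
  next
    assume ex: "exact_at R N n\<^sub>1 n\<^sub>0 n\<^sub>1 B A"
    show "torsion_free R (tensor R M N)"
      unfolding torsion_free_tensor_iff[OF N]
    proof (intro ballI impI)
      fix y a assume y: "y \<in> carrier (pow_mod N n\<^sub>0)" and a: "a \<in> nonzerodivisors R"
        and "a \<odot>\<^bsub>pow_mod N n\<^sub>0\<^esub> y \<in> ?A ` carrier (pow_mod N n\<^sub>1)"
      then obtain z where z: "z \<in> carrier (pow_mod N n\<^sub>1)" "a \<odot>\<^bsub>pow_mod N n\<^sub>0\<^esub> y = ?A z" by blast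
      have By: "?B y \<in> carrier (pow_mod N n\<^sub>1)" by (rule N.hom_ext_closed[OF B y])
      \<comment> \<open>If \<open>a y\<close> is in the image of \<open>A\<close>, then
        \<open>a\<close> kills \<open>B y\<close>, and the power of N in which \<open>B y\<close>
        lives has no torsion.\<close>
      have aB: "a \<odot>\<^bsub>pow_mod N n\<^sub>1\<^esub> ?B y = \<zero>\<^bsub>pow_mod N n\<^sub>1\<^esub>"
        using mod_hom_smult[OF N.hom_ext_hom[OF B] nz[OF a] y] BA_ext_zero[OF N z(1)] z(2) by simp
      have "?B y = \<zero>\<^bsub>pow_mod N n\<^sub>1\<^esub>"
      proof (rule pow_mod_eqI[OF By P1.M.zero_closed])
        fix i assume i: "i < n\<^sub>1"
        have "a \<odot>\<^bsub>N\<^esub> ?B y i = \<zero>\<^bsub>N\<^esub>" using fun_cong[OF aB, of i] i by (simp add: pow_mod_nth)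
        then show "?B y i = \<zero>\<^bsub>pow_mod N n\<^sub>1\<^esub> i"
          using N_tf[OF a pow_mod_nth_closed[OF By i]] i by (simp add: pow_mod_nth)
      qed
      then show "y \<in> ?A ` carrier (pow_mod N n\<^sub>1)" using ex y unfolding exact_at_def[OF N] by blast
    qed
  qed
  then show ?thesis
    unfolding Tor_independent_periodic[OF N] using exact_lattice[OF dim N h] by blast
qed

end
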